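(* Let $C_0>1$ be fixed and let $\frac43<q\le2$. There exist $\delta>0$, depending on $q$, and a constant $C$, independent of $\mu$, $\Omega$, $f_1$ and $f_2$ (but allowed to depend on $q,\delta,C_0$ and $\Psi$), such that for every $\mu\in\mathbb Z$ with $2^{\mu-10}>C_0$, every $\Omega\in L^q(\mathbb S^1)$ with $\int_{\mathbb S^1}\Omega\,d\sigma=0$, and all Schwartz functions $f_1,f_2$ on $\mathbb R$, $$\Big\|\sup_{\gamma\in\mathbb Z}\big|\mathcal L_{\Omega,\mu}^{\gamma}(f_1,f_2)\big|\Big\|_{L^1(\mathbb R)}\le C\,2^{-\delta\mu}\,\|\Omega\|_{L^q(\mathbb S^1)}\,\|f_1\|_{L^2(\mathbb R)}\,\|f_2\|_{L^2(\mathbb R)}.$$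
   Context: $\mathbb S^1\subset\mathbb R^2$ is the unit circle with arc-length measure $\sigma$. For $\Omega\in L^1(\mathbb S^1)$ let $K(\vec y):=\Omega(\vec y/|\vec y|)\,|\vec y|^{-2}$, $\vec y=(y_1,y_2)\in\mathbb R^2\setminus\{0\}$. The fixed constant $C_0>1$ enters only as a threshold for $\mu$ (in the paper it is the support radius of a fixed family of compactly supported wavelets). Fix a Schwartz function $\Psi$ on $\mathbb R^2$ whose Fourier transform satisfies $\mathrm{supp}\,\widehat\Psi\subset\{\vec\xi\in\mathbb R^2:\frac12\le|\vec\xi|\le2\}$ and $\sum_{k\in\mathbb Z}\widehat{\Psi_k}(\vec\xi)=1$ for $\vec\xi\ne0$, where $\Psi_k:=2^{2k}\Psi(2^k\cdot)$, so $\widehat{\Psi_k}(\vec\xi)=\widehat\Psi(2^{-k}\vec\xi)$. Put $\widehat\Phi(\vec y):=1-\sum_{\gamma\ge1}\widehat\Psi(2^{-\gamma}\vec y)$, which is supported in $\{|\vec y|\le2\}$ and equals $1$ for $|\vec y|\le1$. For $\gamma,\mu\in\mathbb Z$ set $$K^*_\gamma(\vec y):=K(\vec y)\,\widehat\Phi(2^{-\gamma}\vec y)\,\chi_{\{2^\gamma<|\vec y|\le2^{\gamma+1}\}}(\vec y),$$ $$\mathcal L_{\Omega,\mu}^{\gamma}(f_1,f_2)(x):=\int_{\mathbb R^2}\big(\Psi_{\mu-\gamma}*K^*_\gamma\big)(\vec y)\,f_1(x-y_1)\,f_2(x-y_2)\,d\vec y,\qquad x\in\mathbb R.$$ *)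

theory Defs
  imports "HOL-Analysis.Analysis"
begin

type_synonym plane = "real \<times> real"

fun iter_pderiv :: "'a list \<Rightarrow> ('a::euclidean_space \<Rightarrow> complex) \<Rightarrow> 'a \<Rightarrow> complex" where
  "iter_pderiv [] f = f"
| "iter_pderiv (b # bs) f = (\<lambda>x. frechet_derivative (iter_pderiv bs f) (at x) b)"

(* A word in basis vectors plays the role of a multi-index. Differentiability of every
   iterated partial derivative is smoothness. *)
definition schwartz :: "('a::euclidean_space \<Rightarrow> complex) \<Rightarrow> bool" where
  "schwartz f \<longleftrightarrow>
     (\<forall>bs. set bs \<subseteq> Basis \<longrightarrow>
        (\<forall>x. iter_pderiv bs f differentiable (at x)) \<and>
        (\<forall>k::nat. bounded (range (\<lambda>x. norm x ^ k *\<^sub>R iter_pderiv bs f x))))"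

definition fourier :: "('a::euclidean_space \<Rightarrow> complex) \<Rightarrow> 'a \<Rightarrow> complex" where
  "fourier f \<xi> = (LINT x|lborel. f x * cis (- 2 * pi * (x \<bullet> \<xi>)))"

definition convolve ::
  "('a::euclidean_space \<Rightarrow> complex) \<Rightarrow> ('a \<Rightarrow> complex) \<Rightarrow> 'a \<Rightarrow> complex" where
  "convolve f g y = (LINT z|lborel. f (y - z) * g z)"

definition in_Lp :: "'a measure \<Rightarrow> real \<Rightarrow> ('a \<Rightarrow> complex) \<Rightarrow> bool" where
  "in_Lp M p f \<longleftrightarrow> f \<in> borel_measurable M \<and> integrable M (\<lambda>x. norm (f x) powr p)"

definition Lp_norm :: "'a measure \<Rightarrow> real \<Rightarrow> ('a \<Rightarrow> complex) \<Rightarrow> real" where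
  "Lp_norm M p f = (LINT x|M. norm (f x) powr p) powr (1 / p)"

(* Arc-length measure on the unit circle: the unit-speed parametrisation pushes
   Lebesgue measure on [0, 2 pi) forward to it. *)
definition circle_measure :: "plane measure" where
  "circle_measure =
     distr (restrict_space lborel {0..<2 * pi}) (restrict_space borel (sphere 0 1))
       (\<lambda>t. (cos t, sin t))"

definition dilate :: "int \<Rightarrow> (plane \<Rightarrow> complex) \<Rightarrow> plane \<Rightarrow> complex" where
  "dilate k \<Psi> y = (2 powi (2 * k)) *\<^sub>R \<Psi> ((2 powi k) *\<^sub>R y)"

definition littlewood_paley :: "(plane \<Rightarrow> complex) \<Rightarrow> bool" where
  "littlewood_paley \<Psi> \<longleftrightarrow>
     schwartz \<Psi> \<and>
     closure {\<xi>. fourier \<Psi> \<xi> \<noteq> 0} \<subseteq> {\<xi>. 1/2 \<le> norm \<xi> \<and> norm \<xi> \<le> 2} \<and>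
     (\<forall>\<xi>. \<xi> \<noteq> 0 \<longrightarrow> ((\<lambda>k. fourier (dilate k \<Psi>) \<xi>) has_sum 1) (UNIV :: int set))"

(* For Psi as above only finitely many terms of the sum are nonzero at each y. *)
definition Phi_hat :: "(plane \<Rightarrow> complex) \<Rightarrow> plane \<Rightarrow> complex" where
  "Phi_hat \<Psi> y = 1 - (\<Sum>\<^sub>\<infinity>\<gamma>\<in>{1::int..}. fourier \<Psi> ((2 powi (- \<gamma>)) *\<^sub>R y))"

definition rough_kernel :: "(plane \<Rightarrow> complex) \<Rightarrow> plane \<Rightarrow> complex" where
  "rough_kernel \<Omega> y = \<Omega> (y /\<^sub>R norm y) /\<^sub>R (norm y)\<^sup>2"

definition K_star ::
  "(plane \<Rightarrow> complex) \<Rightarrow> (plane \<Rightarrow> complex) \<Rightarrow> int \<Rightarrow> plane \<Rightarrow> complex" where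
  "K_star \<Psi> \<Omega> \<gamma> y =
     rough_kernel \<Omega> y * Phi_hat \<Psi> ((2 powi (- \<gamma>)) *\<^sub>R y)
       * indicator {y. 2 powi \<gamma> < norm y \<and> norm y \<le> 2 powi (\<gamma> + 1)} y"

definition L_op ::
  "(plane \<Rightarrow> complex) \<Rightarrow> (plane \<Rightarrow> complex) \<Rightarrow> int \<Rightarrow> int
     \<Rightarrow> (real \<Rightarrow> complex) \<Rightarrow> (real \<Rightarrow> complex) \<Rightarrow> real \<Rightarrow> complex" where
  "L_op \<Psi> \<Omega> \<mu> \<gamma> f1 f2 x =
     (LINT y|lborel. convolve (dilate (\<mu> - \<gamma>) \<Psi>) (K_star \<Psi> \<Omega> \<gamma>) y
        * f1 (x - fst y) * f2 (x - snd y))"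

end

theory Submission
  imports Defs "HOL-Probability.Probability" "HOL-Real_Asymp.Real_Asymp"
begin

text \<open>Rescaling by \<open>2 powi \<gamma>\<close> turns the operator into an average, with weight \<open>\<Psi>\<close>, of translates of a
  bilinear operator whose kernel \<open>K\<close> lives on the annulus \<open>1 < norm y \<le> 2\<close> and does not depend on \<open>\<gamma>\<close>.
  By the support of the Fourier transform of \<open>\<Psi>\<close>, one of the two frequencies must have size about
  \<open>2 powi (\<mu> - \<gamma>)\<close>, and the other one at most that. The latter is split by a Gaussian multiplier at
  scale \<open>2 powi (- \<gamma>)\<close>.

  For the low-pass part, a Taylor expansion bounds the operator by the maximal function of one input times
  a linear multiplier of the other. The Fourier transform of \<open>K\<close> decays, so the multiplier gains
  a power of \<open>2 powi (- \<mu>)\<close>; the supremum over \<open>\<gamma>\<close> is summed in square using the orthogonality of the bands.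

  In the remaining part both frequencies range over \<open>O(\<mu>)\<close> dyadic scales, the supremum is replaced by the sum,
  and a single scale bound suffices. There the frequencies are band into cells of length \<open>1/4\<close>,
  and the operator becomes a bilinear sum whose coefficients are values of the Fourier transform of \<open>K\<close> on a lattice.
  By Hausdorff--Young at most \<open>C * \<kappa> powr (- q')\<close> of them exceed \<open>\<kappa>\<close>, where \<open>q' = q / (q - 1)\<close>,
  whereas a matrix with \<open>n\<close> entries of size \<open>\<kappa>\<close> contributes about \<open>\<kappa> * n powr (1/4)\<close>. The sum
  over the levels \<open>\<kappa>\<close> converges because \<open>q' < 4\<close>, which is the condition \<open>4 / 3 < q\<close>.\<close>

section \<open>Characters and Fourier integrals on the line\<close>

text \<open>The supremum over \<open>\<gamma>\<close> may be replaced by a sum once both inputs are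
  square summable in \<open>\<gamma>\<close>. Pieces near the top of the spectrum of
  \<open>\<Psi>\<close> are, because a fixed frequency meets boundedly many dyadic bands; but a
  fixed frequency lies below the band at infinitely many scales, so the other input is not. Removing
  a Gaussian cures this: \<open>1 - gauss\<close> vanishes at the origin, hence its squares sum to
  \<open>O(\<mu>)\<close>, a loss that the exponential gain absorbs. What is removed is an average
  of the input and is controlled by a maximal function. The Gaussian is chosen because
  \<open>gauss (\<sigma> - y)\<close> separates into a power series in \<open>y\<close> whose
  coefficients beat every geometric growth met later. The maximal theorem is proved for the Cauchy
  kernel because the convolution of two such kernels is bounded by the sum of the same two kernels
  up to a constant, so that a \<open>T T*\<close> estimate closes on itself. The decay exponent
  \<open>1 / 8\<close> of the Fourier transform of the rough kernel is what truncation of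
  \<open>\<Omega>\<close> gives at \<open>q = 4 / 3\<close>; any positive power leads to a positive
  \<open>\<delta>\<close>.\<close>

definition ee :: "real \<Rightarrow> complex" where "ee x = cis (2 * pi * x)"

lemma norm_ee [simp]: "cmod (ee x) = 1"
  by (simp add: ee_def)

lemma ee_add: "ee (x + y) = ee x * ee y"
  by (simp add: ee_def cis_mult algebra_simps)

lemma ee_0 [simp]: "ee 0 = 1"
  by (simp add: ee_def)

lemma ee_diff: "ee (x - y) = ee x * ee (- y)"
  using ee_add[of x "- y"] by simp

lemma cnj_ee [simp]: "cnj (ee x) = ee (- x)"
  by (simp add: ee_def cis_cnj)

lemma ee_minus_cancel [simp]: "ee x * ee (- x) = 1" "ee (- x) * ee x = 1"
  using ee_add[of x "- x"] ee_add[of "- x" x] by simp_all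

lemma cnj_measurable [measurable]: "cnj \<in> borel_measurable borel"
  by (intro borel_measurable_continuous_onI continuous_intros)

lemma ennreal_power2_le_imp_le:
  fixes a b :: ennreal
  assumes "a\<^sup>2 \<le> b\<^sup>2" shows "a \<le> b"
  using assms
  by (cases a; cases b) (auto simp: ennreal_power power_eq_top_ennreal top_unique split: if_splits)

lemma continuous_on_ee [continuous_intros]:
  "continuous_on S f \<Longrightarrow> continuous_on S (\<lambda>x. ee (f x))"
  unfolding ee_def by (intro continuous_intros)

lemma ee_measurable [measurable]: "ee \<in> borel_measurable borel"
  by (intro borel_measurable_continuous_onI continuous_intros)

lemma norm_ee_diff_le: "cmod (ee x - ee y) \<le> 2 * pi * \<bar>x - y\<bar>"
proof -
  have "ee x - ee y = ee y * (ee (x - y) - 1)"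
    by (simp add: ee_add[symmetric] algebra_simps)
  then have "cmod (ee x - ee y) = cmod (ee (x - y) - 1)"
    by (simp add: norm_mult)
  also have "\<dots> = cmod (exp (\<i> * complex_of_real (2 * pi * (x - y))) - 1)"
    by (simp add: ee_def cis_conv_exp)
  also have "\<dots> \<le> \<bar>2 * pi * (x - y)\<bar>"
    using iexp_approx1[of "2 * pi * (x - y)" 0] by simp
  finally show ?thesis by (simp add: abs_mult)
qed

text \<open>The inverse Fourier transform. Inputs enter the operators through functions on the
  frequency side, so a frequency cutoff is a multiplication of \<open>u\<close> and a translation is
  a modulation of \<open>u\<close>.\<close>

definition ift :: "(real \<Rightarrow> complex) \<Rightarrow> real \<Rightarrow> complex" where
  "ift u x = (LINT \<xi>|lborel. u \<xi> * ee (x * \<xi>))"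

lemma fourier_ee: "fourier f \<xi> = (LINT x|lborel. f x * ee (- (x \<bullet> \<xi>)))"
  by (simp add: fourier_def ee_def)

lemma fourier_eq_ift: "fourier f \<xi> = ift f (- \<xi>)"
  by (simp add: fourier_ee ift_def mult.commute)

lemma integrable_mult_bdd:
  fixes f g :: "'a \<Rightarrow> complex"
  assumes "integrable M f" "g \<in> borel_measurable M" "\<And>x. cmod (g x) \<le> C"
  shows "integrable M (\<lambda>x. f x * g x)" "integrable M (\<lambda>x. g x * f x)"
proof -
  show "integrable M (\<lambda>x. f x * g x)"
  proof (rule Bochner_Integration.integrable_bound)
    show "integrable M (\<lambda>x. C * cmod (f x))"
      using assms(1) by auto
    show "AE x in M. cmod (f x * g x) \<le> norm (C * cmod (f x))"
    proof (intro AE_I2)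
      fix x
      have "cmod (f x) * cmod (g x) \<le> cmod (f x) * C"
        by (intro mult_left_mono assms(3)) simp
      then show "cmod (f x * g x) \<le> norm (C * cmod (f x))"
        by (simp add: norm_mult mult.commute)
    qed
  qed (use assms in measurable)
  then show "integrable M (\<lambda>x. g x * f x)"
    by (simp add: mult.commute)
qed

lemma integrable_mult_ee [intro]:
  fixes f :: "'a \<Rightarrow> complex"
  assumes "integrable M f" and [measurable]: "h \<in> borel_measurable M"
  shows "integrable M (\<lambda>x. f x * ee (h x))"
  by (rule integrable_mult_bdd(1)[where C=1]) (use assms in auto)

lemma norm_ift_le:
  assumes "integrable lborel u"
  shows "cmod (ift u x) \<le> (LINT \<xi>|lborel. cmod (u \<xi>))"
  unfolding ift_def
  by (rule order_trans[OF integral_norm_bound]) (simp add: norm_mult)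

lemma ift_measurable [measurable]:
  assumes [measurable]: "u \<in> borel_measurable borel"
  shows "ift u \<in> borel_measurable borel"
  unfolding ift_def by measurable

lemma integrable_tensor:
  fixes a :: "'a::euclidean_space \<Rightarrow> complex" and b :: "'b::euclidean_space \<Rightarrow> complex"
  assumes a: "integrable lborel a" and b: "integrable lborel b"
    and m [measurable]: "m \<in> borel_measurable (borel \<Otimes>\<^sub>M borel)" and le: "\<And>p. cmod (m p) \<le> C"
  shows "integrable (lborel \<Otimes>\<^sub>M lborel) (\<lambda>(x, y). a x * b y * m (x, y))"
proof -
  have [measurable]: "a \<in> borel_measurable borel" "b \<in> borel_measurable borel"
    using a b by auto
  have "integrable (lborel \<Otimes>\<^sub>M lborel) (\<lambda>(x, y). a x * b y)"
  proof (rule lborel_pair.Fubini_integrable)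
    have "integrable lborel (\<lambda>x. cmod (a x) * (LINT y|lborel. cmod (b y)))"
      using a by auto
    then show "integrable lborel (\<lambda>x. LINT y|lborel. cmod (case (x, y) of (x, y) \<Rightarrow> a x * b y))"
      by (simp add: norm_mult)
  qed (use b in auto)
  then have "integrable (lborel \<Otimes>\<^sub>M lborel) (\<lambda>z. (case z of (x, y) \<Rightarrow> a x * b y) * m z)"
    by (rule integrable_mult_bdd(1)[where C=C]) (use le in auto)
  then show ?thesis
    by (simp add: case_prod_beta')
qed

lemma fubini_tensor:
  fixes a :: "'a::euclidean_space \<Rightarrow> complex" and b :: "'b::euclidean_space \<Rightarrow> complex"
  assumes a: "integrable lborel a" and b: "integrable lborel b"
    and m [measurable]: "m \<in> borel_measurable (borel \<Otimes>\<^sub>M borel)" and le: "\<And>p. cmod (m p) \<le> C"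
  shows "(LINT x|lborel. a x * (LINT y|lborel. b y * m (x, y)))
       = (LINT y|lborel. b y * (LINT x|lborel. a x * m (x, y)))"
proof -
  have "(LINT y|lborel. LINT x|lborel. a x * b y * m (x, y))
      = (LINT x|lborel. LINT y|lborel. a x * b y * m (x, y))"
    by (rule lborel_pair.Fubini_integral) (rule integrable_tensor[OF assms])
  moreover have "(LINT y|lborel. LINT x|lborel. a x * b y * m (x, y))
      = (LINT y|lborel. b y * (LINT x|lborel. a x * m (x, y)))"
    by (subst integral_mult_right_zero[symmetric]) (simp only: mult_ac)
  moreover have "(LINT x|lborel. LINT y|lborel. a x * b y * m (x, y))
      = (LINT x|lborel. a x * (LINT y|lborel. b y * m (x, y)))"
    by (simp only: mult.assoc integral_mult_right_zero)
  ultimately show ?thesis by simp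
qed

text \<open>Fubini for the symmetric kernel \<open>ee (x * \<xi>)\<close>. Moving the transform from
  one factor to the other is how the Plancherel inequality is reached.\<close>

lemma ift_multiplication:
  assumes "integrable lborel u" "integrable lborel w"
  shows "(LINT x|lborel. w x * ift u x) = (LINT \<xi>|lborel. u \<xi> * ift w \<xi>)"
proof -
  have "(LINT x|lborel. w x * (LINT \<xi>|lborel. u \<xi> * (\<lambda>p. ee (fst p * snd p)) (x, \<xi>)))
      = (LINT \<xi>|lborel. u \<xi> * (LINT x|lborel. w x * (\<lambda>p. ee (fst p * snd p)) (x, \<xi>)))"
    by (rule fubini_tensor[where C=1]) (use assms in \<open>auto\<close>)
  then show ?thesis
    by (simp add: ift_def mult.commute)
qed

section \<open>The Gaussian as its own Fourier transform\<close>

definition gauss :: "real \<Rightarrow> real" where "gauss x = exp (- pi * x\<^sup>2)"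

lemma gauss_measurable [measurable]: "gauss \<in> borel_measurable borel"
  unfolding gauss_def by measurable

lemma gauss_pos: "0 < gauss x" and gauss_le1: "gauss x \<le> 1" and gauss_nonneg [simp]: "0 \<le> gauss x"
  by (auto simp: gauss_def)

lemma gauss_eq_normal: "gauss x = sqrt (2 * pi) * std_normal_density (0 + sqrt (2 * pi) * x)"
  by (simp add: gauss_def std_normal_density_def power_mult_distrib real_sqrt_mult)

lemma gauss_integrable: "integrable lborel gauss"
proof -
  have "integrable lborel (\<lambda>x. std_normal_density (0 + sqrt (2 * pi) * x))"
    by (rule lborel_integrable_real_affine) auto
  then show ?thesis
    by (simp add: gauss_eq_normal[abs_def])
qed

text \<open>With the factor \<open>2 * pi\<close> in \<open>ee\<close>, the self-dual Gaussian is
  \<open>exp (- pi * x\<^sup>2)\<close>; the identity is the characteristic function of the standard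
  normal law after the substitution by \<open>sqrt (2 * pi)\<close>.\<close>

lemma gauss_transform: "(LINT x|lborel. complex_of_real (gauss x) * ee (t * x)) = of_real (gauss t)"
proof -
  let ?c = "sqrt (2 * pi)"
  have c: "?c * ?c = 2 * pi" "?c > 0" by auto
  have "of_real (exp (- ((?c * t)\<^sup>2) / 2)) = char std_normal_distribution (?c * t)"
    by (simp add: char_std_normal_distribution)
  also have "\<dots> = (LINT x|lborel. std_normal_density x *\<^sub>R iexp (?c * t * x))"
    unfolding char_def by (rule integral_density) auto
  also have "\<dots> = \<bar>?c\<bar> *\<^sub>R (LINT x|lborel. std_normal_density (0 + ?c * x) *\<^sub>R iexp (?c * t * (0 + ?c * x)))"
    by (rule lborel_integral_real_affine) simp
  also have "\<dots> = (LINT x|lborel. ?c *\<^sub>R (std_normal_density (0 + ?c * x) *\<^sub>R iexp (?c * t * (0 + ?c * x))))"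
    by (simp only: integral_scaleR_right abs_of_pos[OF c(2)])
  also have "\<dots> = (LINT x|lborel. complex_of_real (gauss x) * ee (t * x))"
  proof (intro Bochner_Integration.integral_cong refl)
    fix x
    have "?c * t * (0 + ?c * x) = (?c * ?c) * (t * x)"
      by (simp only: add_0 mult_ac)
    then have "?c * t * (0 + ?c * x) = 2 * pi * (t * x)"
      by (simp only: c(1))
    then show "?c *\<^sub>R (std_normal_density (0 + ?c * x) *\<^sub>R iexp (?c * t * (0 + ?c * x)))
        = complex_of_real (gauss x) * ee (t * x)"
      unfolding gauss_eq_normal ee_def cis_conv_exp by (simp only: scaleR_conv_of_real of_real_mult mult.assoc)
  qed
  also have "exp (- ((?c * t)\<^sup>2) / 2) = gauss t"
    by (simp add: gauss_def power_mult_distrib)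
  finally show ?thesis by simp
qed

lemma integral_gauss: "(LINT x|lborel. gauss x) = 1"
proof -
  have "complex_of_real (LINT x|lborel. gauss x) = 1"
    using gauss_transform[of 0] by (simp add: gauss_def del: of_real_exp)
  then show ?thesis by (simp only: of_real_eq_1_iff)
qed

lemma gauss_scaled_integrable:
  assumes "\<epsilon> > 0" shows "integrable lborel (\<lambda>x. gauss (c + \<epsilon> * x))"
  by (rule lborel_integrable_real_affine[OF gauss_integrable]) (use assms in auto)

lemma gauss_scaled_transform:
  assumes "\<epsilon> > 0"
  shows "(LINT x|lborel. complex_of_real (gauss (\<epsilon> * x)) * ee (t * x)) = of_real (gauss (t / \<epsilon>) / \<epsilon>)"
proof -
  have "of_real (gauss (t / \<epsilon>)) = (LINT x|lborel. complex_of_real (gauss x) * ee (t / \<epsilon> * x))"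
    by (simp only: gauss_transform)
  also have "\<dots> = \<bar>\<epsilon>\<bar> *\<^sub>R (LINT x|lborel. complex_of_real (gauss (0 + \<epsilon> * x)) * ee (t / \<epsilon> * (0 + \<epsilon> * x)))"
    by (rule lborel_integral_real_affine) (use assms in auto)
  finally show ?thesis using assms
    by (simp add: scaleR_conv_of_real field_simps)
qed

lemma nn_integral_gauss_scaled:
  assumes "\<epsilon> > 0"
  shows "(\<integral>\<^sup>+x. ennreal (gauss ((x - c) / \<epsilon>) / \<epsilon>) \<partial>lborel) = 1"
proof -
  have "1 = (\<integral>\<^sup>+x. ennreal (gauss x) \<partial>lborel)"
    using nn_integral_eq_integral[OF gauss_integrable] integral_gauss by simp
  also have "\<dots> = ennreal \<bar>1 / \<epsilon>\<bar> * (\<integral>\<^sup>+x. ennreal (gauss (- c / \<epsilon> + 1 / \<epsilon> * x)) \<partial>lborel)"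
    by (rule nn_integral_real_affine) (use assms in auto)
  also have "\<dots> = (\<integral>\<^sup>+x. ennreal \<bar>1 / \<epsilon>\<bar> * ennreal (gauss (- c / \<epsilon> + 1 / \<epsilon> * x)) \<partial>lborel)"
    by (simp add: nn_integral_cmult)
  also have "\<dots> = (\<integral>\<^sup>+x. ennreal (gauss ((x - c) / \<epsilon>) / \<epsilon>) \<partial>lborel)"
    using assms by (intro nn_integral_cong) (simp add: diff_divide_distrib flip: ennreal_mult')
  finally show ?thesis by simp
qed

section \<open>The Plancherel inequality for functions both integrable and square integrable\<close>

definition L2fun :: "(real \<Rightarrow> complex) \<Rightarrow> bool" where
  "L2fun u \<longleftrightarrow> integrable lborel u \<and> integrable lborel (\<lambda>x. (cmod (u x))\<^sup>2)"

definition l2 :: "(real \<Rightarrow> complex) \<Rightarrow> real" where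
  "l2 u = sqrt (LINT x|lborel. (cmod (u x))\<^sup>2)"

lemma l2_nonneg [simp]: "0 \<le> l2 u"
  by (simp add: l2_def)

lemma l2_power2: "(l2 u)\<^sup>2 = (LINT x|lborel. (cmod (u x))\<^sup>2)"
  by (simp add: l2_def)

lemma nn_integral_l2:
  assumes "integrable lborel (\<lambda>x. (cmod (u x))\<^sup>2)"
  shows "(\<integral>\<^sup>+x. ennreal ((cmod (u x))\<^sup>2) \<partial>lborel) = ennreal ((l2 u)\<^sup>2)"
  using nn_integral_eq_integral[OF assms] by (simp add: l2_power2)

lemma L2fun_measurable: "L2fun u \<Longrightarrow> u \<in> borel_measurable borel"
  by (auto simp: L2fun_def)

text \<open>The Gaussian factor makes all integrals absolute. The multiplication formula turns the
  left side into a quadratic form in \<open>u\<close> with kernel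
  \<open>\<gamma> (\<eta> - \<xi>)\<close>, a Gaussian of mass one in either variable; bounding the
  product of two values of \<open>u\<close> by half the sum of their squares (the Schur test)
  finishes the estimate.\<close>

lemma nn_integral_plancherel_damped:
  assumes u: "L2fun u" and e: "\<epsilon> > 0"
  shows "(\<integral>\<^sup>+x. ennreal ((cmod (ift u x))\<^sup>2 * gauss (\<epsilon> * x)) \<partial>lborel) \<le> ennreal ((l2 u)\<^sup>2)"
proof -
  have ui: "integrable lborel u" and u2: "integrable lborel (\<lambda>x. (cmod (u x))\<^sup>2)"
    using u by (auto simp: L2fun_def)
  have [measurable]: "u \<in> borel_measurable borel" by (rule L2fun_measurable[OF u])
  define g where "g x = complex_of_real (gauss (\<epsilon> * x))" for x
  have gi: "integrable lborel g"
    unfolding g_def using gauss_scaled_integrable[OF e, of 0] by auto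
  define C where "C = (LINT \<xi>|lborel. cmod (u \<xi>))"
  have F: "cmod (ift u x) \<le> C" for x
    unfolding C_def by (rule norm_ift_le[OF ui])
  define w where "w x = cnj (ift u x) * g x" for x
  have wi: "integrable lborel w"
    unfolding w_def by (rule integrable_mult_bdd(2)[where C=C]) (use gi F in auto)
  define \<gamma> where "\<gamma> x = gauss (x / \<epsilon>) / \<epsilon>" for x
  have [measurable]: "\<gamma> \<in> borel_measurable borel" unfolding \<gamma>_def by measurable
  have \<gamma>0: "0 \<le> \<gamma> x" for x using e by (simp add: \<gamma>_def)
  have iw: "ift w \<xi> = cnj (LINT \<eta>|lborel. u \<eta> * of_real (\<gamma> (\<eta> - \<xi>)))" for \<xi>
  proof -
    have gt: "ift (\<lambda>x. g x * ee (- (\<xi> * x))) \<eta> = of_real (\<gamma> (\<eta> - \<xi>))" for \<eta>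
    proof -
      have "ift (\<lambda>x. g x * ee (- (\<xi> * x))) \<eta> = (LINT x|lborel. complex_of_real (gauss (\<epsilon> * x)) * ee ((\<eta> - \<xi>) * x))"
        unfolding ift_def
        by (intro Bochner_Integration.integral_cong refl)
           (simp add: g_def mult.assoc ee_add[symmetric] algebra_simps)
      also have "\<dots> = of_real (\<gamma> (\<eta> - \<xi>))"
        using gauss_scaled_transform[OF e] by (simp add: \<gamma>_def)
      finally show ?thesis .
    qed
    have "ift w \<xi> = (LINT x|lborel. cnj ((g x * ee (- (\<xi> * x))) * ift u x))"
      unfolding ift_def[of w] w_def g_def
      by (simp only: complex_cnj_mult cnj_ee complex_cnj_complex_of_real minus_minus mult_ac)
    also have "\<dots> = cnj (LINT x|lborel. (g x * ee (- (\<xi> * x))) * ift u x)"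
      by (rule Bochner_Integration.integral_cnj)
    also have "(LINT x|lborel. (g x * ee (- (\<xi> * x))) * ift u x)
       = (LINT \<eta>|lborel. u \<eta> * ift (\<lambda>x. g x * ee (- (\<xi> * x))) \<eta>)"
      by (rule ift_multiplication) (use ui gi in auto)
    finally show ?thesis by (simp only: gt)
  qed
  have sq: "complex_of_real ((cmod (ift u x))\<^sup>2 * gauss (\<epsilon> * x)) = w x * ift u x" for x
    by (simp add: w_def g_def complex_norm_square mult_ac flip: of_real_power)
  have wfi: "integrable lborel (\<lambda>x. w x * ift u x)"
    by (rule integrable_mult_bdd(1)[OF wi _ F]) auto
  have ri: "integrable lborel (\<lambda>x. (cmod (ift u x))\<^sup>2 * gauss (\<epsilon> * x))"
    using integrable_norm[OF wfi]
    by (simp add: sq[symmetric] norm_mult norm_power abs_mult)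
  have "complex_of_real (LINT x|lborel. (cmod (ift u x))\<^sup>2 * gauss (\<epsilon> * x)) = (LINT x|lborel. w x * ift u x)"
    by (simp only: sq[symmetric] integral_complex_of_real)
  also have "\<dots> = (LINT \<xi>|lborel. u \<xi> * ift w \<xi>)"
    by (rule ift_multiplication[OF ui wi])
  finally have eq: "complex_of_real (LINT x|lborel. (cmod (ift u x))\<^sup>2 * gauss (\<epsilon> * x)) = (LINT \<xi>|lborel. u \<xi> * ift w \<xi>)" .
  have conv: "(\<integral>\<^sup>+\<eta>. ennreal (\<gamma> (\<eta> - \<xi>)) \<partial>lborel) = 1" for \<xi>
    unfolding \<gamma>_def by (rule nn_integral_gauss_scaled[OF e])
  have conv': "(\<integral>\<^sup>+\<xi>. ennreal (\<gamma> (\<eta> - \<xi>)) \<partial>lborel) = 1" for \<eta>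
  proof -
    have "\<gamma> (\<eta> - \<xi>) = \<gamma> (\<xi> - \<eta>)" for \<xi>
      by (simp add: \<gamma>_def gauss_def power_divide power2_commute)
    then show ?thesis by (simp add: conv)
  qed
  have cm: "(\<integral>\<^sup>+\<eta>. ennreal (a * \<gamma> (\<eta> - \<xi>)) \<partial>lborel) = ennreal a"
    and cm': "(\<integral>\<^sup>+\<eta>. ennreal (a * \<gamma> (\<xi> - \<eta>)) \<partial>lborel) = ennreal a" if "a \<ge> 0" for a \<xi>
    using that by (simp_all add: ennreal_mult nn_integral_cmult conv conv' \<gamma>0)
  have "(\<integral>\<^sup>+x. ennreal ((cmod (ift u x))\<^sup>2 * gauss (\<epsilon> * x)) \<partial>lborel)
      = ennreal (LINT x|lborel. (cmod (ift u x))\<^sup>2 * gauss (\<epsilon> * x))"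
    by (rule nn_integral_eq_integral[OF ri]) auto
  also have "\<dots> \<le> ennreal (cmod (LINT \<xi>|lborel. u \<xi> * ift w \<xi>))"
    unfolding eq[symmetric] by (intro ennreal_leI) simp
  also have "\<dots> \<le> (\<integral>\<^sup>+\<xi>. ennreal (cmod (u \<xi> * ift w \<xi>)) \<partial>lborel)"
    by (rule integral_norm_bound_ennreal)
      (rule integrable_mult_bdd(1)[OF ui _ norm_ift_le[OF wi]], use wi in auto)
  also have "\<dots> \<le> (\<integral>\<^sup>+\<xi>. (\<integral>\<^sup>+\<eta>. ennreal (((cmod (u \<xi>))\<^sup>2 / 2) * \<gamma> (\<eta> - \<xi>)) + ennreal (((cmod (u \<eta>))\<^sup>2 / 2) * \<gamma> (\<eta> - \<xi>)) \<partial>lborel) \<partial>lborel)"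
  proof (intro nn_integral_mono)
    fix \<xi> :: real
    have "integrable lborel (\<lambda>\<eta>. u \<eta> * of_real (\<gamma> (\<eta> - \<xi>)))"
      by (rule integrable_mult_bdd(1)[OF ui, where C="1/\<epsilon>"])
        (use e in \<open>auto simp: \<gamma>_def gauss_le1 divide_right_mono norm_divide\<close>)
    then have "ennreal (cmod (ift w \<xi>)) \<le> (\<integral>\<^sup>+\<eta>. ennreal (cmod (u \<eta> * of_real (\<gamma> (\<eta> - \<xi>)))) \<partial>lborel)"
      unfolding iw complex_mod_cnj by (rule integral_norm_bound_ennreal)
    then have "ennreal (cmod (u \<xi> * ift w \<xi>)) \<le> ennreal (cmod (u \<xi>)) * (\<integral>\<^sup>+\<eta>. ennreal (cmod (u \<eta> * of_real (\<gamma> (\<eta> - \<xi>)))) \<partial>lborel)"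
      by (simp add: norm_mult ennreal_mult' mult_left_mono)
    also have "\<dots> = (\<integral>\<^sup>+\<eta>. ennreal (cmod (u \<xi>) * cmod (u \<eta>) * \<gamma> (\<eta> - \<xi>)) \<partial>lborel)"
      by (subst nn_integral_cmult[symmetric])
         (auto simp: norm_mult ennreal_mult'[symmetric] \<gamma>0 mult_ac)
    also have "\<dots> \<le> (\<integral>\<^sup>+\<eta>. ennreal (((cmod (u \<xi>))\<^sup>2 / 2) * \<gamma> (\<eta> - \<xi>)) + ennreal (((cmod (u \<eta>))\<^sup>2 / 2) * \<gamma> (\<eta> - \<xi>)) \<partial>lborel)"
    proof (intro nn_integral_mono)
      fix \<eta> :: real
      have "cmod (u \<xi>) * cmod (u \<eta>) \<le> (cmod (u \<xi>))\<^sup>2 / 2 + (cmod (u \<eta>))\<^sup>2 / 2"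
        using sum_squares_bound[of "cmod (u \<xi>)" "cmod (u \<eta>)"] by simp
      then have "cmod (u \<xi>) * cmod (u \<eta>) * \<gamma> (\<eta> - \<xi>) \<le> ((cmod (u \<xi>))\<^sup>2 / 2 + (cmod (u \<eta>))\<^sup>2 / 2) * \<gamma> (\<eta> - \<xi>)"
        by (rule mult_right_mono) (rule \<gamma>0)
      then show "ennreal (cmod (u \<xi>) * cmod (u \<eta>) * \<gamma> (\<eta> - \<xi>)) \<le> ennreal (((cmod (u \<xi>))\<^sup>2 / 2) * \<gamma> (\<eta> - \<xi>)) + ennreal (((cmod (u \<eta>))\<^sup>2 / 2) * \<gamma> (\<eta> - \<xi>))"
        by (subst ennreal_plus[symmetric]) (simp_all only: distrib_right ennreal_leI, simp_all add: \<gamma>0)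
    qed
    finally show "ennreal (cmod (u \<xi> * ift w \<xi>)) \<le> (\<integral>\<^sup>+\<eta>. ennreal (((cmod (u \<xi>))\<^sup>2 / 2) * \<gamma> (\<eta> - \<xi>)) + ennreal (((cmod (u \<eta>))\<^sup>2 / 2) * \<gamma> (\<eta> - \<xi>)) \<partial>lborel)" .
  qed
  also have "\<dots> = (\<integral>\<^sup>+\<xi>. (\<integral>\<^sup>+\<eta>. ennreal (((cmod (u \<xi>))\<^sup>2 / 2) * \<gamma> (\<eta> - \<xi>)) \<partial>lborel) \<partial>lborel)
               + (\<integral>\<^sup>+\<xi>. (\<integral>\<^sup>+\<eta>. ennreal (((cmod (u \<eta>))\<^sup>2 / 2) * \<gamma> (\<eta> - \<xi>)) \<partial>lborel) \<partial>lborel)"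
    by (subst nn_integral_add[symmetric]) (auto intro!: nn_integral_cong nn_integral_add)
  also have "(\<integral>\<^sup>+\<xi>. (\<integral>\<^sup>+\<eta>. ennreal (((cmod (u \<eta>))\<^sup>2 / 2) * \<gamma> (\<eta> - \<xi>)) \<partial>lborel) \<partial>lborel)
      = (\<integral>\<^sup>+\<eta>. (\<integral>\<^sup>+\<xi>. ennreal (((cmod (u \<eta>))\<^sup>2 / 2) * \<gamma> (\<eta> - \<xi>)) \<partial>lborel) \<partial>lborel)"
    by (rule lborel_pair.Fubini') simp
  also have "\<dots> = (\<integral>\<^sup>+\<eta>. ennreal ((cmod (u \<eta>))\<^sup>2 / 2) \<partial>lborel)"
    by (intro nn_integral_cong) (rule cm', simp)
  also have "(\<integral>\<^sup>+\<xi>. (\<integral>\<^sup>+\<eta>. ennreal (((cmod (u \<xi>))\<^sup>2 / 2) * \<gamma> (\<eta> - \<xi>)) \<partial>lborel) \<partial>lborel)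
      = (\<integral>\<^sup>+\<eta>. ennreal ((cmod (u \<eta>))\<^sup>2 / 2) \<partial>lborel)"
    by (intro nn_integral_cong) (rule cm, simp)
  also have "(\<integral>\<^sup>+\<eta>. ennreal ((cmod (u \<eta>))\<^sup>2 / 2) \<partial>lborel) + (\<integral>\<^sup>+\<eta>. ennreal ((cmod (u \<eta>))\<^sup>2 / 2) \<partial>lborel)
     = (\<integral>\<^sup>+\<eta>. ennreal ((cmod (u \<eta>))\<^sup>2) \<partial>lborel)"
    by (subst nn_integral_add[symmetric]) (auto intro!: nn_integral_cong simp flip: ennreal_plus)
  also have "\<dots> = ennreal ((l2 u)\<^sup>2)"
    by (rule nn_integral_l2[OF u2])
  finally show ?thesis .
qed

text \<open>The damping tends to one pointwise and the damped bound is uniform, so Fatou's lemma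
  removes it.\<close>

lemma nn_integral_plancherel_le:
  assumes u: "L2fun u"
  shows "(\<integral>\<^sup>+x. ennreal ((cmod (ift u x))\<^sup>2) \<partial>lborel) \<le> ennreal ((l2 u)\<^sup>2)"
proof -
  have [measurable]: "u \<in> borel_measurable borel" by (rule L2fun_measurable[OF u])
  define g where "g n x = ennreal ((cmod (ift u x))\<^sup>2 * gauss (inverse (real (Suc n)) * x))" for n x
  have lim: "(\<lambda>n. g n x) \<longlonglongrightarrow> ennreal ((cmod (ift u x))\<^sup>2)" for x
  proof -
    have "(\<lambda>n. exp (- pi * (inverse (real (Suc n)) * x)\<^sup>2)) \<longlonglongrightarrow> exp (- pi * (0 * x)\<^sup>2)"
      by (intro tendsto_intros LIMSEQ_inverse_real_of_nat)
    then have "(\<lambda>n. (cmod (ift u x))\<^sup>2 * gauss (inverse (real (Suc n)) * x)) \<longlonglongrightarrow> (cmod (ift u x))\<^sup>2 * 1"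
      by (intro tendsto_intros) (simp add: gauss_def)
    then show ?thesis unfolding g_def by (intro tendsto_ennrealI) simp
  qed
  have "(\<integral>\<^sup>+x. ennreal ((cmod (ift u x))\<^sup>2) \<partial>lborel) = (\<integral>\<^sup>+x. liminf (\<lambda>n. g n x) \<partial>lborel)"
    by (intro nn_integral_cong) (simp add: lim_imp_Liminf[OF _ lim])
  also have "\<dots> \<le> liminf (\<lambda>n. \<integral>\<^sup>+x. g n x \<partial>lborel)"
    by (rule nn_integral_liminf) (auto simp: g_def)
  also have "\<dots> \<le> ennreal ((l2 u)\<^sup>2)"
    unfolding g_def
    by (intro Liminf_le) (auto intro!: always_eventually nn_integral_plancherel_damped[OF u])
  finally show ?thesis .
qed

lemma ift_square_integrable:
  assumes u: "L2fun u"
  shows "integrable lborel (\<lambda>x. (cmod (ift u x))\<^sup>2)"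
proof (rule integrableI_bounded)
  have [measurable]: "u \<in> borel_measurable borel" by (rule L2fun_measurable[OF u])
  show "(\<lambda>x. (cmod (ift u x))\<^sup>2) \<in> borel_measurable lborel" by measurable
  show "(\<integral>\<^sup>+ x. ennreal (norm ((cmod (ift u x))\<^sup>2)) \<partial>lborel) < \<infinity>"
    using nn_integral_plancherel_le[OF u] by (auto intro: le_less_trans)
qed

lemma l2_ift_le:
  assumes u: "L2fun u"
  shows "l2 (ift u) \<le> l2 u"
proof -
  have "ennreal ((l2 (ift u))\<^sup>2) \<le> ennreal ((l2 u)\<^sup>2)"
    using nn_integral_plancherel_le[OF u] nn_integral_l2[OF ift_square_integrable[OF u]] by simp
  then show ?thesis by simp
qed

lemma nn_integral_mult_l2:
  fixes f g :: "real \<Rightarrow> complex"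
  assumes f: "integrable lborel (\<lambda>x. (cmod (f x))\<^sup>2)" and g: "integrable lborel (\<lambda>x. (cmod (g x))\<^sup>2)"
    and [measurable]: "f \<in> borel_measurable borel" "g \<in> borel_measurable borel"
  shows "(\<integral>\<^sup>+x. ennreal (cmod (f x * g x)) \<partial>lborel) \<le> ennreal (l2 f * l2 g)"
proof -
  have "(\<integral>\<^sup>+x. ennreal (cmod (f x * g x)) \<partial>lborel)\<^sup>2
      = (\<integral>\<^sup>+x. ennreal (cmod (f x)) * ennreal (cmod (g x)) \<partial>lborel)\<^sup>2"
    by (simp add: norm_mult ennreal_mult')
  also have "\<dots> \<le> (\<integral>\<^sup>+x. (ennreal (cmod (f x)))\<^sup>2 \<partial>lborel) * (\<integral>\<^sup>+x. (ennreal (cmod (g x)))\<^sup>2 \<partial>lborel)"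
    by (rule Cauchy_Schwarz_nn_integral) auto
  also have "\<dots> = (ennreal (l2 f * l2 g))\<^sup>2"
    by (simp add: ennreal_power nn_integral_l2 f g power_mult_distrib flip: ennreal_mult)
  finally show ?thesis by (rule ennreal_power2_le_imp_le)
qed

section \<open>Fourier inversion for Schwartz functions\<close>

lemma quadratic_decay_integrable_real:
  "integrable lborel (\<lambda>x::real. c / (1 + x\<^sup>2))"
proof -
  have "integrable lborel (\<lambda>x::real. inverse (1 + x\<^sup>2))"
    using integrable_inverse_1_plus_square by (simp add: set_integrable_def)
  then have "integrable lborel (\<lambda>x::real. c * inverse (1 + x\<^sup>2))" by simp
  then show ?thesis by (simp add: divide_inverse)
qed

lemma quadratic_decay_integrable:
  fixes f :: "real \<Rightarrow> complex"
  assumes [measurable]: "f \<in> borel_measurable borel" and "\<And>x. cmod (f x) \<le> c / (1 + x\<^sup>2)"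
  shows "integrable lborel f"
  by (rule Bochner_Integration.integrable_bound[OF quadratic_decay_integrable_real[of c]])
     (use assms order_trans[OF assms(2) abs_ge_self] in auto)

lemma quadratic_decay_tendsto_0:
  fixes f :: "real \<Rightarrow> complex"
  assumes "\<And>x. cmod (f x) \<le> c / (1 + x\<^sup>2)"
  shows "(f \<longlongrightarrow> 0) at_top" "(f \<longlongrightarrow> 0) at_bot"
proof -
  have "((\<lambda>x::real. c / (1 + x\<^sup>2)) \<longlongrightarrow> 0) at_top" by real_asymp
  then show "(f \<longlongrightarrow> 0) at_top"
    by (rule Lim_null_comparison[rotated]) (use assms in auto)
  have "((\<lambda>x::real. c / (1 + x\<^sup>2)) \<longlongrightarrow> 0) at_bot" by real_asymp
  then show "(f \<longlongrightarrow> 0) at_bot"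
    by (rule Lim_null_comparison[rotated]) (use assms in auto)
qed

text \<open>The fundamental theorem of calculus on the whole line for \<open>f * e\<close>, whose
  boundary values vanish by the quadratic decay.\<close>

lemma fourier_vector_derivative:
  fixes f f' :: "real \<Rightarrow> complex"
  assumes der: "\<And>x. (f has_vector_derivative f' x) (at x)" and cont: "continuous_on UNIV f'"
    and le: "\<And>x. cmod (f x) \<le> c / (1 + x\<^sup>2)" and le': "\<And>x. cmod (f' x) \<le> c' / (1 + x\<^sup>2)"
  shows "fourier f' \<xi> = 2 * pi * \<i> * \<xi> * fourier f \<xi>"
proof -
  have cf: "continuous_on UNIV f"
    by (rule continuous_on_vector_derivative) (use der has_vector_derivative_at_within in blast)
  have fm [measurable]: "f \<in> borel_measurable borel" "f' \<in> borel_measurable borel"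
    using cf cont borel_measurable_continuous_onI by auto
  have fi: "integrable lborel f" "integrable lborel f'"
    using quadratic_decay_integrable[OF _ le] quadratic_decay_integrable[OF _ le'] by auto
  define e where "e x = ee (- (x * \<xi>))" for x
  have ede: "(e has_vector_derivative (- 2 * pi * \<i> * \<xi>) * e x) (at x)" for x
    unfolding e_def ee_def cis_conv_exp
    by (rule has_vector_derivative_real_field | rule derivative_eq_intros refl | simp)+
  define g where "g x = f x * e x" for x
  define g' where "g' x = f' x * e x + f x * ((- 2 * pi * \<i> * \<xi>) * e x)" for x
  have gd: "(g has_vector_derivative g' x) (at x)" for x
    unfolding g_def g'_def
    using has_vector_derivative_mult[OF der ede] by (simp add: add.commute)
  have ne: "cmod (e x) = 1" for x by (simp add: e_def)
  have ec: "continuous_on UNIV e" unfolding e_def by (intro continuous_intros)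
  then have em [measurable]: "e \<in> borel_measurable borel" by (rule borel_measurable_continuous_onI)
  have gc: "continuous_on UNIV g'"
    unfolding g'_def by (intro continuous_intros cont cf ec)
  have i1: "integrable lborel (\<lambda>x. f' x * e x)" "integrable lborel (\<lambda>x. f x * e x)"
    by (rule integrable_mult_bdd(1)[where C=1]; use fi ne in auto)+
  have gi: "integrable lborel g'"
  proof -
    have "g' = (\<lambda>x. f' x * e x + (- 2 * pi * \<i> * \<xi>) * (f x * e x))"
      by (auto simp: g'_def)
    moreover have "integrable lborel (\<lambda>x. f' x * e x + (- 2 * pi * \<i> * \<xi>) * (f x * e x))"
      by (intro Bochner_Integration.integrable_add integrable_mult_right i1)
    ultimately show ?thesis by simp
  qed
  have gle: "cmod (g x) \<le> c / (1 + x\<^sup>2)" for x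
    using le[of x] by (simp add: g_def norm_mult ne)
  have "(LBINT x=-\<infinity>..\<infinity>. g' x) = 0 - 0"
  proof (rule interval_integral_FTC_integrable)
    show "((g \<circ> real_of_ereal) \<longlongrightarrow> 0) (at_right (- \<infinity>))"
      using quadratic_decay_tendsto_0(2)[OF gle] by (simp add: ereal_tendsto_simps1)
    show "((g \<circ> real_of_ereal) \<longlongrightarrow> 0) (at_left \<infinity>)"
      using quadratic_decay_tendsto_0(1)[OF gle] by (simp add: ereal_tendsto_simps1)
    show "set_integrable lborel (einterval (- \<infinity>) \<infinity>) g'"
      using gi by (simp add: set_integrable_def)
    show "isCont g' x" for x
      using gc continuous_on_eq_continuous_at by blast
  qed (use gd in auto)
  then have "0 = (LINT x|lborel. g' x)"
    by (simp add: interval_lebesgue_integral_def set_lebesgue_integral_def)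
  also have "\<dots> = (LINT x|lborel. f' x * e x) + (LINT x|lborel. (- 2 * pi * \<i> * \<xi>) * (f x * e x))"
    unfolding g'_def
    by (subst Bochner_Integration.integral_add[symmetric])
      (intro integrable_mult_right i1, intro integrable_mult_right i1, simp only: mult_ac)
  also have "\<dots> = fourier f' \<xi> + (- 2 * pi * \<i> * \<xi>) * fourier f \<xi>"
    by (simp only: integral_mult_right_zero fourier_ee e_def inner_real_def)
  finally show ?thesis
    by (simp add: algebra_simps add_eq_0_iff)
qed

section \<open>Schwartz functions on the line and their transforms\<close>

lemma schwartz_decay:
  assumes "schwartz f" "set bs \<subseteq> Basis"
  obtains c where "c \<ge> 0" "\<And>x. norm x ^ k * cmod (iter_pderiv bs f x) \<le> c"
proof -
  have "bounded (range (\<lambda>x. norm x ^ k *\<^sub>R iter_pderiv bs f x))"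
    using assms unfolding schwartz_def by blast
  then obtain c where "\<forall>y \<in> range (\<lambda>x. norm x ^ k *\<^sub>R iter_pderiv bs f x). cmod y \<le> c"
    unfolding bounded_iff by blast
  then have "norm x ^ k * cmod (iter_pderiv bs f x) \<le> c" for x
    by auto
  moreover from this[of 0] have "c \<ge> 0" by (rule order_trans[rotated]) simp
  ultimately show ?thesis using that by blast
qed

lemma schwartz_continuous:
  assumes "schwartz f" "set bs \<subseteq> Basis"
  shows "continuous_on UNIV (iter_pderiv bs f)"
  using assms unfolding schwartz_def
  by (meson differentiable_imp_continuous_within continuous_at_imp_continuous_on)

lemma schwartz_quadratic_decay:
  fixes f :: "real \<Rightarrow> complex"
  assumes "schwartz f" "set bs \<subseteq> Basis"
  obtains c where "\<And>x. cmod (iter_pderiv bs f x) \<le> c / (1 + x\<^sup>2)"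
proof -
  obtain c0 c2 where "\<And>x. norm x ^ 0 * cmod (iter_pderiv bs f x) \<le> c0"
    "\<And>x. norm x ^ 2 * cmod (iter_pderiv bs f x) \<le> c2"
    by (meson schwartz_decay assms)
  then have "(1 + x\<^sup>2) * cmod (iter_pderiv bs f x) \<le> c0 + c2" for x
    by (simp add: distrib_right add_mono)
  then have "cmod (iter_pderiv bs f x) \<le> (c0 + c2) / (1 + x\<^sup>2)" for x
    by (simp add: pos_le_divide_eq add_pos_nonneg mult.commute)
  then show ?thesis using that by blast
qed

lemma schwartz_vector_derivative:
  fixes f :: "real \<Rightarrow> complex"
  assumes "schwartz f" "set bs \<subseteq> Basis"
  shows "(iter_pderiv bs f has_vector_derivative iter_pderiv (1 # bs) f x) (at x)"
proof -
  have "iter_pderiv bs f differentiable (at x)"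
    using assms unfolding schwartz_def by blast
  then have *: "(iter_pderiv bs f has_derivative frechet_derivative (iter_pderiv bs f) (at x)) (at x)"
    by (rule iffD1[OF frechet_derivative_works])
  then interpret bounded_linear "frechet_derivative (iter_pderiv bs f) (at x)"
    by (rule has_derivative_bounded_linear)
  have "frechet_derivative (iter_pderiv bs f) (at x) h = h *\<^sub>R iter_pderiv (1 # bs) f x" for h
    using scaleR[of h 1] by simp
  with * show ?thesis unfolding has_vector_derivative_def
    by (metis (no_types, lifting) ext)
qed

text \<open>Two derivatives become a factor of size \<open>\<xi>\<^sup>2\<close>; this quadratic
  decay already makes the transform integrable and square integrable.\<close>

lemma schwartz_fourier_decay:
  fixes f :: "real \<Rightarrow> complex"
  assumes f: "schwartz f"
  obtains c where "\<And>\<xi>. cmod (fourier f \<xi>) \<le> c / (1 + \<xi>\<^sup>2)"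
proof -
  define d where "d n = iter_pderiv (replicate n 1) f" for n
  have b: "set (replicate n 1) \<subseteq> (Basis :: real set)" for n by auto
  obtain c0 c1 c2 where c: "\<And>x. cmod (d 0 x) \<le> c0 / (1 + x\<^sup>2)" "\<And>x. cmod (d 1 x) \<le> c1 / (1 + x\<^sup>2)"
      "\<And>x. cmod (d 2 x) \<le> c2 / (1 + x\<^sup>2)"
    unfolding d_def by (meson schwartz_quadratic_decay[OF f b])
  have der: "(d n has_vector_derivative d (Suc n) x) (at x)" for n x
    unfolding d_def using schwartz_vector_derivative[OF f b] by simp
  have cont: "continuous_on UNIV (d n)" for n
    unfolding d_def by (rule schwartz_continuous[OF f b])
  then have [measurable]: "d n \<in> borel_measurable borel" for n
    by (rule borel_measurable_continuous_onI)
  have F1: "fourier (d 1) \<xi> = 2 * pi * \<i> * \<xi> * fourier (d 0) \<xi>" for \<xi>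
    by (rule fourier_vector_derivative[OF _ cont]) (use der[of 0] c in auto)
  have F2: "fourier (d 2) \<xi> = 2 * pi * \<i> * \<xi> * fourier (d 1) \<xi>" for \<xi>
    by (rule fourier_vector_derivative[OF _ cont]) (use der[of 1] c in \<open>auto simp: numeral_2_eq_2\<close>)
  have int: "integrable lborel (d 0)" "integrable lborel (d 2)"
    using quadratic_decay_integrable[OF _ c(1)] quadratic_decay_integrable[OF _ c(3)] by auto
  define m0 m2 where "m0 = (LINT x|lborel. cmod (d 0 x))" and "m2 = (LINT x|lborel. cmod (d 2 x))"
  have m: "cmod (fourier (d 0) \<xi>) \<le> m0" "cmod (fourier (d 2) \<xi>) \<le> m2" for \<xi>
    unfolding fourier_eq_ift m0_def m2_def by (rule norm_ift_le int)+
  have "(1 + \<xi>\<^sup>2) * cmod (fourier f \<xi>) \<le> m0 + m2" for \<xi>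
  proof -
    have "cmod (fourier (d 2) \<xi>) = (2 * pi)\<^sup>2 * \<xi>\<^sup>2 * cmod (fourier (d 0) \<xi>)"
    proof -
      have "cmod (fourier (d 2) \<xi>) = 2 * pi * \<bar>\<xi>\<bar> * (2 * pi * \<bar>\<xi>\<bar> * cmod (fourier (d 0) \<xi>))"
        unfolding F2 F1 by (simp add: norm_mult)
      also have "\<dots> = (2 * pi)\<^sup>2 * (\<bar>\<xi>\<bar> * \<bar>\<xi>\<bar>) * cmod (fourier (d 0) \<xi>)"
        by (simp only: power2_eq_square mult_ac)
      finally show ?thesis by (simp add: power2_eq_square[of \<xi>])
    qed
    moreover have "\<xi>\<^sup>2 * cmod (fourier (d 0) \<xi>) * 1 \<le> \<xi>\<^sup>2 * cmod (fourier (d 0) \<xi>) * (2 * pi)\<^sup>2"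
    proof (intro mult_left_mono)
      show "1 \<le> (2 * pi)\<^sup>2" by (rule one_le_power) (use pi_gt3 in simp)
    qed auto
    ultimately have "\<xi>\<^sup>2 * cmod (fourier (d 0) \<xi>) \<le> m2"
      using m(2)[of \<xi>] by (simp add: mult_ac)
    with m(1)[of \<xi>] show ?thesis by (simp add: d_def distrib_right)
  qed
  then have "cmod (fourier f \<xi>) \<le> (m0 + m2) / (1 + \<xi>\<^sup>2)" for \<xi>
    by (simp add: pos_le_divide_eq add_pos_nonneg mult.commute)
  then show ?thesis using that by blast
qed

text \<open>Gaussian summability. With a damping factor, Fubini turns the double integral into an
  average of \<open>f\<close> against a Gaussian of width \<open>\<epsilon> n\<close> centred at
  \<open>t\<close>. As \<open>\<epsilon> n\<close> tends to zero one side tends to the undamped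
  integral and the other to \<open>f t\<close>, both by dominated convergence.\<close>

lemma ift_fourier:
  fixes f :: "real \<Rightarrow> complex"
  assumes f: "integrable lborel f" and cont: "continuous_on UNIV f" and bd: "\<And>x. cmod (f x) \<le> c"
    and F: "integrable lborel (fourier f)"
  shows "ift (fourier f) t = f t"
proof -
  have fm [measurable]: "f \<in> borel_measurable borel"
    using f by auto
  define \<epsilon> where "\<epsilon> n = inverse (real (Suc n))" for n
  have e: "\<epsilon> n > 0" for n by (simp add: \<epsilon>_def)
  have e0: "\<epsilon> \<longlonglongrightarrow> 0" unfolding \<epsilon>_def by (rule LIMSEQ_inverse_real_of_nat)
  define I where "I n = (LINT \<xi>|lborel. fourier f \<xi> * (of_real (gauss (\<epsilon> n * \<xi>)) * ee (t * \<xi>)))" for n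
  have gl: "(\<lambda>n. gauss (\<epsilon> n * \<xi>)) \<longlonglongrightarrow> 1" for \<xi>
  proof -
    have "(\<lambda>n. exp (- pi * (\<epsilon> n * \<xi>)\<^sup>2)) \<longlonglongrightarrow> exp (- pi * (0 * \<xi>)\<^sup>2)"
      by (intro tendsto_intros e0)
    then show ?thesis by (simp add: gauss_def)
  qed
  have Fm [measurable]: "fourier f \<in> borel_measurable borel" using F by auto
  have I1: "I \<longlonglongrightarrow> (LINT \<xi>|lborel. fourier f \<xi> * ee (t * \<xi>))"
    unfolding I_def
  proof (rule integral_dominated_convergence[where w="\<lambda>\<xi>. cmod (fourier f \<xi>)"])
    show "AE \<xi> in lborel. (\<lambda>n. fourier f \<xi> * (complex_of_real (gauss (\<epsilon> n * \<xi>)) * ee (t * \<xi>))) \<longlonglongrightarrow> fourier f \<xi> * ee (t * \<xi>)"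
    proof (intro AE_I2)
      fix \<xi>
      have "(\<lambda>n. fourier f \<xi> * (complex_of_real (gauss (\<epsilon> n * \<xi>)) * ee (t * \<xi>))) \<longlonglongrightarrow> fourier f \<xi> * (complex_of_real 1 * ee (t * \<xi>))"
        by (intro tendsto_intros gl)
      then show "(\<lambda>n. fourier f \<xi> * (complex_of_real (gauss (\<epsilon> n * \<xi>)) * ee (t * \<xi>))) \<longlonglongrightarrow> fourier f \<xi> * ee (t * \<xi>)"
        by simp
    qed
    show "AE x in lborel. cmod (fourier f x * (complex_of_real (gauss (\<epsilon> n * x)) * ee (t * x))) \<le> cmod (fourier f x)" for n
      by (auto simp: norm_mult gauss_le1 intro!: mult_left_le)
  qed (use F in auto)
  have In: "I n = (LINT r|lborel. gauss r *\<^sub>R f (t + \<epsilon> n * r))" for n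
  proof -
    define g where "g \<xi> = complex_of_real (gauss (\<epsilon> n * \<xi>)) * ee (t * \<xi>)" for \<xi>
    have gi: "integrable lborel g"
      unfolding g_def using gauss_scaled_integrable[OF e, of 0] by auto
    have "I n = (LINT \<xi>|lborel. g \<xi> * (LINT s|lborel. f s * (\<lambda>p. ee (- (snd p * fst p))) (\<xi>, s)))"
      unfolding I_def fourier_ee g_def by (simp add: mult_ac)
    also have "\<dots> = (LINT s|lborel. f s * (LINT \<xi>|lborel. g \<xi> * (\<lambda>p. ee (- (snd p * fst p))) (\<xi>, s)))"
      by (rule fubini_tensor[OF gi f, where C=1]) auto
    also have "\<dots> = (LINT s|lborel. f s * of_real (gauss ((t - s) / \<epsilon> n) / \<epsilon> n))"
    proof -
      have "(LINT \<xi>|lborel. g \<xi> * ee (- (s * \<xi>))) = of_real (gauss ((t - s) / \<epsilon> n) / \<epsilon> n)" for s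
      proof -
        have "ee (t * \<xi>) * ee (- (s * \<xi>)) = ee ((t - s) * \<xi>)" for \<xi>
          by (simp add: ee_add[symmetric] algebra_simps)
        then show ?thesis
          unfolding g_def gauss_scaled_transform[OF e, symmetric] by (simp only: mult.assoc)
      qed
      then show ?thesis by simp
    qed
    also have "\<dots> = \<bar>\<epsilon> n\<bar> *\<^sub>R (LINT r|lborel. f (t + \<epsilon> n * r) * of_real (gauss ((t - (t + \<epsilon> n * r)) / \<epsilon> n) / \<epsilon> n))"
      by (rule lborel_integral_real_affine) (use e[of n] in auto)
    also have "\<dots> = (LINT r|lborel. \<bar>\<epsilon> n\<bar> *\<^sub>R (f (t + \<epsilon> n * r) * of_real (gauss ((t - (t + \<epsilon> n * r)) / \<epsilon> n) / \<epsilon> n)))"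
      by simp
    also have "\<dots> = (LINT r|lborel. gauss r *\<^sub>R f (t + \<epsilon> n * r))"
      using e[of n] by (intro Bochner_Integration.integral_cong refl)
        (simp add: scaleR_conv_of_real gauss_def)
    finally show ?thesis .
  qed
  have "(\<lambda>n. LINT r|lborel. gauss r *\<^sub>R f (t + \<epsilon> n * r)) \<longlonglongrightarrow> (LINT r|lborel. gauss r *\<^sub>R f t)"
  proof (rule integral_dominated_convergence[where w="\<lambda>r. c * gauss r"])
    show "integrable lborel (\<lambda>r. c * gauss r)" using gauss_integrable by auto
    show "AE r in lborel. (\<lambda>n. gauss r *\<^sub>R f (t + \<epsilon> n * r)) \<longlonglongrightarrow> gauss r *\<^sub>R f t"
    proof (intro AE_I2 tendsto_intros)
      fix r
      have "(\<lambda>n. t + \<epsilon> n * r) \<longlonglongrightarrow> t + 0 * r"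
        by (intro tendsto_intros e0)
      then show "(\<lambda>n. f (t + \<epsilon> n * r)) \<longlonglongrightarrow> f t"
        using cont continuous_on_tendsto_compose[of UNIV f "\<lambda>n. t + \<epsilon> n * r" t sequentially] by simp
    qed
    show "AE r in lborel. norm (gauss r *\<^sub>R f (t + \<epsilon> n * r)) \<le> c * gauss r" for n
      by (auto simp: mult.commute[of c] intro!: mult_left_mono bd)
  qed auto
  then have "I \<longlonglongrightarrow> (LINT r|lborel. gauss r *\<^sub>R f t)" by (simp add: In[abs_def])
  then have "(LINT \<xi>|lborel. fourier f \<xi> * ee (t * \<xi>)) = (LINT r|lborel. gauss r *\<^sub>R f t)"
    by (rule LIMSEQ_unique[OF I1])
  then show ?thesis
    by (simp add: ift_def integral_gauss gauss_integrable)
qed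

lemma schwartz_real_facts:
  fixes f :: "real \<Rightarrow> complex"
  assumes f: "schwartz f"
  shows "L2fun f" "L2fun (fourier f)" "ift (fourier f) = f" "l2 (fourier f) \<le> l2 f"
    "continuous_on UNIV f" "\<exists>c. \<forall>x. cmod (f x) \<le> c"
proof -
  obtain c where c: "\<And>x. cmod (f x) \<le> c / (1 + x\<^sup>2)"
    using schwartz_quadratic_decay[OF f, of "[]"] by auto
  obtain d where d: "\<And>x. cmod (fourier f x) \<le> d / (1 + x\<^sup>2)"
    using schwartz_fourier_decay[OF f] by auto
  show cont: "continuous_on UNIV f" using schwartz_continuous[OF f, of "[]"] by simp
  then have fm [measurable]: "f \<in> borel_measurable borel" by (rule borel_measurable_continuous_onI)
  have Fm [measurable]: "fourier f \<in> borel_measurable borel"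
    unfolding fourier_eq_ift[abs_def] by measurable
  have L: "L2fun g" if g: "g \<in> borel_measurable borel" "\<And>x. cmod (g x) \<le> k / (1 + x\<^sup>2)" for g :: "real \<Rightarrow> complex" and k
  proof -
    note [measurable] = g(1)
    have k0: "0 \<le> k" using order_trans[OF norm_ge_zero g(2)[of 0]] by simp
    have gk: "cmod (g x) \<le> k" for x
      using order_trans[OF g(2)[of x]] k0 by (simp add: divide_le_eq add_pos_nonneg mult_le_cancel_left1)
    have "integrable lborel g" by (rule quadratic_decay_integrable[OF g])
    moreover have "integrable lborel (\<lambda>x. (cmod (g x))\<^sup>2)"
    proof (rule Bochner_Integration.integrable_bound)
      show "integrable lborel (\<lambda>x. k * cmod (g x))" using \<open>integrable lborel g\<close> by auto
      show "AE x in lborel. norm ((cmod (g x))\<^sup>2) \<le> norm (k * cmod (g x))"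
        using gk by (auto simp: power2_eq_square abs_mult k0 intro!: mult_right_mono)
    qed auto
    ultimately show ?thesis by (simp add: L2fun_def)
  qed
  show Lf: "L2fun f" by (rule L[OF fm c])
  show LF: "L2fun (fourier f)" by (rule L[OF Fm d])
  have "0 \<le> c" using order_trans[OF norm_ge_zero c[of 0]] by simp
  then have fc: "cmod (f x) \<le> c" for x
    using order_trans[OF c[of x]] by (simp add: divide_le_eq add_pos_nonneg mult_le_cancel_left1)
  then show "\<exists>c. \<forall>x. cmod (f x) \<le> c" by blast
  show "ift (fourier f) = f"
    using ift_fourier[OF _ cont fc] Lf LF by (auto simp: L2fun_def)
  have "(l2 (fourier f))\<^sup>2 = (LINT x|lborel. (cmod (ift f (0 + (-1) * x)))\<^sup>2)"
    by (simp add: l2_power2 fourier_eq_ift)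
  also have "\<dots> = (l2 (ift f))\<^sup>2"
    using lborel_integral_real_affine[of "-1" "\<lambda>x. (cmod (ift f x))\<^sup>2" 0] by (simp add: l2_power2)
  finally have "l2 (fourier f) = l2 (ift f)" by (simp add: power2_eq_iff_nonneg)
  then show "l2 (fourier f) \<le> l2 f" using l2_ift_le[OF Lf] by simp
qed

section \<open>The maximal function of the Cauchy kernel\<close>

text \<open>The Poisson kernel of the half-plane at height \<open>t\<close>, without the factor
  \<open>1 / pi\<close>. Its mass is therefore \<open>pi\<close>, the source of the powers of
  \<open>pi\<close> in the maximal theorem.\<close>

definition cauchy :: "real \<Rightarrow> real \<Rightarrow> real" where
  "cauchy t x = t / (t\<^sup>2 + x\<^sup>2)"

lemma cauchy_measurable [measurable]: "(\<lambda>p. cauchy (fst p) (snd p)) \<in> borel_measurable (borel \<Otimes>\<^sub>M borel)"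
  unfolding cauchy_def by measurable

lemma cauchy_measurable' [measurable (raw)]:
  assumes [measurable]: "f \<in> borel_measurable M" "g \<in> borel_measurable M"
  shows "(\<lambda>x. cauchy (f x) (g x)) \<in> borel_measurable M"
  unfolding cauchy_def by measurable

lemma cauchy_nonneg: "t > 0 \<Longrightarrow> 0 \<le> cauchy t x"
  by (simp add: cauchy_def)

lemma nn_integral_cauchy:
  assumes "t > 0"
  shows "(\<integral>\<^sup>+x. ennreal (cauchy t (x - c)) \<partial>lborel) = ennreal pi"
proof -
  have i: "integrable lborel (\<lambda>x::real. inverse (1 + x\<^sup>2))" and v: "(LINT x|lborel. inverse (1 + (x::real)\<^sup>2)) = pi"
    using integrable_inverse_1_plus_square LBINT_inverse_1_plus_square
    by (simp_all add: set_integrable_def interval_lebesgue_integral_def set_lebesgue_integral_def)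
  have "(\<integral>\<^sup>+x. ennreal (cauchy t (x - c)) \<partial>lborel) = ennreal \<bar>t\<bar> * (\<integral>\<^sup>+x. ennreal (cauchy t (c + t * x - c)) \<partial>lborel)"
    by (rule nn_integral_real_affine) (use assms in auto)
  also have "\<dots> = (\<integral>\<^sup>+x. ennreal \<bar>t\<bar> * ennreal (cauchy t (c + t * x - c)) \<partial>lborel)"
    by (simp add: nn_integral_cmult)
  also have "\<dots> = (\<integral>\<^sup>+x. ennreal (inverse (1 + x\<^sup>2)) \<partial>lborel)"
  proof (intro nn_integral_cong)
    fix x
    have e: "t\<^sup>2 + (t * x)\<^sup>2 = t * (t * (1 + x\<^sup>2))"
      by (simp add: power2_eq_square algebra_simps)
    have "t * (t / (t * (t * w))) = inverse w" if "w > 0" for w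
      using assms that by (simp add: field_simps)
    then have "t * cauchy t (t * x) = inverse (1 + x\<^sup>2)"
      unfolding cauchy_def e by (simp add: add_pos_nonneg)
    then show "ennreal \<bar>t\<bar> * ennreal (cauchy t (c + t * x - c)) = ennreal (inverse (1 + x\<^sup>2))"
      using assms by (simp flip: ennreal_mult')
  qed
  also have "\<dots> = ennreal pi"
    using nn_integral_eq_integral[OF i] v by simp
  finally show ?thesis .
qed

lemma cauchy_minus: "cauchy t (- x) = cauchy t x"
  by (simp add: cauchy_def)

lemma nn_integral_cauchy':
  assumes "t > 0"
  shows "(\<integral>\<^sup>+x. ennreal (cauchy t (c - x)) \<partial>lborel) = ennreal pi"
  using nn_integral_cauchy[OF assms, of c] cauchy_minus[of t "x - c" for x] by simp

lemma cauchy_le_4: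
  assumes "t > 0" "\<bar>x\<bar> \<le> 2 * \<bar>y\<bar>"
  shows "cauchy t y \<le> 4 * cauchy t x"
proof -
  have "x\<^sup>2 \<le> (2 * y)\<^sup>2"
    by (rule iffD1[OF abs_le_square_iff]) (use assms(2) in \<open>simp add: abs_mult\<close>)
  then have "x\<^sup>2 \<le> 4 * y\<^sup>2" by (simp add: power_mult_distrib)
  then have "t\<^sup>2 + x\<^sup>2 \<le> 4 * (t\<^sup>2 + y\<^sup>2)" 
    using add_mono[of "x\<^sup>2" "4 * y\<^sup>2" 0 "3 * t\<^sup>2"] by simp
  moreover have "t\<^sup>2 + x\<^sup>2 > 0" "t\<^sup>2 + y\<^sup>2 > 0" using assms by (simp_all add: sum_power2_gt_zero_iff)
  ultimately show ?thesis
    using assms(1) by (simp add: cauchy_def divide_simps mult_ac)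
qed

text \<open>Either \<open>z\<close> is far from \<open>x\<close> or far from \<open>y\<close>, so one factor may be pulled out of the integral.\<close>
lemma cauchy_convolution_le:
  assumes s: "s > 0" and t: "t > 0"
  shows "(\<integral>\<^sup>+z. ennreal (cauchy s (x - z)) * ennreal (cauchy t (y - z)) \<partial>lborel)
    \<le> ennreal (4 * pi) * (ennreal (cauchy s (x - y)) + ennreal (cauchy t (y - x)))"
proof -
  have "(\<integral>\<^sup>+z. ennreal (cauchy s (x - z)) * ennreal (cauchy t (y - z)) \<partial>lborel)
     \<le> (\<integral>\<^sup>+z. ennreal (4 * cauchy s (x - y)) * ennreal (cauchy t (y - z))
            + ennreal (4 * cauchy t (y - x)) * ennreal (cauchy s (x - z)) \<partial>lborel)"
  proof (intro nn_integral_mono)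
    fix z
    show "ennreal (cauchy s (x - z)) * ennreal (cauchy t (y - z))
      \<le> ennreal (4 * cauchy s (x - y)) * ennreal (cauchy t (y - z))
        + ennreal (4 * cauchy t (y - x)) * ennreal (cauchy s (x - z))"
    proof (cases "\<bar>x - y\<bar> \<le> 2 * \<bar>x - z\<bar>")
      case True
      have "ennreal (cauchy s (x - z)) * ennreal (cauchy t (y - z)) \<le> ennreal (4 * cauchy s (x - y)) * ennreal (cauchy t (y - z))"
        by (intro mult_right_mono ennreal_leI cauchy_le_4 s True) simp
      then show ?thesis by (rule order_trans) simp
    next
      case False
      then have "\<bar>y - x\<bar> \<le> 2 * \<bar>y - z\<bar>" by (smt (verit))
      then have "ennreal (cauchy t (y - z)) * ennreal (cauchy s (x - z)) \<le> ennreal (4 * cauchy t (y - x)) * ennreal (cauchy s (x - z))"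
        by (intro mult_right_mono ennreal_leI cauchy_le_4 t) simp_all
      then show ?thesis by (simp add: mult.commute[of "ennreal (cauchy s (x - z))"] add_increasing)
    qed
  qed
  also have "\<dots> = ennreal (4 * cauchy s (x - y)) * ennreal pi + ennreal (4 * cauchy t (y - x)) * ennreal pi"
    by (simp add: nn_integral_add nn_integral_cmult nn_integral_cauchy' s t)
  also have "\<dots> = ennreal (4 * pi) * (ennreal (cauchy s (x - y)) + ennreal (cauchy t (y - x)))"
    using cauchy_nonneg[OF s] cauchy_nonneg[OF t]
    by (simp add: ennreal_mult'[symmetric] ennreal_plus[symmetric] distrib_left mult_ac del: ennreal_plus)
  finally show ?thesis .
qed

text \<open>The square of the linearised maximal operator is estimated by \<open>T T*\<close>: a bound \<open>N\<close> improves to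
  \<open>sqrt (8 * pi * N)\<close>, and iteration gives \<open>8 * pi\<close>, whatever the initial bound was.\<close>
lemma maximal_selected_bootstrap:
  fixes \<tau> :: "real \<Rightarrow> real"
  assumes \<tau> [measurable]: "\<tau> \<in> borel_measurable borel" and pos: "\<And>x. \<tau> x > 0"
    and f [measurable]: "f \<in> borel_measurable borel"
    and N: "\<And>g. g \<in> borel_measurable borel \<Longrightarrow> (\<integral>\<^sup>+x. (\<integral>\<^sup>+s. g s * ennreal (cauchy (\<tau> x) (x - s)) \<partial>lborel)\<^sup>2 \<partial>lborel) \<le> ennreal (N\<^sup>2) * (\<integral>\<^sup>+x. (g x)\<^sup>2 \<partial>lborel)"
    and N0: "N \<ge> 0"
  shows "(\<integral>\<^sup>+x. (\<integral>\<^sup>+s. f s * ennreal (cauchy (\<tau> x) (x - s)) \<partial>lborel)\<^sup>2 \<partial>lborel) \<le> ennreal (8 * pi * N) * (\<integral>\<^sup>+x. (f x)\<^sup>2 \<partial>lborel)"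
proof (cases "(\<integral>\<^sup>+x. (f x)\<^sup>2 \<partial>lborel) = \<infinity>")
  case True
  show ?thesis
  proof (cases "N = 0")
    case True
    then have "(\<integral>\<^sup>+x. (\<integral>\<^sup>+s. f s * ennreal (cauchy (\<tau> x) (x - s)) \<partial>lborel)\<^sup>2 \<partial>lborel) \<le> 0"
      using N[OF f] by simp
    then show ?thesis by simp
  next
    case False
    with True N0 show ?thesis by (simp add: ennreal_mult_top ennreal_mult_eq_top_iff)
  qed
next
  case fin: False
  define T where "T g x = (\<integral>\<^sup>+s. g s * ennreal (cauchy (\<tau> x) (x - s)) \<partial>lborel)" for g :: "real \<Rightarrow> ennreal" and x
  have Tm [measurable]: "T g \<in> borel_measurable borel" if [measurable]: "g \<in> borel_measurable borel" for g
    unfolding T_def by measurable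
  define F where "F = T f"
  have Fm [measurable]: "F \<in> borel_measurable borel" unfolding F_def by measurable
  define A where "A = (\<integral>\<^sup>+x. (F x)\<^sup>2 \<partial>lborel)"
  define Bf where "Bf = (\<integral>\<^sup>+x. (f x)\<^sup>2 \<partial>lborel)"
  define S where "S s = (\<integral>\<^sup>+x. F x * ennreal (cauchy (\<tau> x) (x - s)) \<partial>lborel)" for s
  have Sm [measurable]: "S \<in> borel_measurable borel" unfolding S_def by measurable
  have AleN: "A \<le> ennreal (N\<^sup>2) * Bf"
    using N[OF f] by (simp add: A_def F_def T_def Bf_def)
  have "A = (\<integral>\<^sup>+x. (\<integral>\<^sup>+s. F x * (f s * ennreal (cauchy (\<tau> x) (x - s))) \<partial>lborel) \<partial>lborel)"
    unfolding A_def
    by (intro nn_integral_cong) (simp add: power2_eq_square F_def T_def[of f] nn_integral_cmult)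
  also have "\<dots> = (\<integral>\<^sup>+s. (\<integral>\<^sup>+x. F x * (f s * ennreal (cauchy (\<tau> x) (x - s))) \<partial>lborel) \<partial>lborel)"
    by (rule lborel_pair.Fubini') simp
  also have "\<dots> = (\<integral>\<^sup>+s. f s * S s \<partial>lborel)"
    unfolding S_def by (intro nn_integral_cong) (simp add: nn_integral_cmult[symmetric] mult_ac)
  finally have A1: "A\<^sup>2 \<le> Bf * (\<integral>\<^sup>+s. (S s)\<^sup>2 \<partial>lborel)"
    using Cauchy_Schwarz_nn_integral[of f lborel S] by (simp add: Bf_def)
  define k where "k x y = (\<integral>\<^sup>+s. ennreal (cauchy (\<tau> x) (x - s)) * ennreal (cauchy (\<tau> y) (y - s)) \<partial>lborel)" for x y
  define I where "I = (\<integral>\<^sup>+x. F x * T F x \<partial>lborel)"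
  have "(\<integral>\<^sup>+s. (S s)\<^sup>2 \<partial>lborel) = (\<integral>\<^sup>+s. (\<integral>\<^sup>+x. (\<integral>\<^sup>+y. (F x * F y) * (ennreal (cauchy (\<tau> x) (x - s)) * ennreal (cauchy (\<tau> y) (y - s))) \<partial>lborel) \<partial>lborel) \<partial>lborel)"
    unfolding S_def power2_eq_square
    by (intro nn_integral_cong) (simp add: nn_integral_cmult[symmetric] nn_integral_multc[symmetric] mult_ac)
  also have "\<dots> = (\<integral>\<^sup>+x. (\<integral>\<^sup>+s. (\<integral>\<^sup>+y. (F x * F y) * (ennreal (cauchy (\<tau> x) (x - s)) * ennreal (cauchy (\<tau> y) (y - s))) \<partial>lborel) \<partial>lborel) \<partial>lborel)"
    by (rule lborel_pair.Fubini') simp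
  also have "\<dots> = (\<integral>\<^sup>+x. (\<integral>\<^sup>+y. (\<integral>\<^sup>+s. (F x * F y) * (ennreal (cauchy (\<tau> x) (x - s)) * ennreal (cauchy (\<tau> y) (y - s))) \<partial>lborel) \<partial>lborel) \<partial>lborel)"
    by (intro nn_integral_cong lborel_pair.Fubini') simp
  also have "\<dots> = (\<integral>\<^sup>+x. (\<integral>\<^sup>+y. (F x * F y) * k x y \<partial>lborel) \<partial>lborel)"
    unfolding k_def by (intro nn_integral_cong nn_integral_cmult) simp
  also have "\<dots> \<le> (\<integral>\<^sup>+x. (\<integral>\<^sup>+y. (F x * F y) * (ennreal (4 * pi) * (ennreal (cauchy (\<tau> x) (x - y)) + ennreal (cauchy (\<tau> y) (y - x)))) \<partial>lborel) \<partial>lborel)"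
    unfolding k_def by (intro nn_integral_mono mult_left_mono cauchy_convolution_le pos) simp
  also have "\<dots> = (\<integral>\<^sup>+x. (\<integral>\<^sup>+y. ennreal (4 * pi) * (F x * (F y * ennreal (cauchy (\<tau> x) (x - y)))) + ennreal (4 * pi) * (F y * (F x * ennreal (cauchy (\<tau> y) (y - x)))) \<partial>lborel) \<partial>lborel)"
    by (intro nn_integral_cong) (simp add: distrib_left mult_ac)
  also have "\<dots> = (\<integral>\<^sup>+x. (\<integral>\<^sup>+y. ennreal (4 * pi) * (F x * (F y * ennreal (cauchy (\<tau> x) (x - y)))) \<partial>lborel) \<partial>lborel)
      + (\<integral>\<^sup>+x. (\<integral>\<^sup>+y. ennreal (4 * pi) * (F y * (F x * ennreal (cauchy (\<tau> y) (y - x)))) \<partial>lborel) \<partial>lborel)"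
    by (subst nn_integral_add[symmetric]) (auto intro!: nn_integral_cong nn_integral_add)
  also have "(\<integral>\<^sup>+x. (\<integral>\<^sup>+y. ennreal (4 * pi) * (F y * (F x * ennreal (cauchy (\<tau> y) (y - x)))) \<partial>lborel) \<partial>lborel)
      = (\<integral>\<^sup>+y. (\<integral>\<^sup>+x. ennreal (4 * pi) * (F y * (F x * ennreal (cauchy (\<tau> y) (y - x)))) \<partial>lborel) \<partial>lborel)"
    by (rule lborel_pair.Fubini') simp
  also have "(\<integral>\<^sup>+x. (\<integral>\<^sup>+y. ennreal (4 * pi) * (F x * (F y * ennreal (cauchy (\<tau> x) (x - y)))) \<partial>lborel) \<partial>lborel) = ennreal (4 * pi) * I"
    unfolding I_def T_def by (simp add: nn_integral_cmult)
  also have "ennreal (4 * pi) * I + ennreal (4 * pi) * I = ennreal (8 * pi) * I"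
    by (simp add: distrib_right[symmetric] ennreal_plus[symmetric] del: ennreal_plus)
  finally have SI: "(\<integral>\<^sup>+s. (S s)\<^sup>2 \<partial>lborel) \<le> ennreal (8 * pi) * I" .
  have "I\<^sup>2 \<le> A * (\<integral>\<^sup>+x. (T F x)\<^sup>2 \<partial>lborel)"
    unfolding I_def A_def by (rule Cauchy_Schwarz_nn_integral) auto
  also have "\<dots> \<le> A * (ennreal (N\<^sup>2) * A)"
    using N[OF Fm] by (intro mult_left_mono) (auto simp: T_def A_def)
  also have "\<dots> = (ennreal N * A)\<^sup>2"
    by (simp add: power2_eq_square ennreal_mult N0 mult_ac)
  finally have IN: "I \<le> ennreal N * A" by (rule ennreal_power2_le_imp_le)
  have "A\<^sup>2 \<le> Bf * (ennreal (8 * pi) * (ennreal N * A))"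
    by (rule order_trans[OF A1]) (intro mult_left_mono order_trans[OF SI] IN; simp)
  then have A2: "A * A \<le> ennreal (8 * pi * N) * Bf * A"
    by (simp add: power2_eq_square ennreal_mult N0 mult_ac)
  \<comment> \<open>Cancelling one factor \<open>A\<close> requires \<open>A\<close> to be finite;
    this is the purpose of starting from some a priori bound \<open>N\<close>, however bad.\<close>
  have "Bf \<noteq> \<infinity>" using fin by (simp add: Bf_def)
  then have "A \<noteq> \<infinity>" using AleN by (metis ennreal_mult_eq_top_iff ennreal_neq_top infinity_ennreal_def top_unique)
  then have "A \<le> ennreal (8 * pi * N) * Bf"
    using A2 by (cases "A = 0") (auto, metis ennreal_mult_le_mult_iff mult.commute infinity_ennreal_def)
  then show ?thesis by (simp add: A_def Bf_def F_def T_def)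
qed

text \<open>One fixed scale: Cauchy--Schwarz against the kernel, of mass \<open>pi\<close>, gives
  one factor \<open>pi\<close> and Fubini the other. Summed over finitely many scales it supplies
  the starting bound of the bootstrap.\<close>

lemma nn_integral_cauchy_average_square:
  assumes t: "t > 0" and f [measurable]: "f \<in> borel_measurable borel"
  shows "(\<integral>\<^sup>+x. (\<integral>\<^sup>+s. f s * ennreal (cauchy t (x - s)) \<partial>lborel)\<^sup>2 \<partial>lborel)
    \<le> ennreal (pi\<^sup>2) * (\<integral>\<^sup>+x. (f x)\<^sup>2 \<partial>lborel)"
proof -
  have sq: "ennreal (sqrt (cauchy t y)) * ennreal (sqrt (cauchy t y)) = ennreal (cauchy t y)" for y
    using cauchy_nonneg[OF t, of y] by (simp flip: ennreal_mult')
  have "(\<integral>\<^sup>+x. (\<integral>\<^sup>+s. f s * ennreal (cauchy t (x - s)) \<partial>lborel)\<^sup>2 \<partial>lborel)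
     = (\<integral>\<^sup>+x. (\<integral>\<^sup>+s. (f s * ennreal (sqrt (cauchy t (x - s)))) * ennreal (sqrt (cauchy t (x - s))) \<partial>lborel)\<^sup>2 \<partial>lborel)"
    by (simp only: mult.assoc sq)
  also have "\<dots> \<le> (\<integral>\<^sup>+x. (\<integral>\<^sup>+s. (f s * ennreal (sqrt (cauchy t (x - s))))\<^sup>2 \<partial>lborel)
                * (\<integral>\<^sup>+s. (ennreal (sqrt (cauchy t (x - s))))\<^sup>2 \<partial>lborel) \<partial>lborel)"
    by (intro nn_integral_mono Cauchy_Schwarz_nn_integral) auto
  also have "\<dots> = (\<integral>\<^sup>+x. (\<integral>\<^sup>+s. (f s)\<^sup>2 * ennreal (cauchy t (x - s)) \<partial>lborel) * ennreal pi \<partial>lborel)"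
    by (simp add: power2_eq_square sq mult_ac nn_integral_cauchy'[OF t] mult.left_commute[of "f _" "ennreal (sqrt _)"])
  also have "\<dots> = (\<integral>\<^sup>+x. (\<integral>\<^sup>+s. (f s)\<^sup>2 * ennreal (cauchy t (x - s)) \<partial>lborel) \<partial>lborel) * ennreal pi"
    by (simp add: nn_integral_multc)
  also have "(\<integral>\<^sup>+x. (\<integral>\<^sup>+s. (f s)\<^sup>2 * ennreal (cauchy t (x - s)) \<partial>lborel) \<partial>lborel)
      = (\<integral>\<^sup>+s. (\<integral>\<^sup>+x. (f s)\<^sup>2 * ennreal (cauchy t (x - s)) \<partial>lborel) \<partial>lborel)"
    by (rule lborel_pair.Fubini') simp
  also have "\<dots> = (\<integral>\<^sup>+s. (f s)\<^sup>2 \<partial>lborel) * ennreal pi"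
    by (simp add: nn_integral_cmult nn_integral_cauchy[OF t] nn_integral_multc)
  finally show ?thesis
    by (simp add: power2_eq_square[of pi] ennreal_mult' mult_ac)
qed

text \<open>Linearisation: among finitely many scales the supremum is attained at a measurable
  choice \<open>\<tau>\<close>, so the maximal operator becomes a linear integral operator to which
  duality applies. Measurability of the selected value is carried through the induction because
  \<open>a\<close> is only assumed measurable for each \<open>t\<close> separately.\<close>

lemma finite_measurable_selection:
  fixes a :: "real \<Rightarrow> 'a \<Rightarrow> ennreal"
  assumes "finite T" "T \<noteq> {}" and [measurable]: "\<And>t. a t \<in> borel_measurable M"
  shows "\<exists>\<tau>\<in>borel_measurable M. \<forall>x. \<tau> x \<in> T \<and> (\<forall>t\<in>T. a t x \<le> a (\<tau> x) x) \<and>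
     (\<lambda>x. a (\<tau> x) x) \<in> borel_measurable M"
  using assms(1,2)
proof (induction T rule: finite_ne_induct)
  case (singleton t)
  then show ?case by (intro bexI[of _ "\<lambda>_. t"]) auto
next
  case (insert t T)
  then obtain \<tau> where \<tau> [measurable]: "\<tau> \<in> borel_measurable M" and *: "\<And>x. \<tau> x \<in> T"
      "\<And>x t. t \<in> T \<Longrightarrow> a t x \<le> a (\<tau> x) x" and m [measurable]: "(\<lambda>x. a (\<tau> x) x) \<in> borel_measurable M" by blast
  define \<rho> where "\<rho> x = (if a (\<tau> x) x \<le> a t x then t else \<tau> x)" for x
  have [measurable]: "\<rho> \<in> borel_measurable M" unfolding \<rho>_def by measurable
  have e: "(\<lambda>x. a (\<rho> x) x) = (\<lambda>x. max (a t x) (a (\<tau> x) x))"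
    by (auto simp: fun_eq_iff \<rho>_def max_def intro: antisym)
  have "(\<lambda>x. a (\<rho> x) x) \<in> borel_measurable M" unfolding e by measurable
  moreover have "\<rho> x \<in> insert t T" for x using * by (auto simp: \<rho>_def)
  moreover have "a t' x \<le> a (\<rho> x) x" if "t' \<in> insert t T" for t' x
    using that *(2)[of t' x] fun_cong[OF e, of x] by (auto simp: max_def)
  ultimately show ?case by (intro bexI[of _ \<rho>]) auto
qed

lemma maximal_finite:
  assumes T: "finite T" "T \<noteq> {}" "\<And>t. t \<in> T \<Longrightarrow> t > 0" and f: "f \<in> borel_measurable borel"
  shows "(\<integral>\<^sup>+x. (SUP t\<in>T. \<integral>\<^sup>+s. f s * ennreal (cauchy t (x - s)) \<partial>lborel)\<^sup>2 \<partial>lborel)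
     \<le> ennreal ((8 * pi)\<^sup>2) * (\<integral>\<^sup>+x. (f x)\<^sup>2 \<partial>lborel)"
proof -
  note [measurable] = f
  define a where "a t x = (\<integral>\<^sup>+s. f s * ennreal (cauchy t (x - s)) \<partial>lborel)" for t x
  have am [measurable]: "a t \<in> borel_measurable borel" for t unfolding a_def by measurable
  obtain \<tau> where \<tau> [measurable]: "\<tau> \<in> borel_measurable borel" and \<tau>T: "\<And>x. \<tau> x \<in> T"
      and max: "\<And>x t. t \<in> T \<Longrightarrow> a t x \<le> a (\<tau> x) x"
    using finite_measurable_selection[OF T(1,2), of a borel] am by blast
  have pos: "\<tau> x > 0" for x using T(3) \<tau>T by auto
  define valid where "valid N \<longleftrightarrow> N \<ge> 0 \<and> (\<forall>g\<in>borel_measurable borel.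
    (\<integral>\<^sup>+x. (\<integral>\<^sup>+s. g s * ennreal (cauchy (\<tau> x) (x - s)) \<partial>lborel)\<^sup>2 \<partial>lborel) \<le> ennreal (N\<^sup>2) * (\<integral>\<^sup>+x. (g x)\<^sup>2 \<partial>lborel))" for N
  \<comment> \<open>The starting constant comes from bounding the selected square by the sum over
    all of \<open>T\<close>, and so depends on the number of scales; the iteration below removes
    this dependence.\<close>
  define N0 where "N0 = sqrt (real (card T)) * pi"
  have "valid N0"
    unfolding valid_def
  proof (intro conjI ballI)
    fix g :: "real \<Rightarrow> ennreal" assume [measurable]: "g \<in> borel_measurable borel"
    have "(\<integral>\<^sup>+x. (\<integral>\<^sup>+s. g s * ennreal (cauchy (\<tau> x) (x - s)) \<partial>lborel)\<^sup>2 \<partial>lborel)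
       \<le> (\<integral>\<^sup>+x. (\<Sum>t\<in>T. (\<integral>\<^sup>+s. g s * ennreal (cauchy t (x - s)) \<partial>lborel)\<^sup>2) \<partial>lborel)"
      by (intro nn_integral_mono member_le_sum[where f="\<lambda>t. (\<integral>\<^sup>+s. g s * ennreal (cauchy t (_ - s)) \<partial>lborel)\<^sup>2"] \<tau>T T(1)) simp
    also have "\<dots> = (\<Sum>t\<in>T. (\<integral>\<^sup>+x. (\<integral>\<^sup>+s. g s * ennreal (cauchy t (x - s)) \<partial>lborel)\<^sup>2 \<partial>lborel))"
      by (rule nn_integral_sum) simp
    also have "\<dots> \<le> (\<Sum>t\<in>T. ennreal (pi\<^sup>2) * (\<integral>\<^sup>+x. (g x)\<^sup>2 \<partial>lborel))"
      by (intro sum_mono nn_integral_cauchy_average_square T(3)) auto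
    also have "\<dots> = ennreal (N0\<^sup>2) * (\<integral>\<^sup>+x. (g x)\<^sup>2 \<partial>lborel)"
      by (simp add: N0_def power_mult_distrib ennreal_mult' ennreal_of_nat_eq_real_of_nat mult_ac)
    finally show "(\<integral>\<^sup>+x. (\<integral>\<^sup>+s. g s * ennreal (cauchy (\<tau> x) (x - s)) \<partial>lborel)\<^sup>2 \<partial>lborel)
       \<le> ennreal (N0\<^sup>2) * (\<integral>\<^sup>+x. (g x)\<^sup>2 \<partial>lborel)" .
  qed (simp add: N0_def)
  have step: "valid (sqrt (8 * pi * N))" if "valid N" for N
    using that maximal_selected_bootstrap[OF \<tau> pos, of _ N] unfolding valid_def by simp
  \<comment> \<open>\<open>8 * pi\<close> is the fixed point of the map from \<open>N\<close> to
    \<open>sqrt (8 * pi * N)\<close>. Each step takes the square root of the ratio to this fixed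
    point, and the ratio tends to one.\<close>
  define c where "c = N0 / (8 * pi)"
  have c: "c > 0" using T(1,2) by (simp add: c_def N0_def card_gt_0_iff)
  have vk: "valid (8 * pi * c powr ((1/2) ^ k))" for k
  proof (induction k)
    case 0
    have "N0 \<ge> 0" by (simp add: N0_def)
    then show ?case using \<open>valid N0\<close> c by (simp add: c_def)
  next
    case (Suc k)
    have "sqrt (8 * pi * (8 * pi * c powr ((1/2) ^ k))) = 8 * pi * sqrt (c powr ((1/2) ^ k))"
      by (simp add: real_sqrt_mult)
    also have "sqrt (c powr ((1/2) ^ k)) = c powr ((1/2) ^ Suc k)"
      by (simp add: powr_half_sqrt[symmetric] powr_powr)
    finally show ?case using step[OF Suc.IH] by simp
  qed
  have "(\<integral>\<^sup>+x. (a (\<tau> x) x)\<^sup>2 \<partial>lborel) \<le> ennreal ((8 * pi)\<^sup>2) * (\<integral>\<^sup>+x. (f x)\<^sup>2 \<partial>lborel)"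
  proof (rule LIMSEQ_le_const)
    have "(\<lambda>k. (8 * pi * c powr ((1/2) ^ k))\<^sup>2) \<longlonglongrightarrow> (8 * pi * c powr 0)\<^sup>2"
      by (intro tendsto_intros LIMSEQ_realpow_zero) (use c in auto)
    then have "(\<lambda>k. (8 * pi * c powr ((1/2) ^ k))\<^sup>2) \<longlonglongrightarrow> (8 * pi)\<^sup>2" using c by simp
    then have l: "(\<lambda>k. ennreal ((8 * pi * c powr ((1/2) ^ k))\<^sup>2)) \<longlonglongrightarrow> ennreal ((8 * pi)\<^sup>2)"
      by (rule tendsto_ennrealI)
    show "(\<lambda>k. ennreal ((8 * pi * c powr ((1/2) ^ k))\<^sup>2) * (\<integral>\<^sup>+x. (f x)\<^sup>2 \<partial>lborel)) \<longlonglongrightarrow> ennreal ((8 * pi)\<^sup>2) * (\<integral>\<^sup>+x. (f x)\<^sup>2 \<partial>lborel)"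
    proof (cases "(\<integral>\<^sup>+x. (f x)\<^sup>2 \<partial>lborel) = \<top>")
      case True
      then show ?thesis using c by (simp add: ennreal_mult_top)
    next
      case False
      then show ?thesis
        using ennreal_tendsto_cmult[OF _ l, of "\<integral>\<^sup>+x. (f x)\<^sup>2 \<partial>lborel"] by (simp add: mult.commute less_top)
    qed
    show "\<exists>N. \<forall>n\<ge>N. (\<integral>\<^sup>+x. (a (\<tau> x) x)\<^sup>2 \<partial>lborel) \<le> ennreal ((8 * pi * c powr ((1/2) ^ n))\<^sup>2) * (\<integral>\<^sup>+x. (f x)\<^sup>2 \<partial>lborel)"
      using vk f unfolding valid_def a_def by blast
  qed
  moreover have "(SUP t\<in>T. a t x) = a (\<tau> x) x" for x
    by (rule antisym) (auto intro!: SUP_least max SUP_upper \<tau>T)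
  ultimately show ?thesis by (simp add: a_def)
qed

definition maxfun :: "(real \<Rightarrow> ennreal) \<Rightarrow> real \<Rightarrow> ennreal" where
  "maxfun f x = (SUP \<gamma>::int. \<integral>\<^sup>+s. f s * ennreal (cauchy (2 powi \<gamma>) (x - s)) \<partial>lborel)"

lemma maxfun_measurable [measurable]:
  assumes [measurable]: "f \<in> borel_measurable borel"
  shows "maxfun f \<in> borel_measurable borel"
  unfolding maxfun_def by measurable

text \<open>The finite bound is independent of the number of scales, so monotone convergence over
  growing windows of exponents passes to all dyadic scales.\<close>

theorem maximal_L2:
  assumes f: "f \<in> borel_measurable borel"
  shows "(\<integral>\<^sup>+x. (maxfun f x)\<^sup>2 \<partial>lborel) \<le> ennreal ((8 * pi)\<^sup>2) * (\<integral>\<^sup>+x. (f x)\<^sup>2 \<partial>lborel)"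
proof -
  note [measurable] = f
  define a where "a \<gamma> x = (\<integral>\<^sup>+s. f s * ennreal (cauchy (2 powi \<gamma>) (x - s)) \<partial>lborel)" for \<gamma> :: int and x
  have am [measurable]: "a \<gamma> \<in> borel_measurable borel" for \<gamma> unfolding a_def by measurable
  define F where "F n x = (SUP \<gamma>\<in>{- int n..int n}. a \<gamma> x)" for n x
  have Fm [measurable]: "F n \<in> borel_measurable borel" for n unfolding F_def by measurable
  have inc: "F m x \<le> F n x" if "m \<le> n" for m n x
    unfolding F_def by (rule SUP_subset_mono) (use that in auto)
  have "maxfun f x \<le> (SUP n. F n x)" for x
    unfolding maxfun_def a_def[symmetric]
  proof (rule SUP_least)
    fix \<gamma> :: int
    have "a \<gamma> x \<le> F (nat \<bar>\<gamma>\<bar>) x" unfolding F_def by (rule SUP_upper) auto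
    then show "a \<gamma> x \<le> (SUP n. F n x)" by (rule SUP_upper2[rotated]) simp
  qed
  then have "(maxfun f x)\<^sup>2 \<le> (SUP n. (F n x)\<^sup>2)" for x
  proof -
    assume *: "\<And>x. maxfun f x \<le> (SUP n. F n x)"
    have "(maxfun f x)\<^sup>2 \<le> (SUP n. F n x) * (SUP n. F n x)"
      unfolding power2_eq_square by (intro mult_mono * ) auto
    also have "\<dots> = (SUP m. SUP n. F m x * F n x)"
      by (simp add: SUP_mult_left_ennreal SUP_mult_right_ennreal mult.commute)
    also have "\<dots> \<le> (SUP n. (F n x)\<^sup>2)"
    proof (intro SUP_least)
      fix m n
      have "F m x * F n x \<le> (F (max m n) x)\<^sup>2"
        unfolding power2_eq_square by (intro mult_mono inc) auto
      then show "F m x * F n x \<le> (SUP n. (F n x)\<^sup>2)" by (rule SUP_upper2[rotated]) simp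
    qed
    finally show ?thesis .
  qed
  then have "(\<integral>\<^sup>+x. (maxfun f x)\<^sup>2 \<partial>lborel) \<le> (\<integral>\<^sup>+x. (SUP n. (F n x)\<^sup>2) \<partial>lborel)"
    by (intro nn_integral_mono)
  also have "\<dots> = (SUP n. \<integral>\<^sup>+x. (F n x)\<^sup>2 \<partial>lborel)"
    by (rule nn_integral_monotone_convergence_SUP)
       (auto simp: incseq_def le_fun_def intro!: power_mono inc)
  also have "\<dots> \<le> ennreal ((8 * pi)\<^sup>2) * (\<integral>\<^sup>+x. (f x)\<^sup>2 \<partial>lborel)"
  proof (rule SUP_least)
    fix n
    have "F n x = (SUP t\<in>(\<lambda>\<gamma>::int. 2 powi \<gamma>) ` {- int n..int n}. \<integral>\<^sup>+s. f s * ennreal (cauchy t (x - s)) \<partial>lborel)" for x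
      unfolding F_def a_def by (simp add: image_image)
    then show "(\<integral>\<^sup>+x. (F n x)\<^sup>2 \<partial>lborel) \<le> ennreal ((8 * pi)\<^sup>2) * (\<integral>\<^sup>+x. (f x)\<^sup>2 \<partial>lborel)"
      by (simp only:) (rule maximal_finite, auto simp: f zero_less_power_int)
  qed
  finally show ?thesis .
qed

section \<open>Bilinear sums over frequency cells\<close>

text \<open>The restriction of \<open>u\<close> to the interval from \<open>k / 4\<close> to
  \<open>(k + 1) / 4\<close>, open at the right end. The length \<open>1 / 4\<close> is dual to the
  side 4 of \<open>square\<close>, which contains the supports of the kernels.\<close>

definition cell :: "(real \<Rightarrow> complex) \<Rightarrow> int \<Rightarrow> real \<Rightarrow> complex" where
  "cell u k \<xi> = (if \<lfloor>4 * \<xi>\<rfloor> = k then u \<xi> else 0)"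

lemma cell_measurable [measurable]:
  assumes [measurable]: "u \<in> borel_measurable borel"
  shows "cell u k \<in> borel_measurable borel"
  unfolding cell_def by measurable

lemma L2fun_dominated:
  assumes u: "L2fun u" and [measurable]: "w \<in> borel_measurable borel" and le: "\<And>\<xi>. cmod (w \<xi>) \<le> c * cmod (u \<xi>)"
  shows "L2fun w" "(l2 w)\<^sup>2 \<le> c\<^sup>2 * (l2 u)\<^sup>2"
proof -
  have i: "integrable lborel u" and i2: "integrable lborel (\<lambda>x. (cmod (u x))\<^sup>2)" using u by (auto simp: L2fun_def)
  have "integrable lborel w"
    by (rule Bochner_Integration.integrable_bound[of _ "\<lambda>x. c * cmod (u x)"])
       (use i order_trans[OF le abs_ge_self] in auto)
  have sq: "(cmod (w x))\<^sup>2 \<le> c\<^sup>2 * (cmod (u x))\<^sup>2" for x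
    using power_mono[OF le[of x], of 2] by (simp add: power_mult_distrib)
  have w2: "integrable lborel (\<lambda>x. (cmod (w x))\<^sup>2)"
    by (rule Bochner_Integration.integrable_bound[of _ "\<lambda>x. c\<^sup>2 * (cmod (u x))\<^sup>2"])
       (use i2 sq in auto)
  with \<open>integrable lborel w\<close> show "L2fun w" by (simp add: L2fun_def)
  have "(l2 w)\<^sup>2 \<le> (LINT x|lborel. c\<^sup>2 * (cmod (u x))\<^sup>2)"
    unfolding l2_power2 by (rule integral_mono) (use w2 i2 sq in auto)
  then show "(l2 w)\<^sup>2 \<le> c\<^sup>2 * (l2 u)\<^sup>2" by (simp add: l2_power2)
qed

lemma l2_dominated:
  assumes "L2fun u" "w \<in> borel_measurable borel" "\<And>\<xi>. cmod (w \<xi>) \<le> c * cmod (u \<xi>)" "c \<ge> 0"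
  shows "l2 w \<le> c * l2 u"
proof -
  have "(l2 w)\<^sup>2 \<le> (c * l2 u)\<^sup>2"
    using L2fun_dominated(2)[OF assms(1-3)] by (simp add: power_mult_distrib)
  then show ?thesis by (rule power2_le_imp_le) (use assms in simp)
qed

lemma L2fun_cell:
  assumes u: "L2fun u" shows "L2fun (cell u k)"
  by (rule L2fun_dominated(1)[OF u, of _ 1]) (use L2fun_measurable[OF u] in measurable, auto simp: cell_def)

lemma cell_sum_eq:
  assumes "finite L"
  shows "(\<Sum>k\<in>L. c k * cell u k \<xi>) = (if \<lfloor>4 * \<xi>\<rfloor> \<in> L then c \<lfloor>4 * \<xi>\<rfloor> * u \<xi> else 0)"
proof -
  have "(\<Sum>k\<in>L. c k * cell u k \<xi>) = (\<Sum>k\<in>L. if k = \<lfloor>4 * \<xi>\<rfloor> then c k * u \<xi> else 0)"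
    by (intro sum.cong) (auto simp: cell_def)
  then show ?thesis using assms by simp
qed

lemma ift_sum:
  assumes "finite L" "\<And>k. k \<in> L \<Longrightarrow> integrable lborel (w k)"
  shows "ift (\<lambda>\<xi>. \<Sum>k\<in>L. c k * w k \<xi>) x = (\<Sum>k\<in>L. c k * ift (w k) x)"
proof -
  have "ift (\<lambda>\<xi>. \<Sum>k\<in>L. c k * w k \<xi>) x = (LINT \<xi>|lborel. (\<Sum>k\<in>L. c k * (w k \<xi> * ee (x * \<xi>))))"
    unfolding ift_def by (simp add: sum_distrib_right mult.assoc)
  also have "\<dots> = (\<Sum>k\<in>L. (LINT \<xi>|lborel. c k * (w k \<xi> * ee (x * \<xi>))))"
    by (rule Bochner_Integration.integral_sum) (intro integrable_mult_right integrable_mult_ee assms, auto)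
  finally show ?thesis by (simp add: ift_def)
qed

lemma cell_sum_L2:
  assumes u: "L2fun u" and L: "finite L"
  shows "L2fun (\<lambda>\<xi>. \<Sum>k\<in>L. c k * cell u k \<xi>)"
    "(l2 (\<lambda>\<xi>. \<Sum>k\<in>L. c k * cell u k \<xi>))\<^sup>2 = (\<Sum>k\<in>L. (cmod (c k))\<^sup>2 * (l2 (cell u k))\<^sup>2)"
proof -
  have [measurable]: "u \<in> borel_measurable borel" by (rule L2fun_measurable[OF u])
  let ?w = "\<lambda>\<xi>. \<Sum>k\<in>L. c k * cell u k \<xi>"
  have sq: "(cmod (?w \<xi>))\<^sup>2 = (\<Sum>k\<in>L. (cmod (c k))\<^sup>2 * (cmod (cell u k \<xi>))\<^sup>2)" for \<xi>
  proof -
    have "(\<Sum>k\<in>L. (cmod (c k))\<^sup>2 * (cmod (cell u k \<xi>))\<^sup>2)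
       = (\<Sum>k\<in>L. if k = \<lfloor>4 * \<xi>\<rfloor> then (cmod (c k * u \<xi>))\<^sup>2 else 0)"
      by (intro sum.cong) (auto simp: cell_def norm_mult power_mult_distrib)
    then show ?thesis using L by (simp add: cell_sum_eq)
  qed
  have i2: "integrable lborel (\<lambda>\<xi>. (cmod (cell u k \<xi>))\<^sup>2)" and i1: "integrable lborel (cell u k)" for k
    using L2fun_cell[OF u, of k] by (auto simp: L2fun_def)
  show "L2fun ?w" unfolding L2fun_def sq using i1 i2 by auto
  show "(l2 ?w)\<^sup>2 = (\<Sum>k\<in>L. (cmod (c k))\<^sup>2 * (l2 (cell u k))\<^sup>2)"
    unfolding l2_power2 sq using i2 by (subst Bochner_Integration.integral_sum) auto
qed

lemma cell_sum_power2_le: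
  assumes u: "L2fun u" and L: "finite L"
  shows "(\<Sum>k\<in>L. (l2 (cell u k))\<^sup>2) \<le> (l2 u)\<^sup>2"
proof -
  have [measurable]: "u \<in> borel_measurable borel" by (rule L2fun_measurable[OF u])
  have "(l2 (\<lambda>\<xi>. \<Sum>k\<in>L. 1 * cell u k \<xi>))\<^sup>2 \<le> 1\<^sup>2 * (l2 u)\<^sup>2"
    by (rule L2fun_dominated(2)[OF u]) (measurable, auto simp only: cell_sum_eq[OF L] split: if_splits, auto)
  then show ?thesis unfolding cell_sum_L2(2)[OF u L] by simp
qed

lemma nn_integral_norm_sum_le:
  fixes f :: "'i \<Rightarrow> real \<Rightarrow> complex"
  assumes "finite I" and [measurable]: "\<And>i. i \<in> I \<Longrightarrow> f i \<in> borel_measurable borel"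
    and "\<And>i. i \<in> I \<Longrightarrow> (\<integral>\<^sup>+x. ennreal (cmod (f i x)) \<partial>lborel) \<le> ennreal (b i)" "\<And>i. i \<in> I \<Longrightarrow> b i \<ge> 0"
  shows "(\<integral>\<^sup>+x. ennreal (cmod (\<Sum>i\<in>I. f i x)) \<partial>lborel) \<le> ennreal (\<Sum>i\<in>I. b i)"
proof -
  have "(\<integral>\<^sup>+x. ennreal (cmod (\<Sum>i\<in>I. f i x)) \<partial>lborel) \<le> (\<integral>\<^sup>+x. (\<Sum>i\<in>I. ennreal (cmod (f i x))) \<partial>lborel)"
    by (intro nn_integral_mono) (auto intro: ennreal_leI norm_sum)
  also have "\<dots> = (\<Sum>i\<in>I. \<integral>\<^sup>+x. ennreal (cmod (f i x)) \<partial>lborel)"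
    by (rule nn_integral_sum) auto
  also have "\<dots> \<le> (\<Sum>i\<in>I. ennreal (b i))" by (intro sum_mono assms(3))
  finally show ?thesis using assms(4) by simp
qed

lemma nn_integral_ift_mult_le:
  assumes "L2fun u" "L2fun v"
  shows "(\<integral>\<^sup>+x. ennreal (cmod (ift u x * ift v x)) \<partial>lborel) \<le> ennreal (l2 u * l2 v)"
proof -
  have [measurable]: "u \<in> borel_measurable borel" "v \<in> borel_measurable borel"
    using assms by (auto intro: L2fun_measurable)
  have "(\<integral>\<^sup>+x. ennreal (cmod (ift u x * ift v x)) \<partial>lborel) \<le> ennreal (l2 (ift u) * l2 (ift v))"
    by (rule nn_integral_mult_l2) (auto intro: ift_square_integrable assms)
  also have "\<dots> \<le> ennreal (l2 u * l2 v)"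
    by (intro ennreal_leI mult_mono l2_ift_le assms) auto
  finally show ?thesis .
qed

lemma sum_mult_le_sqrt:
  fixes f g :: "'i \<Rightarrow> real"
  assumes "(\<Sum>i\<in>I. (f i)\<^sup>2) \<le> F\<^sup>2" "(\<Sum>i\<in>I. (g i)\<^sup>2) \<le> G\<^sup>2" "F \<ge> 0" "G \<ge> 0"
  shows "(\<Sum>i\<in>I. f i * g i) \<le> F * G"
proof -
  have "(\<Sum>i\<in>I. f i * g i)\<^sup>2 \<le> (\<Sum>i\<in>I. (f i)\<^sup>2) * (\<Sum>i\<in>I. (g i)\<^sup>2)"
    by (rule Cauchy_Schwarz_ineq_sum)
  also have "\<dots> \<le> F\<^sup>2 * G\<^sup>2" by (intro mult_mono assms sum_nonneg) auto
  finally have "(\<Sum>i\<in>I. f i * g i)\<^sup>2 \<le> (F * G)\<^sup>2" by (simp add: power_mult_distrib)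
  then show ?thesis by (rule power2_le_imp_le) (use assms in simp)
qed

text \<open>Rows with more than \<open>sqrt (card E)\<close> entries are few and are summed by Cauchy--Schwarz over the rows;
  the remaining entries are summed over the columns.\<close>
lemma bilinear_sum_le:
  assumes u: "L2fun u" and v: "L2fun v" and E: "finite E"
    and a: "\<And>k l. (k, l) \<in> E \<Longrightarrow> cmod (a (k, l)) \<le> \<kappa>" and \<kappa>: "\<kappa> \<ge> 0"
  shows "(\<integral>\<^sup>+x. ennreal (cmod (\<Sum>(k, l)\<in>E. a (k, l) * (ift (cell u k) x * ift (cell v l) x))) \<partial>lborel)
     \<le> ennreal (2 * \<kappa> * sqrt (sqrt (card E)) * (l2 u * l2 v))"
proof -
  have [measurable]: "u \<in> borel_measurable borel" "v \<in> borel_measurable borel"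
    using assms by (auto intro: L2fun_measurable)
  define s where "s = sqrt (card E)"
  have s0: "s \<ge> 0" and ss: "s * s = card E" by (simp_all add: s_def)
  define row where "row k = {l. (k, l) \<in> E}" for k
  define R where "R = {k \<in> fst ` E. real (card (row k)) > s}"
  define col where "col l = {k. (k, l) \<in> E \<and> k \<notin> R}" for l
  have frow: "finite (row k)" for k
    by (rule finite_subset[OF _ finite_imageI[OF E, of snd]]) (force simp: row_def)
  have fcol: "finite (col l)" for l
    by (rule finite_subset[OF _ finite_imageI[OF E, of fst]]) (force simp: col_def)
  have fR: "finite R" using E by (simp add: R_def)
  define U where "U l = (\<lambda>\<xi>. \<Sum>k\<in>col l. a (k, l) * cell u k \<xi>)" for l
  define V where "V k = (\<lambda>\<xi>. \<Sum>l\<in>row k. a (k, l) * cell v l \<xi>)" for k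
  have LU: "L2fun (U l)" and LV: "L2fun (V k)" for k l
    unfolding U_def V_def by (intro cell_sum_L2 u v fcol frow)+
  have [measurable]: "U l \<in> borel_measurable borel" "V k \<in> borel_measurable borel" for k l
    using LU LV by (auto intro: L2fun_measurable)
  have iu: "integrable lborel (cell u k)" "integrable lborel (cell v k)" for k
    using L2fun_cell[OF u] L2fun_cell[OF v] by (auto simp: L2fun_def)
  define P1 where "P1 x = (\<Sum>k\<in>R. ift (cell u k) x * ift (V k) x)" for x
  define P2 where "P2 x = (\<Sum>l\<in>snd ` E. ift (U l) x * ift (cell v l) x)" for x
  have split: "(\<Sum>(k, l)\<in>E. a (k, l) * (ift (cell u k) x * ift (cell v l) x)) = P1 x + P2 x" for x
  proof -
    let ?f = "\<lambda>(k, l). a (k, l) * (ift (cell u k) x * ift (cell v l) x)"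
    define E1 where "E1 = {p \<in> E. fst p \<in> R}"
    define E2 where "E2 = {p \<in> E. fst p \<notin> R}"
    have e12: "E = E1 \<union> E2" "E1 \<inter> E2 = {}" by (auto simp: E1_def E2_def)
    have "finite E1" "finite E2" using E by (simp_all add: E1_def E2_def)
    with e12 have "sum ?f E = sum ?f E1 + sum ?f E2"
      by (simp only: sum.union_disjoint)
    also have "sum ?f E1 = P1 x"
    proof -
      have "E1 = Sigma R row" by (auto simp: E1_def row_def R_def intro: rev_image_eqI)
      then have "sum ?f E1 = (\<Sum>k\<in>R. \<Sum>l\<in>row k. ?f (k, l))"
        using fR frow by (simp add: sum.Sigma)
      also have "\<dots> = P1 x"
        unfolding P1_def V_def
        by (intro sum.cong refl, subst ift_sum) (auto simp: frow iu sum_distrib_left mult_ac)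
      finally show ?thesis .
    qed
    also have "sum ?f E2 = P2 x"
    proof -
      have "sum ?f E2 = (\<Sum>(l, k)\<in>Sigma (snd ` E) col. ?f (k, l))"
        by (rule sum.reindex_bij_witness[of _ "\<lambda>(l, k). (k, l)" "\<lambda>(k, l). (l, k)"]) (force simp: E2_def col_def)+
      also have "\<dots> = (\<Sum>l\<in>snd ` E. \<Sum>k\<in>col l. ?f (k, l))"
        using E fcol by (subst sum.Sigma) auto
      also have "\<dots> = P2 x"
        unfolding P2_def U_def
        by (intro sum.cong refl, subst ift_sum) (auto simp: fcol iu sum_distrib_left mult_ac)
      finally show ?thesis .
    qed
    finally show ?thesis .
  qed
  \<comment> \<open>The cells are disjoint, so the coefficients of one row act on \<open>v\<close>
    as a multiplier bounded by \<open>\<kappa>\<close>: a row costs the same however long it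
    is.\<close>
  have Vle: "l2 (V k) \<le> \<kappa> * l2 v" for k
    unfolding V_def
  proof (rule l2_dominated[OF v])
    fix \<xi> show "cmod (\<Sum>l\<in>row k. a (k, l) * cell v l \<xi>) \<le> \<kappa> * cmod (v \<xi>)"
      unfolding cell_sum_eq[OF frow]
      using a[of k "\<lfloor>4 * \<xi>\<rfloor>"] \<kappa> by (auto simp: row_def norm_mult intro!: mult_right_mono)
  qed (use \<kappa> in auto)
  have cardR: "real (card R) \<le> s"
  proof (cases "s = 0")
    case True
    then have "E = {}" using E by (simp add: s_def)
    then show ?thesis using s0 by (simp add: R_def)
  next
    case False
    have "real (card R) * s \<le> (\<Sum>k\<in>R. real (card (row k)))"
      using sum_mono[of R "\<lambda>_. s" "\<lambda>k. real (card (row k))"] by (auto simp: R_def)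
    also have "\<dots> = real (card (Sigma R row))"
      using fR frow by (simp add: card_SigmaI)
    also have "\<dots> \<le> real (card E)"
      by (intro of_nat_mono card_mono E) (auto simp: row_def)
    finally have "real (card R) * s \<le> s * s" by (simp add: ss)
    then show ?thesis using False s0 by (simp add: mult_le_cancel_right)
  qed
  have b1: "(\<integral>\<^sup>+x. ennreal (cmod (P1 x)) \<partial>lborel) \<le> ennreal (\<kappa> * sqrt s * (l2 u * l2 v))"
  proof -
    have "(\<integral>\<^sup>+x. ennreal (cmod (P1 x)) \<partial>lborel) \<le> ennreal (\<Sum>k\<in>R. l2 (cell u k) * l2 (V k))"
      unfolding P1_def
      by (rule nn_integral_norm_sum_le) (auto intro: fR nn_integral_ift_mult_le L2fun_cell u LV)
    also have "(\<Sum>k\<in>R. l2 (cell u k) * l2 (V k)) \<le> (\<Sum>k\<in>R. (l2 (cell u k) * 1) * (\<kappa> * l2 v))"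
      by (intro sum_mono) (auto intro!: mult_left_mono Vle)
    also have "\<dots> = (\<Sum>k\<in>R. l2 (cell u k) * 1) * (\<kappa> * l2 v)"
      by (rule sum_distrib_right[symmetric])
    also have "(\<Sum>k\<in>R. l2 (cell u k) * 1) \<le> l2 u * sqrt s"
      by (rule sum_mult_le_sqrt) (use cell_sum_power2_le[OF u fR] cardR s0 in auto)
    finally show ?thesis using \<kappa> by (simp add: mult_ac mult_right_mono ennreal_leI)
  qed
  have b2: "(\<integral>\<^sup>+x. ennreal (cmod (P2 x)) \<partial>lborel) \<le> ennreal (\<kappa> * sqrt s * (l2 u * l2 v))"
  proof -
    have "(\<integral>\<^sup>+x. ennreal (cmod (P2 x)) \<partial>lborel) \<le> ennreal (\<Sum>l\<in>snd ` E. l2 (U l) * l2 (cell v l))"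
      unfolding P2_def
      by (rule nn_integral_norm_sum_le) (auto intro: E nn_integral_ift_mult_le L2fun_cell v LU)
    also have "(\<Sum>l\<in>snd ` E. l2 (U l) * l2 (cell v l)) \<le> (\<kappa> * sqrt s * l2 u) * l2 v"
    proof (rule sum_mult_le_sqrt)
      show "(\<Sum>l\<in>snd ` E. (l2 (cell v l))\<^sup>2) \<le> (l2 v)\<^sup>2"
        by (intro cell_sum_power2_le v finite_imageI E)
      have "(\<Sum>l\<in>snd ` E. (l2 (U l))\<^sup>2) = (\<Sum>l\<in>snd ` E. \<Sum>k\<in>col l. (cmod (a (k, l)))\<^sup>2 * (l2 (cell u k))\<^sup>2)"
        unfolding U_def by (intro sum.cong refl cell_sum_L2 u fcol)
      also have "\<dots> \<le> (\<Sum>l\<in>snd ` E. \<Sum>k\<in>col l. \<kappa>\<^sup>2 * (l2 (cell u k))\<^sup>2)"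
        by (intro sum_mono mult_right_mono power_mono) (auto simp: col_def intro: a)
      also have "\<dots> = (\<Sum>(l, k)\<in>Sigma (snd ` E) col. \<kappa>\<^sup>2 * (l2 (cell u k))\<^sup>2)"
        using E fcol by (subst sum.Sigma) auto
      \<comment> \<open>Summation by rows instead of columns: a row outside \<open>R\<close> has at
        most \<open>s\<close> entries, so each cell of \<open>u\<close> is counted at most
        \<open>s\<close> times.\<close>
      also have "\<dots> = (\<Sum>(k, l)\<in>Sigma (fst ` E - R) row. \<kappa>\<^sup>2 * (l2 (cell u k))\<^sup>2)"
        by (rule sum.reindex_bij_witness[of _ "\<lambda>(k, l). (l, k)" "\<lambda>(l, k). (k, l)"]) (force simp: col_def row_def)+
      also have "\<dots> = (\<Sum>k\<in>fst ` E - R. real (card (row k)) * (\<kappa>\<^sup>2 * (l2 (cell u k))\<^sup>2))"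
        using E frow by (subst sum.Sigma[symmetric]) auto
      also have "\<dots> \<le> (\<Sum>k\<in>fst ` E - R. s * (\<kappa>\<^sup>2 * (l2 (cell u k))\<^sup>2))"
        by (intro sum_mono mult_right_mono) (auto simp: R_def)
      also have "\<dots> = s * \<kappa>\<^sup>2 * (\<Sum>k\<in>fst ` E - R. (l2 (cell u k))\<^sup>2)"
        by (simp add: sum_distrib_left mult_ac)
      also have "\<dots> \<le> s * \<kappa>\<^sup>2 * (l2 u)\<^sup>2"
        by (intro mult_left_mono cell_sum_power2_le u) (use E s0 in auto)
      finally show "(\<Sum>l\<in>snd ` E. (l2 (U l))\<^sup>2) \<le> (\<kappa> * sqrt s * l2 u)\<^sup>2"
        using s0 by (simp add: power_mult_distrib mult_ac)
    qed (use \<kappa> s0 in auto)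
    finally show ?thesis by (simp add: mult_ac ennreal_leI)
  qed
  have "(\<integral>\<^sup>+x. ennreal (cmod (P1 x + P2 x)) \<partial>lborel) \<le> (\<integral>\<^sup>+x. ennreal (cmod (P1 x)) + ennreal (cmod (P2 x)) \<partial>lborel)"
    by (intro nn_integral_mono) (simp add: norm_triangle_ineq ennreal_leI flip: ennreal_plus)
  also have "\<dots> = (\<integral>\<^sup>+x. ennreal (cmod (P1 x)) \<partial>lborel) + (\<integral>\<^sup>+x. ennreal (cmod (P2 x)) \<partial>lborel)"
    by (rule nn_integral_add) (auto simp: P1_def P2_def)
  also have "\<dots> \<le> ennreal (\<kappa> * sqrt s * (l2 u * l2 v)) + ennreal (\<kappa> * sqrt s * (l2 u * l2 v))"
    by (intro add_mono b1 b2)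
  also have "\<dots> = ennreal (2 * \<kappa> * sqrt (sqrt (card E)) * (l2 u * l2 v))"
    using \<kappa> s0 by (subst ennreal_plus[symmetric]) (auto simp: s_def)
  finally show ?thesis by (simp only: split)
qed

text \<open>The coefficients are grouped by dyadic size. A level of height \<open>\<kappa>\<close>
  has at most \<open>(2 * N / \<kappa>) powr r\<close> entries, so \<open>bilinear_sum_le\<close>
  bounds its contribution by a multiple of \<open>\<kappa> * (N / \<kappa>) powr (r / 4)\<close>.
  This is a positive power of \<open>\<kappa>\<close> because \<open>r < 4\<close>, and the
  geometric series over the levels is dominated by the top level \<open>B\<close>.\<close>

lemma bilinear_sum_level_sets:
  assumes u: "L2fun u" and v: "L2fun v" and S: "finite S" and B: "B > 0" and N: "N > 0" and r: "0 < r" "r < 4"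
    and a: "\<And>p. p \<in> S \<Longrightarrow> cmod (a p) \<le> B"
    and cnt: "\<And>\<kappa> F. \<kappa> > 0 \<Longrightarrow> F \<subseteq> S \<Longrightarrow> (\<And>p. p \<in> F \<Longrightarrow> \<kappa> \<le> cmod (a p)) \<Longrightarrow> real (card F) \<le> (N / \<kappa>) powr r"
  shows "(\<integral>\<^sup>+x. ennreal (cmod (\<Sum>(k, l)\<in>S. a (k, l) * (ift (cell u k) x * ift (cell v l) x))) \<partial>lborel)
     \<le> ennreal (4 / (1 - (1/2) powr (1 - r / 4)) * (B powr (1 - r / 4) * N powr (r / 4)) * (l2 u * l2 v))"
proof -
  have [measurable]: "u \<in> borel_measurable borel" "v \<in> borel_measurable borel"
    using assms by (auto intro: L2fun_measurable)
  define S' where "S' = {p \<in> S. a p \<noteq> 0}"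
  have S': "finite S'" using S by (simp add: S'_def)
  have ex: "\<exists>j. (1/2) ^ Suc j * B < cmod (a p)" if "p \<in> S'" for p
  proof -
    have "0 < cmod (a p) / B" using that B by (simp add: S'_def)
    then obtain j where "(1/2 :: real) ^ j < cmod (a p) / B"
      using real_arch_pow_inv[of "cmod (a p) / B" "1/2"] by auto
    then have "(1/2) ^ j * B < cmod (a p)" using B by (simp add: pos_less_divide_eq)
    moreover have "(1/2) ^ Suc j * B \<le> (1/2) ^ j * B" using B by (intro mult_right_mono) auto
    ultimately show ?thesis by (meson le_less_trans)
  qed
  \<comment> \<open>Taking the least index places \<open>cmod (a p)\<close> above
    \<open>(1/2) ^ Suc (lev p) * B\<close> and at most at \<open>(1/2) ^ lev p * B\<close>; at level
    zero the upper bound is the hypothesis on \<open>B\<close>.\<close>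
  define lev where "lev p = (LEAST j. (1/2) ^ Suc j * B < cmod (a p))" for p
  have lo: "(1/2) ^ Suc (lev p) * B < cmod (a p)" if "p \<in> S'" for p
    unfolding lev_def by (rule LeastI_ex[OF ex[OF that]])
  have mid: "cmod (a p) \<le> (1/2) ^ lev p * B" if "p \<in> S'" for p
  proof (cases "lev p")
    case 0 then show ?thesis using a that by (simp add: S'_def)
  next
    case (Suc j)
    then have "\<not> (1/2) ^ Suc j * B < cmod (a p)"
      unfolding lev_def by (metis lessI not_less_Least)
    then show ?thesis using Suc by simp
  qed
  define J where "J = Suc (Max (insert 0 (lev ` S')))"
  have J: "lev p < J" if "p \<in> S'" for p
    unfolding J_def using that S' by (intro le_imp_less_Suc Max_ge) auto
  define Ej where "Ej j = {p \<in> S'. lev p = j}" for j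
  let ?f = "\<lambda>x (k, l). a (k, l) * (ift (cell u k) x * ift (cell v l) x)"
  have dec: "sum (?f x) S = (\<Sum>j<J. sum (?f x) (Ej j))" for x
  proof -
    have "sum (?f x) S = sum (?f x) S'"
      by (rule sum.mono_neutral_right) (use S in \<open>auto simp: S'_def\<close>)
    also have "\<dots> = (\<Sum>j<J. sum (?f x) (Ej j))"
      unfolding Ej_def by (rule sum.group[symmetric]) (use S' J in auto)
    finally show ?thesis .
  qed
  define \<theta> where "\<theta> = (1/2 :: real) powr (1 - r / 4)"
  have \<theta>: "0 < \<theta>" "\<theta> < 1" unfolding \<theta>_def using r powr_less_mono'[of "1/2" 0 "1 - r / 4"] by auto
  define M where "M = B powr (1 - r / 4) * N powr (r / 4)"
  have M: "M > 0" using B N by (simp add: M_def)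
  have Ejb: "(\<integral>\<^sup>+x. ennreal (cmod (sum (?f x) (Ej j))) \<partial>lborel) \<le> ennreal (4 * M * \<theta> ^ j * (l2 u * l2 v))" for j
  proof -
    define \<kappa> where "\<kappa> = (1/2) ^ j * B"
    have \<kappa>: "\<kappa> > 0" using B by (simp add: \<kappa>_def)
    have "real (card (Ej j)) \<le> (N / (\<kappa> / 2)) powr r"
    proof (rule cnt)
      show "Ej j \<subseteq> S" by (auto simp: Ej_def S'_def)
      show "\<kappa> / 2 \<le> cmod (a p)" if "p \<in> Ej j" for p
        using lo[of p] that by (auto simp: Ej_def \<kappa>_def)
    qed (use \<kappa> in simp)
    then have "sqrt (sqrt (card (Ej j))) \<le> sqrt (sqrt ((2 * N / \<kappa>) powr r))"
      by (simp add: mult_ac)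
    also have "\<dots> = (2 * N / \<kappa>) powr (r / 4)"
      using N \<kappa> by (simp add: powr_half_sqrt[symmetric] powr_powr)
    finally have c: "sqrt (sqrt (card (Ej j))) \<le> (2 * N / \<kappa>) powr (r / 4)" .
    have "\<kappa> * (2 * N / \<kappa>) powr (r / 4) = 2 powr (r / 4) * (\<kappa> powr (1 - r / 4) * N powr (r / 4))"
      using N \<kappa> by (simp add: powr_mult powr_divide powr_diff)
    also have "\<kappa> powr (1 - r / 4) = \<theta> ^ j * B powr (1 - r / 4)"
      using B by (simp add: \<kappa>_def \<theta>_def powr_mult powr_realpow[symmetric] powr_powr mult.commute)
    finally have e: "\<kappa> * (2 * N / \<kappa>) powr (r / 4) = 2 powr (r / 4) * (\<theta> ^ j * M)"
      by (simp add: M_def)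
    have "(\<integral>\<^sup>+x. ennreal (cmod (sum (?f x) (Ej j))) \<partial>lborel) \<le> ennreal (2 * \<kappa> * sqrt (sqrt (card (Ej j))) * (l2 u * l2 v))"
    proof (rule bilinear_sum_le[OF u v])
      show "finite (Ej j)" using S' by (simp add: Ej_def)
      show "cmod (a (k, l)) \<le> \<kappa>" if "(k, l) \<in> Ej j" for k l
        using mid[of "(k, l)"] that by (auto simp: Ej_def \<kappa>_def)
    qed (use \<kappa> in simp)
    also have "2 * \<kappa> * sqrt (sqrt (card (Ej j))) * (l2 u * l2 v) \<le> 2 * \<kappa> * (2 * N / \<kappa>) powr (r / 4) * (l2 u * l2 v)"
      using c \<kappa> by (intro mult_right_mono mult_left_mono) auto
    also have "\<dots> = 2 * 2 powr (r / 4) * (\<theta> ^ j * M) * (l2 u * l2 v)"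
      using e by (simp only: mult.assoc)
    \<comment> \<open>\<open>r / 4 \<le> 1\<close> is used to make the constant 4 independent of
      \<open>r\<close>.\<close>
    also have "\<dots> \<le> 2 * 2 powr 1 * (\<theta> ^ j * M) * (l2 u * l2 v)"
      using r \<theta> M by (intro mult_right_mono mult_left_mono powr_mono) auto
    finally show ?thesis by (simp add: mult_ac ennreal_leI)
  qed
  have "(\<integral>\<^sup>+x. ennreal (cmod (sum (?f x) S)) \<partial>lborel) \<le> ennreal (\<Sum>j<J. 4 * M * \<theta> ^ j * (l2 u * l2 v))"
    unfolding dec
  proof (rule nn_integral_norm_sum_le)
    show "(\<lambda>x. sum (?f x) (Ej j)) \<in> borel_measurable borel" for j
      by (intro borel_measurable_sum) (auto simp: case_prod_beta')
  qed (use Ejb M \<theta> in auto)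
  also have "(\<Sum>j<J. 4 * M * \<theta> ^ j * (l2 u * l2 v)) = (4 * M * (l2 u * l2 v)) * (\<Sum>j<J. \<theta> ^ j)"
    by (simp add: sum_distrib_left mult_ac)
  also have "\<dots> \<le> (4 * M * (l2 u * l2 v)) * (1 / (1 - \<theta>))"
  proof (intro mult_left_mono)
    have "(\<Sum>j<J. \<theta> ^ j) = (1 - \<theta> ^ J) / (1 - \<theta>)"
      using \<theta> by (simp add: sum_gp_strict)
    also have "\<dots> \<le> 1 / (1 - \<theta>)" using \<theta> by (intro divide_right_mono) auto
    finally show "(\<Sum>j<J. \<theta> ^ j) \<le> 1 / (1 - \<theta>)" .
  qed (use M in auto)
  finally show ?thesis
    by (simp add: M_def \<theta>_def mult_ac ennreal_leI)
qed

section \<open>Characters on the square and their lattice of frequencies\<close>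

lemma plane_fubini:
  fixes f :: "plane \<Rightarrow> complex"
  assumes "integrable lborel f"
  shows "(LINT p|lborel. f p) = (LINT x|lborel. LINT y|lborel. f (x, y))"
proof -
  have "integrable (lborel \<Otimes>\<^sub>M lborel) f" using assms by (simp add: lborel_prod)
  from lborel_pair.integral_fst'[OF this] show ?thesis by (simp add: lborel_prod)
qed

lemma integral_ee_interval:
  fixes m :: int
  shows "(LINT x|lborel. indicator {-2..2} x *\<^sub>R ee (of_int m * x / 4)) = (if m = 0 then 4 else 0)"
proof (cases "m = 0")
  case True
  then show ?thesis by (simp add: scaleR_conv_of_real)
next
  case False
  define F where "F x = ee (of_int m * x / 4) / (2 * pi * \<i> * of_int m / 4)" for x
  have "(LINT x|lborel. indicator {-2..2} x *\<^sub>R ee (of_int m * x / 4)) = F 2 - F (-2)"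
  proof (rule integral_FTC_Icc)
    show "(F has_vector_derivative ee (of_int m * x / 4)) (at x within {-2..2})" for x
      unfolding F_def ee_def cis_conv_exp using False
      by (auto intro!: has_vector_derivative_real_field derivative_eq_intros simp: mult_ac)
    show "continuous_on {-2..2} (\<lambda>x. ee (of_int m * x / 4))"
      by (intro continuous_intros) simp
  qed simp
  \<comment> \<open>The endpoints differ by 4, which is a whole number \<open>m\<close> of periods
    of the integrand, so the primitive takes equal values there.\<close>
  also have "ee (of_int m * 2 / 4) = ee (of_int m * (-2) / 4) * ee (of_int m)"
    by (simp add: ee_add[symmetric] field_simps)
  then have "F 2 = F (-2)"
    by (simp add: F_def ee_def cis_multiple_2pi)
  finally show ?thesis using False by simp
qed

definition square :: "plane set" where "square = {-2..2} \<times> {-2..2}"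

lemma square_measurable [measurable]: "square \<in> sets borel"
  unfolding square_def by (intro borel_closed closed_Times) auto

lemma square_bounded_integrable:
  fixes f :: "plane \<Rightarrow> complex"
  assumes [measurable]: "f \<in> borel_measurable borel" and "\<And>p. cmod (f p) \<le> C" "\<And>p. p \<notin> square \<Longrightarrow> f p = 0"
  shows "integrable lborel f"
proof (rule integrableI_bounded_set[where A=square and B=C])
  have "square = cbox (-2, -2) (2, 2)" by (simp add: square_def cbox_Pair_eq)
  then have "bounded square" by (metis bounded_cbox)
  then show "emeasure lborel square < \<infinity>" by (rule emeasure_bounded_finite)
qed (use assms in auto)

lemma fourier_lattice_orthogonal:
  fixes k l k' l' :: int
  shows "(LINT p|lborel. indicator square p *\<^sub>R ee (p \<bullet> (of_int k / 4, of_int l / 4) - p \<bullet> (of_int k' / 4, of_int l' / 4)))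
    = (if (k, l) = (k', l') then 16 else 0)"
proof -
  let ?g = "\<lambda>m x. indicator {-2..2} x *\<^sub>R ee (of_int m * x / 4)"
  have "(LINT p|lborel. indicator square p *\<^sub>R ee (p \<bullet> (of_int k / 4, of_int l / 4) - p \<bullet> (of_int k' / 4, of_int l' / 4)))
     = (LINT x|lborel. LINT y|lborel. indicator square (x, y) *\<^sub>R ee ((x, y) \<bullet> (of_int k / 4, of_int l / 4) - (x, y) \<bullet> (of_int k' / 4, of_int l' / 4)))"
    by (rule plane_fubini, rule square_bounded_integrable[where C=1]) (auto simp: indicator_def)
  also have "\<dots> = (LINT x|lborel. LINT y|lborel. ?g (k - k') x * ?g (l - l') y)"
  proof (intro Bochner_Integration.integral_cong refl)
    fix x y :: real
    have "(x, y) \<bullet> (of_int k / 4, of_int l / 4) - (x, y) \<bullet> (of_int k' / 4, of_int l' / 4)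
      = of_int (k - k') * x / 4 + of_int (l - l') * y / 4"
      by (simp add: field_simps)
    then show "indicator square (x, y) *\<^sub>R ee ((x, y) \<bullet> (of_int k / 4, of_int l / 4) - (x, y) \<bullet> (of_int k' / 4, of_int l' / 4))
      = ?g (k - k') x * ?g (l - l') y"
      by (auto simp: ee_add indicator_def square_def)
  qed
  also have "\<dots> = (LINT x|lborel. ?g (k - k') x) * (LINT y|lborel. ?g (l - l') y)"
    by (simp only: integral_mult_right_zero integral_mult_left_zero)
  also have "\<dots> = (if (k, l) = (k', l') then 16 else 0)"
    unfolding integral_ee_interval by auto
  finally show ?thesis .
qed

definition lattice_point :: "int \<times> int \<Rightarrow> plane" where "lattice_point p = (of_int (fst p) / 4, of_int (snd p) / 4)"

text \<open>Bessel's inequality by duality. Let \<open>P\<close> be the trigonometric polynomial on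
  the square formed from the Fourier coefficients of \<open>K\<close> itself. Pairing
  \<open>K\<close> with \<open>P\<close> gives \<open>S\<close>, orthogonality gives
  \<open>P\<close> the squared norm \<open>16 * S\<close> (16 is the area of the square), and
  Cauchy--Schwarz allows one factor \<open>S\<close> to be cancelled.\<close>

lemma lattice_bessel:
  fixes K :: "plane \<Rightarrow> complex"
  assumes K [measurable]: "K \<in> borel_measurable borel" and K1: "integrable lborel K" and K2: "integrable lborel (\<lambda>y. (cmod (K y))\<^sup>2)"
    and supp: "\<And>y. y \<notin> square \<Longrightarrow> K y = 0" and F: "finite F"
  shows "(\<Sum>p\<in>F. (cmod (fourier K (lattice_point p)))\<^sup>2) \<le> 16 * (LINT y|lborel. (cmod (K y))\<^sup>2)"
proof -
  define a where "a p = fourier K (lattice_point p)" for p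
  define S where "S = (\<Sum>p\<in>F. (cmod (a p))\<^sup>2)"
  have S0: "S \<ge> 0" by (simp add: S_def sum_nonneg)
  define P where "P y = indicator square y *\<^sub>R (\<Sum>p\<in>F. a p * ee (y \<bullet> lattice_point p))" for y
  have [measurable]: "P \<in> borel_measurable borel" unfolding P_def by measurable
  have P0: "P y = 0" if "y \<notin> square" for y using that by (simp add: P_def)
  have Pb: "cmod (P y) \<le> (\<Sum>p\<in>F. cmod (a p))" for y
  proof -
    have "cmod (P y) \<le> cmod (\<Sum>p\<in>F. a p * ee (y \<bullet> lattice_point p))"
      by (simp add: P_def indicator_def)
    also have "\<dots> \<le> (\<Sum>p\<in>F. cmod (a p * ee (y \<bullet> lattice_point p)))" by (rule norm_sum)
    finally show ?thesis by (simp add: norm_mult)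
  qed
  have Pi: "integrable lborel P"
    by (rule square_bounded_integrable[where C="\<Sum>p\<in>F. cmod (a p)"]) (use Pb P0 in auto)
  have P2: "integrable lborel (\<lambda>y. (cmod (P y))\<^sup>2)"
  proof -
    have "integrable lborel (\<lambda>y. P y * cnj (P y))"
      by (rule integrable_mult_bdd(1)[OF Pi, where C="\<Sum>p\<in>F. cmod (a p)"]) (use Pb in auto)
    then show ?thesis
      by (simp add: complex_norm_square[symmetric] complex_of_real_integrable_eq del: of_real_power flip: of_real_power)
  qed
  have "complex_of_real (LINT y|lborel. (cmod (P y))\<^sup>2) = (LINT y|lborel. P y * cnj (P y))"
    by (simp add: complex_norm_square[symmetric] flip: of_real_power)
  also have "\<dots> = (LINT y|lborel. (\<Sum>p\<in>F. \<Sum>p'\<in>F. (a p * cnj (a p')) * (indicator square y *\<^sub>R ee (y \<bullet> lattice_point p - y \<bullet> lattice_point p'))))"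
    unfolding P_def
    by (intro Bochner_Integration.integral_cong refl)
       (auto simp: indicator_def sum_product ee_diff mult_ac)
  also have "\<dots> = (\<Sum>p\<in>F. \<Sum>p'\<in>F. LINT y|lborel. (a p * cnj (a p')) * (indicator square y *\<^sub>R ee (y \<bullet> lattice_point p - y \<bullet> lattice_point p')))"
  proof -
    have i: "integrable lborel (\<lambda>y. (a p * cnj (a p')) * (indicator square y *\<^sub>R ee (y \<bullet> lattice_point p - y \<bullet> lattice_point p')))" for p p'
      by (intro integrable_mult_right square_bounded_integrable[where C=1]) (auto simp: indicator_def)
    show ?thesis
      by (subst Bochner_Integration.integral_sum, intro Bochner_Integration.integrable_sum i,
          intro sum.cong refl Bochner_Integration.integral_sum i)
  qed
  also have "\<dots> = (\<Sum>p\<in>F. \<Sum>p'\<in>F. (a p * cnj (a p')) * (if p = p' then 16 else 0))"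
    unfolding integral_mult_right_zero lattice_point_def fourier_lattice_orthogonal by simp
  also have "\<dots> = (\<Sum>p\<in>F. 16 * (a p * cnj (a p)))"
    using F by (intro sum.cong refl) (simp add: if_distrib[of "\<lambda>x. _ * x"] cong: if_cong)
  also have "\<dots> = complex_of_real (16 * S)"
    by (simp add: S_def complex_norm_square[symmetric] sum_distrib_left flip: of_real_power)
  finally have PP: "(LINT y|lborel. (cmod (P y))\<^sup>2) = 16 * S" by (simp only: of_real_eq_iff)
  have "complex_of_real S = (\<Sum>p\<in>F. cnj (a p) * (LINT y|lborel. K y * ee (- (y \<bullet> lattice_point p))))"
    by (simp add: S_def a_def fourier_ee complex_norm_square mult.commute flip: of_real_power)
  also have "\<dots> = (LINT y|lborel. (\<Sum>p\<in>F. cnj (a p) * (K y * ee (- (y \<bullet> lattice_point p)))))"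
    by (subst Bochner_Integration.integral_sum) (auto intro!: integrable_mult_right integrable_mult_ee K1)
  also have "\<dots> = (LINT y|lborel. K y * cnj (P y))"
  proof (intro Bochner_Integration.integral_cong refl)
    fix y show "(\<Sum>p\<in>F. cnj (a p) * (K y * ee (- (y \<bullet> lattice_point p)))) = K y * cnj (P y)"
      using supp[of y] by (cases "y \<in> square") (simp_all add: P_def sum_distrib_left mult_ac)
  qed
  finally have SK: "complex_of_real S = (LINT y|lborel. K y * cnj (P y))" .
  have KPi: "integrable lborel (\<lambda>y. K y * cnj (P y))"
    by (rule integrable_mult_bdd(1)[OF K1, where C="\<Sum>p\<in>F. cmod (a p)"]) (use Pb in auto)
  have "ennreal S = ennreal (cmod (LINT y|lborel. K y * cnj (P y)))"
    using S0 by (simp add: SK[symmetric])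
  also have "\<dots> \<le> (\<integral>\<^sup>+y. ennreal (cmod (K y)) * ennreal (cmod (P y)) \<partial>lborel)"
    using integral_norm_bound_ennreal[OF KPi] by (simp add: norm_mult ennreal_mult')
  finally have "(ennreal S)\<^sup>2 \<le> (\<integral>\<^sup>+y. ennreal (cmod (K y)) * ennreal (cmod (P y)) \<partial>lborel)\<^sup>2"
    by (rule power_mono) simp
  also have "\<dots> \<le> (\<integral>\<^sup>+y. (ennreal (cmod (K y)))\<^sup>2 \<partial>lborel) * (\<integral>\<^sup>+y. (ennreal (cmod (P y)))\<^sup>2 \<partial>lborel)"
    by (rule Cauchy_Schwarz_nn_integral) auto
  also have "\<dots> = ennreal (LINT y|lborel. (cmod (K y))\<^sup>2) * ennreal (16 * S)"
    by (simp add: ennreal_power nn_integral_eq_integral K2 P2 PP)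
  finally have "S * S \<le> (16 * (LINT y|lborel. (cmod (K y))\<^sup>2)) * S"
    using S0 by (simp add: ennreal_power power2_eq_square mult_ac integral_nonneg_AE flip: ennreal_mult)
  then show ?thesis
    using S0 by (cases "S = 0") (auto simp: S_def[symmetric] a_def[symmetric] mult_le_cancel_right integral_nonneg_AE)
qed

text \<open>Truncating \<open>K\<close> at height \<open>s\<close> and using Bessel on the bounded part is Marcinkiewicz' proof of a
  weak-type Hausdorff--Young inequality; \<open>s\<close> is chosen so that the tall part contributes at most \<open>\<lambda>/2\<close>.\<close>
lemma lattice_count_le:
  fixes K :: "plane \<Rightarrow> complex"
  assumes q: "1 < q" "q \<le> 2" and K [measurable]: "K \<in> borel_measurable borel"
    and Kq: "integrable lborel (\<lambda>y. cmod (K y) powr q)" and KN: "(LINT y|lborel. cmod (K y) powr q) \<le> N powr q"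
    and N: "N > 0" and h: "h > 0"
    and supp: "\<And>y. y \<notin> square \<Longrightarrow> K y = 0" and F: "finite F" and Fh: "\<And>p. p \<in> F \<Longrightarrow> h \<le> cmod (fourier K (lattice_point p))"
  shows "real (card F) \<le> 16 * (2 * N / h) powr (q / (q - 1))"
proof -
  define s where "s = N * (2 * N / h) powr (1 / (q - 1))"
  have s: "s > 0" using N h by (simp add: s_def)
  have sq: "s powr (1 - q) * N powr q = h / 2"
  proof -
    have "s powr (1 - q) = N powr (1 - q) * (2 * N / h) powr (1 / (q - 1) * (1 - q))"
      using N h by (simp add: s_def powr_mult powr_powr)
    also have "1 / (q - 1) * (1 - q) = - 1" using q by (simp add: field_simps)
    finally have "s powr (1 - q) * N powr q = N powr (1 - q) * N powr q * (h / (2 * N))"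
      using N h by (simp add: powr_minus)
    also have "N powr (1 - q) * N powr q = N" using N by (simp add: powr_add[symmetric])
    finally show ?thesis using N by simp
  qed
  define K1 where "K1 y = (if cmod (K y) \<le> s then K y else 0)" for y
  define K2 where "K2 y = (if cmod (K y) \<le> s then 0 else K y)" for y
  have [measurable]: "K1 \<in> borel_measurable borel" "K2 \<in> borel_measurable borel"
    unfolding K1_def K2_def by measurable
  have i1: "integrable lborel K1"
    by (rule square_bounded_integrable[where C=s]) (use s supp in \<open>auto simp: K1_def\<close>)
  have b2: "cmod (K2 y) \<le> s powr (1 - q) * cmod (K y) powr q" for y
  proof (cases "cmod (K y) \<le> s")
    case False
    then have "cmod (K y) = cmod (K y) powr (1 - q) * cmod (K y) powr q"
      using s by (simp add: powr_add[symmetric])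
    also have "\<dots> \<le> s powr (1 - q) * cmod (K y) powr q"
      using False s q by (intro mult_right_mono powr_mono2') auto
    finally show ?thesis using False by (simp add: K2_def)
  qed (simp add: K2_def)
  have i2: "integrable lborel K2"
    by (rule Bochner_Integration.integrable_bound[of _ "\<lambda>y. s powr (1 - q) * cmod (K y) powr q"])
       (use Kq b2 in auto)
  have f2: "cmod (fourier K2 \<xi>) \<le> h / 2" for \<xi>
  proof -
    have "cmod (fourier K2 \<xi>) \<le> (LINT y|lborel. cmod (K2 y))"
      unfolding fourier_ee by (rule order_trans[OF integral_norm_bound]) (simp add: norm_mult)
    also have "\<dots> \<le> (LINT y|lborel. s powr (1 - q) * cmod (K y) powr q)"
      by (rule integral_mono) (use Kq b2 i2 in auto)
    also have "\<dots> \<le> s powr (1 - q) * N powr q"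
      using KN by (simp add: mult_left_mono)
    finally show ?thesis by (simp add: sq)
  qed
  have fK: "fourier K \<xi> = fourier K1 \<xi> + fourier K2 \<xi>" for \<xi>
  proof -
    have "fourier K \<xi> = (LINT y|lborel. K1 y * ee (- (y \<bullet> \<xi>)) + K2 y * ee (- (y \<bullet> \<xi>)))"
      unfolding fourier_ee by (intro Bochner_Integration.integral_cong refl) (simp add: K1_def K2_def)
    also have "\<dots> = fourier K1 \<xi> + fourier K2 \<xi>"
      unfolding fourier_ee by (rule Bochner_Integration.integral_add) (intro integrable_mult_ee i1 i2, simp)+
    finally show ?thesis .
  qed
  have f1: "h / 2 \<le> cmod (fourier K1 (lattice_point p))" if "p \<in> F" for p
    using Fh[OF that] f2[of "lattice_point p"] norm_triangle_ineq[of "fourier K1 (lattice_point p)" "fourier K2 (lattice_point p)"]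
    unfolding fK by simp
  have b1: "(cmod (K1 y))\<^sup>2 \<le> s powr (2 - q) * cmod (K y) powr q" for y
  proof (cases "cmod (K y) \<le> s \<and> K y \<noteq> 0")
    case True
    then have "(cmod (K1 y))\<^sup>2 = cmod (K y) powr (2 - q) * cmod (K y) powr q"
      by (simp add: K1_def powr_add[symmetric])
    also have "\<dots> \<le> s powr (2 - q) * cmod (K y) powr q"
      using True q by (intro mult_right_mono powr_mono2) auto
    finally show ?thesis .
  qed (auto simp: K1_def)
  have i12: "integrable lborel (\<lambda>y. (cmod (K1 y))\<^sup>2)"
    by (rule Bochner_Integration.integrable_bound[of _ "\<lambda>y. s powr (2 - q) * cmod (K y) powr q"])
       (use Kq b1 in auto)
  have "real (card F) * (h / 2)\<^sup>2 = (\<Sum>p\<in>F. (h / 2)\<^sup>2)" by simp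
  also have "\<dots> \<le> (\<Sum>p\<in>F. (cmod (fourier K1 (lattice_point p)))\<^sup>2)"
    using f1 h by (intro sum_mono power_mono) auto
  also have "\<dots> \<le> 16 * (LINT y|lborel. (cmod (K1 y))\<^sup>2)"
    by (rule lattice_bessel) (use i1 i12 F supp in \<open>auto simp: K1_def\<close>)
  also have "(LINT y|lborel. (cmod (K1 y))\<^sup>2) \<le> (LINT y|lborel. s powr (2 - q) * cmod (K y) powr q)"
    by (rule integral_mono) (use Kq b1 i12 in auto)
  also have "\<dots> \<le> s powr (2 - q) * N powr q"
    using KN by (simp add: mult_left_mono)
  finally have c: "real (card F) * (h / 2)\<^sup>2 \<le> 16 * (s powr (2 - q) * N powr q)" by simp
  \<comment> \<open>Squaring the defining relation of \<open>s\<close> expresses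
    \<open>(h / 2)\<^sup>2\<close> through \<open>s\<close> and \<open>N\<close>; in these terms the
    bound given by Bessel is the claimed power of \<open>2 * N / h\<close>.\<close>
  have "(2 * N / h) powr (q / (q - 1)) * (h / 2)\<^sup>2 = s powr (2 - q) * N powr q"
  proof -
    have "(2 * N / h) powr (q / (q - 1)) = (s / N) powr q"
      using N h by (simp add: s_def powr_powr)
    moreover have "(s / N) powr q = s powr q * N powr (- q)"
      using s N by (simp add: powr_divide powr_minus_divide)
    moreover have "(s powr (1 - q))\<^sup>2 = s powr (2 - 2 * q)" "(N powr q)\<^sup>2 = N powr (2 * q)"
      by (simp_all add: power2_eq_square powr_add[symmetric])
    then have "(h / 2)\<^sup>2 = s powr (2 - 2 * q) * N powr (2 * q)"
      by (simp only: sq[symmetric] power_mult_distrib)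
    ultimately have "(2 * N / h) powr (q / (q - 1)) * (h / 2)\<^sup>2 = (s powr q * s powr (2 - 2 * q)) * (N powr (- q) * N powr (2 * q))"
      by (simp only: mult_ac)
    also have "\<dots> = s powr (2 - q) * N powr q"
      using s N by (simp add: powr_add[symmetric])
    finally show ?thesis .
  qed
  with c have "real (card F) * (h / 2)\<^sup>2 \<le> (16 * (2 * N / h) powr (q / (q - 1))) * (h / 2)\<^sup>2"
    by simp
  then show ?thesis using h by (simp add: mult_le_cancel_right)
qed

section \<open>Bilinear operators with rough kernels at a single scale\<close>

definition ann :: "plane set" where "ann = {y. 1 < norm y \<and> norm y \<le> 2}"

lemma ann_measurable [measurable]: "ann \<in> sets borel"
  unfolding ann_def by measurable

lemma abs_fst_le_norm: "\<bar>fst y\<bar> \<le> norm (y :: plane)" and abs_snd_le_norm: "\<bar>snd y\<bar> \<le> norm (y :: plane)"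
  by (metis norm_fst_le prod.collapse real_norm_def, metis norm_snd_le prod.collapse real_norm_def)

lemma ann_coord: "y \<in> ann \<Longrightarrow> \<bar>fst y\<bar> \<le> 2" "y \<in> ann \<Longrightarrow> \<bar>snd y\<bar> \<le> 2"
  using abs_fst_le_norm[of y] abs_snd_le_norm[of y] by (auto simp: ann_def)

lemma ann_subset_square: "ann \<subseteq> square"
  using ann_coord by (force simp: square_def abs_le_iff)

lemma plane_proj_measurable [measurable]:
  "fst \<in> borel_measurable (borel :: plane measure)" "snd \<in> borel_measurable (borel :: plane measure)"
  by (metis borel_prod measurable_fst, metis borel_prod measurable_snd)

text \<open>Lipschitz continuity is what a shift by half a period consumes. One constant serves for
  both the size and the Lipschitz bound, so that products only cost the factor 2 of the product
  rule.\<close>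

definition amp :: "real \<Rightarrow> (plane \<Rightarrow> complex) \<Rightarrow> bool" where
  "amp M A \<longleftrightarrow> A \<in> borel_measurable borel \<and> (\<forall>y\<in>ann. cmod (A y) \<le> M) \<and>
     (\<forall>y\<in>ann. \<forall>z\<in>ann. cmod (A y - A z) \<le> M * norm (y - z))"

lemma ampD:
  assumes "amp M A"
  shows "A \<in> borel_measurable borel" "y \<in> ann \<Longrightarrow> cmod (A y) \<le> M"
    "y \<in> ann \<Longrightarrow> z \<in> ann \<Longrightarrow> cmod (A y - A z) \<le> M * norm (y - z)"
  using assms by (auto simp: amp_def)

lemma amp_nonneg: "amp M A \<Longrightarrow> 0 \<le> M"
  by (rule order_trans[OF norm_ge_zero ampD(2)[of M A "(2, 0)"]]) (auto simp: ann_def norm_Pair)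

lemma amp_mult:
  assumes A: "amp M A" and B: "amp N B"
  shows "amp (2 * M * N) (\<lambda>y. A y * B y)"
  unfolding amp_def
proof (intro conjI ballI)
  note [measurable] = ampD(1)[OF A] ampD(1)[OF B]
  note M = amp_nonneg[OF A] and N = amp_nonneg[OF B]
  show "(\<lambda>y. A y * B y) \<in> borel_measurable borel" by measurable
  fix y assume y: "y \<in> ann"
  have "cmod (A y * B y) \<le> M * N"
    unfolding norm_mult by (intro mult_mono ampD(2)[OF A] ampD(2)[OF B] y M) auto
  also have "\<dots> \<le> 2 * M * N" using M N by simp
  finally show "cmod (A y * B y) \<le> 2 * M * N" .
  fix z assume z: "z \<in> ann"
  have "A y * B y - A z * B z = A y * (B y - B z) + (A y - A z) * B z"
    by (simp add: algebra_simps)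
  then have "cmod (A y * B y - A z * B z) \<le> cmod (A y) * cmod (B y - B z) + cmod (A y - A z) * cmod (B z)"
    by (metis norm_triangle_ineq norm_mult)
  also have "\<dots> \<le> M * (N * norm (y - z)) + (M * norm (y - z)) * N"
    by (intro add_mono mult_mono ampD(2)[OF A] ampD(2)[OF B] ampD(3)[OF A] ampD(3)[OF B] y z M mult_nonneg_nonneg) auto
  also have "\<dots> = 2 * M * N * norm (y - z)" by simp
  finally show "cmod (A y * B y - A z * B z) \<le> 2 * M * N * norm (y - z)" .
qed

lemma amp_1: "amp 1 (\<lambda>_. 1)"
  by (simp add: amp_def)

lemma amp_fst: "amp 2 (\<lambda>y. complex_of_real (fst y))" and amp_snd: "amp 2 (\<lambda>y. complex_of_real (snd y))"
proof -
  have *: "cmod (complex_of_real a - complex_of_real b) = \<bar>a - b\<bar>" for a b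
    by (simp flip: of_real_diff)
  show "amp 2 (\<lambda>y. complex_of_real (fst y))" "amp 2 (\<lambda>y. complex_of_real (snd y))"
    unfolding amp_def *
    using ann_coord abs_fst_le_norm[of "y - z" for y z] abs_snd_le_norm[of "y - z" for y z]
    by (auto intro: order_trans[OF _ mult_right_mono[of 1 2]])
qed

text \<open>What matters is that the growth in \<open>n\<close> is only geometric: it is absorbed by
  factorials in the Taylor expansion over cells and by \<open>(1/64) ^ n\<close> in the low-pass
  part.\<close>

lemma amp_power:
  assumes "amp 2 A" shows "amp (4 ^ n) (\<lambda>y. A y ^ n)"
proof (induction n)
  case 0
  then show ?case using amp_1 by simp
next
  case (Suc n)
  then show ?case using amp_mult[OF assms Suc.IH] by (simp add: mult.assoc)
qed

text \<open>The amplitudes \<open>A\<close> are built into the definition so that \<open>K\<close> may be multiplied by smooth functions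
  on the annulus without a new oscillation estimate.\<close>
definition rough_class :: "real \<Rightarrow> real \<Rightarrow> (plane \<Rightarrow> complex) \<Rightarrow> bool" where
  "rough_class q N K \<longleftrightarrow> K \<in> borel_measurable borel \<and> (\<forall>y. y \<notin> ann \<longrightarrow> K y = 0) \<and>
     integrable lborel K \<and>
     integrable lborel (\<lambda>y. cmod (K y) powr q) \<and> (LINT y|lborel. cmod (K y) powr q) \<le> N powr q \<and>
     (\<forall>M A \<xi>. amp M A \<longrightarrow> 1 \<le> norm \<xi> \<longrightarrow> cmod (fourier (\<lambda>y. K y * A y) \<xi>) \<le> M * N * norm \<xi> powr (- 1 / 8))"

lemma rough_classD:
  assumes "rough_class q N K"
  shows "K \<in> borel_measurable borel" "y \<notin> ann \<Longrightarrow> K y = 0" "integrable lborel K"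
    "integrable lborel (\<lambda>y. cmod (K y) powr q)" "(LINT y|lborel. cmod (K y) powr q) \<le> N powr q"
    "amp M A \<Longrightarrow> 1 \<le> norm \<xi> \<Longrightarrow> cmod (fourier (\<lambda>y. K y * A y) \<xi>) \<le> M * N * norm \<xi> powr (- 1 / 8)"
  using assms unfolding rough_class_def by blast+

lemma rough_class_mult:
  assumes K: "rough_class q N K" and A: "amp M A" and q: "q > 0" and N: "N \<ge> 0"
  shows "rough_class q (2 * M * N) (\<lambda>y. K y * A y)"
  unfolding rough_class_def
proof (intro conjI allI impI)
  note [measurable] = rough_classD(1)[OF K] ampD(1)[OF A]
  note M = amp_nonneg[OF A]
  show "(\<lambda>y. K y * A y) \<in> borel_measurable borel" by measurable
  show "K y * A y = 0" if "y \<notin> ann" for y using rough_classD(2)[OF K that] by simp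
  have le: "cmod (K y * A y) \<le> M * cmod (K y)" for y
    using mult_right_mono[OF ampD(2)[OF A], of y "cmod (K y)"] rough_classD(2)[OF K, of y]
    by (cases "y \<in> ann") (auto simp: norm_mult mult.commute)
  show "integrable lborel (\<lambda>y. K y * A y)"
    by (rule Bochner_Integration.integrable_bound[of _ "\<lambda>y. M * cmod (K y)"])
       (use rough_classD(3)[OF K] order_trans[OF le abs_ge_self] in auto)
  have leq: "cmod (K y * A y) powr q \<le> M powr q * cmod (K y) powr q" for y
    using powr_mono2[OF _ _ le[of y], of q] q M by (simp add: powr_mult)
  show i: "integrable lborel (\<lambda>y. cmod (K y * A y) powr q)"
    by (rule Bochner_Integration.integrable_bound[of _ "\<lambda>y. M powr q * cmod (K y) powr q"])
       (use rough_classD(4)[OF K] leq in auto)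
  have "(LINT y|lborel. cmod (K y * A y) powr q) \<le> (LINT y|lborel. M powr q * cmod (K y) powr q)"
    by (rule integral_mono) (use i rough_classD(4)[OF K] leq in auto)
  also have "\<dots> \<le> M powr q * N powr q"
    using rough_classD(5)[OF K] by (simp add: mult_left_mono)
  also have "\<dots> = (M * N) powr q" using M N by (simp add: powr_mult)
  also have "\<dots> \<le> (2 * M * N) powr q" using M N q by (intro powr_mono2) auto
  finally show "(LINT y|lborel. cmod (K y * A y) powr q) \<le> (2 * M * N) powr q" .
  fix M' A' \<xi> assume A': "amp M' A'" and \<xi>: "1 \<le> norm (\<xi> :: plane)"
  show "cmod (fourier (\<lambda>y. K y * A y * A' y) \<xi>) \<le> M' * (2 * M * N) * norm \<xi> powr (- 1 / 8)"
    using rough_classD(6)[OF K amp_mult[OF A A'] \<xi>] by (simp add: mult_ac)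
qed

lemma norm_integral_le_suminf:
  fixes f :: "nat \<Rightarrow> 'a \<Rightarrow> complex"
  assumes i: "\<And>n. integrable M (f n)" and s: "\<And>x. (\<lambda>n. f n x) sums g x"
    and w: "integrable M w" and le: "\<And>n x. cmod (f n x) \<le> b n * w x" and b: "summable b" and w0: "\<And>x. w x \<ge> 0"
  shows "ennreal (cmod (LINT x|M. g x)) \<le> (\<Sum>n. ennreal (cmod (LINT x|M. f n x)))"
proof -
  have "summable (\<lambda>n. LINT x|M. cmod (f n x))"
  proof (rule summable_comparison_test')
    show "summable (\<lambda>n. b n * (LINT x|M. w x))" using b by (rule summable_mult2)
    fix n
    have "(LINT x|M. cmod (f n x)) \<le> (LINT x|M. b n * w x)"
      by (rule integral_mono) (use i w le in auto)
    then show "norm (LINT x|M. cmod (f n x)) \<le> b n * (LINT x|M. w x)" by simp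
  qed
  moreover have "summable (\<lambda>n. cmod (f n x))" for x
    by (rule summable_comparison_test'[OF summable_mult2[OF b, of "w x"]]) (use le in auto)
  ultimately have "(\<lambda>n. LINT x|M. f n x) sums (LINT x|M. (\<Sum>n. f n x))"
    by (intro sums_integral i AE_I2)
  moreover have "(\<Sum>n. f n x) = g x" for x using s by (simp add: sums_iff)
  ultimately have S: "(\<lambda>n. LINT x|M. f n x) sums (LINT x|M. g x)" by simp
  have "(\<lambda>n. ennreal (cmod (\<Sum>k<n. LINT x|M. f k x))) \<longlonglongrightarrow> ennreal (cmod (LINT x|M. g x))"
    using S unfolding sums_def by (intro tendsto_ennrealI tendsto_norm)
  then show ?thesis
  proof (rule LIMSEQ_le_const2)
    show "\<exists>N. \<forall>n\<ge>N. ennreal (cmod (\<Sum>k<n. LINT x|M. f k x)) \<le> (\<Sum>n. ennreal (cmod (LINT x|M. f n x)))"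
    proof (intro exI allI impI)
      fix n
      have "ennreal (cmod (\<Sum>k<n. LINT x|M. f k x)) \<le> ennreal (\<Sum>k<n. cmod (LINT x|M. f k x))"
        by (intro ennreal_leI norm_sum)
      also have "\<dots> = (\<Sum>k<n. ennreal (cmod (LINT x|M. f k x)))" by simp
      also have "\<dots> \<le> (\<Sum>n. ennreal (cmod (LINT x|M. f n x)))"
        by (intro sum_le_suminf) auto
      finally show "ennreal (cmod (\<Sum>k<n. LINT x|M. f k x)) \<le> (\<Sum>n. ennreal (cmod (LINT x|M. f n x)))" .
    qed
  qed
qed

section \<open>Taylor expansion inside the frequency cells\<close>

definition taylor_u :: "(real \<Rightarrow> complex) \<Rightarrow> nat \<Rightarrow> real \<Rightarrow> complex" where
  "taylor_u u n \<xi> = u \<xi> * of_real ((\<xi> - of_int \<lfloor>4 * \<xi>\<rfloor> / 4) ^ n)"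

definition taylor_c :: "nat \<Rightarrow> complex" where "taylor_c n = (- 2 * pi * \<i>) ^ n / fact n"

lemma frac_cell_bounds: "0 \<le> \<xi> - of_int \<lfloor>4 * \<xi>\<rfloor> / 4" "\<xi> - of_int \<lfloor>4 * \<xi>\<rfloor> / 4 \<le> 1 / 4"
proof -
  have "of_int \<lfloor>4 * \<xi>\<rfloor> \<le> 4 * \<xi>" "4 * \<xi> < of_int \<lfloor>4 * \<xi>\<rfloor> + 1" by linarith+
  then show "0 \<le> \<xi> - of_int \<lfloor>4 * \<xi>\<rfloor> / 4" "\<xi> - of_int \<lfloor>4 * \<xi>\<rfloor> / 4 \<le> 1 / 4" by (simp_all add: field_simps)
qed

text \<open>The offset from the corner of the cell is at most \<open>1 / 4\<close>, so its powers
  may be attached to \<open>u\<close> without enlarging any norm, uniformly in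
  \<open>n\<close>.\<close>

lemma norm_taylor_u_le: "cmod (taylor_u u n \<xi>) \<le> 1 * cmod (u \<xi>)"
  using frac_cell_bounds[of \<xi>]
  by (auto simp: taylor_u_def norm_mult norm_power simp del: of_real_power intro!: mult_left_le power_le_one)

lemma taylor_u_measurable [measurable]:
  assumes [measurable]: "u \<in> borel_measurable borel"
  shows "taylor_u u n \<in> borel_measurable borel"
  unfolding taylor_u_def by measurable

lemma L2fun_taylor_u: "L2fun u \<Longrightarrow> L2fun (taylor_u u n)"
  by (rule L2fun_dominated(1)[OF _ _ norm_taylor_u_le]) (auto dest: L2fun_measurable)

lemma l2_taylor_u: "L2fun u \<Longrightarrow> l2 (taylor_u u n) \<le> l2 u"
  using l2_dominated[of u "taylor_u u n" 1] norm_taylor_u_le[of u n] by (auto dest: L2fun_measurable)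

lemma norm_taylor_c: "cmod (taylor_c n) = (2 * pi) ^ n / fact n"
  by (simp add: taylor_c_def norm_divide norm_power norm_mult)

text \<open>On the cell of \<open>\<xi>\<close> with corner \<open>k / 4\<close>, the character \<open>ee (- s * (\<xi> - k / 4))\<close> is expanded into its
  exponential series, which separates the variables \<open>s\<close> and \<open>\<xi>\<close>.\<close>
lemma ift_taylor_sums:
  fixes x :: real
  assumes u: "L2fun u" and S: "finite S" "\<And>\<xi>. u \<xi> \<noteq> 0 \<Longrightarrow> \<lfloor>4 * \<xi>\<rfloor> \<in> S"
  defines "t n s \<equiv> taylor_c n * of_real s ^ n * (\<Sum>k\<in>S. ee (- (s * of_int k / 4)) * ift (cell (taylor_u u n) k) x)"
  shows "(\<lambda>n. t n s) sums ift u (x - s)"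
    and "cmod (t n s) \<le> (2 * pi * \<bar>s\<bar>) ^ n / fact n * (LINT \<xi>|lborel. cmod (u \<xi>))"
proof -
  have [measurable]: "u \<in> borel_measurable borel" by (rule L2fun_measurable[OF u])
  have ui: "integrable lborel u" using u by (simp add: L2fun_def)
  define e where "e n \<xi> = taylor_c n * of_real s ^ n * ee (- (s * of_int \<lfloor>4 * \<xi>\<rfloor> / 4)) * ee (x * \<xi>)" for n \<xi>
  define f where "f n \<xi> = taylor_u u n \<xi> * e n \<xi>" for n \<xi>
  have [measurable]: "e n \<in> borel_measurable borel" for n unfolding e_def by measurable
  have ne: "cmod (e n \<xi>) = (2 * pi * \<bar>s\<bar>) ^ n / fact n" for n \<xi>
    by (simp add: e_def norm_mult norm_power norm_taylor_c power_mult_distrib)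
  have tui: "integrable lborel (taylor_u u n)" for n
    using L2fun_taylor_u[OF u] by (simp add: L2fun_def)
  have fi: "integrable lborel (f n)" for n
    unfolding f_def by (rule integrable_mult_bdd(1)[OF tui, where C="(2 * pi * \<bar>s\<bar>) ^ n / fact n"]) (use ne in auto)
  have fle: "cmod (f n \<xi>) \<le> (2 * pi * \<bar>s\<bar>) ^ n / fact n * cmod (u \<xi>)" for n \<xi>
    using norm_taylor_u_le[of u n \<xi>]
    by (auto simp: f_def norm_mult ne mult.commute intro!: mult_right_mono divide_right_mono)
  have b: "summable (\<lambda>n. (2 * pi * \<bar>s\<bar>) ^ n / fact n)"
    using summable_exp[of "2 * pi * \<bar>s\<bar>"] by (simp add: divide_inverse mult.commute)
  have tf: "t n s = (LINT \<xi>|lborel. f n \<xi>)" for n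
  proof -
    have eq: "(\<Sum>k\<in>S. ee (- (s * of_int k / 4)) * cell (taylor_u u n) k \<xi>) = taylor_u u n \<xi> * ee (- (s * of_int \<lfloor>4 * \<xi>\<rfloor> / 4))" for \<xi>
      unfolding cell_sum_eq[OF S(1)] using S(2)[of \<xi>] by (auto simp: taylor_u_def)
    have "(\<Sum>k\<in>S. ee (- (s * of_int k / 4)) * ift (cell (taylor_u u n) k) x)
      = ift (\<lambda>\<xi>. \<Sum>k\<in>S. ee (- (s * of_int k / 4)) * cell (taylor_u u n) k \<xi>) x"
      by (rule ift_sum[symmetric]) (use S L2fun_cell[OF L2fun_taylor_u[OF u]] in \<open>auto simp: L2fun_def\<close>)
    then have "t n s = (LINT \<xi>|lborel. (taylor_c n * of_real s ^ n) * (taylor_u u n \<xi> * ee (- (s * of_int \<lfloor>4 * \<xi>\<rfloor> / 4)) * ee (x * \<xi>)))"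
      unfolding t_def ift_def eq integral_mult_right_zero by simp
    also have "\<dots> = (LINT \<xi>|lborel. f n \<xi>)" by (simp add: f_def e_def mult_ac)
    finally show ?thesis .
  qed
  show "cmod (t n s) \<le> (2 * pi * \<bar>s\<bar>) ^ n / fact n * (LINT \<xi>|lborel. cmod (u \<xi>))"
  proof -
    have "cmod (t n s) \<le> (LINT \<xi>|lborel. cmod (f n \<xi>))" unfolding tf by (rule integral_norm_bound)
    also have "\<dots> \<le> (LINT \<xi>|lborel. (2 * pi * \<bar>s\<bar>) ^ n / fact n * cmod (u \<xi>))"
      by (rule integral_mono) (use fi ui fle in auto)
    finally show ?thesis by simp
  qed
  have fs: "(\<lambda>n. f n \<xi>) sums (u \<xi> * ee ((x - s) * \<xi>))" for \<xi>
  proof -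
    let ?\<eta> = "\<xi> - of_int \<lfloor>4 * \<xi>\<rfloor> / 4"
    have "(\<lambda>n. (- 2 * pi * \<i> * s * ?\<eta>) ^ n /\<^sub>R fact n) sums exp (- 2 * pi * \<i> * s * ?\<eta>)"
      by (rule exp_converges)
    also have "exp (- 2 * pi * \<i> * s * ?\<eta>) = ee (- (s * ?\<eta>))"
      by (simp add: ee_def cis_conv_exp mult_ac)
    finally have "(\<lambda>n. (u \<xi> * ee (- (s * of_int \<lfloor>4 * \<xi>\<rfloor> / 4)) * ee (x * \<xi>)) * ((- 2 * pi * \<i> * s * ?\<eta>) ^ n /\<^sub>R fact n))
      sums ((u \<xi> * ee (- (s * of_int \<lfloor>4 * \<xi>\<rfloor> / 4)) * ee (x * \<xi>)) * ee (- (s * ?\<eta>)))"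
      by (rule sums_mult)
    moreover have "(u \<xi> * ee (- (s * of_int \<lfloor>4 * \<xi>\<rfloor> / 4)) * ee (x * \<xi>)) * ee (- (s * ?\<eta>)) = u \<xi> * ee ((x - s) * \<xi>)"
      by (simp add: mult.assoc ee_add[symmetric]) (simp add: algebra_simps)
    moreover have "(u \<xi> * ee (- (s * of_int \<lfloor>4 * \<xi>\<rfloor> / 4)) * ee (x * \<xi>)) * ((- 2 * pi * \<i> * s * ?\<eta>) ^ n /\<^sub>R fact n) = f n \<xi>" for n
    proof -
      have gen: "(c * of_real s * of_real h) ^ n /\<^sub>R fact n = c ^ n / fact n * of_real s ^ n * of_real (h ^ n)" for c :: complex and h
        by (simp add: power_mult_distrib scaleR_conv_of_real divide_inverse mult_ac)
      show ?thesis
        unfolding f_def e_def taylor_u_def taylor_c_def gen by (simp only: mult_ac)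
    qed
    ultimately show ?thesis by simp
  qed
  have "summable (\<lambda>n. LINT x|lborel. cmod (f n x))"
  proof (rule summable_comparison_test')
    show "summable (\<lambda>n. (2 * pi * \<bar>s\<bar>) ^ n / fact n * (LINT \<xi>|lborel. cmod (u \<xi>)))" using b by (rule summable_mult2)
    fix n
    have "(LINT \<xi>|lborel. cmod (f n \<xi>)) \<le> (LINT \<xi>|lborel. (2 * pi * \<bar>s\<bar>) ^ n / fact n * cmod (u \<xi>))"
      by (rule integral_mono) (use fi ui fle in auto)
    then show "norm (LINT \<xi>|lborel. cmod (f n \<xi>)) \<le> (2 * pi * \<bar>s\<bar>) ^ n / fact n * (LINT \<xi>|lborel. cmod (u \<xi>))" by simp
  qed
  moreover have "summable (\<lambda>n. cmod (f n \<xi>))" for \<xi>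
    by (rule summable_comparison_test'[OF summable_mult2[OF b, of "cmod (u \<xi>)"]]) (use fle in auto)
  ultimately have "(\<lambda>n. LINT \<xi>|lborel. f n \<xi>) sums (LINT \<xi>|lborel. (\<Sum>n. f n \<xi>))"
    by (intro sums_integral fi AE_I2)
  then show "(\<lambda>n. t n s) sums ift u (x - s)"
    using fs by (simp add: tf ift_def sums_iff)
qed

lemma rough_class_monomial:
  assumes K: "rough_class q N K" and q: "q > 0" and N: "N \<ge> 0"
  shows "rough_class q (4 * 4 ^ n * 4 ^ m * N) (\<lambda>y. K y * (of_real (fst y) ^ n * of_real (snd y) ^ m))"
  using rough_class_mult[OF K amp_mult[OF amp_power[OF amp_fst, of n] amp_power[OF amp_snd, of m]] q N]
  by (simp add: mult.assoc)

text \<open>The condition reads \<open>\<rho> / 2\<close> because the transform is evaluated at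
  corners of cells, which may be somewhat closer to the origin than the frequencies of the
  inputs.\<close>

lemma rough_class_fourier_le:
  assumes K: "rough_class q N K" and \<xi>: "\<rho> / 2 \<le> norm \<xi>" "2 \<le> \<rho>" and N: "N \<ge> 0"
  shows "cmod (fourier K \<xi>) \<le> 2 * N * \<rho> powr (- 1 / 8)"
proof -
  have "cmod (fourier (\<lambda>y. K y * 1) \<xi>) \<le> 1 * N * norm \<xi> powr (- 1 / 8)"
    by (rule rough_classD(6)[OF K amp_1]) (use \<xi> in simp)
  also have "\<dots> \<le> N * (2 * \<rho> powr (- 1 / 8))"
  proof -
    have "norm \<xi> powr (- 1 / 8) \<le> (\<rho> / 2) powr (- 1 / 8)"
      using \<xi> by (intro powr_mono2') auto
    also have "\<dots> = 2 powr (1 / 8) * \<rho> powr (- 1 / 8)"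
      using \<xi> by (simp add: powr_divide powr_minus_divide)
    also have "\<dots> \<le> 2 powr 1 * \<rho> powr (- 1 / 8)"
      by (intro mult_right_mono powr_mono) auto
    finally show ?thesis using N by (simp add: mult_left_mono)
  qed
  finally show ?thesis by (simp add: mult_ac)
qed

definition T_op :: "(plane \<Rightarrow> complex) \<Rightarrow> (real \<Rightarrow> complex) \<Rightarrow> (real \<Rightarrow> complex) \<Rightarrow> real \<Rightarrow> complex" where
  "T_op K u v x = (LINT y|lborel. K y * (ift u (x - fst y) * ift v (x - snd y)))"

definition C_level :: "real \<Rightarrow> real" where
  "C_level q = 4 / (1 - (1/2) powr (1 - (q / (q - 1)) / 4))"

text \<open>The largest coefficient decays like \<open>\<rho> powr (- 1 / 8)\<close> and enters the
  sum over levels with the power \<open>1 - r / 4\<close>, where \<open>r = q / (q - 1)\<close> is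
  the dual exponent. For \<open>q > 1\<close> the product of the two exponents is positive exactly
  when \<open>4 / 3 < q\<close>.\<close>

definition rate :: "real \<Rightarrow> real" where "rate q = (1 - (q / (q - 1)) / 4) / 8"

lemma dual_exponent:
  assumes "4 / 3 < q" "q \<le> (2::real)"
  shows "2 \<le> q / (q - 1)" "q / (q - 1) < 4"
  using assms by (simp_all add: field_simps)

lemma one_minus_quarter_pos: "r < 4 \<Longrightarrow> 0 < 1 - r / (4::real)"
  by simp

lemma rate_pos:
  assumes "4 / 3 < q" "q \<le> (2::real)" shows "rate q > 0"
proof -
  have "0 < 1 - (q / (q - 1)) / 4" by (rule one_minus_quarter_pos[OF dual_exponent(2)[OF assms]])
  then show ?thesis unfolding rate_def by (rule divide_pos_pos) simp
qed

lemma C_level_pos: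
  assumes "4 / 3 < q" "q \<le> (2::real)" shows "C_level q > 0"
proof -
  have "0 < 1 - (q / (q - 1)) / 4" by (rule one_minus_quarter_pos[OF dual_exponent(2)[OF assms]])
  then have "(1/2 :: real) powr (1 - (q / (q - 1)) / 4) < (1/2) powr 0"
    by (rule powr_less_mono'[rotated 2]) auto
  then have "0 < 1 - (1/2 :: real) powr (1 - (q / (q - 1)) / 4)" by simp
  then show ?thesis unfolding C_level_def by (rule divide_pos_pos[rotated]) simp
qed

lemma floor_cell_norm:
  assumes "\<rho> \<le> \<bar>\<xi>\<bar>" "2 \<le> \<rho>" "\<lfloor>4 * \<xi>\<rfloor> = k" shows "\<rho> / 2 \<le> \<bar>of_int k / 4\<bar>"
  using frac_cell_bounds[of \<xi>] assms by (auto simp: abs_if split: if_splits)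

text \<open>The two sources of smallness meet here: Fourier decay bounds the top level
  \<open>B\<close>, and the weak-type count bounds the number of coefficients at each level. The
  powers of \<open>N\<close> from both recombine to a single factor \<open>N\<close>.\<close>

lemma lattice_bilinear_le:
  assumes q: "4 / 3 < q" "q \<le> 2" and K: "rough_class q N K" and N: "N > 0" and \<rho>: "2 \<le> \<rho>"
    and u: "L2fun u" and v: "L2fun v" and S: "finite S" and far: "\<And>p. p \<in> S \<Longrightarrow> \<rho> / 2 \<le> norm (lattice_point p)"
  shows "(\<integral>\<^sup>+x. ennreal (cmod (\<Sum>(k, l)\<in>S. fourier K (lattice_point (k, l)) * (ift (cell u k) x * ift (cell v l) x))) \<partial>lborel)
     \<le> ennreal (C_level q * 32 * N * \<rho> powr (- rate q) * (l2 u * l2 v))"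
proof -
  define r where "r = q / (q - 1)"
  have r: "2 \<le> r" "r < 4" using dual_exponent[OF q] by (simp_all add: r_def)
  define B where "B = 2 * N * \<rho> powr (- 1 / 8)"
  have B: "B > 0" using N \<rho> by (simp add: B_def)
  have "(\<integral>\<^sup>+x. ennreal (cmod (\<Sum>(k, l)\<in>S. fourier K (lattice_point (k, l)) * (ift (cell u k) x * ift (cell v l) x))) \<partial>lborel)
    \<le> ennreal (4 / (1 - (1/2) powr (1 - r / 4)) * (B powr (1 - r / 4) * (32 * N) powr (r / 4)) * (l2 u * l2 v))"
  proof (rule bilinear_sum_level_sets[where a="\<lambda>p. fourier K (lattice_point p)", OF u v S B])
    show "cmod (fourier K (lattice_point p)) \<le> B" if "p \<in> S" for p
      unfolding B_def using far[OF that] \<rho> N by (intro rough_class_fourier_le[OF K]) auto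
    fix h F assume h: "h > (0::real)" and F: "F \<subseteq> S" and Fh: "\<And>p. p \<in> F \<Longrightarrow> h \<le> cmod (fourier K (lattice_point p))"
    have "real (card F) \<le> 16 * (2 * N / h) powr (q / (q - 1))"
    proof (rule lattice_count_le[OF _ q(2)])
      show "K y = 0" if "y \<notin> square" for y
        using rough_classD(2)[OF K, of y] that ann_subset_square by auto
      show "finite F" using F S by (rule finite_subset)
    qed (use q rough_classD[OF K] N h Fh in auto)
    \<comment> \<open>The factor 16 is absorbed into the base, using \<open>r \<ge> 1\<close>, to
      match the shape of the counting hypothesis.\<close>
    also have "\<dots> \<le> 16 powr r * (2 * N / h) powr r"
      unfolding r_def[symmetric] using powr_mono[of 1 r 16] r by (intro mult_right_mono) auto
    also have "\<dots> = (32 * N / h) powr r"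
      using N h by (simp add: powr_mult[symmetric])
    finally show "real (card F) \<le> (32 * N / h) powr r" .
  qed (use N r in auto)
  also have "4 / (1 - (1/2) powr (1 - r / 4)) = C_level q" by (simp add: C_level_def r_def)
  also have "B powr (1 - r / 4) * (32 * N) powr (r / 4) \<le> 32 * N * \<rho> powr (- rate q)"
  proof -
    have "B powr (1 - r / 4) = (2 * N) powr (1 - r / 4) * \<rho> powr (- rate q)"
      using N \<rho> by (simp add: B_def powr_mult powr_powr rate_def r_def)
    also have "(2 * N) powr (1 - r / 4) \<le> (32 * N) powr (1 - r / 4)"
      using N r by (intro powr_mono2) auto
    finally have "B powr (1 - r / 4) * (32 * N) powr (r / 4) \<le> (32 * N) powr (1 - r / 4) * \<rho> powr (- rate q) * (32 * N) powr (r / 4)"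
      by (simp add: mult_right_mono)
    also have "\<dots> = ((32 * N) powr (1 - r / 4) * (32 * N) powr (r / 4)) * \<rho> powr (- rate q)"
      by (simp only: mult_ac)
    also have "(32 * N) powr (1 - r / 4) * (32 * N) powr (r / 4) = 32 * N"
      using N by (simp add: powr_add[symmetric])
    finally show ?thesis .
  qed
  finally show ?thesis
    using C_level_pos[OF q] by (simp add: mult.assoc mult_left_mono mult_right_mono ennreal_leI)
qed

lemma summable_exp_series: "summable (\<lambda>n. (a::real) ^ n / fact n)"
  using summable_exp[of a] by (simp add: divide_inverse mult.commute)

text \<open>Both inputs are expanded in their cells. The term of order \<open>(n, m)\<close> is a
  lattice sum for the kernel \<open>K\<close> times a monomial, which is again of rough class with a
  constant growing like \<open>4 ^ n * 4 ^ m\<close>, and the factorials sum to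
  \<open>(exp (8 * pi))\<^sup>2\<close>. The bound \<open>X\<close> makes the sums over cells finite
  and does not enter the constant.\<close>

lemma T_op_le:
  assumes q: "4 / 3 < q" "q \<le> 2" and K: "rough_class q N K" and N: "N > 0" and \<rho>: "2 \<le> \<rho>"
    and u: "L2fun u" and v: "L2fun v"
    and X: "\<And>\<xi>. u \<xi> \<noteq> 0 \<Longrightarrow> \<bar>\<xi>\<bar> \<le> X" "\<And>\<xi>. v \<xi> \<noteq> 0 \<Longrightarrow> \<bar>\<xi>\<bar> \<le> X"
    and far: "(\<forall>\<xi>. u \<xi> \<noteq> 0 \<longrightarrow> \<rho> \<le> \<bar>\<xi>\<bar>) \<or> (\<forall>\<xi>. v \<xi> \<noteq> 0 \<longrightarrow> \<rho> \<le> \<bar>\<xi>\<bar>)"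
  shows "(\<integral>\<^sup>+x. ennreal (cmod (T_op K u v x)) \<partial>lborel)
     \<le> ennreal (C_level q * 128 * (exp (8 * pi))\<^sup>2 * N * \<rho> powr (- rate q) * (l2 u * l2 v))"
proof -
  have um [measurable]: "u \<in> borel_measurable borel" "v \<in> borel_measurable borel"
    using u v by (auto intro: L2fun_measurable)
  note Km [measurable] = rough_classD(1)[OF K]
  define Su where "Su = (\<lambda>\<xi>. \<lfloor>4 * \<xi>\<rfloor>) ` {\<xi>. u \<xi> \<noteq> 0}"
  define Sv where "Sv = (\<lambda>\<xi>. \<lfloor>4 * \<xi>\<rfloor>) ` {\<xi>. v \<xi> \<noteq> 0}"
  have fin: "finite ((\<lambda>\<xi>. \<lfloor>4 * \<xi>\<rfloor>) ` {\<xi>. w \<xi> \<noteq> 0})" if "\<And>\<xi>. w \<xi> \<noteq> 0 \<Longrightarrow> \<bar>\<xi>\<bar> \<le> X" for w :: "real \<Rightarrow> complex"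
  proof (rule finite_subset)
    show "(\<lambda>\<xi>. \<lfloor>4 * \<xi>\<rfloor>) ` {\<xi>. w \<xi> \<noteq> 0} \<subseteq> {\<lfloor>- 4 * X\<rfloor>..\<lfloor>4 * X\<rfloor>}"
      using that by (auto intro!: floor_mono simp: abs_le_iff) (smt (verit) that abs_le_iff)
  qed simp
  have fSu: "finite Su" and fSv: "finite Sv" unfolding Su_def Sv_def by (intro fin X; simp)+
  have Su: "\<lfloor>4 * \<xi>\<rfloor> \<in> Su" if "u \<xi> \<noteq> 0" for \<xi> using that by (auto simp: Su_def)
  have Sv: "\<lfloor>4 * \<xi>\<rfloor> \<in> Sv" if "v \<xi> \<noteq> 0" for \<xi> using that by (auto simp: Sv_def)
  have latfar: "\<rho> / 2 \<le> norm (lattice_point p)" if "p \<in> Su \<times> Sv" for p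
  proof -
    have "\<rho> / 2 \<le> \<bar>fst (lattice_point p)\<bar> \<or> \<rho> / 2 \<le> \<bar>snd (lattice_point p)\<bar>"
      using far that floor_cell_norm[OF _ \<rho>] by (auto simp: Su_def Sv_def lattice_point_def)
    then show ?thesis using abs_fst_le_norm[of "lattice_point p"] abs_snd_le_norm[of "lattice_point p"] by linarith
  qed
  define tu where "tu x n s = taylor_c n * of_real s ^ n * (\<Sum>k\<in>Su. ee (- (s * of_int k / 4)) * ift (cell (taylor_u u n) k) x)" for x n s
  define tv where "tv x n s = taylor_c n * of_real s ^ n * (\<Sum>k\<in>Sv. ee (- (s * of_int k / 4)) * ift (cell (taylor_u v n) k) x)" for x n s
  have [measurable]: "tu x n \<in> borel_measurable borel" "tv x n \<in> borel_measurable borel" for x n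
    unfolding tu_def tv_def by measurable
  have su: "(\<lambda>n. tu x n s) sums ift u (x - s)" and sv: "(\<lambda>n. tv x n s) sums ift v (x - s)" for x s
    unfolding tu_def tv_def by (intro ift_taylor_sums u v fSu fSv Su Sv; simp)+
  define U where "U = (LINT \<xi>|lborel. cmod (u \<xi>))"
  define V where "V = (LINT \<xi>|lborel. cmod (v \<xi>))"
  have UV: "U \<ge> 0" "V \<ge> 0" by (simp_all add: U_def V_def)
  have tb: "(2 * pi * \<bar>s\<bar>) ^ n / fact n \<le> (4 * pi) ^ n / fact n" if "\<bar>s\<bar> \<le> 2" for s n
    using that by (intro divide_right_mono power_mono) auto
  have tub: "cmod (tu x n s) \<le> (4 * pi) ^ n / fact n * U" if "\<bar>s\<bar> \<le> 2" for x n s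
    unfolding tu_def U_def
    by (rule order_trans[OF ift_taylor_sums(2)[OF u fSu Su] mult_right_mono[OF tb[OF that]]]) (use UV in \<open>simp_all add: U_def\<close>)
  have tvb: "cmod (tv x n s) \<le> (4 * pi) ^ n / fact n * V" if "\<bar>s\<bar> \<le> 2" for x n s
    unfolding tv_def V_def
    by (rule order_trans[OF ift_taylor_sums(2)[OF v fSv Sv] mult_right_mono[OF tb[OF that]]]) (use UV in \<open>simp_all add: V_def\<close>)
  have vb: "cmod (ift v x) \<le> V" for x
    unfolding V_def using v by (intro norm_ift_le) (simp add: L2fun_def)
  have Ki: "integrable lborel (\<lambda>y. cmod (K y))" using rough_classD(3)[OF K] by simp
  have K0: "K y = 0" if "\<not> \<bar>fst y\<bar> \<le> 2 \<or> \<not> \<bar>snd y\<bar> \<le> 2" for y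
    using that ann_coord[of y] rough_classD(2)[OF K, of y] by blast
  have bnd: "cmod (K y * (a * b)) \<le> A * (B * cmod (K y))"
    if "\<bar>fst y\<bar> \<le> 2 \<Longrightarrow> cmod a \<le> A" "\<bar>snd y\<bar> \<le> 2 \<Longrightarrow> cmod b \<le> B" for y a b A B
  proof (cases "\<bar>fst y\<bar> \<le> 2 \<and> \<bar>snd y\<bar> \<le> 2")
    case True
    then have "cmod a \<le> A" "cmod b \<le> B" using that by auto
    then have "cmod a * cmod b \<le> A * B" by (intro mult_mono order_trans[OF norm_ge_zero \<open>cmod a \<le> A\<close>]) auto
    then have "cmod (K y) * (cmod a * cmod b) \<le> cmod (K y) * (A * B)" by (rule mult_left_mono) simp
    then show ?thesis by (simp add: norm_mult mult_ac)
  next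
    case False
    then show ?thesis using K0[of y] by auto
  qed
  have intb: "integrable lborel (\<lambda>y. K y * (a y * b y))"
    if [measurable]: "a \<in> borel_measurable borel" "b \<in> borel_measurable borel" and "\<And>y. \<bar>fst y\<bar> \<le> 2 \<Longrightarrow> cmod (a y) \<le> A" "\<And>y. \<bar>snd y\<bar> \<le> 2 \<Longrightarrow> cmod (b y) \<le> B"
    for a b A B
  proof (rule Bochner_Integration.integrable_bound)
    show "integrable lborel (\<lambda>y. A * (B * cmod (K y)))" using Ki by simp
    show "AE y in lborel. norm (K y * (a y * b y)) \<le> norm (A * (B * cmod (K y)))"
    proof (intro AE_I2)
      fix y
      have "cmod (K y * (a y * b y)) \<le> A * (B * cmod (K y))"
        by (rule bnd) (rule that, assumption)+
      also have "\<dots> \<le> norm (A * (B * cmod (K y)))" by simp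
      finally show "norm (K y * (a y * b y)) \<le> norm (A * (B * cmod (K y)))" .
    qed
  qed measurable
  define a where "a n m = fourier (\<lambda>y. K y * (of_real (fst y) ^ n * of_real (snd y) ^ m))" for n m
  define G where "G n m x = (\<Sum>(k, l)\<in>Su \<times> Sv. a n m (lattice_point (k, l)) * (ift (cell (taylor_u u n) k) x * ift (cell (taylor_u v m) l) x))" for n m x
  have [measurable]: "G n m \<in> borel_measurable borel" for n m
    unfolding G_def case_prod_beta' by measurable
  have inner: "(LINT y|lborel. K y * (tu x n (fst y) * tv x m (snd y))) = taylor_c n * taylor_c m * G n m x" for x n m
  proof -
    have Kmi: "integrable lborel (\<lambda>y. K y * (of_real (fst y) ^ n * of_real (snd y) ^ m))"
      by (rule rough_classD(3)[OF rough_class_monomial[OF K]]) (use q N in auto)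
    have "K y * (tu x n (fst y) * tv x m (snd y))
        = (\<Sum>(k, l)\<in>Su \<times> Sv. (taylor_c n * taylor_c m * (ift (cell (taylor_u u n) k) x * ift (cell (taylor_u v m) l) x))
            * (K y * (of_real (fst y) ^ n * of_real (snd y) ^ m) * ee (- (y \<bullet> lattice_point (k, l)))))" for y
    proof -
      have e: "ee (- (y \<bullet> lattice_point (k, l))) = ee (- (fst y * of_int k / 4)) * ee (- (snd y * of_int l / 4))" for k l
        by (simp add: lattice_point_def inner_prod_def ee_add[symmetric])
      show ?thesis
        unfolding tu_def tv_def e sum.cartesian_product[symmetric]
        by (simp add: sum_product sum_distrib_left mult_ac)
    qed
    then have "(LINT y|lborel. K y * (tu x n (fst y) * tv x m (snd y)))
       = (\<Sum>(k, l)\<in>Su \<times> Sv. LINT y|lborel. (taylor_c n * taylor_c m * (ift (cell (taylor_u u n) k) x * ift (cell (taylor_u v m) l) x))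
            * (K y * (of_real (fst y) ^ n * of_real (snd y) ^ m) * ee (- (y \<bullet> lattice_point (k, l)))))"
      unfolding case_prod_beta'
      by (simp only:, subst Bochner_Integration.integral_sum)
         (intro integrable_mult_right integrable_mult_ee Kmi, simp, rule refl)
    also have "\<dots> = taylor_c n * taylor_c m * G n m x"
      unfolding integral_mult_right_zero G_def a_def fourier_ee sum_distrib_left case_prod_beta'
      by (simp add: mult_ac)
    finally show ?thesis .
  qed
  have expand: "ennreal (cmod (T_op K u v x)) \<le> (\<Sum>n. \<Sum>m. ennreal (cmod (taylor_c n * taylor_c m * G n m x)))" for x
  proof -
    have "ennreal (cmod (T_op K u v x)) \<le> (\<Sum>n. ennreal (cmod (LINT y|lborel. K y * (tu x n (fst y) * ift v (x - snd y)))))"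
      unfolding T_op_def
    proof (rule norm_integral_le_suminf[where w="\<lambda>y. U * (V * cmod (K y))" and b="\<lambda>n. (4 * pi) ^ n / fact n"])
      show "integrable lborel (\<lambda>y. K y * (tu x n (fst y) * ift v (x - snd y)))" for n
        by (rule intb[OF _ _ tub vb]) auto
      show "(\<lambda>n. K y * (tu x n (fst y) * ift v (x - snd y))) sums (K y * (ift u (x - fst y) * ift v (x - snd y)))" for y
        by (intro sums_mult sums_mult2 su)
      show "cmod (K y * (tu x n (fst y) * ift v (x - snd y))) \<le> (4 * pi) ^ n / fact n * (U * (V * cmod (K y)))" for n y
        using bnd[of y "tu x n (fst y)" "(4 * pi) ^ n / fact n * U" "ift v (x - snd y)" V, OF tub vb] by (simp add: mult_ac)
    qed (use Ki UV summable_exp_series[of "4 * pi"] in auto)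
    also have "\<dots> \<le> (\<Sum>n. \<Sum>m. ennreal (cmod (LINT y|lborel. K y * (tu x n (fst y) * tv x m (snd y)))))"
    proof (intro suminf_le)
      fix n
      show "ennreal (cmod (LINT y|lborel. K y * (tu x n (fst y) * ift v (x - snd y)))) \<le> (\<Sum>m. ennreal (cmod (LINT y|lborel. K y * (tu x n (fst y) * tv x m (snd y)))))"
      proof (rule norm_integral_le_suminf[where w="\<lambda>y. ((4 * pi) ^ n / fact n * U) * (V * cmod (K y))" and b="\<lambda>m. (4 * pi) ^ m / fact m"])
        show "integrable lborel (\<lambda>y. K y * (tu x n (fst y) * tv x m (snd y)))" for m
          by (rule intb[OF _ _ tub tvb]) auto
        show "(\<lambda>m. K y * (tu x n (fst y) * tv x m (snd y))) sums (K y * (tu x n (fst y) * ift v (x - snd y)))" for y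
          by (intro sums_mult sv)
        show "cmod (K y * (tu x n (fst y) * tv x m (snd y))) \<le> (4 * pi) ^ m / fact m * (((4 * pi) ^ n / fact n * U) * (V * cmod (K y)))" for m y
          using bnd[of y "tu x n (fst y)" "(4 * pi) ^ n / fact n * U" "tv x m (snd y)" "(4 * pi) ^ m / fact m * V", OF tub tvb] by (simp add: mult_ac)
      qed (use Ki UV summable_exp_series[of "4 * pi"] in auto)
    qed auto
    finally show ?thesis unfolding inner .
  qed
  define D where "D = C_level q * 32 * (4 * N) * \<rho> powr (- rate q) * (l2 u * l2 v)"
  have D: "D \<ge> 0" using C_level_pos[OF q] N by (simp add: D_def)
  \<comment> \<open>\<open>8 * pi\<close> collects \<open>2 * pi\<close> from the Taylor coefficient
    and 4 from the amplitude constant of the monomial.\<close>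
  have Gb: "(\<integral>\<^sup>+x. ennreal (cmod (taylor_c n * taylor_c m * G n m x)) \<partial>lborel) \<le> ennreal ((8 * pi) ^ n / fact n * ((8 * pi) ^ m / fact m) * D)" for n m
  proof -
    have "(\<integral>\<^sup>+x. ennreal (cmod (G n m x)) \<partial>lborel)
      \<le> ennreal (C_level q * 32 * (4 * 4 ^ n * 4 ^ m * N) * \<rho> powr (- rate q) * (l2 (taylor_u u n) * l2 (taylor_u v m)))"
      unfolding G_def a_def
      by (rule lattice_bilinear_le[OF q rough_class_monomial[OF K] _ \<rho>])
         (use q N u v fSu fSv latfar L2fun_taylor_u in auto)
    also have "\<dots> \<le> ennreal (4 ^ n * 4 ^ m * D)"
    proof -
      have "l2 (taylor_u u n) * l2 (taylor_u v m) \<le> l2 u * l2 v"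
        by (intro mult_mono l2_taylor_u u v) auto
      then have "C_level q * 32 * (4 * 4 ^ n * 4 ^ m * N) * \<rho> powr (- rate q) * (l2 (taylor_u u n) * l2 (taylor_u v m))
         \<le> C_level q * 32 * (4 * 4 ^ n * 4 ^ m * N) * \<rho> powr (- rate q) * (l2 u * l2 v)"
        using C_level_pos[OF q] N by (intro mult_left_mono) auto
      then show ?thesis by (simp add: D_def mult_ac ennreal_leI)
    qed
    finally have *: "(\<integral>\<^sup>+x. ennreal (cmod (G n m x)) \<partial>lborel) \<le> ennreal (4 ^ n * 4 ^ m * D)" .
    have "(\<integral>\<^sup>+x. ennreal (cmod (taylor_c n * taylor_c m * G n m x)) \<partial>lborel) = ennreal (cmod (taylor_c n * taylor_c m)) * (\<integral>\<^sup>+x. ennreal (cmod (G n m x)) \<partial>lborel)"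
      by (simp only: norm_mult[of "taylor_c n * taylor_c m"] ennreal_mult'[OF norm_ge_zero], subst nn_integral_cmult) auto
    also have "\<dots> \<le> ennreal (cmod (taylor_c n * taylor_c m)) * ennreal (4 ^ n * 4 ^ m * D)"
      by (intro mult_left_mono *) simp
    also have "\<dots> = ennreal ((8 * pi) ^ n / fact n * ((8 * pi) ^ m / fact m) * D)"
    proof -
      have p: "(8 * pi) ^ j / fact j = (2 * pi) ^ j / fact j * 4 ^ j" for j
      proof -
        have "8 * pi = (2 * pi) * 4" by simp
        then have "(8 * pi) ^ j = (2 * pi) ^ j * 4 ^ j" by (simp only: power_mult_distrib)
        then show ?thesis by (simp only: times_divide_eq_left)
      qed
      have "ennreal (cmod (taylor_c n * taylor_c m)) * ennreal (4 ^ n * 4 ^ m * D) = ennreal (cmod (taylor_c n * taylor_c m) * (4 ^ n * 4 ^ m * D))"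
        by (rule ennreal_mult'[symmetric]) simp
      also have "cmod (taylor_c n * taylor_c m) * (4 ^ n * 4 ^ m * D) = (8 * pi) ^ n / fact n * ((8 * pi) ^ m / fact m) * D"
        unfolding norm_mult norm_taylor_c p by (simp only: mult_ac)
      finally show ?thesis .
    qed
    finally show ?thesis .
  qed
  have es: "(\<lambda>n. (8 * pi) ^ n / fact n) sums exp (8 * pi)"
    using exp_converges[of "8 * pi"] by (simp add: divide_inverse mult.commute)
  have "(\<integral>\<^sup>+x. ennreal (cmod (T_op K u v x)) \<partial>lborel) \<le> (\<integral>\<^sup>+x. (\<Sum>n. \<Sum>m. ennreal (cmod (taylor_c n * taylor_c m * G n m x))) \<partial>lborel)"
    by (intro nn_integral_mono expand)
  also have "\<dots> = (\<Sum>n. \<Sum>m. \<integral>\<^sup>+x. ennreal (cmod (taylor_c n * taylor_c m * G n m x)) \<partial>lborel)"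
    by (subst nn_integral_suminf, measurable, intro suminf_cong nn_integral_suminf) measurable
  also have "\<dots> \<le> (\<Sum>n. \<Sum>m. ennreal ((8 * pi) ^ n / fact n * ((8 * pi) ^ m / fact m) * D))"
    by (intro suminf_le Gb) auto
  also have "\<dots> = (\<Sum>n. ennreal ((8 * pi) ^ n / fact n * exp (8 * pi) * D))"
    by (intro suminf_cong suminf_ennreal_eq sums_mult sums_mult2 es) (use D in auto)
  also have "\<dots> = ennreal (exp (8 * pi) * exp (8 * pi) * D)"
    by (intro suminf_ennreal_eq sums_mult2 es) (use D in auto)
  finally show ?thesis by (simp add: D_def power2_eq_square mult_ac)
qed

section \<open>Fourier decay of homogeneous kernels\<close>

lemma integrable_indicator_Ioc [simp]: "integrable lborel (indicator {a<..b::real} :: real \<Rightarrow> real)"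
  by (rule integrable_real_indicator, simp, rule emeasure_bounded_finite, rule bounded_subset[of "{a..b}"]) auto

lemma measure_Ioc_le: "measure lborel {a<..b::real} \<le> max 0 (b - a)"
  by (cases "a \<le> b") auto

text \<open>Shifting by half a period turns the oscillation of \<open>ee\<close> into a difference of values of \<open>g\<close>.\<close>
lemma oscillatory_integral_le:
  fixes g :: "real \<Rightarrow> complex"
  assumes [measurable]: "g \<in> borel_measurable borel" and len: "b - a \<le> 1"
    and bd: "\<And>r. a < r \<Longrightarrow> r \<le> b \<Longrightarrow> cmod (g r) \<le> M"
    and lip: "\<And>r r'. a < r \<Longrightarrow> r \<le> b \<Longrightarrow> a < r' \<Longrightarrow> r' \<le> b \<Longrightarrow> cmod (g r - g r') \<le> M * \<bar>r - r'\<bar>"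
    and M: "M \<ge> 0" and s: "s \<noteq> 0"
  shows "cmod (LINT r|lborel. indicator {a<..b} r *\<^sub>R (g r * ee (- (r * s)))) \<le> 2 * M / \<bar>s\<bar>"
proof -
  define h where "h = 1 / (2 * \<bar>s\<bar>)"
  have h: "h > 0" using s by (simp add: h_def)
  have Mh: "M * h \<ge> 0" using M h by simp
  have eh: "ee (- ((r + h) * s)) = - ee (- (r * s))" for r
  proof -
    have "h * s = 1 / 2 \<or> h * s = - (1 / 2)" using s by (auto simp: h_def abs_if)
    then have "ee (- (h * s)) = - 1"
    proof
      assume *: "h * s = 1 / 2"
      show ?thesis unfolding * by (simp add: ee_def complex_eq_iff)
    next
      assume *: "h * s = - (1 / 2)"
      show ?thesis unfolding * by (simp add: ee_def complex_eq_iff)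
    qed
    moreover have "ee (- ((r + h) * s)) = ee (- (r * s)) * ee (- (h * s))"
      by (simp add: ee_add[symmetric] algebra_simps)
    ultimately show ?thesis by simp
  qed
  define f where "f r = indicator {a<..b} r *\<^sub>R (g r * ee (- (r * s)))" for r
  have [measurable]: "f \<in> borel_measurable borel" unfolding f_def by measurable
  have fb: "cmod (f r) \<le> indicator {a<..b} r * M" for r
    using bd[of r] by (auto simp: f_def indicator_def norm_mult)
  have fi: "integrable lborel f"
    by (rule Bochner_Integration.integrable_bound[of _ "\<lambda>r. indicator {a<..b} r * M"])
       (use fb order_trans[OF fb abs_ge_self] in auto)
  have fih: "integrable lborel (\<lambda>r. f (h + 1 * r))"
    by (rule lborel_integrable_real_affine[OF fi]) simp
  have "(LINT r|lborel. f r) = (LINT r|lborel. f (h + 1 * r))"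
    using lborel_integral_real_affine[of 1 f h] by simp
  then have eq: "2 * (LINT r|lborel. f r) = (LINT r|lborel. f r + f (h + 1 * r))"
    using fi fih by simp
  have bound: "cmod (2 * (LINT r|lborel. f r)) \<le> (LINT r|lborel. indicator {a<..b} r * (M * h) + (indicator {b - h<..b} r * M + indicator {a - h<..a} r * M))"
    unfolding eq
  proof (rule Bochner_Integration.integral_norm_bound_integral)
    show "integrable lborel (\<lambda>r. f r + f (h + 1 * r))" using fi fih by simp
    show "integrable lborel (\<lambda>r. indicator {a<..b} r * (M * h) + (indicator {b - h<..b} r * M + indicator {a - h<..a} r * M))"
      by (intro Bochner_Integration.integrable_add) auto
    fix r
    have e2: "f (h + 1 * r) = - (indicator {a<..b} (r + h) *\<^sub>R (g (r + h) * ee (- (r * s))))"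
    proof -
      have *: "h + 1 * r = r + h" by simp
      show ?thesis unfolding f_def * eh by simp
    qed
    \<comment> \<open>When \<open>r\<close> and \<open>r + h\<close> both lie in the interval, the
      sign change of \<open>ee\<close> leaves a difference of values of \<open>g\<close>. When just
      one does, \<open>r\<close> lies in one of two end pieces of length \<open>h\<close>, where the
      size of \<open>g\<close> suffices.\<close>
    consider "a < r \<and> r + h \<le> b" | "a < r \<and> r \<le> b \<and> b < r + h" | "r \<le> a \<and> a < r + h \<and> r + h \<le> b" | "(r \<le> a \<or> b < r) \<and> (r + h \<le> a \<or> b < r + h)"
      by linarith
    then show "cmod (f r + f (h + 1 * r)) \<le> indicator {a<..b} r * (M * h) + (indicator {b - h<..b} r * M + indicator {a - h<..a} r * M)"
    proof cases
      case 1
      then have "f r + f (h + 1 * r) = (g r - g (r + h)) * ee (- (r * s))"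
        unfolding e2 unfolding f_def using h by (simp add: algebra_simps)
      then have "cmod (f r + f (h + 1 * r)) \<le> M * h"
        using lip[of r "r + h"] 1 h by (simp add: norm_mult)
      then show ?thesis using 1 h M Mh by (auto simp: indicator_def)
    next
      case 2
      then have "f r + f (h + 1 * r) = f r" unfolding e2 using h by simp
      moreover have "cmod (f r) \<le> M * h + M" using fb[of r] 2 Mh by (intro add_increasing[OF Mh]) simp
      ultimately show ?thesis using 2 h M by (auto simp: indicator_def)
    next
      case 3
      then have "f r + f (h + 1 * r) = f (h + 1 * r)" using h by (simp add: f_def)
      moreover have "cmod (f (h + 1 * r)) \<le> M" using fb[of "h + 1 * r"] 3 by (simp add: add.commute)
      ultimately show ?thesis using 3 h M by (auto simp: indicator_def)
    next
      case 4
      then have "f r + f (h + 1 * r) = 0" using h by (auto simp: f_def add.commute)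
      then show ?thesis using h M Mh by (auto simp: indicator_def)
    qed
  qed
  have "(LINT r|lborel. indicator {a<..b} r * (M * h) + (indicator {b - h<..b} r * M + indicator {a - h<..a} r * M)) \<le> M * h + (M * h + M * h)"
  proof -
    have "(LINT r|lborel. indicator {a<..b} r * (M * h) + (indicator {b - h<..b} r * M + indicator {a - h<..a} r * M))
      = measure lborel {a<..b} * (M * h) + (measure lborel {b - h<..b} * M + measure lborel {a - h<..a} * M)"
    proof -
      have i: "integrable lborel (\<lambda>r. indicator {c<..d} r * k)" and v: "(LINT r|lborel. indicator {c<..d} r * k) = measure lborel {c<..d} * k" for c d k :: real
        by simp_all
      show ?thesis
        by (simp only: Bochner_Integration.integral_add[OF i Bochner_Integration.integrable_add[OF i i]] Bochner_Integration.integral_add[OF i i] v)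
    qed
    also have "\<dots> \<le> 1 * (M * h) + (h * M + h * M)"
      using h M len by (intro add_mono mult_right_mono order_trans[OF measure_Ioc_le]) auto
    finally show ?thesis by (simp add: mult.commute)
  qed
  from order_trans[OF bound this] have "2 * cmod (LINT r|lborel. f r) \<le> 3 * M * h" by (simp add: norm_mult)
  also have "\<dots> \<le> 4 * M / \<bar>s\<bar>" using M s by (simp add: h_def field_simps)
  finally show ?thesis by (simp add: f_def)
qed

lemma oscillatory_integral_le':
  fixes g :: "real \<Rightarrow> complex"
  assumes [measurable]: "g \<in> borel_measurable borel" and len: "b - a \<le> 1"
    and bd: "\<And>r. a < r \<Longrightarrow> r \<le> b \<Longrightarrow> cmod (g r) \<le> M"
    and M: "M \<ge> 0"
  shows "cmod (LINT r|lborel. indicator {a<..b} r *\<^sub>R (g r * ee (- (r * s)))) \<le> M"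
proof -
  have "cmod (LINT r|lborel. indicator {a<..b} r *\<^sub>R (g r * ee (- (r * s)))) \<le> (LINT r|lborel. indicator {a<..b} r * M)"
  proof (rule Bochner_Integration.integral_norm_bound_integral)
    show "integrable lborel (\<lambda>r. indicator {a<..b} r *\<^sub>R (g r * ee (- (r * s))))"
    proof (rule Bochner_Integration.integrable_bound[of _ "\<lambda>r. indicator {a<..b} r * M"])
      show "AE r in lborel. norm (indicator {a<..b} r *\<^sub>R (g r * ee (- (r * s)))) \<le> norm (indicator {a<..b} r * M)"
        using bd M by (auto simp: indicator_def norm_mult)
    qed simp_all
    show "integrable lborel (\<lambda>r. indicator {a<..b} r * M)" by simp
    show "cmod (indicator {a<..b} r *\<^sub>R (g r * ee (- (r * s)))) \<le> indicator {a<..b} r * M" for r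
      using bd by (auto simp: indicator_def norm_mult)
  qed
  also have "\<dots> = measure lborel {a<..b} * M" by simp
  also have "\<dots> \<le> 1 * M" using len M by (intro mult_right_mono order_trans[OF measure_Ioc_le]) auto
  finally show ?thesis by simp
qed

text \<open>The range of \<open>y\<close> for which some \<open>r *\<^sub>R y\<close> with
  \<open>1 < r \<le> 2\<close> lies in \<open>ann\<close>.\<close>

definition half_ann :: "plane set" where "half_ann = {y. 1/2 < norm y \<and> norm y \<le> 2}"

lemma half_ann_measurable [measurable]: "half_ann \<in> sets borel"
  unfolding half_ann_def by measurable

text \<open>Along a ray the phase is linear in \<open>r\<close> with frequency
  \<open>y \<bullet> \<xi>\<close>, and the amplitude, including the Jacobian
  \<open>r\<^sup>2\<close>, is Lipschitz on an interval of length at most one. The oscillatory bound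
  is used for large \<open>y \<bullet> \<xi>\<close>, the trivial one otherwise.\<close>

lemma radial_integral_le:
  assumes A: "amp M A"
  shows "cmod (LINT r|lborel. indicator {1<..2} r *\<^sub>R (of_real (r\<^sup>2) * (indicator ann (r *\<^sub>R y) * (A (r *\<^sub>R y) * ee (- ((r *\<^sub>R y) \<bullet> \<xi>))))))
    \<le> indicator half_ann y * (24 * M / max 1 \<bar>y \<bullet> \<xi>\<bar>)"
proof (cases "y \<in> half_ann")
  case False
  have "indicator {1<..2} r *\<^sub>R (of_real (r\<^sup>2) * (indicator ann (r *\<^sub>R y) * (A (r *\<^sub>R y) * ee (- ((r *\<^sub>R y) \<bullet> \<xi>))))) = 0" for r
  proof (cases "1 < r \<and> r \<le> 2 \<and> r *\<^sub>R y \<in> ann")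
    case True
    then have "1 < r * norm y" "r * norm y \<le> 2" "1 < r" "r \<le> 2" by (auto simp: ann_def)
    moreover have "r * norm y \<le> 2 * norm y" using True by (intro mult_right_mono) auto
    moreover have "1 * norm y \<le> r * norm y" using True by (intro mult_right_mono) auto
    ultimately have "y \<in> half_ann" by (auto simp: half_ann_def)
    with False show ?thesis by simp
  qed (auto simp: indicator_def)
  then show ?thesis by (simp only:) (use False in simp)
next
  case True
  note [measurable] = ampD(1)[OF A]
  note M = amp_nonneg[OF A]
  have y: "1/2 < norm y" "norm y \<le> 2" using True by (auto simp: half_ann_def)
  define a where "a = max 1 (1 / norm y)"
  define b where "b = min 2 (2 / norm y)"
  define g where "g r = of_real (r\<^sup>2) * A (r *\<^sub>R y)" for r
  have [measurable]: "g \<in> borel_measurable borel" unfolding g_def by measurable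
  have ab: "a < r \<and> r \<le> b \<longleftrightarrow> 1 < r \<and> r \<le> 2 \<and> r *\<^sub>R y \<in> ann" for r
  proof (cases "1 < r")
    case True
    have "0 < norm y" using y by linarith
    then have "1 / norm y < r \<longleftrightarrow> 1 < r * norm y" "r \<le> 2 / norm y \<longleftrightarrow> r * norm y \<le> 2"
      by (rule pos_divide_less_eq, rule pos_le_divide_eq)
    then show ?thesis using True by (auto simp: a_def b_def ann_def)
  qed (simp add: a_def)
  have len: "b - a \<le> 1" by (simp add: a_def b_def)
  have gb: "cmod (g r) \<le> 4 * M" if "a < r" "r \<le> b" for r
  proof -
    have r: "1 < r" "r \<le> 2" "r *\<^sub>R y \<in> ann" using ab that by auto
    have "r\<^sup>2 * cmod (A (r *\<^sub>R y)) \<le> 2\<^sup>2 * M"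
      using r by (intro mult_mono power_mono ampD(2)[OF A]) auto
    then show ?thesis by (simp add: g_def norm_mult norm_power)
  qed
  have gl: "cmod (g r - g r') \<le> 12 * M * \<bar>r - r'\<bar>" if "a < r" "r \<le> b" "a < r'" "r' \<le> b" for r r'
  proof -
    have r: "1 < r" "r \<le> 2" "r *\<^sub>R y \<in> ann" "1 < r'" "r' \<le> 2" "r' *\<^sub>R y \<in> ann" using ab that by auto
    have "g r - g r' = of_real ((r + r') * (r - r')) * A (r *\<^sub>R y) + of_real (r'\<^sup>2) * (A (r *\<^sub>R y) - A (r' *\<^sub>R y))"
      by (simp add: g_def algebra_simps power2_eq_square)
    then have "cmod (g r - g r') \<le> cmod (of_real ((r + r') * (r - r')) * A (r *\<^sub>R y)) + cmod (of_real (r'\<^sup>2) * (A (r *\<^sub>R y) - A (r' *\<^sub>R y)))"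
      by (simp only: norm_triangle_ineq)
    also have "\<dots> = (r + r') * \<bar>r - r'\<bar> * cmod (A (r *\<^sub>R y)) + r'\<^sup>2 * cmod (A (r *\<^sub>R y) - A (r' *\<^sub>R y))"
      unfolding norm_mult norm_of_real using r by (simp add: abs_mult)
    also have "\<dots> \<le> 4 * \<bar>r - r'\<bar> * M + 2\<^sup>2 * (M * norm (r *\<^sub>R y - r' *\<^sub>R y))"
      using r M by (intro add_mono mult_mono power_mono ampD(2)[OF A] ampD(3)[OF A]) auto
    also have "norm (r *\<^sub>R y - r' *\<^sub>R y) = \<bar>r - r'\<bar> * norm y"
      by (simp flip: scaleR_diff_left)
    also have "4 * \<bar>r - r'\<bar> * M + 2\<^sup>2 * (M * (\<bar>r - r'\<bar> * norm y)) \<le> 4 * \<bar>r - r'\<bar> * M + 2\<^sup>2 * (M * (\<bar>r - r'\<bar> * 2))"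
      using y M by (intro add_left_mono mult_left_mono) auto
    finally show ?thesis by simp
  qed
  have eq: "(LINT r|lborel. indicator {1<..2} r *\<^sub>R (of_real (r\<^sup>2) * (indicator ann (r *\<^sub>R y) * (A (r *\<^sub>R y) * ee (- ((r *\<^sub>R y) \<bullet> \<xi>))))))
    = (LINT r|lborel. indicator {a<..b} r *\<^sub>R (g r * ee (- (r * (y \<bullet> \<xi>)))))"
  proof (intro Bochner_Integration.integral_cong refl)
    fix r
    show "indicator {1<..2} r *\<^sub>R (of_real (r\<^sup>2) * (indicator ann (r *\<^sub>R y) * (A (r *\<^sub>R y) * ee (- ((r *\<^sub>R y) \<bullet> \<xi>)))))
      = indicator {a<..b} r *\<^sub>R (g r * ee (- (r * (y \<bullet> \<xi>))))"
      using ab[of r] by (auto simp: indicator_def g_def mult.assoc)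
  qed
  have 1: "cmod (LINT r|lborel. indicator {a<..b} r *\<^sub>R (g r * ee (- (r * (y \<bullet> \<xi>))))) \<le> 12 * M"
    by (rule oscillatory_integral_le'[OF _ len]) (use gb M in \<open>auto intro: order_trans[of _ "4 * M"]\<close>)
  show ?thesis
  proof (cases "y \<bullet> \<xi> = 0")
    case True
    then show ?thesis unfolding eq using 1 \<open>y \<in> half_ann\<close> M by simp
  next
    case False
    have "cmod (LINT r|lborel. indicator {a<..b} r *\<^sub>R (g r * ee (- (r * (y \<bullet> \<xi>))))) \<le> 2 * (12 * M) / \<bar>y \<bullet> \<xi>\<bar>"
      by (rule oscillatory_integral_le[OF _ len]) (use gb gl M False in \<open>auto intro: order_trans[of _ "4 * M"]\<close>)
    then show ?thesis unfolding eq using 1 \<open>y \<in> half_ann\<close> M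
      by (auto simp: max_def)
  qed
qed

section \<open>Polar coordinates up to a constant\<close>

lemma nn_integral_plane_fubini:
  fixes f :: "plane \<Rightarrow> ennreal"
  assumes [measurable]: "f \<in> borel_measurable borel"
  shows "(\<integral>\<^sup>+p. f p \<partial>lborel) = (\<integral>\<^sup>+x. \<integral>\<^sup>+y. f (x, y) \<partial>lborel \<partial>lborel)"
proof -
  have "f \<in> borel_measurable (lborel \<Otimes>\<^sub>M lborel)" by (simp add: lborel_prod)
  from lborel.nn_integral_fst[OF this] show ?thesis by (simp add: lborel_prod)
qed

lemma nn_integral_plane_fubini':
  fixes f :: "plane \<Rightarrow> ennreal"
  assumes [measurable]: "f \<in> borel_measurable borel"
  shows "(\<integral>\<^sup>+p. f p \<partial>lborel) = (\<integral>\<^sup>+y. \<integral>\<^sup>+x. f (x, y) \<partial>lborel \<partial>lborel)"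
proof -
  have "f \<in> borel_measurable (lborel \<Otimes>\<^sub>M lborel)" by (simp add: lborel_prod)
  from lborel_pair.nn_integral_snd[OF this] show ?thesis by (simp add: lborel_prod)
qed

lemma nn_integral_plane_swap:
  fixes f :: "plane \<Rightarrow> ennreal"
  assumes [measurable]: "f \<in> borel_measurable borel"
  shows "(\<integral>\<^sup>+p. f (snd p, fst p) \<partial>lborel) = (\<integral>\<^sup>+p. f p \<partial>lborel)"
  by (subst nn_integral_plane_fubini, measurable, subst nn_integral_plane_fubini') simp_all

lemma nn_integral_plane_scale:
  fixes f :: "plane \<Rightarrow> ennreal"
  assumes [measurable]: "f \<in> borel_measurable borel" and c: "c \<noteq> 0"
  shows "(\<integral>\<^sup>+p. f p \<partial>lborel) = ennreal (c\<^sup>2) * (\<integral>\<^sup>+p. f (c *\<^sub>R p) \<partial>lborel)"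
  by (subst lborel_affine[OF c, of 0])
     (simp add: nn_integral_density nn_integral_distr nn_integral_cmult power2_eq_square)

definition circ :: "real \<Rightarrow> plane" where "circ t = (cos t, sin t)"

lemma circ_measurable [measurable]: "circ \<in> borel_measurable borel"
  unfolding circ_def by (intro borel_measurable_continuous_onI continuous_intros)

lemma normalize_measurable [measurable]: "(\<lambda>y :: plane. y /\<^sub>R norm y) \<in> borel_measurable borel"
  by measurable

text \<open>On each vertical line in the sector the substitution \<open>y = x * tan t\<close>
  parametrises by the angle. Its derivative is at most 4, since \<open>x \<le> 2\<close> and
  \<open>\<bar>tan t\<bar> \<le> 1\<close>; integrating over \<open>x\<close> in an interval of
  length 2 gives the factor 8.\<close>

lemma sector_integral_le:
  fixes G :: "plane \<Rightarrow> ennreal"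
  assumes [measurable]: "G \<in> borel_measurable borel"
  shows "(\<integral>\<^sup>+p. indicator {p. 0 < fst p \<and> fst p \<le> 2 \<and> \<bar>snd p\<bar> \<le> fst p} p * G (p /\<^sub>R norm p) \<partial>lborel)
    \<le> 8 * (\<integral>\<^sup>+t. G (circ t) * indicator {-(pi/4)..pi/4} t \<partial>lborel)"
proof -
  define J where "J = (\<integral>\<^sup>+t. G (circ t) * indicator {-(pi/4)..pi/4} t \<partial>lborel)"
  have row: "(\<integral>\<^sup>+y. G ((x, y) /\<^sub>R norm (x, y)) * indicator {-x..x} y \<partial>lborel) \<le> 4 * J" if x: "0 < x" "x \<le> 2" for x
  proof -
    define g where "g t = x * tan t" for t
    define g' where "g' t = x * (1 + (tan t)\<^sup>2)" for t
    have cos: "0 < cos t" if "t \<in> {-(pi/4)..pi/4}" for t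
    proof (rule cos_gt_zero_pi)
      show "- (pi / 2) < t" "t < pi / 2"
        using that pi_gt_zero unfolding atLeastAtMost_iff by linarith+
    qed
    have d: "(g has_real_derivative g' t) (at t)" if "t \<in> {-(pi/4)..pi/4}" for t
      unfolding g_def g'_def using cos[OF that]
      by (auto intro!: derivative_eq_intros simp: tan_sec power_inverse)
    have c: "continuous_on {-(pi/4)..pi/4} g'"
    proof -
      have "cos t \<noteq> 0" if "t \<in> {-(pi/4)..pi/4}" for t using cos[OF that] by simp
      then show ?thesis unfolding g'_def by (intro continuous_intros ballI)
    qed
    have g'0: "g' t \<ge> 0" for t unfolding g'_def using x by simp
    have "(\<integral>\<^sup>+y. G ((x, y) /\<^sub>R norm (x, y)) * indicator {-x..x} y \<partial>lborel)
       = (\<integral>\<^sup>+y. G ((x, y) /\<^sub>R norm (x, y)) * indicator {g (-(pi/4))..g (pi/4)} y \<partial>lborel)"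
      by (simp add: g_def tan_45)
    also have "\<dots> = (\<integral>\<^sup>+t. G ((x, g t) /\<^sub>R norm (x, g t)) * ennreal (g' t) * indicator {-(pi/4)..pi/4} t \<partial>lborel)"
      by (rule nn_integral_substitution_aux[OF _ _ d c g'0]) (auto simp: pi_gt_zero)
    also have "\<dots> \<le> (\<integral>\<^sup>+t. 4 * (G (circ t) * indicator {-(pi/4)..pi/4} t) \<partial>lborel)"
    proof (intro nn_integral_mono)
      fix t
      show "G ((x, g t) /\<^sub>R norm (x, g t)) * ennreal (g' t) * indicator {-(pi/4)..pi/4} t \<le> 4 * (G (circ t) * indicator {-(pi/4)..pi/4} t)"
      proof (cases "t \<in> {-(pi/4)..pi/4}")
        case True
        note ct = cos[OF True]
        have e: "(x, g t) = (x / cos t) *\<^sub>R circ t"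
          using ct by (simp add: g_def circ_def tan_def)
        have "norm (x, g t) = x / cos t"
          unfolding e norm_scaleR using x ct by (simp add: circ_def norm_Pair)
        then have "(x, g t) /\<^sub>R norm (x, g t) = circ t"
          unfolding e using x ct by simp
        moreover have "\<bar>tan t\<bar> \<le> 1"
        proof -
          have tb: "- (pi / 2) < t" "t < pi / 2" "- (pi / 2) < - (pi / 4)" "pi / 4 < pi / 2" "t \<le> pi / 4" "- (pi / 4) \<le> t"
            using True pi_gt_zero unfolding atLeastAtMost_iff by linarith+
          have "tan t \<le> tan (pi/4)" "tan (-(pi/4)) \<le> tan t"
            by (rule tan_mono_le[OF tb(1) tb(5) tb(4)], rule tan_mono_le[OF tb(3) tb(6) tb(2)])
          then show ?thesis by (simp add: tan_45 abs_le_iff)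
        qed
        then have "(tan t)\<^sup>2 \<le> 1" by (simp add: abs_square_le_1)
        then have "g' t \<le> 2 * 2" unfolding g'_def using x by (intro mult_mono) auto
        then have "G (circ t) * ennreal (g' t) \<le> G (circ t) * ennreal 4"
          by (intro mult_left_mono ennreal_leI) auto
        ultimately show ?thesis using True by (simp add: mult.commute)
      qed simp
    qed
    also have "\<dots> = 4 * J" by (simp add: J_def nn_integral_cmult)
    finally show ?thesis .
  qed
  have "(\<integral>\<^sup>+p. indicator {p. 0 < fst p \<and> fst p \<le> 2 \<and> \<bar>snd p\<bar> \<le> fst p} p * G (p /\<^sub>R norm p) \<partial>lborel)
     = (\<integral>\<^sup>+x. \<integral>\<^sup>+y. indicator {p. 0 < fst p \<and> fst p \<le> 2 \<and> \<bar>snd p\<bar> \<le> fst p} (x, y) * G ((x, y) /\<^sub>R norm (x, y)) \<partial>lborel \<partial>lborel)"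
    by (rule nn_integral_plane_fubini) measurable
  also have "\<dots> \<le> (\<integral>\<^sup>+x. indicator {0<..2::real} x * (4 * J) \<partial>lborel)"
  proof (intro nn_integral_mono)
    fix x :: real
    show "(\<integral>\<^sup>+y. indicator {p. 0 < fst p \<and> fst p \<le> 2 \<and> \<bar>snd p\<bar> \<le> fst p} (x, y) * G ((x, y) /\<^sub>R norm (x, y)) \<partial>lborel) \<le> indicator {0<..2::real} x * (4 * J)"
    proof (cases "0 < x \<and> x \<le> 2")
      case True
      have "indicator {p. 0 < fst p \<and> fst p \<le> 2 \<and> \<bar>snd p\<bar> \<le> fst p} (x, y) = (indicator {-x..x} y :: ennreal)" for y
        using True by (auto simp: indicator_def abs_le_iff)
      then show ?thesis using row[of x] True by (simp add: mult.commute)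
    next
      case False
      then have "indicator {p. 0 < fst p \<and> fst p \<le> 2 \<and> \<bar>snd p\<bar> \<le> fst p} (x, y) = (0 :: ennreal)" for y
        by (auto simp: indicator_def)
      then show ?thesis by simp
    qed
  qed
  also have "\<dots> = 2 * (4 * J)"
    by (subst nn_integral_multc) (auto)
  finally show ?thesis by (simp add: J_def mult.assoc[symmetric])
qed

lemma circ_add_2pi [simp]: "circ (t + 2 * pi) = circ t"
  by (simp add: circ_def)

text \<open>A rotated or reflected arc may leave the fundamental period. Inside two periods it meets
  every point of the circle at most twice, hence the factor 2.\<close>

lemma arc_integral_le:
  fixes G :: "plane \<Rightarrow> ennreal"
  assumes [measurable]: "G \<in> borel_measurable borel" and S: "S \<subseteq> {-2*pi..<2*pi}" and [measurable]: "S \<in> sets borel"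
  shows "(\<integral>\<^sup>+t. G (circ t) * indicator S t \<partial>lborel) \<le> 2 * (\<integral>\<^sup>+t. G (circ t) * indicator {0..<2*pi} t \<partial>lborel)"
proof -
  have "(\<integral>\<^sup>+t. G (circ t) * indicator S t \<partial>lborel)
     \<le> (\<integral>\<^sup>+t. G (circ t) * indicator {-2*pi..<0} t + G (circ t) * indicator {0..<2*pi} t \<partial>lborel)"
    using S by (intro nn_integral_mono) (auto simp: indicator_def)
  also have "\<dots> = (\<integral>\<^sup>+t. G (circ t) * indicator {-2*pi..<0} t \<partial>lborel) + (\<integral>\<^sup>+t. G (circ t) * indicator {0..<2*pi} t \<partial>lborel)"
    by (rule nn_integral_add) auto
  finally have le: "(\<integral>\<^sup>+t. G (circ t) * indicator S t \<partial>lborel)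
    \<le> (\<integral>\<^sup>+t. G (circ t) * indicator {-2*pi..<0} t \<partial>lborel) + (\<integral>\<^sup>+t. G (circ t) * indicator {0..<2*pi} t \<partial>lborel)" .
  have "(\<integral>\<^sup>+t. G (circ t) * indicator {0..<2*pi} t \<partial>lborel)
     = ennreal \<bar>1\<bar> * (\<integral>\<^sup>+t. G (circ (2 * pi + 1 * t)) * indicator {0..<2*pi} (2 * pi + 1 * t) \<partial>lborel)"
    by (rule nn_integral_real_affine) auto
  moreover have "indicator {0..<2*pi} (2 * pi + 1 * t) = (indicator {-2*pi..<0} t :: ennreal)" for t
    by (auto simp: indicator_def)
  moreover have "circ (2 * pi + 1 * t) = circ t" for t
    using circ_add_2pi[of t] by (simp add: add.commute)
  ultimately have "(\<integral>\<^sup>+t. G (circ t) * indicator {-2*pi..<0} t \<partial>lborel) = (\<integral>\<^sup>+t. G (circ t) * indicator {0..<2*pi} t \<partial>lborel)"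
    by simp
  with le show ?thesis by (simp only: mult_2)
qed

text \<open>The annulus is covered by four copies of the sector, obtained by the reflection through
  the origin and the swap of coordinates. Both preserve Lebesgue measure and act on the angle by a
  shift or a reflection. The constant is four sectors times 8 times 2.\<close>

lemma circle_radial_integral_le:
  fixes G :: "plane \<Rightarrow> ennreal"
  assumes [measurable]: "G \<in> borel_measurable borel"
  shows "(\<integral>\<^sup>+p. indicator half_ann p * G (p /\<^sub>R norm p) \<partial>lborel)
    \<le> 64 * (\<integral>\<^sup>+t. G (circ t) * indicator {0..<2*pi} t \<partial>lborel)"
proof -
  define J where "J = (\<integral>\<^sup>+t. G (circ t) * indicator {0..<2*pi} t \<partial>lborel)"
  define Q :: "plane set" where "Q = {p. 0 < fst p \<and> fst p \<le> 2 \<and> \<bar>snd p\<bar> \<le> fst p}"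
  have [measurable]: "Q \<in> sets borel" unfolding Q_def by measurable
  have arc: "(\<integral>\<^sup>+p. indicator Q p * H (p /\<^sub>R norm p) \<partial>lborel) \<le> 8 * (2 * J)"
    if [measurable]: "H \<in> borel_measurable borel" and H: "\<And>t. H (circ t) = G (circ (c + d * t))"
      and d: "d = 1 \<or> d = -1" and c: "- pi \<le> c" "c \<le> pi" for H c d
  proof -
    have "(\<integral>\<^sup>+t. H (circ t) * indicator {-(pi/4)..pi/4} t \<partial>lborel)
       = (\<integral>\<^sup>+t. G (circ (c + d * t)) * indicator ((\<lambda>s. c + d * s) ` {-(pi/4)..pi/4}) (c + d * t) \<partial>lborel)"
      unfolding H using d by (intro nn_integral_cong arg_cong2[where f="(*)"] refl) (auto simp: indicator_def)
    also have "\<dots> = (\<integral>\<^sup>+t. G (circ t) * indicator ((\<lambda>s. c + d * s) ` {-(pi/4)..pi/4}) t \<partial>lborel)"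
    proof -
      have [measurable]: "(\<lambda>s. c + d * s) ` {-(pi/4)..pi/4} \<in> sets borel"
        by (intro borel_closed compact_imp_closed compact_continuous_image continuous_intros) auto
      show ?thesis
        using nn_integral_real_affine[of "\<lambda>t. G (circ t) * indicator ((\<lambda>s. c + d * s) ` {-(pi/4)..pi/4}) t" d c] d
        by auto
    qed
    also have "\<dots> \<le> 2 * J"
      unfolding J_def
    proof (rule arc_integral_le)
      show "(\<lambda>s. c + d * s) ` {-(pi/4)..pi/4} \<subseteq> {-2*pi..<2*pi}"
      proof (rule image_subsetI)
        fix s assume "s \<in> {-(pi/4)..pi/4}"
        then have "- (pi / 4) \<le> s" "s \<le> pi / 4" by auto
        then show "c + d * s \<in> {-2*pi..<2*pi}"
          using d c pi_gt_zero unfolding atLeastLessThan_iff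
          by (elim disjE) (simp_all only: mult_1 mult_minus1, linarith+)
      qed
      show "(\<lambda>s. c + d * s) ` {-(pi/4)..pi/4} \<in> sets borel"
        by (intro borel_closed compact_imp_closed compact_continuous_image continuous_intros) auto
    qed simp
    finally have "(\<integral>\<^sup>+t. H (circ t) * indicator {-(pi/4)..pi/4} t \<partial>lborel) \<le> 2 * J" .
    then show ?thesis
      using order_trans[OF sector_integral_le[of H] mult_left_mono[of _ "2 * J" 8]] unfolding Q_def by auto
  qed
  let ?n = "\<lambda>p::plane. p /\<^sub>R norm p"
  let ?s = "\<lambda>p::plane. (snd p, fst p)"
  have nn: "norm (- p) = norm p" "norm (?s p) = norm p" for p :: plane
    by (simp_all add: norm_prod_def add.commute)
  have I1: "(\<integral>\<^sup>+p. indicator Q p * G (?n p) \<partial>lborel) \<le> 8 * (2 * J)"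
    by (rule arc[of G 0 1]) auto
  have I2: "(\<integral>\<^sup>+p. indicator Q (- p) * G (?n p) \<partial>lborel) \<le> 8 * (2 * J)"
  proof -
    have "(\<integral>\<^sup>+p. indicator Q (- p) * G (?n p) \<partial>lborel) = (\<integral>\<^sup>+p. indicator Q p * G (- ?n p) \<partial>lborel)"
      using nn_integral_plane_scale[of "\<lambda>p. indicator Q (- p) * G (?n p)" "-1"] by simp
    also have "\<dots> \<le> 8 * (2 * J)"
      by (rule arc[of "\<lambda>p. G (- p)" pi 1]) (auto simp: circ_def add.commute[of pi])
    finally show ?thesis .
  qed
  have I3: "(\<integral>\<^sup>+p. indicator Q (?s p) * G (?n p) \<partial>lborel) \<le> 8 * (2 * J)"
  proof -
    have "(\<integral>\<^sup>+p. indicator Q (?s p) * G (?n p) \<partial>lborel) = (\<integral>\<^sup>+p. indicator Q p * G (?s (?n p)) \<partial>lborel)"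
      using nn_integral_plane_swap[of "\<lambda>p. indicator Q (?s p) * G (?n p)"] by (simp add: nn)
    also have "\<dots> \<le> 8 * (2 * J)"
      by (rule arc[of "\<lambda>p. G (?s p)" "pi/2" "-1"]) (auto simp: circ_def cos_diff sin_diff)
    finally show ?thesis .
  qed
  have I4: "(\<integral>\<^sup>+p. indicator Q (- ?s p) * G (?n p) \<partial>lborel) \<le> 8 * (2 * J)"
  proof -
    have "(\<integral>\<^sup>+p. indicator Q (- ?s p) * G (?n p) \<partial>lborel) = (\<integral>\<^sup>+p. indicator Q (- p) * G (?s (?n p)) \<partial>lborel)"
      using nn_integral_plane_swap[of "\<lambda>p. indicator Q (- ?s p) * G (?n p)"] by (simp add: nn)
    also have "\<dots> = (\<integral>\<^sup>+p. indicator Q p * G (- ?s (?n p)) \<partial>lborel)"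
      using nn_integral_plane_scale[of "\<lambda>p. indicator Q (- p) * G (?s (?n p))" "-1"] by simp
    also have "\<dots> \<le> 8 * (2 * J)"
    proof (rule arc[of "\<lambda>p. G (- ?s p)" "- (pi/2)" "-1"])
      show "- pi \<le> - (pi / 2)" "- (pi / 2) \<le> pi" using pi_gt_zero by linarith+
    qed (auto simp: circ_def cos_diff sin_diff)
    finally show ?thesis .
  qed
  have "(\<integral>\<^sup>+p. indicator half_ann p * G (?n p) \<partial>lborel)
    \<le> (\<integral>\<^sup>+p. (indicator Q p * G (?n p) + indicator Q (- p) * G (?n p)) + (indicator Q (?s p) * G (?n p) + indicator Q (- ?s p) * G (?n p)) \<partial>lborel)"
  proof (intro nn_integral_mono)
    fix p :: plane
    have "p \<in> half_ann \<Longrightarrow> p \<in> Q \<or> - p \<in> Q \<or> ?s p \<in> Q \<or> - ?s p \<in> Q"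
    proof -
      assume "p \<in> half_ann"
      then have n: "norm p > 0" "norm p \<le> 2" by (auto simp: half_ann_def)
      then have "\<bar>fst p\<bar> \<le> 2" "\<bar>snd p\<bar> \<le> 2" using abs_fst_le_norm[of p] abs_snd_le_norm[of p] by linarith+
      moreover have "fst p \<noteq> 0 \<or> snd p \<noteq> 0" using n by (cases p) (auto simp: norm_Pair)
      ultimately show ?thesis unfolding Q_def by (auto simp: abs_if split: if_splits)
    qed
    then show "indicator half_ann p * G (?n p) \<le> (indicator Q p * G (?n p) + indicator Q (- p) * G (?n p)) + (indicator Q (?s p) * G (?n p) + indicator Q (- ?s p) * G (?n p))"
      by (cases "p \<in> half_ann") (auto simp: indicator_def add_increasing add_increasing2)
  qed
  also have "\<dots> = ((\<integral>\<^sup>+p. indicator Q p * G (?n p) \<partial>lborel) + (\<integral>\<^sup>+p. indicator Q (- p) * G (?n p) \<partial>lborel))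
      + ((\<integral>\<^sup>+p. indicator Q (?s p) * G (?n p) \<partial>lborel) + (\<integral>\<^sup>+p. indicator Q (- ?s p) * G (?n p) \<partial>lborel))"
    by (simp add: nn_integral_add)
  also have "\<dots> \<le> (8 * (2 * J) + 8 * (2 * J)) + (8 * (2 * J) + 8 * (2 * J))"
    by (intro add_mono I1 I2 I3 I4)
  also have "\<dots> = 64 * J" by (simp add: mult_2[symmetric] mult.assoc[symmetric])
  finally show ?thesis by (simp add: J_def)
qed

text \<open>\<open>\<Omega>\<close> is only measurable with respect to the \<open>\<sigma>\<close>-algebra of the circle, hence the indicator of the circle.\<close>
definition ext_circle :: "(plane \<Rightarrow> complex) \<Rightarrow> plane \<Rightarrow> complex" where
  "ext_circle \<Omega> y = indicator (sphere 0 1) y *\<^sub>R \<Omega> y"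

definition angular :: "(plane \<Rightarrow> complex) \<Rightarrow> plane \<Rightarrow> complex" where
  "angular \<Omega> y = ext_circle \<Omega> (y /\<^sub>R norm y)"

lemma norm_circ [simp]: "norm (circ t) = 1"
  by (simp add: circ_def norm_Pair)

lemma circ_in_sphere: "circ t \<in> sphere 0 1"
  by (simp add: circ_def norm_Pair)

lemma ext_circle_measurable:
  assumes "in_Lp circle_measure q \<Omega>"
  shows "ext_circle \<Omega> \<in> borel_measurable borel"
proof -
  have "\<Omega> \<in> borel_measurable (restrict_space borel (sphere 0 1))"
    using assms by (simp add: in_Lp_def circle_measure_def measurable_distr_eq1)
  then have "(\<lambda>y. indicator (sphere 0 1) y *\<^sub>R \<Omega> y) \<in> borel_measurable borel"
    by (subst (asm) borel_measurable_restrict_space_iff) auto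
  then show ?thesis by (simp add: ext_circle_def[abs_def])
qed

lemma nn_integral_ext_circle:
  assumes \<Omega>: "in_Lp circle_measure q \<Omega>" and q: "q > 0"
  shows "(\<integral>\<^sup>+t. ennreal (cmod (ext_circle \<Omega> (circ t)) powr q) * indicator {0..<2*pi} t \<partial>lborel)
    = ennreal (Lp_norm circle_measure q \<Omega> powr q)"
proof -
  have \<Omega>m: "\<Omega> \<in> borel_measurable (restrict_space borel (sphere 0 1))" and i: "integrable circle_measure (\<lambda>x. cmod (\<Omega> x) powr q)"
    using \<Omega> by (auto simp: in_Lp_def circle_measure_def measurable_distr_eq1)
  have c: "(\<lambda>t. (cos t, sin t)) \<in> measurable (restrict_space lborel {0..<2 * pi}) (restrict_space borel (sphere 0 1))"
    using circ_measurable circ_in_sphere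
    by (intro measurable_restrict_space2 measurable_restrict_space1) (auto simp: circ_def[abs_def] space_restrict_space)
  have "ennreal (Lp_norm circle_measure q \<Omega> powr q) = ennreal (LINT x|circle_measure. cmod (\<Omega> x) powr q)"
    using q by (simp add: Lp_norm_def powr_powr)
  also have "\<dots> = (\<integral>\<^sup>+x. ennreal (cmod (\<Omega> x) powr q) \<partial>circle_measure)"
    by (rule nn_integral_eq_integral[symmetric, OF i]) simp
  also have "\<dots> = (\<integral>\<^sup>+t. ennreal (cmod (\<Omega> (circ t)) powr q) \<partial>restrict_space lborel {0..<2*pi})"
    unfolding circle_measure_def circ_def
    using \<Omega>m by (intro nn_integral_distr c) measurable
  also have "\<dots> = (\<integral>\<^sup>+t. ennreal (cmod (\<Omega> (circ t)) powr q) * indicator {0..<2*pi} t \<partial>lborel)"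
    by (rule nn_integral_restrict_space) simp
  finally show ?thesis
    by (simp add: ext_circle_def indicator_def)
qed

lemma angular_measurable:
  assumes "in_Lp circle_measure q \<Omega>"
  shows "angular \<Omega> \<in> borel_measurable borel"
  unfolding angular_def[abs_def]
  by (rule measurable_compose[OF normalize_measurable ext_circle_measurable[OF assms]])

lemma angular_scale: "r > 0 \<Longrightarrow> angular \<Omega> (r *\<^sub>R y) = angular \<Omega> y"
proof -
  assume "r > 0"
  then have "inverse (\<bar>r\<bar> * norm y) * r = inverse (norm y)" by simp
  then show ?thesis by (simp only: angular_def norm_scaleR scaleR_scaleR)
qed

lemma nn_integral_angular_le:
  assumes \<Omega>: "in_Lp circle_measure q \<Omega>" and q: "q > 0"
  shows "(\<integral>\<^sup>+y. indicator half_ann y * ennreal (cmod (angular \<Omega> y) powr q) \<partial>lborel) \<le> ennreal (64 * Lp_norm circle_measure q \<Omega> powr q)"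
proof -
  have [measurable]: "ext_circle \<Omega> \<in> borel_measurable borel" by (rule ext_circle_measurable[OF \<Omega>])
  have "(\<integral>\<^sup>+y. indicator half_ann y * ennreal (cmod (angular \<Omega> y) powr q) \<partial>lborel)
    \<le> 64 * (\<integral>\<^sup>+t. ennreal (cmod (ext_circle \<Omega> (circ t)) powr q) * indicator {0..<2*pi} t \<partial>lborel)"
    unfolding angular_def by (rule circle_radial_integral_le[of "\<lambda>y. ennreal (cmod (ext_circle \<Omega> y) powr q)"]) measurable
  also have "\<dots> = ennreal (64 * Lp_norm circle_measure q \<Omega> powr q)"
    unfolding nn_integral_ext_circle[OF \<Omega> q] by (simp add: ennreal_mult')
  finally show ?thesis .
qed

lemma le_truncation:
  fixes a s q :: real
  assumes "a \<ge> 0" "s > 0" "q \<ge> 1"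
  shows "a \<le> s + s powr (1 - q) * a powr q"
proof (cases "a \<le> s")
  case False
  then have "a = a powr (1 - q) * a powr q" using assms by (simp add: powr_add[symmetric])
  also have "\<dots> \<le> s powr (1 - q) * a powr q"
    using False assms by (intro mult_right_mono powr_mono2') auto
  finally show ?thesis using assms by simp
qed (use assms in \<open>simp add: add_increasing2\<close>)

lemma emeasure_affine_strip:
  assumes b: "b \<noteq> 0" and h: "h \<ge> 0"
  shows "(\<integral>\<^sup>+x. indicator {-h..h} (c + b * x) \<partial>lborel) = ennreal (2 * h / \<bar>b\<bar>)"
proof -
  have "ennreal (2 * h) = (\<integral>\<^sup>+x. indicator {-h..h} x \<partial>lborel)"
    using h by simp
  also have "\<dots> = ennreal \<bar>b\<bar> * (\<integral>\<^sup>+x. indicator {-h..h} (c + b * x) \<partial>lborel)"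
    by (rule nn_integral_real_affine) (use b in auto)
  finally have "ennreal (1 / \<bar>b\<bar>) * ennreal (2 * h) = ennreal (1 / \<bar>b\<bar>) * (ennreal \<bar>b\<bar> * (\<integral>\<^sup>+x. indicator {-h..h} (c + b * x) \<partial>lborel))" by simp
  also have "\<dots> = (\<integral>\<^sup>+x. indicator {-h..h} (c + b * x) \<partial>lborel)"
    using b by (simp add: mult.assoc[symmetric] ennreal_mult'[symmetric])
  finally show ?thesis using b h by (simp add: ennreal_mult'[symmetric])
qed

text \<open>One coordinate of \<open>\<xi>\<close> is at least half its norm. In that direction the
  strip cuts every line in an interval of length at most \<open>4 * h / norm \<xi>\<close>, and the
  other coordinate ranges over an interval of length 4.\<close>

lemma strip_integral_le:
  fixes \<xi> :: plane
  assumes \<xi>: "1 \<le> norm \<xi>" and h: "h \<ge> 0"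
  shows "(\<integral>\<^sup>+y. indicator half_ann y * indicator {-h..h} (y \<bullet> \<xi>) \<partial>lborel) \<le> ennreal (16 * h / norm \<xi>)"
proof -
  obtain p r where pr: "\<xi> = (p, r)" by (cases \<xi>)
  have bound: "4 * ennreal (2 * h / \<bar>b\<bar>) \<le> ennreal (16 * h / norm \<xi>)" if "norm \<xi> / 2 \<le> \<bar>b\<bar>" for b
  proof -
    have "2 * h / \<bar>b\<bar> \<le> 2 * h / (norm \<xi> / 2)"
      using that \<xi> h by (intro divide_left_mono mult_pos_pos) (auto simp: zero_less_divide_iff)
    then have "4 * (2 * h / \<bar>b\<bar>) \<le> 16 * h / norm \<xi>" by simp
    then show ?thesis using ennreal_leI by (simp add: ennreal_mult'[of 4, simplified, symmetric])
  qed
  have four: "(\<integral>\<^sup>+y. indicator {-2..2::real} y * ennreal k \<partial>lborel) = 4 * ennreal k" for k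
    by (subst nn_integral_multc) auto
  have "norm \<xi> \<le> \<bar>p\<bar> + \<bar>r\<bar>" unfolding pr norm_Pair real_norm_def using sqrt_sum_squares_le_sum_abs[of p r] by (simp only: power2_abs)
  then consider "norm \<xi> / 2 \<le> \<bar>p\<bar>" | "norm \<xi> / 2 \<le> \<bar>r\<bar>" by linarith
  then show ?thesis
  proof cases
    case 1
    then have p0: "p \<noteq> 0" using \<xi> by auto
    have "(\<integral>\<^sup>+y. indicator half_ann y * indicator {-h..h} (y \<bullet> \<xi>) \<partial>lborel)
      = (\<integral>\<^sup>+y2. \<integral>\<^sup>+y1. indicator half_ann (y1, y2) * indicator {-h..h} ((y1, y2) \<bullet> \<xi>) \<partial>lborel \<partial>lborel)"
      by (rule nn_integral_plane_fubini') measurable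
    also have "\<dots> \<le> (\<integral>\<^sup>+y2. \<integral>\<^sup>+y1. indicator {-2..2::real} y2 * indicator {-h..h} (y2 * r + p * y1) \<partial>lborel \<partial>lborel)"
    proof (intro nn_integral_mono)
      fix y1 y2 :: real
      have "(y1, y2) \<bullet> \<xi> = y2 * r + p * y1" by (simp add: pr)
      moreover have "(y1, y2) \<in> half_ann \<Longrightarrow> y2 \<in> {-2..2}"
        using abs_snd_le_norm[of "(y1, y2)"] by (auto simp: half_ann_def abs_le_iff)
      ultimately show "indicator half_ann (y1, y2) * indicator {-h..h} ((y1, y2) \<bullet> \<xi>) \<le> (indicator {-2..2::real} y2 * indicator {-h..h} (y2 * r + p * y1) :: ennreal)"
        by (auto simp: indicator_def)
    qed
    also have "\<dots> = (\<integral>\<^sup>+y2. indicator {-2..2::real} y2 * ennreal (2 * h / \<bar>p\<bar>) \<partial>lborel)"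
      by (simp add: nn_integral_cmult emeasure_affine_strip p0 h)
    also have "\<dots> \<le> ennreal (16 * h / norm \<xi>)" unfolding four by (rule bound[OF 1])
    finally show ?thesis .
  next
    case 2
    then have r0: "r \<noteq> 0" using \<xi> by auto
    have "(\<integral>\<^sup>+y. indicator half_ann y * indicator {-h..h} (y \<bullet> \<xi>) \<partial>lborel)
      = (\<integral>\<^sup>+y1. \<integral>\<^sup>+y2. indicator half_ann (y1, y2) * indicator {-h..h} ((y1, y2) \<bullet> \<xi>) \<partial>lborel \<partial>lborel)"
      by (rule nn_integral_plane_fubini) measurable
    also have "\<dots> \<le> (\<integral>\<^sup>+y1. \<integral>\<^sup>+y2. indicator {-2..2::real} y1 * indicator {-h..h} (y1 * p + r * y2) \<partial>lborel \<partial>lborel)"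
    proof (intro nn_integral_mono)
      fix y1 y2 :: real
      have "(y1, y2) \<bullet> \<xi> = y1 * p + r * y2" by (simp add: pr)
      moreover have "(y1, y2) \<in> half_ann \<Longrightarrow> y1 \<in> {-2..2}"
        using abs_fst_le_norm[of "(y1, y2)"] by (auto simp: half_ann_def abs_le_iff)
      ultimately show "indicator half_ann (y1, y2) * indicator {-h..h} ((y1, y2) \<bullet> \<xi>) \<le> (indicator {-2..2::real} y1 * indicator {-h..h} (y1 * p + r * y2) :: ennreal)"
        by (auto simp: indicator_def)
    qed
    also have "\<dots> = (\<integral>\<^sup>+y1. indicator {-2..2::real} y1 * ennreal (2 * h / \<bar>r\<bar>) \<partial>lborel)"
      by (simp add: nn_integral_cmult emeasure_affine_strip r0 h)
    also have "\<dots> \<le> ennreal (16 * h / norm \<xi>)" unfolding four by (rule bound[OF 2])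
    finally show ?thesis .
  qed
qed

lemma emeasure_half_ann_le: "(\<integral>\<^sup>+y. indicator half_ann y \<partial>lborel) \<le> ennreal 16"
proof -
  have le: "indicator half_ann (x, y) \<le> (indicator {-2..2::real} x * indicator {-2..2::real} y :: ennreal)" for x y
    using abs_fst_le_norm[of "(x, y)"] abs_snd_le_norm[of "(x, y)"]
    by (auto simp: indicator_def half_ann_def abs_le_iff)
  have "(\<integral>\<^sup>+y. indicator half_ann y \<partial>lborel) = (\<integral>\<^sup>+x. \<integral>\<^sup>+y. indicator half_ann (x, y) \<partial>lborel \<partial>lborel)"
    by (rule nn_integral_plane_fubini) measurable
  also have "\<dots> \<le> (\<integral>\<^sup>+x. \<integral>\<^sup>+y. indicator {-2..2::real} x * indicator {-2..2::real} y \<partial>lborel \<partial>lborel)"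
    by (intro nn_integral_mono le)
  also have "\<dots> = ennreal 4 * ennreal 4"
    by (simp add: nn_integral_cmult nn_integral_multc)
  also have "\<dots> = ennreal 16"
    by (subst ennreal_mult[symmetric]) auto
  finally show ?thesis .
qed

lemma ennreal_plus_4:
  "0 \<le> a \<Longrightarrow> 0 \<le> b \<Longrightarrow> 0 \<le> c \<Longrightarrow> 0 \<le> d \<Longrightarrow>
    (ennreal a + ennreal b) + (ennreal c + ennreal d) = ennreal ((a + b) + (c + d))"
  by simp

text \<open>Off the strip \<open>\<bar>y \<bullet> \<xi>\<bar> \<le> h\<close> with \<open>h\<close> the square root of \<open>norm \<xi>\<close> the weight is small; the strip itself has
  small measure, which is exploited by truncating \<open>\<Omega>\<close> at height \<open>s\<close>.\<close>
lemma angular_weight_le: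
  assumes \<Omega>: "in_Lp circle_measure q \<Omega>" and q: "4 / 3 < q" and N: "N > 0" "Lp_norm circle_measure q \<Omega> \<le> N"
    and \<xi>: "1 \<le> norm (\<xi> :: plane)"
  shows "(\<integral>\<^sup>+y. ennreal (cmod (angular \<Omega> y) * (indicator half_ann y / max 1 \<bar>y \<bullet> \<xi>\<bar>)) \<partial>lborel) \<le> ennreal (160 * N * norm \<xi> powr (- 1 / 8))"
proof -
  note [measurable] = angular_measurable[OF \<Omega>]
  define R where "R = norm \<xi>"
  define h where "h = R powr (1/2)"
  \<comment> \<open>The height that balances the two contributions of the strip:
    \<open>s * h / R\<close> and \<open>s powr (1 - q) * N powr q\<close> are both equal to
    \<open>N * R powr ((1 - q) / (2 * q))\<close>.\<close>
  define s where "s = N * R powr (1 / (2 * q))"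
  have R: "R \<ge> 1" using \<xi> by (simp add: R_def)
  have s: "s > 0" using N R by (simp add: s_def)
  have h: "h \<ge> 1" using R by (simp add: h_def ge_one_powr_ge_zero)
  define a where "a y = cmod (angular \<Omega> y)" for y
  have a0: "a y \<ge> 0" for y by (simp add: a_def)
  define Iq where "Iq y = indicator half_ann y * ennreal (a y powr q)" for y
  have [measurable]: "Iq \<in> borel_measurable borel" unfolding Iq_def a_def by measurable
  have Iq: "(\<integral>\<^sup>+y. Iq y \<partial>lborel) \<le> ennreal (64 * N powr q)"
  proof -
    have "Lp_norm circle_measure q \<Omega> powr q \<le> N powr q"
      using N q by (intro powr_mono2) (auto simp: Lp_norm_def)
    then show ?thesis
      unfolding Iq_def a_def using nn_integral_angular_le[OF \<Omega>, of] q by (auto intro!: order_trans[OF nn_integral_angular_le[OF \<Omega>]] ennreal_leI)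
  qed
  \<comment> \<open>Inside the strip \<open>a\<close> is truncated at \<open>s\<close>, outside it
    at \<open>N\<close>; each truncation leaves a constant term and a multiple of the
    \<open>q\<close>-th power.\<close>
  have pt: "ennreal (a y * (indicator half_ann y / max 1 \<bar>y \<bullet> \<xi>\<bar>)) \<le>
      (ennreal s * (indicator half_ann y * indicator {-h..h} (y \<bullet> \<xi>)) + ennreal (s powr (1 - q)) * Iq y)
      + (ennreal (N / h) * indicator half_ann y + ennreal (N powr (1 - q) / h) * Iq y)" for y
  proof (cases "y \<in> half_ann")
    case False
    then show ?thesis by simp
  next
    case True
    show ?thesis
    proof (cases "\<bar>y \<bullet> \<xi>\<bar> \<le> h")
      case in_strip: True
      have "a y * (1 / max 1 \<bar>y \<bullet> \<xi>\<bar>) \<le> a y * 1" using a0[of y] by (intro mult_left_mono) auto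
      also have "\<dots> \<le> s + s powr (1 - q) * a y powr q" using le_truncation[OF a0 s, of q] q by simp
      finally have "ennreal (a y * (1 / max 1 \<bar>y \<bullet> \<xi>\<bar>)) \<le> ennreal s + ennreal (s powr (1 - q)) * ennreal (a y powr q)"
        using s by (simp add: ennreal_mult'[symmetric] ennreal_plus[symmetric] ennreal_leI del: ennreal_plus)
      moreover have "y \<bullet> \<xi> \<in> {-h..h}" using in_strip by (auto simp: abs_le_iff)
      ultimately show ?thesis using True by (auto simp: Iq_def intro: add_increasing2)
    next
      case False
      have "a y * (1 / max 1 \<bar>y \<bullet> \<xi>\<bar>) \<le> a y * (1 / h)"
        using a0[of y] False h by (intro mult_left_mono divide_left_mono) auto
      also have "\<dots> \<le> (N + N powr (1 - q) * a y powr q) * (1 / h)"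
        using le_truncation[OF a0 N(1), of q] q h by (intro mult_right_mono) auto
      also have "\<dots> = N / h + N powr (1 - q) / h * a y powr q"
        by (simp add: add_divide_distrib)
      finally have "ennreal (a y * (1 / max 1 \<bar>y \<bullet> \<xi>\<bar>)) \<le> ennreal (N / h) + ennreal (N powr (1 - q) / h) * ennreal (a y powr q)"
        using N h by (simp add: ennreal_mult'[symmetric] ennreal_plus[symmetric] ennreal_leI del: ennreal_plus)
      then show ?thesis using True by (auto simp: Iq_def intro: add_increasing)
    qed
  qed
  have "(\<integral>\<^sup>+y. ennreal (a y * (indicator half_ann y / max 1 \<bar>y \<bullet> \<xi>\<bar>)) \<partial>lborel)
    \<le> (\<integral>\<^sup>+y. (ennreal s * (indicator half_ann y * indicator {-h..h} (y \<bullet> \<xi>)) + ennreal (s powr (1 - q)) * Iq y)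
      + (ennreal (N / h) * indicator half_ann y + ennreal (N powr (1 - q) / h) * Iq y) \<partial>lborel)"
    by (intro nn_integral_mono pt)
  also have "\<dots> = (ennreal s * (\<integral>\<^sup>+y. indicator half_ann y * indicator {-h..h} (y \<bullet> \<xi>) \<partial>lborel) + ennreal (s powr (1 - q)) * (\<integral>\<^sup>+y. Iq y \<partial>lborel))
     + (ennreal (N / h) * (\<integral>\<^sup>+y. indicator half_ann y \<partial>lborel) + ennreal (N powr (1 - q) / h) * (\<integral>\<^sup>+y. Iq y \<partial>lborel))"
    by (simp add: nn_integral_add nn_integral_cmult)
  also have "\<dots> \<le> (ennreal s * ennreal (16 * h / norm \<xi>) + ennreal (s powr (1 - q)) * ennreal (64 * N powr q))
     + (ennreal (N / h) * ennreal 16 + ennreal (N powr (1 - q) / h) * ennreal (64 * N powr q))"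
    using h by (intro add_mono mult_left_mono strip_integral_le \<xi> Iq emeasure_half_ann_le) auto
  also have "\<dots> = ennreal ((s * (16 * h / R) + s powr (1 - q) * (64 * N powr q)) + (N / h * 16 + N powr (1 - q) / h * (64 * N powr q)))"
  proof -
    have e: "ennreal s * ennreal (16 * h / norm \<xi>) = ennreal (s * (16 * h / R))"
      "ennreal (s powr (1 - q)) * ennreal (64 * N powr q) = ennreal (s powr (1 - q) * (64 * N powr q))"
      "ennreal (N / h) * ennreal 16 = ennreal (N / h * 16)"
      "ennreal (N powr (1 - q) / h) * ennreal (64 * N powr q) = ennreal (N powr (1 - q) / h * (64 * N powr q))"
      unfolding R_def by (rule ennreal_mult[symmetric]; use s h N in simp)+
    show ?thesis
      unfolding e by (rule ennreal_plus_4; use s h N R in simp)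
  qed
  also have "\<dots> \<le> ennreal (160 * N * R powr (- 1 / 8))"
  proof (rule ennreal_leI)
    \<comment> \<open>Equality holds at \<open>q = 4 / 3\<close>; this is the origin of the exponent
      \<open>1 / 8\<close>.\<close>
    have ex: "(1 - q) / (2 * q) \<le> - 1 / 8" using q by (simp add: field_simps)
    have t1: "s * (16 * h / R) \<le> 16 * (N * R powr (- 1 / 8))"
    proof -
      have "s * (16 * h / R) = 16 * (N * (R powr (1 / (2 * q)) * R powr (1/2) * R powr (-1)))"
      proof -
        have "R powr (-1) = 1 / R" using R by (simp add: powr_minus_divide)
        then show ?thesis unfolding s_def h_def by simp
      qed
      also have "R powr (1 / (2 * q)) * R powr (1/2) * R powr (-1) = R powr ((1 - q) / (2 * q))"
      proof -
        have "1 / (2 * q) + 1 / 2 + (-1) = (1 - q) / (2 * q)" using q by (simp add: field_simps)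
        then show ?thesis by (simp only: powr_add[symmetric])
      qed
      also have "\<dots> \<le> R powr (- 1 / 8)" using R ex by (intro powr_mono) auto
      finally show ?thesis using N by (simp add: mult_left_mono)
    qed
    have t2: "s powr (1 - q) * (64 * N powr q) \<le> 64 * (N * R powr (- 1 / 8))"
    proof -
      have "s powr (1 - q) * (64 * N powr q) = 64 * ((N powr (1 - q) * N powr q) * R powr (1 / (2 * q) * (1 - q)))"
        using N R by (simp add: s_def powr_mult powr_powr)
      also have "N powr (1 - q) * N powr q = N" using N by (simp add: powr_add[symmetric])
      also have "R powr (1 / (2 * q) * (1 - q)) \<le> R powr (- 1 / 8)" using R ex by (intro powr_mono) auto
      finally show ?thesis using N by (simp add: mult_left_mono)
    qed
    have h8: "1 / h \<le> R powr (- 1 / 8)"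
    proof -
      have "1 / h = R powr (- (1/2))" by (simp add: h_def powr_minus_divide)
      also have "\<dots> \<le> R powr (- 1 / 8)" using R by (intro powr_mono) auto
      finally show ?thesis .
    qed
    have t3: "N / h * 16 \<le> 16 * (N * R powr (- 1 / 8))"
    proof -
      have "N / h * 16 = 16 * (N * (1 / h))" by simp
      also have "\<dots> \<le> 16 * (N * R powr (- 1 / 8))"
        by (intro mult_left_mono h8) (use N in auto)
      finally show ?thesis .
    qed
    have t4: "N powr (1 - q) / h * (64 * N powr q) \<le> 64 * (N * R powr (- 1 / 8))"
    proof -
      have "N powr (1 - q) / h * (64 * N powr q) = 64 * ((N powr (1 - q) * N powr q) * (1 / h))" by simp
      also have "N powr (1 - q) * N powr q = N" using N by (simp add: powr_add[symmetric])
      also have "64 * (N * (1 / h)) \<le> 64 * (N * R powr (- 1 / 8))"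
        by (intro mult_left_mono h8) (use N in auto)
      finally show ?thesis .
    qed
    show "(s * (16 * h / R) + s powr (1 - q) * (64 * N powr q)) + (N / h * 16 + N powr (1 - q) / h * (64 * N powr q)) \<le> 160 * N * R powr (- 1 / 8)"
      using t1 t2 t3 t4 by linarith
  qed
  finally show ?thesis by (simp add: a_def R_def)
qed

text \<open>The integral is averaged over the dilations of its variable by
  \<open>1 < r \<le> 2\<close>. Since \<open>angular \<Omega>\<close> is homogeneous of degree zero
  it does not depend on \<open>r\<close>, so for fixed \<open>y\<close> the integral over
  \<open>r\<close> sees the Lipschitz amplitude and the oscillation alone. The gain from
  \<open>radial_integral_le\<close> is then integrated against the merely integrable factor. The
  constant is \<open>24 * 160\<close>.\<close>

lemma rough_fourier_le:
  assumes \<Omega>: "in_Lp circle_measure q \<Omega>" and q: "4 / 3 < q" and N: "N > 0" "Lp_norm circle_measure q \<Omega> \<le> N"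
    and \<xi>: "1 \<le> norm (\<xi> :: plane)" and A: "amp M A"
    and Ki: "integrable lborel (\<lambda>y. indicator ann y *\<^sub>R angular \<Omega> y)"
  shows "cmod (fourier (\<lambda>y. (indicator ann y *\<^sub>R angular \<Omega> y) * A y) \<xi>) \<le> M * (3840 * N) * norm \<xi> powr (- 1 / 8)"
proof -
  note [measurable] = angular_measurable[OF \<Omega>] ampD(1)[OF A]
  note M = amp_nonneg[OF A]
  define f where "f y = ((indicator ann y *\<^sub>R angular \<Omega> y) * A y) * ee (- (y \<bullet> \<xi>))" for y
  have [measurable]: "f \<in> borel_measurable borel" unfolding f_def by measurable
  have fi: "integrable lborel f"
  proof (rule Bochner_Integration.integrable_bound[of _ "\<lambda>y. M * cmod (indicator ann y *\<^sub>R angular \<Omega> y)"])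
    show "integrable lborel (\<lambda>y. M * cmod (indicator ann y *\<^sub>R angular \<Omega> y))"
      by (rule integrable_mult_right[OF integrable_norm[OF Ki]])
    show "AE y in lborel. norm (f y) \<le> norm (M * cmod (indicator ann y *\<^sub>R angular \<Omega> y))"
    proof (intro AE_I2)
      fix y show "norm (f y) \<le> norm (M * cmod (indicator ann y *\<^sub>R angular \<Omega> y))"
        using mult_left_mono[OF ampD(2)[OF A], of y "cmod (angular \<Omega> y)"] M
        by (cases "y \<in> ann") (auto simp: f_def norm_mult mult.commute)
    qed
  qed simp
  define I where "I = (LINT y|lborel. f y)"
  have scale: "I = r\<^sup>2 *\<^sub>R (LINT y|lborel. f (r *\<^sub>R y))" and scalei: "integrable lborel (\<lambda>y. f (r *\<^sub>R y))" 
    and scalen: "(LINT y|lborel. cmod (f y)) = r\<^sup>2 *\<^sub>R (LINT y|lborel. cmod (f (r *\<^sub>R y)))" if "r > 0" for r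
  proof -
    have lb: "(lborel :: plane measure) = density (distr lborel borel (\<lambda>x. 0 + r *\<^sub>R x)) (\<lambda>_. ennreal (\<bar>r\<bar> ^ DIM(plane)))"
      by (rule lborel_affine) (use that in simp)
    show "I = r\<^sup>2 *\<^sub>R (LINT y|lborel. f (r *\<^sub>R y))"
      unfolding I_def by (subst lb) (use that in \<open>simp add: integral_density integral_distr power2_eq_square\<close>)
    show "(LINT y|lborel. cmod (f y)) = r\<^sup>2 *\<^sub>R (LINT y|lborel. cmod (f (r *\<^sub>R y)))"
      by (subst lb) (use that in \<open>simp add: integral_density integral_distr power2_eq_square\<close>)
    have "integrable (density (distr lborel borel (\<lambda>x. 0 + r *\<^sub>R x)) (\<lambda>_. ennreal (\<bar>r\<bar> ^ DIM(plane)))) f"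
      using fi lb by simp
    then have "integrable lborel (\<lambda>y. (r * r) *\<^sub>R f (r *\<^sub>R y))"
      using that by (simp add: integrable_density integrable_distr_eq)
    then have "integrable lborel (\<lambda>y. inverse (r * r) *\<^sub>R ((r * r) *\<^sub>R f (r *\<^sub>R y)))"
      by (rule integrable_scaleR_right)
    moreover have "inverse (r * r) * (r * r) = 1" using that by (intro left_inverse) simp
    ultimately show "integrable lborel (\<lambda>y. f (r *\<^sub>R y))" by (simp only: scaleR_scaleR scaleR_one)
  qed
  define F where "F = (\<lambda>(r, y). indicator {1<..2} r *\<^sub>R (r\<^sup>2 *\<^sub>R f (r *\<^sub>R y)))"
  have Fm [measurable]: "F \<in> borel_measurable (lborel \<Otimes>\<^sub>M lborel)"
    unfolding F_def by measurable
  have Fi: "integrable (lborel \<Otimes>\<^sub>M lborel) F"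
  proof (rule lborel_pair.Fubini_integrable[OF Fm])
    have "(LINT y|lborel. norm (F (r, y))) = indicator {1<..2} r * (LINT y|lborel. cmod (f y))" for r
    proof (cases "r \<in> {1<..2}")
      case True
      then show ?thesis using scalen[of r] by (simp add: F_def)
    qed (simp add: F_def)
    then show "integrable lborel (\<lambda>r. LINT y|lborel. norm (F (r, y)))" by simp
    show "AE r in lborel. integrable lborel (\<lambda>y. F (r, y))"
    proof (intro AE_I2)
      fix r :: real
      show "integrable lborel (\<lambda>y. F (r, y))"
        using scalei[of r] by (cases "r \<in> {1<..2}") (auto simp: F_def)
    qed
  qed
  have "(LINT r|lborel. LINT y|lborel. F (r, y)) = (LINT r|lborel. indicator {1<..2::real} r *\<^sub>R I)"
  proof (intro Bochner_Integration.integral_cong refl)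
    fix r :: real
    show "(LINT y|lborel. F (r, y)) = indicator {1<..2::real} r *\<^sub>R I"
      using scale[of r] by (cases "r \<in> {1<..2}") (auto simp: F_def)
  qed
  also have "\<dots> = I" by (subst integral_scaleR_left) simp_all
  finally have "I = (LINT y|lborel. LINT r|lborel. F (r, y))"
    using lborel_pair.Fubini_integral[of "\<lambda>r y. F (r, y)"] Fi by simp
  then have "ennreal (cmod I) \<le> (\<integral>\<^sup>+y. ennreal (cmod (LINT r|lborel. F (r, y))) \<partial>lborel)"
    by (simp only:, intro integral_norm_bound_ennreal) (rule lborel_pair.integrable_snd, simp add: Fi)
  also have "\<dots> \<le> (\<integral>\<^sup>+y. ennreal (24 * M) * ennreal (cmod (angular \<Omega> y) * (indicator half_ann y / max 1 \<bar>y \<bullet> \<xi>\<bar>)) \<partial>lborel)"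
  proof (intro nn_integral_mono)
    fix y :: plane
    have "F (r, y) = angular \<Omega> y * (indicator {1<..2} r *\<^sub>R (of_real (r\<^sup>2) * (indicator ann (r *\<^sub>R y) * (A (r *\<^sub>R y) * ee (- ((r *\<^sub>R y) \<bullet> \<xi>))))))" for r
      using angular_scale[of r \<Omega> y] by (auto simp: F_def f_def indicator_def scaleR_conv_of_real mult_ac)
    then have "(LINT r|lborel. F (r, y)) = angular \<Omega> y * (LINT r|lborel. indicator {1<..2} r *\<^sub>R (of_real (r\<^sup>2) * (indicator ann (r *\<^sub>R y) * (A (r *\<^sub>R y) * ee (- ((r *\<^sub>R y) \<bullet> \<xi>))))))"
      by (simp only: integral_mult_right_zero)
    then have "cmod (LINT r|lborel. F (r, y)) \<le> cmod (angular \<Omega> y) * (indicator half_ann y * (24 * M / max 1 \<bar>y \<bullet> \<xi>\<bar>))"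
      using radial_integral_le[OF A, of y \<xi>] by (simp only: norm_mult) (intro mult_left_mono norm_ge_zero)
    also have "\<dots> = 24 * M * (cmod (angular \<Omega> y) * (indicator half_ann y / max 1 \<bar>y \<bullet> \<xi>\<bar>))" by simp
    finally show "ennreal (cmod (LINT r|lborel. F (r, y))) \<le> ennreal (24 * M) * ennreal (cmod (angular \<Omega> y) * (indicator half_ann y / max 1 \<bar>y \<bullet> \<xi>\<bar>))"
      using M by (simp add: ennreal_mult'[symmetric] ennreal_leI)
  qed
  also have "\<dots> = ennreal (24 * M) * (\<integral>\<^sup>+y. ennreal (cmod (angular \<Omega> y) * (indicator half_ann y / max 1 \<bar>y \<bullet> \<xi>\<bar>)) \<partial>lborel)"
    by (rule nn_integral_cmult) measurable
  also have "\<dots> \<le> ennreal (24 * M) * ennreal (160 * N * norm \<xi> powr (- 1 / 8))"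
    by (intro mult_left_mono angular_weight_le[OF \<Omega> q N \<xi>]) simp
  also have "\<dots> = ennreal (M * (3840 * N) * norm \<xi> powr (- 1 / 8))"
    using M by (simp add: ennreal_mult'[symmetric] mult_ac)
  finally show ?thesis
    using M N by (simp add: I_def f_def fourier_ee)
qed

lemma ann_subset_half_ann: "ann \<subseteq> half_ann"
  by (auto simp: ann_def half_ann_def)

theorem rough_class_angular:
  assumes \<Omega>: "in_Lp circle_measure q \<Omega>" and q: "4 / 3 < q" and N: "N > 0" "Lp_norm circle_measure q \<Omega> \<le> N"
  shows "rough_class q (3840 * N) (\<lambda>y. indicator ann y *\<^sub>R angular \<Omega> y)"
proof -
  note [measurable] = angular_measurable[OF \<Omega>]
  define K where "K y = indicator ann y *\<^sub>R angular \<Omega> y" for y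
  have [measurable]: "K \<in> borel_measurable borel" unfolding K_def by measurable
  have "(\<integral>\<^sup>+y. ennreal (cmod (K y) powr q) \<partial>lborel) \<le> (\<integral>\<^sup>+y. indicator half_ann y * ennreal (cmod (angular \<Omega> y) powr q) \<partial>lborel)"
    using ann_subset_half_ann by (intro nn_integral_mono) (auto simp: K_def indicator_def)
  also have "\<dots> \<le> ennreal (64 * Lp_norm circle_measure q \<Omega> powr q)"
    by (rule nn_integral_angular_le[OF \<Omega>]) (use q in simp)
  also have "\<dots> \<le> ennreal ((3840 * N) powr q)"
  proof (rule ennreal_leI)
    have "64 * Lp_norm circle_measure q \<Omega> powr q \<le> 3840 powr q * N powr q"
    proof (intro mult_mono)
      show "64 \<le> (3840 :: real) powr q" using powr_mono[of 1 q 3840] q by simp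
      show "Lp_norm circle_measure q \<Omega> powr q \<le> N powr q" using N q by (intro powr_mono2) (auto simp: Lp_norm_def)
    qed auto
    then show "64 * Lp_norm circle_measure q \<Omega> powr q \<le> (3840 * N) powr q" using N by (simp add: powr_mult)
  qed
  finally have nn: "(\<integral>\<^sup>+y. ennreal (cmod (K y) powr q) \<partial>lborel) \<le> ennreal ((3840 * N) powr q)" .
  have Kq: "integrable lborel (\<lambda>y. cmod (K y) powr q)"
    by (rule integrableI_bounded) (use nn in \<open>auto intro: le_less_trans\<close>)
  have "(\<integral>\<^sup>+y. ennreal (cmod (K y) powr q) \<partial>lborel) = ennreal (LINT y|lborel. cmod (K y) powr q)"
    by (rule nn_integral_eq_integral[OF Kq]) simp
  with nn have Kle: "(LINT y|lborel. cmod (K y) powr q) \<le> (3840 * N) powr q" by simp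
  have i1: "integrable lborel (indicator half_ann :: plane \<Rightarrow> real)"
    by (rule integrable_real_indicator) (use emeasure_half_ann_le in \<open>auto intro: le_less_trans\<close>)
  have Ki: "integrable lborel K"
  proof (rule Bochner_Integration.integrable_bound)
    show "integrable lborel (\<lambda>y. indicator half_ann y + cmod (K y) powr q)"
      by (intro Bochner_Integration.integrable_add i1 Kq)
    show "AE y in lborel. norm (K y) \<le> norm (indicator half_ann y + cmod (K y) powr q)"
    proof (intro AE_I2)
      fix y
      show "norm (K y) \<le> norm (indicator half_ann y + cmod (K y) powr q)"
        using le_truncation[of "cmod (K y)" 1 q] q ann_subset_half_ann by (cases "y \<in> ann") (auto simp: K_def)
    qed
  qed simp
  have "rough_class q (3840 * N) K"
    unfolding rough_class_def
  proof (intro conjI allI impI)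
    fix M A \<xi> assume A: "amp M A" and \<xi>: "1 \<le> norm (\<xi> :: plane)"
    show "cmod (fourier (\<lambda>y. K y * A y) \<xi>) \<le> M * (3840 * N) * norm \<xi> powr (- 1 / 8)"
      unfolding K_def by (rule rough_fourier_le[OF \<Omega> q N \<xi> A Ki[unfolded K_def[abs_def]]])
  qed (use Kq Kle Ki in \<open>auto simp: K_def\<close>)
  then show ?thesis by (simp add: K_def[abs_def])
qed

section \<open>Averages of modulated operators\<close>

text \<open>A translation by \<open>c\<close> seen on the frequency side. It preserves absolute
  values, so supports and norms are unchanged and estimates pass to translated inputs.\<close>

definition modulate :: "real \<Rightarrow> (real \<Rightarrow> complex) \<Rightarrow> real \<Rightarrow> complex" where
  "modulate c u \<xi> = u \<xi> * ee (- (c * \<xi>))"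

lemma ift_modulate: "ift (modulate c u) x = ift u (x - c)"
  unfolding ift_def modulate_def
  by (intro Bochner_Integration.integral_cong refl) (simp add: mult.assoc ee_add[symmetric] algebra_simps)

lemma modulate_measurable [measurable]:
  assumes [measurable]: "u \<in> borel_measurable borel" shows "modulate c u \<in> borel_measurable borel"
  unfolding modulate_def by measurable

lemma norm_modulate [simp]: "cmod (modulate c u \<xi>) = cmod (u \<xi>)"
  by (simp add: modulate_def norm_mult)

lemma L2fun_modulate: "L2fun u \<Longrightarrow> L2fun (modulate c u)"
  by (rule L2fun_dominated(1)[of u _ 1]) (auto dest: L2fun_measurable)

lemma l2_modulate [simp]: "l2 (modulate c u) = l2 u"
  by (simp add: l2_def)

lemma modulate_eq_0 [simp]: "modulate c u \<xi> = 0 \<longleftrightarrow> u \<xi> = 0"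
  using norm_modulate[of c u \<xi>] by (metis norm_eq_zero)

text \<open>The factor \<open>1 / t\<close> is the Jacobian that makes
  \<open>ift (rescale t u) x\<close> equal to \<open>ift u (t * x)\<close>.\<close>

definition rescale :: "real \<Rightarrow> (real \<Rightarrow> complex) \<Rightarrow> real \<Rightarrow> complex" where
  "rescale t u \<xi> = u (\<xi> / t) / of_real t"

lemma ift_rescale:
  assumes t: "t > 0" shows "ift (rescale t u) x = ift u (t * x)"
proof -
  have "ift (rescale t u) x = \<bar>t\<bar> *\<^sub>R (LINT \<xi>|lborel. rescale t u (0 + t * \<xi>) * ee (x * (0 + t * \<xi>)))"
    unfolding ift_def by (rule lborel_integral_real_affine) (use t in simp)
  also have "\<dots> = (LINT \<xi>|lborel. \<bar>t\<bar> *\<^sub>R (rescale t u (0 + t * \<xi>) * ee (x * (0 + t * \<xi>))))" by simp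
  also have "\<dots> = ift u (t * x)"
    unfolding ift_def
    using t by (intro Bochner_Integration.integral_cong refl) (simp add: rescale_def scaleR_conv_of_real mult_ac)
  finally show ?thesis .
qed

lemma rescale_L2:
  assumes t: "t > 0" and u: "L2fun u"
  shows "L2fun (rescale t u)" "t * (l2 (rescale t u))\<^sup>2 = (l2 u)\<^sup>2"
proof -
  have i: "integrable lborel u" "integrable lborel (\<lambda>x. (cmod (u x))\<^sup>2)" using u by (auto simp: L2fun_def)
  have "integrable lborel (\<lambda>x. u (0 + 1 / t * x))" "integrable lborel (\<lambda>x. (cmod (u (0 + 1 / t * x)))\<^sup>2)"
    using t lborel_integrable_real_affine[OF i(1), of "1/t" 0] lborel_integrable_real_affine[OF i(2), of "1/t" 0] by simp_all
  then show "L2fun (rescale t u)"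
    by (simp add: L2fun_def rescale_def[abs_def] norm_divide power_divide)
  have "(l2 u)\<^sup>2 = \<bar>1 / t\<bar> *\<^sub>R (LINT x|lborel. (cmod (u (0 + 1 / t * x)))\<^sup>2)"
    unfolding l2_power2 by (rule lborel_integral_real_affine) (use t in simp)
  also have "\<dots> = t * (LINT x|lborel. (cmod (u (x / t)) / t)\<^sup>2)"
    using t by (simp add: power_divide power2_eq_square)
  also have "\<dots> = t * (l2 (rescale t u))\<^sup>2"
    using t by (simp add: l2_power2 rescale_def norm_divide)
  finally show "t * (l2 (rescale t u))\<^sup>2 = (l2 u)\<^sup>2" by simp
qed

definition T_dil :: "(plane \<Rightarrow> complex) \<Rightarrow> real \<Rightarrow> (real \<Rightarrow> complex) \<Rightarrow> (real \<Rightarrow> complex) \<Rightarrow> real \<Rightarrow> complex" where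
  "T_dil K t u v x = (LINT y|lborel. K y * (ift u (x - t * fst y) * ift v (x - t * snd y)))"

lemma T_dil_rescale: "t > 0 \<Longrightarrow> T_dil K t u v (t * x) = T_op K (rescale t u) (rescale t v) x"
  by (simp add: T_dil_def T_op_def ift_rescale right_diff_distrib)

definition C_diag :: "real \<Rightarrow> real" where "C_diag q = C_level q * 128 * (exp (8 * pi))\<^sup>2"

lemma C_diag_pos: "4 / 3 < q \<Longrightarrow> q \<le> 2 \<Longrightarrow> C_diag q > 0"
  using C_level_pos[of q] by (simp add: C_diag_def)

lemma T_op_measurable [measurable]:
  assumes [measurable]: "K \<in> borel_measurable borel" "u \<in> borel_measurable borel" "v \<in> borel_measurable borel"
  shows "T_op K u v \<in> borel_measurable borel"
  unfolding T_op_def by measurable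

lemma T_dil_measurable [measurable]:
  assumes [measurable]: "K \<in> borel_measurable borel" "u \<in> borel_measurable borel" "v \<in> borel_measurable borel"
  shows "T_dil K t u v \<in> borel_measurable borel"
  unfolding T_dil_def by measurable

text \<open>A bound from two square norms to the integral norm is scale invariant: the factor
  \<open>t\<close> from the integration variable is shared equally by the two inputs. Hence the
  estimate at scale one gives all scales with the same constant.\<close>

lemma T_dil_le:
  assumes q: "4 / 3 < q" "q \<le> 2" and K: "rough_class q N K" and N: "N > 0" and \<rho>: "2 \<le> \<rho>" and t: "t > 0"
    and u: "L2fun u" and v: "L2fun v"
    and X: "\<And>\<xi>. u \<xi> \<noteq> 0 \<Longrightarrow> t * \<bar>\<xi>\<bar> \<le> X" "\<And>\<xi>. v \<xi> \<noteq> 0 \<Longrightarrow> t * \<bar>\<xi>\<bar> \<le> X"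
    and far: "(\<forall>\<xi>. u \<xi> \<noteq> 0 \<longrightarrow> \<rho> \<le> t * \<bar>\<xi>\<bar>) \<or> (\<forall>\<xi>. v \<xi> \<noteq> 0 \<longrightarrow> \<rho> \<le> t * \<bar>\<xi>\<bar>)"
  shows "(\<integral>\<^sup>+x. ennreal (cmod (T_dil K t u v x)) \<partial>lborel) \<le> ennreal (C_diag q * N * \<rho> powr (- rate q) * (l2 u * l2 v))"
proof -
  note [measurable] = rough_classD(1)[OF K] L2fun_measurable[OF u] L2fun_measurable[OF v]
  define A where "A = C_diag q * N * \<rho> powr (- rate q)"
  have A: "A \<ge> 0" using C_diag_pos[OF q] N by (simp add: A_def)
  have sn: "rescale t w \<xi> \<noteq> 0 \<longleftrightarrow> w (\<xi> / t) \<noteq> 0" "t * \<bar>\<xi> / t\<bar> = \<bar>\<xi>\<bar>" for w \<xi> using t by (simp_all add: rescale_def)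
  have "(\<integral>\<^sup>+x. ennreal (cmod (T_dil K t u v x)) \<partial>lborel) = ennreal \<bar>t\<bar> * (\<integral>\<^sup>+x. ennreal (cmod (T_dil K t u v (0 + t * x))) \<partial>lborel)"
    by (rule nn_integral_real_affine) (use t in auto)
  also have "\<dots> = ennreal t * (\<integral>\<^sup>+x. ennreal (cmod (T_op K (rescale t u) (rescale t v) x)) \<partial>lborel)"
    using t by (simp add: T_dil_rescale)
  also have "\<dots> \<le> ennreal t * ennreal (A * (l2 (rescale t u) * l2 (rescale t v)))"
  proof (rule mult_left_mono)
    show "(\<integral>\<^sup>+x. ennreal (cmod (T_op K (rescale t u) (rescale t v) x)) \<partial>lborel) \<le> ennreal (A * (l2 (rescale t u) * l2 (rescale t v)))"
      unfolding A_def C_diag_def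
    proof (rule T_op_le[OF q K N \<rho> rescale_L2(1)[OF t u] rescale_L2(1)[OF t v], where X=X])
      show "\<bar>\<xi>\<bar> \<le> X" if "rescale t u \<xi> \<noteq> 0" for \<xi> using X(1)[of "\<xi> / t"] that unfolding sn by simp
      show "\<bar>\<xi>\<bar> \<le> X" if "rescale t v \<xi> \<noteq> 0" for \<xi> using X(2)[of "\<xi> / t"] that unfolding sn by simp
      show "(\<forall>\<xi>. rescale t u \<xi> \<noteq> 0 \<longrightarrow> \<rho> \<le> \<bar>\<xi>\<bar>) \<or> (\<forall>\<xi>. rescale t v \<xi> \<noteq> 0 \<longrightarrow> \<rho> \<le> \<bar>\<xi>\<bar>)"
        using far unfolding sn(1) by (metis sn(2))
    qed
  qed simp
  also have "\<dots> = ennreal (A * (l2 u * l2 v))"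
  proof -
    have "(t * (l2 (rescale t u) * l2 (rescale t v)))\<^sup>2 = (t * (l2 (rescale t u))\<^sup>2) * (t * (l2 (rescale t v))\<^sup>2)"
      by (simp only: power2_eq_square mult_ac)
    also have "\<dots> = (l2 u * l2 v)\<^sup>2"
      unfolding rescale_L2(2)[OF t u] rescale_L2(2)[OF t v] by (simp only: power_mult_distrib)
    finally have "t * (l2 (rescale t u) * l2 (rescale t v)) = l2 u * l2 v"
      by (rule power2_eq_imp_eq) (use t in auto)
    then have "A * (l2 u * l2 v) = t * (A * (l2 (rescale t u) * l2 (rescale t v)))" by (simp add: mult_ac)
    then show ?thesis
      by (simp only:) (rule ennreal_mult'[symmetric], use t in simp)
  qed
  finally show ?thesis by (simp add: A_def)
qed

text \<open>Here \<open>t\<close> is the scale of the truncated kernel and \<open>s\<close> that of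
  the dilated \<open>\<Psi>\<close>. In the application \<open>s / t\<close> is
  \<open>2 powi (- \<mu>)\<close> for every \<open>\<gamma>\<close>, so the translations by
  \<open>s\<close> are small compared with \<open>t\<close>.\<close>

definition T_avg :: "(plane \<Rightarrow> complex) \<Rightarrow> (plane \<Rightarrow> complex) \<Rightarrow> real \<Rightarrow> real \<Rightarrow> (real \<Rightarrow> complex) \<Rightarrow> (real \<Rightarrow> complex) \<Rightarrow> real \<Rightarrow> complex" where
  "T_avg \<Psi> K t s u v x = (LINT \<zeta>|lborel. \<Psi> \<zeta> * (LINT y|lborel. K y *
      (ift u (x - t * fst y - s * fst \<zeta>) * ift v (x - t * snd y - s * snd \<zeta>))))"

lemma T_avg_inner: "(LINT y|lborel. K y * (ift u (x - t * fst y - s * fst \<zeta>) * ift v (x - t * snd y - s * snd \<zeta>)))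
   = T_dil K t (modulate (s * fst \<zeta>) u) (modulate (s * snd \<zeta>) v) x"
  by (simp add: T_dil_def ift_modulate)

lemma T_dil_modulate_measurable [measurable]:
  assumes [measurable]: "K \<in> borel_measurable borel" "u \<in> borel_measurable borel" "v \<in> borel_measurable borel"
  shows "(\<lambda>(x, \<zeta>). T_dil K t (modulate (s * fst \<zeta>) u) (modulate (s * snd \<zeta>) v) x) \<in> borel_measurable (lborel \<Otimes>\<^sub>M (lborel :: plane measure))"
  unfolding T_avg_inner[symmetric] case_prod_beta' by measurable

lemma T_avg_measurable [measurable]:
  assumes [measurable]: "\<Psi> \<in> borel_measurable borel" "K \<in> borel_measurable borel" "u \<in> borel_measurable borel" "v \<in> borel_measurable borel"
  shows "T_avg \<Psi> K t s u v \<in> borel_measurable borel"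
  unfolding T_avg_def by measurable

lemma T_avg_integrands:
  assumes K: "integrable lborel K" and \<Psi>: "integrable lborel \<Psi>" and u: "integrable lborel u" and v: "integrable lborel v"
  shows "integrable lborel (\<lambda>y. K y * (ift u (x - t * fst y - s * fst \<zeta>) * ift v (x - t * snd y - s * snd \<zeta>)))"
    "integrable lborel (\<lambda>\<zeta>. \<Psi> \<zeta> * (LINT y|lborel. K y * (ift u (x - t * fst y - s * fst \<zeta>) * ift v (x - t * snd y - s * snd \<zeta>))))"
proof -
  have [measurable]: "K \<in> borel_measurable borel" "\<Psi> \<in> borel_measurable borel" "u \<in> borel_measurable borel" "v \<in> borel_measurable borel"
    using assms by auto
  define U V where "U = (LINT \<xi>|lborel. cmod (u \<xi>))" and "V = (LINT \<xi>|lborel. cmod (v \<xi>))"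
  have b: "cmod (ift u a * ift v b) \<le> U * V" for a b
    unfolding norm_mult U_def V_def by (intro mult_mono norm_ift_le u v) auto
  show i: "integrable lborel (\<lambda>y. K y * (ift u (x - t * fst y - s * fst \<zeta>) * ift v (x - t * snd y - s * snd \<zeta>)))" for \<zeta>
    by (rule integrable_mult_bdd(1)[OF K _ b]) measurable
  have "cmod (LINT y|lborel. K y * (ift u (x - t * fst y - s * fst \<zeta>) * ift v (x - t * snd y - s * snd \<zeta>)))
     \<le> (LINT y|lborel. cmod (K y) * (U * V))" for \<zeta>
  proof (rule Bochner_Integration.integral_norm_bound_integral[OF i])
    show "cmod (K y * (ift u (x - t * fst y - s * fst \<zeta>) * ift v (x - t * snd y - s * snd \<zeta>))) \<le> cmod (K y) * (U * V)" for y
      unfolding norm_mult[of "K y"] by (intro mult_left_mono b) simp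
  qed (use K in simp)
  then show "integrable lborel (\<lambda>\<zeta>. \<Psi> \<zeta> * (LINT y|lborel. K y * (ift u (x - t * fst y - s * fst \<zeta>) * ift v (x - t * snd y - s * snd \<zeta>))))"
    by (intro integrable_mult_bdd(1)[OF \<Psi>]) measurable
qed

lemma T_avg_norm_le:
  assumes K: "integrable lborel K" and \<Psi>: "integrable lborel \<Psi>" and u: "integrable lborel u" and v: "integrable lborel v"
  shows "ennreal (cmod (T_avg \<Psi> K t s u v x)) \<le> (\<integral>\<^sup>+\<zeta>. ennreal (cmod (\<Psi> \<zeta>)) * ennreal (cmod (T_dil K t (modulate (s * fst \<zeta>) u) (modulate (s * snd \<zeta>) v) x)) \<partial>lborel)"
  using integral_norm_bound_ennreal[OF T_avg_integrands(2)[OF assms, of x t s]]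
  unfolding T_avg_def[symmetric] by (simp add: norm_mult ennreal_mult' T_avg_inner)

text \<open>Translating the inputs changes neither norms nor frequency supports, so the average over
  \<open>\<zeta>\<close> costs only the integral of \<open>cmod (\<Psi> \<zeta>)\<close>.\<close>

lemma T_avg_diag_le:
  assumes q: "4 / 3 < q" "q \<le> 2" and K: "rough_class q N K" and N: "N > 0" and \<rho>: "2 \<le> \<rho>" and t: "t > 0"
    and u: "L2fun u" and v: "L2fun v" and \<Psi>: "integrable lborel \<Psi>"
    and X: "\<And>\<xi>. u \<xi> \<noteq> 0 \<Longrightarrow> t * \<bar>\<xi>\<bar> \<le> X" "\<And>\<xi>. v \<xi> \<noteq> 0 \<Longrightarrow> t * \<bar>\<xi>\<bar> \<le> X"
    and far: "(\<forall>\<xi>. u \<xi> \<noteq> 0 \<longrightarrow> \<rho> \<le> t * \<bar>\<xi>\<bar>) \<or> (\<forall>\<xi>. v \<xi> \<noteq> 0 \<longrightarrow> \<rho> \<le> t * \<bar>\<xi>\<bar>)"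
  shows "(\<integral>\<^sup>+x. ennreal (cmod (T_avg \<Psi> K t s u v x)) \<partial>lborel)
     \<le> ennreal ((LINT \<zeta>|lborel. cmod (\<Psi> \<zeta>)) * (C_diag q * N * \<rho> powr (- rate q)) * (l2 u * l2 v))"
proof -
  note Km [measurable] = rough_classD(1)[OF K] L2fun_measurable[OF u] L2fun_measurable[OF v]
  have [measurable]: "\<Psi> \<in> borel_measurable borel" using \<Psi> by auto
  have i: "integrable lborel u" "integrable lborel v" using u v by (auto simp: L2fun_def)
  define A where "A = C_diag q * N * \<rho> powr (- rate q) * (l2 u * l2 v)"
  have A: "A \<ge> 0" using C_diag_pos[OF q] N by (simp add: A_def)
  define g where "g \<zeta> x = ennreal (cmod (T_dil K t (modulate (s * fst \<zeta>) u) (modulate (s * snd \<zeta>) v) x))" for \<zeta> x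
  have gm [measurable]: "(\<lambda>(x, \<zeta>). g \<zeta> x) \<in> borel_measurable (lborel \<Otimes>\<^sub>M lborel)"
    unfolding g_def T_avg_inner[symmetric] case_prod_beta' by measurable
  have gm' [measurable]: "(\<lambda>x. g \<zeta> x) \<in> borel_measurable lborel" for \<zeta>
    unfolding g_def by measurable
  have "(\<integral>\<^sup>+x. ennreal (cmod (T_avg \<Psi> K t s u v x)) \<partial>lborel) \<le> (\<integral>\<^sup>+x. \<integral>\<^sup>+\<zeta>. ennreal (cmod (\<Psi> \<zeta>)) * g \<zeta> x \<partial>lborel \<partial>lborel)"
    unfolding g_def by (intro nn_integral_mono T_avg_norm_le rough_classD(3)[OF K] \<Psi> i)
  also have "\<dots> = (\<integral>\<^sup>+\<zeta>. \<integral>\<^sup>+x. ennreal (cmod (\<Psi> \<zeta>)) * g \<zeta> x \<partial>lborel \<partial>lborel)"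
    by (rule lborel_pair.Fubini'[symmetric]) (use gm in \<open>simp add: case_prod_beta'\<close>)
  also have "\<dots> = (\<integral>\<^sup>+\<zeta>. ennreal (cmod (\<Psi> \<zeta>)) * (\<integral>\<^sup>+x. g \<zeta> x \<partial>lborel) \<partial>lborel)"
    by (intro nn_integral_cong nn_integral_cmult) measurable
  also have "\<dots> \<le> (\<integral>\<^sup>+\<zeta>. ennreal (cmod (\<Psi> \<zeta>)) * ennreal A \<partial>lborel)"
  proof (intro nn_integral_mono mult_left_mono)
    fix \<zeta> :: plane
    have "(\<integral>\<^sup>+x. g \<zeta> x \<partial>lborel) \<le> ennreal (C_diag q * N * \<rho> powr (- rate q) * (l2 (modulate (s * fst \<zeta>) u) * l2 (modulate (s * snd \<zeta>) v)))"
      unfolding g_def by (rule T_dil_le[OF q K N \<rho> t L2fun_modulate[OF u] L2fun_modulate[OF v], where X=X]) (use X far in auto)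
    then show "(\<integral>\<^sup>+x. g \<zeta> x \<partial>lborel) \<le> ennreal A" by (simp add: A_def)
  qed simp
  also have "\<dots> = ennreal (LINT \<zeta>|lborel. cmod (\<Psi> \<zeta>)) * ennreal A"
    using \<Psi> by (subst nn_integral_multc) (auto simp: nn_integral_eq_integral)
  also have "\<dots> = ennreal ((LINT \<zeta>|lborel. cmod (\<Psi> \<zeta>)) * (C_diag q * N * \<rho> powr (- rate q)) * (l2 u * l2 v))"
    by (simp add: A_def ennreal_mult'[symmetric] mult.assoc)
  finally show ?thesis .
qed

section \<open>One low-pass factor\<close>

definition low :: "real \<Rightarrow> (real \<Rightarrow> complex) \<Rightarrow> real \<Rightarrow> complex" where
  "low t a \<xi> = of_real (gauss (t * \<xi>)) * a \<xi>"

lemma low_measurable [measurable]: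
  assumes [measurable]: "a \<in> borel_measurable borel" shows "low t a \<in> borel_measurable borel"
  unfolding low_def by measurable

lemma L2fun_low: "L2fun a \<Longrightarrow> L2fun (low t a)"
  by (rule L2fun_dominated(1)[of a _ 1])
     (auto dest: L2fun_measurable simp: low_def norm_mult gauss_le1 intro!: mult_left_le_one_le)

lemma ift_low_fourier:
  assumes f: "integrable lborel f" and t: "t > 0"
  shows "ift (low t (fourier f)) x = (LINT s|lborel. f s * of_real (gauss ((x - s) / t) / t))"
proof -
  have [measurable]: "f \<in> borel_measurable borel" using f by auto
  define g where "g \<xi> = complex_of_real (gauss (t * \<xi>)) * ee (x * \<xi>)" for \<xi>
  have gi: "integrable lborel g"
    unfolding g_def using gauss_scaled_integrable[OF t, of 0] by auto
  have inner: "(LINT \<xi>|lborel. g \<xi> * (\<lambda>p. ee (- (snd p * fst p))) (\<xi>, s)) = of_real (gauss ((x - s) / t) / t)" for s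
  proof -
    have e: "ee (x * \<xi>) * ee (- (s * \<xi>)) = ee ((x - s) * \<xi>)" for \<xi>
      by (simp add: ee_add[symmetric] algebra_simps)
    show ?thesis
      unfolding g_def gauss_scaled_transform[OF t, symmetric] fst_conv snd_conv mult.assoc e ..
  qed
  have "ift (low t (fourier f)) x = (LINT \<xi>|lborel. g \<xi> * (LINT s|lborel. f s * (\<lambda>p. ee (- (snd p * fst p))) (\<xi>, s)))"
    unfolding ift_def low_def fourier_ee g_def by (simp add: mult_ac)
  also have "\<dots> = (LINT s|lborel. f s * (LINT \<xi>|lborel. g \<xi> * (\<lambda>p. ee (- (snd p * fst p))) (\<xi>, s)))"
    by (rule fubini_tensor[OF gi f, where C=1]) auto
  finally show ?thesis by (simp only: inner)
qed

section \<open>Power series of a translated Gaussian\<close>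

definition C_low :: real where "C_low = exp (2048 * pi\<^sup>2)"

text \<open>From the factorisation of \<open>gauss (\<sigma> - y)\<close> into
  \<open>gauss \<sigma> * gauss y * exp (2 * pi * \<sigma> * y)\<close>. The factor
  \<open>gauss y\<close> stays with the kernel, so the coefficients are monomials times a Gaussian
  instead of Hermite functions.\<close>

definition gauss_coeff :: "nat \<Rightarrow> real \<Rightarrow> real" where
  "gauss_coeff n \<sigma> = gauss \<sigma> * (2 * pi * \<sigma>) ^ n / fact n"

lemma gauss_coeff_measurable [measurable]: "gauss_coeff n \<in> borel_measurable borel"
  unfolding gauss_coeff_def by measurable

lemma gauss_shift_sums: "(\<lambda>n. gauss_coeff n \<sigma> * (y ^ n * gauss y)) sums gauss (\<sigma> - y)"
proof -
  have s: "(\<lambda>n. (gauss \<sigma> * gauss y) * ((2 * pi * \<sigma> * y) ^ n /\<^sub>R fact n)) sums ((gauss \<sigma> * gauss y) * exp (2 * pi * \<sigma> * y))"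
    by (intro sums_mult exp_converges)
  have e2: "(gauss \<sigma> * gauss y) * exp (2 * pi * \<sigma> * y) = gauss (\<sigma> - y)"
    by (simp add: gauss_def exp_add[symmetric] power2_eq_square algebra_simps)
  have e3: "(gauss \<sigma> * gauss y) * ((2 * pi * \<sigma> * y) ^ n /\<^sub>R fact n) = gauss_coeff n \<sigma> * (y ^ n * gauss y)" for n
  proof -
    have "(2 * pi * \<sigma> * y) ^ n = (2 * pi * \<sigma>) ^ n * y ^ n" by (rule power_mult_distrib)
    then show ?thesis by (simp add: gauss_coeff_def divide_inverse mult_ac)
  qed
  from s show ?thesis unfolding e2 e3 .
qed

text \<open>A single term of the exponential series at 64 times the argument is at most the
  exponential, which yields \<open>(1/64) ^ n\<close>; the Gaussian absorbs that exponential. The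
  number 64 leaves room for the factor \<open>4 ^ n * 4 ^ n\<close> in the squared kernel bounds and
  for \<open>2 ^ n\<close> from powers of coordinates on the annulus.\<close>

lemma gauss_coeff_le: "\<bar>gauss_coeff n \<sigma>\<bar> \<le> C_low * (1/64) ^ n / (1 + \<sigma>\<^sup>2)"
proof -
  have e: "(128 * pi * \<bar>\<sigma>\<bar>) ^ n / fact n \<le> exp (128 * pi * \<bar>\<sigma>\<bar>)"
  proof -
    have sm: "(\<lambda>n. (128 * pi * \<bar>\<sigma>\<bar>) ^ n /\<^sub>R fact n) sums exp (128 * pi * \<bar>\<sigma>\<bar>)"
      by (rule exp_converges)
    have "(\<Sum>k\<in>{n}. (128 * pi * \<bar>\<sigma>\<bar>) ^ k /\<^sub>R fact k) \<le> (\<Sum>k. (128 * pi * \<bar>\<sigma>\<bar>) ^ k /\<^sub>R fact k)"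
      by (rule sum_le_suminf) (use sm in \<open>auto simp: sums_iff\<close>)
    then show ?thesis using sm by (simp add: sums_iff divide_inverse mult.commute)
  qed
  have "(128 * pi * \<bar>\<sigma>\<bar>) ^ n = 64 ^ n * (2 * pi * \<bar>\<sigma>\<bar>) ^ n"
  proof -
    have "128 * pi * \<bar>\<sigma>\<bar> = 64 * (2 * pi * \<bar>\<sigma>\<bar>)" by simp
    then show ?thesis by (simp only: power_mult_distrib)
  qed
  with e have e': "64 ^ n * (2 * pi * \<bar>\<sigma>\<bar>) ^ n / fact n \<le> exp (128 * pi * \<bar>\<sigma>\<bar>)" by (simp only:)
  have o: "(1/64 :: real) ^ n * 64 ^ n = 1" by (simp add: power_divide)
  have "(2 * pi * \<bar>\<sigma>\<bar>) ^ n / fact n = ((1/64) ^ n * 64 ^ n) * ((2 * pi * \<bar>\<sigma>\<bar>) ^ n / fact n)"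
    unfolding o by simp
  also have "\<dots> = (1/64) ^ n * (64 ^ n * (2 * pi * \<bar>\<sigma>\<bar>) ^ n / fact n)"
    by (simp only: mult.assoc times_divide_eq_right)
  also have "\<dots> \<le> (1/64) ^ n * exp (128 * pi * \<bar>\<sigma>\<bar>)"
    by (intro mult_left_mono e') simp
  finally have "(2 * pi * \<bar>\<sigma>\<bar>) ^ n / fact n \<le> (1/64) ^ n * exp (128 * pi * \<bar>\<sigma>\<bar>)" .
  then have "gauss \<sigma> * ((2 * pi * \<bar>\<sigma>\<bar>) ^ n / fact n) \<le> gauss \<sigma> * ((1/64) ^ n * exp (128 * pi * \<bar>\<sigma>\<bar>))"
    by (rule mult_left_mono) simp
  also have "\<dots> = (1/64) ^ n * exp (128 * pi * \<bar>\<sigma>\<bar> - pi * \<sigma>\<^sup>2)"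
  proof -
    have "gauss \<sigma> * exp (128 * pi * \<bar>\<sigma>\<bar>) = exp (128 * pi * \<bar>\<sigma>\<bar> - pi * \<sigma>\<^sup>2)"
      unfolding gauss_def exp_add[symmetric] by simp
    then show ?thesis by (simp only: mult.left_commute[of "gauss \<sigma>"])
  qed
  also have "\<dots> \<le> (1/64) ^ n * (C_low / (1 + \<sigma>\<^sup>2))"
  proof (rule mult_left_mono)
    have "1 + \<sigma>\<^sup>2 \<le> exp (\<sigma>\<^sup>2)" by (rule exp_ge_add_one_self)
    then have "exp (128 * pi * \<bar>\<sigma>\<bar> - pi * \<sigma>\<^sup>2) * (1 + \<sigma>\<^sup>2) \<le> exp (128 * pi * \<bar>\<sigma>\<bar> - pi * \<sigma>\<^sup>2) * exp (\<sigma>\<^sup>2)"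
      by (rule mult_left_mono) simp
    also have "\<dots> = exp (128 * pi * \<bar>\<sigma>\<bar> - pi * \<sigma>\<^sup>2 + \<sigma>\<^sup>2)" by (simp add: exp_add)
    also have "\<dots> \<le> C_low"
    proof -
      have "3 * \<sigma>\<^sup>2 \<le> pi * \<sigma>\<^sup>2" using pi_gt3 by (intro mult_right_mono) auto
      \<comment> \<open>Completing the square:
        \<open>128 * pi * \<bar>\<sigma>\<bar> - 2 * \<sigma>\<^sup>2\<close> is maximal at
        \<open>\<bar>\<sigma>\<bar> = 32 * pi\<close>, with value \<open>2048 * pi\<^sup>2\<close>,
        the exponent in \<open>C_low\<close>.\<close>
      moreover have "0 \<le> 2 * (\<bar>\<sigma>\<bar> - 32 * pi)\<^sup>2" by simp
      then have "128 * pi * \<bar>\<sigma>\<bar> \<le> 2 * \<sigma>\<^sup>2 + 2048 * pi\<^sup>2"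
        by (simp add: power2_diff power_mult_distrib algebra_simps)
      ultimately show ?thesis by (simp add: C_low_def)
    qed
    finally show "exp (128 * pi * \<bar>\<sigma>\<bar> - pi * \<sigma>\<^sup>2) \<le> C_low / (1 + \<sigma>\<^sup>2)"
      by (simp add: pos_le_divide_eq add_pos_nonneg)
  qed simp
  finally show ?thesis
    by (simp add: gauss_coeff_def abs_mult power_abs mult_ac)
qed

text \<open>Peetre's inequality moves the centre from \<open>x - c\<close> back to \<open>x\<close>
  for a factor quadratic in \<open>c / t\<close>. The bound then involves a Cauchy kernel free of
  the translation, and the quadratic factor is later integrated against
  \<open>\<Psi>\<close>.\<close>

lemma gauss_coeff_cauchy:
  assumes t: "t > 0"
  shows "\<bar>gauss_coeff n ((x - c - s) / t) / t\<bar> \<le> 2 * C_low * (1 + (c / t)\<^sup>2) * (1/64) ^ n * cauchy t (x - s)"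
proof -
  define \<sigma> where "\<sigma> = (x - c - s) / t"
  define \<zeta> where "\<zeta> = c / t"
  have s': "(x - s) / t = \<sigma> + \<zeta>" using t by (simp add: \<sigma>_def \<zeta>_def field_simps)
  have "1 + (\<sigma> + \<zeta>)\<^sup>2 \<le> 2 * (1 + \<zeta>\<^sup>2) * (1 + \<sigma>\<^sup>2)"
  proof -
    have "0 \<le> (\<sigma> - \<zeta>)\<^sup>2 + 1 + 2 * (\<sigma>\<^sup>2 * \<zeta>\<^sup>2)" by (intro add_nonneg_nonneg) auto
    then show ?thesis by (simp add: power2_sum power2_diff algebra_simps)
  qed
  then have "1 / (1 + \<sigma>\<^sup>2) \<le> 2 * (1 + \<zeta>\<^sup>2) / (1 + (\<sigma> + \<zeta>)\<^sup>2)"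
    by (simp add: divide_simps add_pos_nonneg add_nonneg_eq_0_iff)
  then have "1 / (1 + \<sigma>\<^sup>2) / t \<le> 2 * (1 + \<zeta>\<^sup>2) / (1 + (\<sigma> + \<zeta>)\<^sup>2) / t"
    by (rule divide_right_mono) (use t in simp)
  also have "2 * (1 + \<zeta>\<^sup>2) / (1 + (\<sigma> + \<zeta>)\<^sup>2) / t = 2 * (1 + \<zeta>\<^sup>2) * cauchy t (x - s)"
  proof -
    have "t\<^sup>2 + (x - s)\<^sup>2 = t * (t * (1 + (\<sigma> + \<zeta>)\<^sup>2))"
      unfolding s'[symmetric] using t by (simp add: power2_eq_square field_simps)
    then have "cauchy t (x - s) = 1 / (1 + (\<sigma> + \<zeta>)\<^sup>2) / t"
      unfolding cauchy_def using t by simp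
    then show ?thesis by simp
  qed
  finally have k: "1 / (1 + \<sigma>\<^sup>2) / t \<le> 2 * (1 + \<zeta>\<^sup>2) * cauchy t (x - s)" .
  have "\<bar>gauss_coeff n \<sigma> / t\<bar> = \<bar>gauss_coeff n \<sigma>\<bar> / t" using t by simp
  also have "\<dots> \<le> C_low * (1/64) ^ n / (1 + \<sigma>\<^sup>2) / t"
    using t by (intro divide_right_mono gauss_coeff_le) simp
  also have "\<dots> = C_low * (1/64) ^ n * (1 / (1 + \<sigma>\<^sup>2) / t)" by simp
  also have "\<dots> \<le> C_low * (1/64) ^ n * (2 * (1 + \<zeta>\<^sup>2) * cauchy t (x - s))"
    by (intro mult_left_mono k) (simp add: C_low_def)
  finally show ?thesis by (simp add: \<sigma>_def \<zeta>_def mult_ac)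
qed

definition low_kernel :: "(plane \<Rightarrow> complex) \<Rightarrow> nat \<Rightarrow> plane \<Rightarrow> complex" where
  "low_kernel K n y = K y * (of_real (fst y) ^ n * of_real (gauss (fst y)))"

lemma amp_gauss: "amp 16 (\<lambda>y. complex_of_real (gauss (fst y)))"
  unfolding amp_def
proof (intro conjI ballI)
  have [measurable]: "(\<lambda>y :: plane. gauss (fst y)) \<in> borel_measurable borel"
    by (rule measurable_compose[OF plane_proj_measurable(1) gauss_measurable])
  show "(\<lambda>y :: plane. complex_of_real (gauss (fst y))) \<in> borel_measurable borel" by measurable
  fix y :: plane assume y: "y \<in> ann"
  show "cmod (complex_of_real (gauss (fst y))) \<le> 16" using gauss_le1[of "fst y"] by simp
  fix z :: plane assume z: "z \<in> ann"
  have lip: "\<bar>exp (- a) - exp (- b)\<bar> \<le> \<bar>a - b\<bar>" if "0 \<le> a" "0 \<le> b" for a b :: real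
  proof -
    have *: "exp (- a) - exp (- b) \<le> b - a" if "0 \<le> a" "a \<le> b" for a b :: real
    proof -
      have "1 + (- (b - a)) \<le> exp (- (b - a))" by (rule exp_ge_add_one_self)
      then have "1 - exp (- (b - a)) \<le> b - a" by linarith
      then have "exp (- a) * (1 - exp (- (b - a))) \<le> 1 * (b - a)"
        using that by (intro mult_mono) auto
      then show ?thesis by (simp add: algebra_simps exp_add[symmetric])
    qed
    show ?thesis using *[of a b] *[of b a] that by (cases "a \<le> b") (auto simp: abs_if)
  qed
  have "cmod (complex_of_real (gauss (fst y)) - complex_of_real (gauss (fst z))) = \<bar>gauss (fst y) - gauss (fst z)\<bar>"
    by (simp flip: of_real_diff)
  also have "\<dots> \<le> \<bar>pi * (fst y)\<^sup>2 - pi * (fst z)\<^sup>2\<bar>"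
    using lip[of "pi * (fst y)\<^sup>2" "pi * (fst z)\<^sup>2"] by (simp add: gauss_def)
  also have "\<dots> = pi * (\<bar>fst y + fst z\<bar> * \<bar>fst y - fst z\<bar>)"
  proof -
    have "pi * (fst y)\<^sup>2 - pi * (fst z)\<^sup>2 = pi * ((fst y + fst z) * (fst y - fst z))"
      by (simp add: power2_eq_square algebra_simps)
    then show ?thesis by (simp add: abs_mult)
  qed
  also have "\<dots> \<le> 4 * (4 * norm (y - z))"
  proof (intro mult_mono)
    show "\<bar>fst y + fst z\<bar> \<le> 4" using ann_coord(1)[OF y] ann_coord(1)[OF z] by linarith
    show "\<bar>fst y - fst z\<bar> \<le> norm (y - z)" using abs_fst_le_norm[of "y - z"] by simp
  qed (use pi_less_4 in auto)
  finally show "cmod (complex_of_real (gauss (fst y)) - complex_of_real (gauss (fst z))) \<le> 16 * norm (y - z)" by simp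
qed

lemma low_kernel_class:
  assumes K: "rough_class q N K" and q: "q > 0" and N: "N \<ge> 0"
  shows "rough_class q (64 * 4 ^ n * N) (low_kernel K n)"
  unfolding low_kernel_def[abs_def]
  using rough_class_mult[OF K amp_mult[OF amp_power[OF amp_fst, of n] amp_gauss] q N] by simp

text \<open>What remains of the bilinear operator at order \<open>n\<close> once the first input has
  been separated: a linear convolution operator acting on \<open>v\<close>.\<close>

definition W_low :: "(plane \<Rightarrow> complex) \<Rightarrow> real \<Rightarrow> (real \<Rightarrow> complex) \<Rightarrow> nat \<Rightarrow> real \<Rightarrow> complex" where
  "W_low K t v n x = (LINT y|lborel. low_kernel K n y * ift v (x - t * snd y))"

text \<open>On the frequency side \<open>W_low\<close> multiplies \<open>v\<close> by
  \<open>fourier (low_kernel K n) (0, t * \<xi>)\<close>. On the support of \<open>v\<close> this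
  point has norm at least \<open>\<rho>\<close>, where the rough class provides decay; Plancherel
  turns the bound on the multiplier into the claim.\<close>

lemma W_low_l2:
  assumes q: "q > 0" and K: "rough_class q N K" and N: "N > 0" and \<rho>: "2 \<le> \<rho>" and t: "t > 0" and v: "L2fun v"
    and far: "\<And>\<xi>. v \<xi> \<noteq> 0 \<Longrightarrow> \<rho> \<le> t * \<bar>\<xi>\<bar>"
  shows "(\<integral>\<^sup>+x. ennreal ((cmod (W_low K t v n x))\<^sup>2) \<partial>lborel) \<le> ennreal ((128 * 4 ^ n * N * \<rho> powr (- 1 / 8) * l2 v)\<^sup>2)"
proof -
  note LK = low_kernel_class[OF K q, of n]
  have N0: "N \<ge> 0" using N by simp
  have LKi: "integrable lborel (low_kernel K n)" by (rule rough_classD(3)[OF LK[OF N0]])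
  have [measurable]: "v \<in> borel_measurable borel" by (rule L2fun_measurable[OF v])
  have vi: "integrable lborel v" using v by (simp add: L2fun_def)
  define m where "m \<xi> = fourier (low_kernel K n) (0, t * \<xi>)" for \<xi>
  have [measurable]: "low_kernel K n \<in> borel_measurable borel" using LKi by auto
  have [measurable]: "m \<in> borel_measurable borel" unfolding m_def fourier_ee by measurable
  define B where "B = 128 * 4 ^ n * N * \<rho> powr (- 1 / 8)"
  have mb: "cmod (m \<xi>) \<le> B" if "v \<xi> \<noteq> 0" for \<xi>
  proof -
    have "norm (0 :: real, t * \<xi>) = t * \<bar>\<xi>\<bar>" using t by (simp add: norm_Pair abs_mult)
    then have "\<rho> \<le> norm (0 :: real, t * \<xi>)" using far[OF that] by simp
    then have "\<rho> / 2 \<le> norm (0 :: real, t * \<xi>)" using \<rho> by linarith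
    from rough_class_fourier_le[OF LK[OF N0] this \<rho>] show ?thesis
      using N by (simp add: m_def B_def mult_ac)
  qed
  have w: "cmod (v \<xi> * m \<xi>) \<le> B * cmod (v \<xi>)" for \<xi>
    using mult_right_mono[OF mb[of \<xi>], of "cmod (v \<xi>)"] by (cases "v \<xi> = 0") (auto simp: norm_mult mult.commute)
  have eq: "W_low K t v n x = ift (\<lambda>\<xi>. v \<xi> * m \<xi>) x" for x
  proof -
    have "W_low K t v n x = (LINT y|lborel. low_kernel K n y * (LINT \<xi>|lborel. v \<xi> * (\<lambda>p. ee ((x - t * snd (fst p)) * snd p)) (y, \<xi>)))"
      by (simp add: W_low_def ift_def)
    also have "\<dots> = (LINT \<xi>|lborel. v \<xi> * (LINT y|lborel. low_kernel K n y * (\<lambda>p. ee ((x - t * snd (fst p)) * snd p)) (y, \<xi>)))"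
      by (rule fubini_tensor[OF LKi vi, where C=1]) auto
    also have "\<dots> = ift (\<lambda>\<xi>. v \<xi> * m \<xi>) x"
      unfolding ift_def m_def fourier_ee
    proof (intro Bochner_Integration.integral_cong refl)
      fix \<xi> :: real
      have "low_kernel K n y * (\<lambda>p. ee ((x - t * snd (fst p)) * snd p)) (y, \<xi>) = (low_kernel K n y * ee (- (y \<bullet> (0, t * \<xi>)))) * ee (x * \<xi>)" for y
        by (simp add: mult.assoc ee_add[symmetric] inner_prod_def algebra_simps)
      then show "v \<xi> * (LINT y|lborel. low_kernel K n y * (\<lambda>p. ee ((x - t * snd (fst p)) * snd p)) (y, \<xi>))
        = v \<xi> * (LINT y|lborel. low_kernel K n y * ee (- (y \<bullet> (0, t * \<xi>)))) * ee (x * \<xi>)"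
        by (simp only: integral_mult_left_zero) (rule mult.assoc[symmetric])
    qed
    finally show ?thesis .
  qed
  have Lw: "L2fun (\<lambda>\<xi>. v \<xi> * m \<xi>)" by (rule L2fun_dominated(1)[OF v _ w]) measurable
  have B0: "B \<ge> 0" using N by (simp add: B_def)
  have "(\<integral>\<^sup>+x. ennreal ((cmod (W_low K t v n x))\<^sup>2) \<partial>lborel) \<le> ennreal ((l2 (\<lambda>\<xi>. v \<xi> * m \<xi>))\<^sup>2)"
    unfolding eq by (rule nn_integral_plancherel_le[OF Lw])
  also have "\<dots> \<le> ennreal ((B * l2 v)\<^sup>2)"
    using l2_dominated[OF v _ w B0] by (intro ennreal_leI power_mono) auto
  finally show ?thesis by (simp add: B_def)
qed

definition G_low :: "(plane \<Rightarrow> complex) \<Rightarrow> real \<Rightarrow> (real \<Rightarrow> complex) \<Rightarrow> real \<Rightarrow> ennreal" where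
  "G_low K t v x = (\<Sum>n. ennreal ((1/64) ^ n) * ennreal (cmod (W_low K t v n x)))"

lemma G_low_l2:
  assumes q: "q > 0" and K: "rough_class q N K" and N: "N > 0" and \<rho>: "2 \<le> \<rho>" and t: "t > 0" and v: "L2fun v"
    and far: "\<And>\<xi>. v \<xi> \<noteq> 0 \<Longrightarrow> \<rho> \<le> t * \<bar>\<xi>\<bar>"
  shows "(\<integral>\<^sup>+x. (G_low K t v x)\<^sup>2 \<partial>lborel) \<le> ennreal ((256 * N * \<rho> powr (- 1 / 8))\<^sup>2 * (l2 v)\<^sup>2)"
proof -
  note [measurable] = rough_classD(1)[OF K] L2fun_measurable[OF v]
  have [measurable]: "low_kernel K n \<in> borel_measurable borel" for n unfolding low_kernel_def by measurable
  have [measurable]: "W_low K t v n \<in> borel_measurable borel" for n unfolding W_low_def by measurable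
  define D where "D = (128 * N * \<rho> powr (- 1 / 8) * l2 v)\<^sup>2"
  have D: "D \<ge> 0" by (simp add: D_def)
  have pt: "(G_low K t v x)\<^sup>2 \<le> ennreal 2 * (\<Sum>n. ennreal ((1/64) ^ n) * ennreal ((cmod (W_low K t v n x))\<^sup>2))" for x
  proof -
    \<comment> \<open>The weight is split evenly, so that both factors of Cauchy--Schwarz in
      \<open>n\<close> keep a convergent series.\<close>
    have s8: "ennreal ((1/8) ^ n) * ennreal ((1/8) ^ n) = ennreal ((1/64) ^ n)" for n
      by (simp add: ennreal_mult'[symmetric] power_mult_distrib[symmetric])
    have "G_low K t v x = (\<integral>\<^sup>+n. ennreal ((1/8) ^ n) * (ennreal ((1/8) ^ n) * ennreal (cmod (W_low K t v n x))) \<partial>count_space UNIV)"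
      by (simp add: G_low_def nn_integral_count_space_nat mult.assoc[symmetric] s8)
    then have "(G_low K t v x)\<^sup>2 \<le> (\<integral>\<^sup>+n. (ennreal ((1/8) ^ n))\<^sup>2 \<partial>count_space UNIV) * (\<integral>\<^sup>+n. (ennreal ((1/8) ^ n) * ennreal (cmod (W_low K t v n x)))\<^sup>2 \<partial>count_space UNIV)"
      by (simp only:) (rule Cauchy_Schwarz_nn_integral; simp)
    also have "\<dots> = (\<Sum>n. ennreal ((1/64) ^ n)) * (\<Sum>n. ennreal ((1/64) ^ n) * ennreal ((cmod (W_low K t v n x))\<^sup>2))"
      by (simp add: nn_integral_count_space_nat power_mult_distrib power2_eq_square[of "ennreal ((1/8) ^ _)"] s8 ennreal_power)
    also have "(\<Sum>n. ennreal ((1/64) ^ n)) = ennreal (1 / (1 - 1/64))"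
      by (rule suminf_ennreal_eq[OF _ geometric_sums]) auto
    also have "\<dots> \<le> ennreal 2" by (rule ennreal_leI) simp
    finally show ?thesis by (simp add: mult_right_mono)
  qed
  have "(\<integral>\<^sup>+x. (G_low K t v x)\<^sup>2 \<partial>lborel) \<le> (\<integral>\<^sup>+x. ennreal 2 * (\<Sum>n. ennreal ((1/64) ^ n) * ennreal ((cmod (W_low K t v n x))\<^sup>2)) \<partial>lborel)"
    by (intro nn_integral_mono pt)
  also have "\<dots> = ennreal 2 * (\<Sum>n. ennreal ((1/64) ^ n) * (\<integral>\<^sup>+x. ennreal ((cmod (W_low K t v n x))\<^sup>2) \<partial>lborel))"
    by (subst nn_integral_cmult, measurable, subst nn_integral_suminf, measurable) (simp add: nn_integral_cmult)
  also have "\<dots> \<le> ennreal 2 * (\<Sum>n. ennreal ((1/64) ^ n) * ennreal ((128 * 4 ^ n * N * \<rho> powr (- 1 / 8) * l2 v)\<^sup>2))"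
    by (intro mult_left_mono suminf_le W_low_l2[OF q K N \<rho> t v far]) auto
  also have "(\<Sum>n. ennreal ((1/64) ^ n) * ennreal ((128 * 4 ^ n * N * \<rho> powr (- 1 / 8) * l2 v)\<^sup>2)) = (\<Sum>n. ennreal ((1/4) ^ n * D))"
  proof (intro suminf_cong)
    fix n
    have "(1/64 :: real) ^ n * (4 ^ n * 4 ^ n) = (1/4) ^ n"
      by (simp add: power_mult_distrib[symmetric])
    moreover have "(1/64 :: real) ^ n * (128 * 4 ^ n * N * \<rho> powr (- 1 / 8) * l2 v)\<^sup>2 = ((1/64) ^ n * (4 ^ n * 4 ^ n)) * D"
      unfolding D_def power2_eq_square by (simp only: mult_ac)
    ultimately have "(1/64) ^ n * (128 * 4 ^ n * N * \<rho> powr (- 1 / 8) * l2 v)\<^sup>2 = (1/4) ^ n * D" by (simp only:)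
    then show "ennreal ((1/64) ^ n) * ennreal ((128 * 4 ^ n * N * \<rho> powr (- 1 / 8) * l2 v)\<^sup>2) = ennreal ((1/4) ^ n * D)"
      by (simp add: ennreal_mult'[symmetric])
  qed
  also have "(\<Sum>n. ennreal ((1/4) ^ n * D)) = ennreal (1 / (1 - 1/4) * D)"
    by (rule suminf_ennreal_eq[OF _ sums_mult2[OF geometric_sums]]) (use D in auto)
  also have "ennreal 2 * ennreal (1 / (1 - 1/4) * D) \<le> ennreal (4 * D)"
    using D by (subst ennreal_mult[symmetric]) (auto intro!: ennreal_leI)
  also have "4 * D = (256 * N * \<rho> powr (- 1 / 8))\<^sup>2 * (l2 v)\<^sup>2"
    by (simp add: D_def power_mult_distrib)
  finally show ?thesis .
qed

lemma sums_integral_dominated: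
  fixes f :: "nat \<Rightarrow> 'a \<Rightarrow> complex"
  assumes i: "\<And>n. integrable M (f n)" and s: "\<And>x. (\<lambda>n. f n x) sums g x"
    and w: "integrable M w" and le: "\<And>n x. cmod (f n x) \<le> b n * w x" and b: "summable b"
  shows "(\<lambda>n. LINT x|M. f n x) sums (LINT x|M. g x)"
proof -
  have "summable (\<lambda>n. LINT x|M. cmod (f n x))"
  proof (rule summable_comparison_test')
    show "summable (\<lambda>n. b n * (LINT x|M. w x))" using b by (rule summable_mult2)
    fix n
    have "(LINT x|M. cmod (f n x)) \<le> (LINT x|M. b n * w x)"
      by (rule integral_mono) (use i w le in auto)
    then show "norm (LINT x|M. cmod (f n x)) \<le> b n * (LINT x|M. w x)" by simp
  qed
  moreover have "summable (\<lambda>n. cmod (f n x))" for x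
    by (rule summable_comparison_test'[OF summable_mult2[OF b, of "w x"]]) (use le in auto)
  ultimately have "(\<lambda>n. LINT x|M. f n x) sums (LINT x|M. (\<Sum>n. f n x))"
    by (intro sums_integral i AE_I2)
  moreover have "(\<Sum>n. f n x) = g x" for x using s by (simp add: sums_iff)
  ultimately show ?thesis by simp
qed

lemma W_low_modulate: "W_low K t (modulate c v) n x = W_low K t v n (x - c)"
  by (simp add: W_low_def ift_modulate algebra_simps)

lemma G_low_modulate: "G_low K t (modulate c v) x = G_low K t v (x - c)"
  by (simp add: G_low_def W_low_modulate)

lemma G_low_measurable [measurable]:
  assumes [measurable]: "K \<in> borel_measurable borel" "v \<in> borel_measurable borel"
  shows "G_low K t v \<in> borel_measurable borel"
proof -
  have [measurable]: "low_kernel K n \<in> borel_measurable borel" for n unfolding low_kernel_def by measurable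
  have [measurable]: "W_low K t v n \<in> borel_measurable borel" for n unfolding W_low_def by measurable
  show ?thesis unfolding G_low_def by measurable
qed

lemma power_gauss_le:
  assumes "\<bar>y\<bar> \<le> 2" shows "\<bar>y ^ n * gauss y\<bar> \<le> 2 ^ n"
proof -
  have "\<bar>y\<bar> ^ n * \<bar>gauss y\<bar> \<le> 2 ^ n * 1"
    by (intro mult_mono power_mono assms) (auto simp: gauss_le1)
  then show ?thesis by (simp add: abs_mult power_abs)
qed

definition cauchy_avg :: "(real \<Rightarrow> complex) \<Rightarrow> real \<Rightarrow> real \<Rightarrow> ennreal" where
  "cauchy_avg f t x = (\<integral>\<^sup>+s. ennreal (cmod (f s)) * ennreal (cauchy t (x - s)) \<partial>lborel)"

text \<open>The expansion of the Gaussian about \<open>x - s\<close> in powers of \<open>fst y\<close> separates the two inputs, and its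
  coefficients are dominated by the Cauchy kernel.\<close>
lemma T_dil_low_le:
  assumes K: "rough_class q N K" and t: "t > 0" and f: "integrable lborel f" and v: "integrable lborel v"
  shows "ennreal (cmod (T_dil K t (modulate c (low t (fourier f))) v x))
    \<le> ennreal (2 * C_low * (1 + (c / t)\<^sup>2)) * (cauchy_avg f t x * G_low K t v x)"
proof -
  note Km [measurable] = rough_classD(1)[OF K]
  note Ki = rough_classD(3)[OF K]
  have [measurable]: "f \<in> borel_measurable borel" "v \<in> borel_measurable borel" using f v by auto
  define V where "V = (LINT \<xi>|lborel. cmod (v \<xi>))"
  have V: "cmod (ift v y) \<le> V" "V \<ge> 0" for y unfolding V_def by (rule norm_ift_le[OF v]) simp
  define F where "F = (LINT s|lborel. cmod (f s))"
  have F: "F \<ge> 0" by (simp add: F_def)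
  define \<sigma> where "\<sigma> s = (x - c - s) / t" for s
  have [measurable]: "\<sigma> \<in> borel_measurable borel" unfolding \<sigma>_def by measurable
  define A where "A n = (LINT s|lborel. f s * of_real (gauss_coeff n (\<sigma> s) / t))" for n
  have cb: "\<bar>gauss_coeff n s / t\<bar> \<le> C_low / t * (1/64) ^ n" for n s
  proof -
    have "\<bar>gauss_coeff n s\<bar> \<le> C_low * (1/64) ^ n / 1"
      by (rule order_trans[OF gauss_coeff_le]) (intro divide_left_mono, auto simp: C_low_def intro: add_pos_nonneg)
    then show ?thesis using t by (simp add: divide_right_mono)
  qed
  have Ai: "integrable lborel (\<lambda>s. f s * of_real (gauss_coeff n (\<sigma> s) / t))" for n
    by (rule integrable_mult_bdd(1)[OF f, where C="C_low / t * (1/64) ^ n"]) (use cb in \<open>auto simp del: of_real_divide\<close>)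
  define B where "B = C_low / t * F"
  have B: "B \<ge> 0" using t F by (simp add: B_def C_low_def)
  have Ab: "cmod (A n) \<le> (1/64) ^ n * B" for n
  proof -
    have "cmod (A n) \<le> (LINT s|lborel. cmod (f s) * (C_low / t * (1/64) ^ n))"
      unfolding A_def
    proof (rule Bochner_Integration.integral_norm_bound_integral[OF Ai])
      show "cmod (f s * of_real (gauss_coeff n (\<sigma> s) / t)) \<le> cmod (f s) * (C_low / t * (1/64) ^ n)" for s
        unfolding norm_mult norm_of_real by (intro mult_left_mono cb) simp
    qed (use f in simp)
    then show ?thesis by (simp add: B_def F_def mult_ac)
  qed
  have Aavg: "ennreal (cmod (A n)) \<le> ennreal (2 * C_low * (1 + (c / t)\<^sup>2)) * (ennreal ((1/64) ^ n) * cauchy_avg f t x)" for n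
  proof -
    have "ennreal (cmod (A n)) \<le> (\<integral>\<^sup>+s. ennreal (cmod (f s * of_real (gauss_coeff n (\<sigma> s) / t))) \<partial>lborel)"
      unfolding A_def by (rule integral_norm_bound_ennreal[OF Ai])
    also have "\<dots> \<le> (\<integral>\<^sup>+s. ennreal (2 * C_low * (1 + (c / t)\<^sup>2)) * (ennreal ((1/64) ^ n) * (ennreal (cmod (f s)) * ennreal (cauchy t (x - s)))) \<partial>lborel)"
    proof (intro nn_integral_mono)
      fix s
      have c0: "0 \<le> 2 * C_low * (1 + (c / t)\<^sup>2)" by (intro mult_nonneg_nonneg add_nonneg_nonneg) (auto simp: C_low_def)
      have "cmod (f s * of_real (gauss_coeff n (\<sigma> s) / t)) \<le> cmod (f s) * (2 * C_low * (1 + (c / t)\<^sup>2) * (1/64) ^ n * cauchy t (x - s))"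
        unfolding norm_mult norm_of_real \<sigma>_def by (intro mult_left_mono gauss_coeff_cauchy[OF t]) simp
      also have "\<dots> = (2 * C_low * (1 + (c / t)\<^sup>2)) * ((1/64) ^ n * (cmod (f s) * cauchy t (x - s)))" by (simp only: mult_ac)
      finally have "ennreal (cmod (f s * of_real (gauss_coeff n (\<sigma> s) / t))) \<le> ennreal ((2 * C_low * (1 + (c / t)\<^sup>2)) * ((1/64) ^ n * (cmod (f s) * cauchy t (x - s))))"
        by (rule ennreal_leI)
      also have "\<dots> = ennreal (2 * C_low * (1 + (c / t)\<^sup>2)) * (ennreal ((1/64) ^ n) * (ennreal (cmod (f s)) * ennreal (cauchy t (x - s))))"
        by (simp only: ennreal_mult'[OF c0] ennreal_mult'[of "(1/64) ^ n"] ennreal_mult'[OF norm_ge_zero] zero_le_power zero_le_divide_1_iff zero_le_numeral)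
      finally show "ennreal (cmod (f s * of_real (gauss_coeff n (\<sigma> s) / t))) \<le> ennreal (2 * C_low * (1 + (c / t)\<^sup>2)) * (ennreal ((1/64) ^ n) * (ennreal (cmod (f s)) * ennreal (cauchy t (x - s))))" .
    qed
    also have "\<dots> = ennreal (2 * C_low * (1 + (c / t)\<^sup>2)) * (ennreal ((1/64) ^ n) * cauchy_avg f t x)"
      by (simp add: nn_integral_cmult cauchy_avg_def)
    finally show ?thesis .
  qed
  have expand: "(\<lambda>n. of_real (y ^ n * gauss y) * A n) sums ift (low t (fourier f)) (x - t * y - c)" if y: "\<bar>y\<bar> \<le> 2" for y
  proof -
    note yb = power_gauss_le[OF y]
    have "(\<lambda>n. LINT s|lborel. f s * of_real (gauss_coeff n (\<sigma> s) / t * (y ^ n * gauss y))) sums (LINT s|lborel. f s * of_real (gauss (\<sigma> s - y) / t))"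
    proof (rule sums_integral_dominated[where w="\<lambda>s. C_low / t * cmod (f s)" and b="\<lambda>n. (1/32) ^ n"])
      have le: "\<bar>gauss_coeff n s / t * (y ^ n * gauss y)\<bar> \<le> (1/32) ^ n * (C_low / t)" for n s
      proof -
        have "\<bar>gauss_coeff n s / t * (y ^ n * gauss y)\<bar> \<le> (C_low / t * (1/64) ^ n) * 2 ^ n"
          unfolding abs_mult[of "gauss_coeff n s / t"]
          using t by (intro mult_mono cb yb mult_nonneg_nonneg) (auto simp: C_low_def)
        also have "\<dots> = ((1/64) ^ n * 2 ^ n) * (C_low / t)" by (simp only: mult_ac)
        also have "(1/64 :: real) ^ n * 2 ^ n = (1/32) ^ n" by (simp add: power_mult_distrib[symmetric])
        finally show ?thesis .
      qed
      show "integrable lborel (\<lambda>s. f s * of_real (gauss_coeff n (\<sigma> s) / t * (y ^ n * gauss y)))" for n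
        by (rule integrable_mult_bdd(1)[OF f, where C="(1/32) ^ n * (C_low / t)"])
           (measurable, simp only: norm_of_real le)
      show "cmod (f s * of_real (gauss_coeff n (\<sigma> s) / t * (y ^ n * gauss y))) \<le> (1/32) ^ n * (C_low / t * cmod (f s))" for n s
        using mult_left_mono[OF le[of n "\<sigma> s"], of "cmod (f s)"] unfolding norm_mult norm_of_real by (simp only: norm_ge_zero mult_ac)
      show "(\<lambda>n. f s * of_real (gauss_coeff n (\<sigma> s) / t * (y ^ n * gauss y))) sums (f s * of_real (gauss (\<sigma> s - y) / t))" for s
      proof -
        have "(\<lambda>n. gauss_coeff n (\<sigma> s) * (y ^ n * gauss y) / t) sums (gauss (\<sigma> s - y) / t)"
          by (intro sums_divide gauss_shift_sums)
        then have "(\<lambda>n. complex_of_real (gauss_coeff n (\<sigma> s) * (y ^ n * gauss y) / t)) sums of_real (gauss (\<sigma> s - y) / t)"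
          by (simp only: sums_of_real_iff)
        then show ?thesis by (intro sums_mult) (simp only: times_divide_eq_left)
      qed
      show "integrable lborel (\<lambda>s. C_low / t * cmod (f s))" using f by simp
    qed (rule summable_geometric, simp)
    moreover have "(LINT s|lborel. f s * of_real (gauss_coeff n (\<sigma> s) / t * (y ^ n * gauss y))) = of_real (y ^ n * gauss y) * A n" for n
    proof -
      have gen: "z * of_real (a * b) = of_real b * (z * of_real a)" for z :: complex and a b by simp
      show ?thesis unfolding A_def integral_mult_right_zero[symmetric] gen ..
    qed
    moreover have "(LINT s|lborel. f s * of_real (gauss (\<sigma> s - y) / t)) = ift (low t (fourier f)) (x - t * y - c)"
    proof -
      have "\<sigma> s - y = (x - t * y - c - s) / t" for s using t by (simp add: \<sigma>_def field_simps)
      then show ?thesis by (simp only: ift_low_fourier[OF f t])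
    qed
    ultimately show ?thesis by (simp only:)
  qed
  define T where "T n y = K y * (of_real (fst y ^ n * gauss (fst y)) * A n * ift v (x - t * snd y))" for n y
  have TW: "T n y = A n * (low_kernel K n y * ift v (x - t * snd y))" for n y
    by (simp add: T_def low_kernel_def mult_ac)
  have gl: "cmod (of_real (fst y ^ n * gauss (fst y)) :: complex) \<le> 2 ^ n" if "y \<in> ann" for n and y :: plane
    unfolding norm_of_real by (rule power_gauss_le[OF ann_coord(1)[OF that]])
  have Tb: "cmod (T n y) \<le> (1/32) ^ n * (B * V * cmod (K y))" for n y
  proof (cases "y \<in> ann")
    case True
    have "cmod (T n y) = cmod (K y) * (cmod (of_real (fst y ^ n * gauss (fst y)) :: complex) * cmod (A n) * cmod (ift v (x - t * snd y)))"
      by (simp only: T_def norm_mult mult.assoc)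
    also have "\<dots> \<le> cmod (K y) * (2 ^ n * ((1/64) ^ n * B) * V)"
      using B by (intro mult_left_mono mult_mono gl[OF True] Ab V mult_nonneg_nonneg) auto
    also have "\<dots> = ((1/64) ^ n * 2 ^ n) * (B * V * cmod (K y))" by (simp only: mult_ac)
    also have "(1/64 :: real) ^ n * 2 ^ n = (1/32) ^ n" by (simp add: power_mult_distrib[symmetric])
    finally show ?thesis .
  qed (simp add: T_def rough_classD(2)[OF K])
  have [measurable]: "T n \<in> borel_measurable borel" for n
  proof -
    have [measurable]: "(\<lambda>y :: plane. gauss (fst y)) \<in> borel_measurable borel"
      by (rule measurable_compose[OF plane_proj_measurable(1) gauss_measurable])
    show ?thesis unfolding T_def by measurable
  qed
  have "ennreal (cmod (T_dil K t (modulate c (low t (fourier f))) v x)) \<le> (\<Sum>n. ennreal (cmod (LINT y|lborel. T n y)))"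
    unfolding T_dil_def ift_modulate
  proof (rule norm_integral_le_suminf[where w="\<lambda>y. B * V * cmod (K y)" and b="\<lambda>n. (1/32) ^ n"])
    show "integrable lborel (T n)" for n
    proof (rule Bochner_Integration.integrable_bound[of _ "\<lambda>y. (1/32) ^ n * (B * V * cmod (K y))"])
      show "AE y in lborel. norm (T n y) \<le> norm ((1/32) ^ n * (B * V * cmod (K y)))"
        using Tb order_trans[OF Tb abs_ge_self] by auto
    qed (use Ki in auto)
    show "(\<lambda>n. T n y) sums (K y * (ift (low t (fourier f)) (x - t * fst y - c) * ift v (x - t * snd y)))" for y
    proof (cases "y \<in> ann")
      case True
      show ?thesis unfolding T_def by (intro sums_mult sums_mult2 expand ann_coord(1) True)
    qed (simp add: T_def rough_classD(2)[OF K])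
    show "summable (\<lambda>n. (1/32 :: real) ^ n)" by (rule summable_geometric) simp
  qed (use Ki Tb B V in auto)
  also have "\<dots> = (\<Sum>n. ennreal (cmod (A n)) * ennreal (cmod (W_low K t v n x)))"
    unfolding TW W_low_def integral_mult_right_zero norm_mult by (simp only: ennreal_mult'[OF norm_ge_zero])
  also have "\<dots> \<le> (\<Sum>n. ennreal (2 * C_low * (1 + (c / t)\<^sup>2)) * (ennreal ((1/64) ^ n) * cauchy_avg f t x) * ennreal (cmod (W_low K t v n x)))"
    by (intro suminf_le mult_right_mono Aavg) auto
  also have "\<dots> = (\<Sum>n. ennreal (2 * C_low * (1 + (c / t)\<^sup>2)) * (cauchy_avg f t x * (ennreal ((1/64) ^ n) * ennreal (cmod (W_low K t v n x)))))"
    by (simp only: mult_ac)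
  also have "\<dots> = ennreal (2 * C_low * (1 + (c / t)\<^sup>2)) * (cauchy_avg f t x * G_low K t v x)"
    unfolding G_low_def ennreal_suminf_cmult ..
  finally show ?thesis .
qed

lemma SUP_power2_le:
  fixes a :: "'i \<Rightarrow> ennreal"
  assumes "\<And>i. (a i)\<^sup>2 \<le> S"
  shows "(SUP i. a i)\<^sup>2 \<le> S"
proof -
  have p: "a i * a j \<le> S" for i j
  proof (cases "a i \<le> a j")
    case True
    then have "a i * a j \<le> a j * a j" by (rule mult_right_mono) simp
    then show ?thesis using assms[of j] by (simp add: power2_eq_square)
  next
    case False
    then have "a i * a j \<le> a i * a i" by (intro mult_left_mono) auto
    then show ?thesis using assms[of i] by (simp add: power2_eq_square)
  qed
  have "(SUP i. a i)\<^sup>2 = (SUP i. a i * (SUP j. a j))"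
    unfolding power2_eq_square by (simp only: SUP_mult_right_ennreal UNIV_not_empty)
  also have "\<dots> = (SUP i. SUP j. a i * a j)"
    by (simp only: SUP_mult_left_ennreal UNIV_not_empty)
  also have "\<dots> \<le> S" by (intro SUP_least p)
  finally show ?thesis .
qed

lemma nn_integral_translate:
  fixes f :: "'a::euclidean_space \<Rightarrow> ennreal"
  assumes [measurable]: "f \<in> borel_measurable borel"
  shows "(\<integral>\<^sup>+y. f (y - z) \<partial>lborel) = (\<integral>\<^sup>+y. f y \<partial>lborel)"
proof -
  have "(\<integral>\<^sup>+y. f y \<partial>distr lborel borel ((+) (- z))) = (\<integral>\<^sup>+y. f ((- z) + y) \<partial>lborel)"
    by (rule nn_integral_distr) auto
  then show ?thesis by (simp add: lborel_distr_plus)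
qed

text \<open>The supremum falls on the two factors separately. The Cauchy averages of
  \<open>f\<close> stay below the maximal function \<open>M\<close> at every scale; the supremum of
  the \<open>G_low\<close> terms is bounded by their square sum, which converges since the
  \<open>v \<gamma>\<close> are square summable. Translating the low-pass input costs
  \<open>1 + (fst \<zeta>)\<^sup>2\<close>, which \<open>P\<close> pays for.\<close>

lemma T_avg_low_sup_le:
  fixes v :: "int \<Rightarrow> real \<Rightarrow> complex"
  assumes q: "q > 0" and K: "rough_class q N K" and N: "N > 0" and \<rho>: "2 \<le> \<rho>" and \<tau>: "0 \<le> \<tau>" "\<tau> \<le> 1"
    and f: "L2fun f" "L2fun (fourier f)" and v: "\<And>\<gamma>. L2fun (v \<gamma>)"
    and far: "\<And>\<gamma> \<xi>. v \<gamma> \<xi> \<noteq> 0 \<Longrightarrow> \<rho> \<le> 2 powi \<gamma> * \<bar>\<xi>\<bar>"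
    and S: "(\<integral>\<^sup>+\<gamma>. ennreal ((l2 (v \<gamma>))\<^sup>2) \<partial>count_space UNIV) \<le> ennreal (S\<^sup>2)" "S \<ge> 0"
    and \<Psi>: "integrable lborel \<Psi>" and P: "(\<integral>\<^sup>+\<zeta>. ennreal (cmod (\<Psi> \<zeta>) * (1 + (fst \<zeta>)\<^sup>2)) \<partial>lborel) \<le> ennreal P" "P \<ge> 0"
  shows "(\<integral>\<^sup>+x. (SUP \<gamma>. ennreal (cmod (T_avg \<Psi> K (2 powi \<gamma>) (2 powi \<gamma> * \<tau>) (low (2 powi \<gamma>) (fourier f)) (v \<gamma>) x))) \<partial>lborel)
    \<le> ennreal (P * (2 * C_low * (8 * pi * l2 f * (256 * N * \<rho> powr (- 1 / 8) * S))))"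
proof -
  have fi: "integrable lborel f" and Fi: "integrable lborel (low t (fourier f))" and vi: "integrable lborel (v \<gamma>)" for t \<gamma>
    using f v[of \<gamma>] L2fun_low[OF f(2), of t] by (auto simp: L2fun_def)
  have [measurable]: "f \<in> borel_measurable borel" "\<Psi> \<in> borel_measurable borel" "v \<gamma> \<in> borel_measurable borel" for \<gamma>
    using fi \<Psi> vi by auto
  note Km [measurable] = rough_classD(1)[OF K]
  define M where "M = maxfun (\<lambda>s. ennreal (cmod (f s)))"
  have [measurable]: "M \<in> borel_measurable borel" unfolding M_def by measurable
  \<comment> \<open>The translation of the second input depends on \<open>\<gamma>\<close>, so it
    stays inside the supremum; it is removed by translation invariance after the supremum has been
    replaced by a sum.\<close>
  define H where "H \<zeta> x = (SUP \<gamma>. G_low K (2 powi \<gamma>) (v \<gamma>) (x - 2 powi \<gamma> * \<tau> * snd \<zeta>))" for \<zeta> :: plane and x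
  have Hm [measurable]: "(\<lambda>p. H (snd p) (fst p)) \<in> borel_measurable (lborel \<Otimes>\<^sub>M lborel)"
    unfolding H_def by measurable
  have Hm' [measurable]: "H \<zeta> \<in> borel_measurable borel" for \<zeta> unfolding H_def by measurable
  have pt: "(SUP \<gamma>. ennreal (cmod (T_avg \<Psi> K (2 powi \<gamma>) (2 powi \<gamma> * \<tau>) (low (2 powi \<gamma>) (fourier f)) (v \<gamma>) x)))
    \<le> (\<integral>\<^sup>+\<zeta>. ennreal (cmod (\<Psi> \<zeta>) * (1 + (fst \<zeta>)\<^sup>2)) * (ennreal (2 * C_low) * (M x * H \<zeta> x)) \<partial>lborel)" for x
  proof (rule SUP_least)
    fix \<gamma> :: int
    let ?t = "2 powi \<gamma> :: real"
    have t: "?t > 0" by simp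
    have "ennreal (cmod (T_avg \<Psi> K ?t (?t * \<tau>) (low ?t (fourier f)) (v \<gamma>) x))
      \<le> (\<integral>\<^sup>+\<zeta>. ennreal (cmod (\<Psi> \<zeta>)) * ennreal (cmod (T_dil K ?t (modulate (?t * \<tau> * fst \<zeta>) (low ?t (fourier f))) (modulate (?t * \<tau> * snd \<zeta>) (v \<gamma>)) x)) \<partial>lborel)"
      by (rule T_avg_norm_le[OF rough_classD(3)[OF K] \<Psi> Fi vi])
    also have "\<dots> \<le> (\<integral>\<^sup>+\<zeta>. ennreal (cmod (\<Psi> \<zeta>) * (1 + (fst \<zeta>)\<^sup>2)) * (ennreal (2 * C_low) * (M x * H \<zeta> x)) \<partial>lborel)"
    proof (intro nn_integral_mono)
      fix \<zeta> :: plane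
      have "integrable lborel (modulate c (v \<gamma>))" for c using L2fun_modulate[OF v] by (simp add: L2fun_def)
      from T_dil_low_le[OF K t fi this]
      have "ennreal (cmod (T_dil K ?t (modulate (?t * \<tau> * fst \<zeta>) (low ?t (fourier f))) (modulate (?t * \<tau> * snd \<zeta>) (v \<gamma>)) x))
        \<le> ennreal (2 * C_low * (1 + (?t * \<tau> * fst \<zeta> / ?t)\<^sup>2)) * (cauchy_avg f ?t x * G_low K ?t (modulate (?t * \<tau> * snd \<zeta>) (v \<gamma>)) x)" .
      also have "\<dots> \<le> ennreal (2 * C_low * (1 + (fst \<zeta>)\<^sup>2)) * (M x * H \<zeta> x)"
      proof (rule mult_mono[OF ennreal_leI mult_mono])
        \<comment> \<open>Measured in units of \<open>2 powi \<gamma>\<close> the translation is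
          \<open>\<tau> * fst \<zeta>\<close>, and \<open>\<tau> \<le> 1\<close>.\<close>
        have "(\<tau> * fst \<zeta>)\<^sup>2 \<le> 1 * (fst \<zeta>)\<^sup>2"
          unfolding power_mult_distrib using \<tau> by (intro mult_right_mono power_le_one) auto
        then show "2 * C_low * (1 + (?t * \<tau> * fst \<zeta> / ?t)\<^sup>2) \<le> 2 * C_low * (1 + (fst \<zeta>)\<^sup>2)"
          by (simp add: C_low_def mult.assoc)
        show "cauchy_avg f ?t x \<le> M x"
          unfolding M_def maxfun_def cauchy_avg_def by (rule SUP_upper) simp
        show "G_low K ?t (modulate (?t * \<tau> * snd \<zeta>) (v \<gamma>)) x \<le> H \<zeta> x"
          unfolding G_low_modulate H_def by (rule SUP_upper) simp
      qed auto
      finally have "ennreal (cmod (\<Psi> \<zeta>)) * ennreal (cmod (T_dil K ?t (modulate (?t * \<tau> * fst \<zeta>) (low ?t (fourier f))) (modulate (?t * \<tau> * snd \<zeta>) (v \<gamma>)) x))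
         \<le> ennreal (cmod (\<Psi> \<zeta>)) * (ennreal (2 * C_low * (1 + (fst \<zeta>)\<^sup>2)) * (M x * H \<zeta> x))"
        by (rule mult_left_mono) simp
      also have "\<dots> = ennreal (cmod (\<Psi> \<zeta>) * (1 + (fst \<zeta>)\<^sup>2)) * (ennreal (2 * C_low) * (M x * H \<zeta> x))"
      proof -
        have c: "0 \<le> 2 * C_low" by (simp add: C_low_def)
        show ?thesis unfolding ennreal_mult'[OF norm_ge_zero] ennreal_mult'[OF c] by (simp only: mult_ac)
      qed
      finally show "ennreal (cmod (\<Psi> \<zeta>)) * ennreal (cmod (T_dil K ?t (modulate (?t * \<tau> * fst \<zeta>) (low ?t (fourier f))) (modulate (?t * \<tau> * snd \<zeta>) (v \<gamma>)) x))
        \<le> ennreal (cmod (\<Psi> \<zeta>) * (1 + (fst \<zeta>)\<^sup>2)) * (ennreal (2 * C_low) * (M x * H \<zeta> x))" .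
    qed
    finally show "ennreal (cmod (T_avg \<Psi> K ?t (?t * \<tau>) (low ?t (fourier f)) (v \<gamma>) x))
      \<le> (\<integral>\<^sup>+\<zeta>. ennreal (cmod (\<Psi> \<zeta>) * (1 + (fst \<zeta>)\<^sup>2)) * (ennreal (2 * C_low) * (M x * H \<zeta> x)) \<partial>lborel)" .
  qed
  define Z where "Z = 8 * pi * l2 f * (256 * N * \<rho> powr (- 1 / 8) * S)"
  have Z0: "Z \<ge> 0" using N S by (simp add: Z_def)
  have MH: "(\<integral>\<^sup>+x. M x * H \<zeta> x \<partial>lborel) \<le> ennreal Z" for \<zeta>
  proof -
    have "(\<integral>\<^sup>+x. (M x)\<^sup>2 \<partial>lborel) \<le> ennreal ((8 * pi)\<^sup>2) * (\<integral>\<^sup>+x. (ennreal (cmod (f x)))\<^sup>2 \<partial>lborel)"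
      unfolding M_def by (rule maximal_L2) measurable
    also have "\<dots> = ennreal ((8 * pi)\<^sup>2) * ennreal ((l2 f)\<^sup>2)"
      using nn_integral_l2[of f] f(1) by (simp add: ennreal_power L2fun_def)
    finally have M2: "(\<integral>\<^sup>+x. (M x)\<^sup>2 \<partial>lborel) \<le> ennreal ((8 * pi)\<^sup>2) * ennreal ((l2 f)\<^sup>2)" .
    have "(\<integral>\<^sup>+x. (H \<zeta> x)\<^sup>2 \<partial>lborel) \<le> (\<integral>\<^sup>+x. (\<integral>\<^sup>+\<gamma>. (G_low K (2 powi \<gamma>) (v \<gamma>) (x - 2 powi \<gamma> * \<tau> * snd \<zeta>))\<^sup>2 \<partial>count_space UNIV) \<partial>lborel)"
      unfolding H_def by (intro nn_integral_mono SUP_power2_le nn_integral_ge_point) simp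
    also have "\<dots> = (\<integral>\<^sup>+\<gamma>. (\<integral>\<^sup>+x. (G_low K (2 powi \<gamma>) (v \<gamma>) (x - 2 powi \<gamma> * \<tau> * snd \<zeta>))\<^sup>2 \<partial>lborel) \<partial>count_space UNIV)"
      by (rule nn_integral_count_space_nn_integral) (auto)
    also have "\<dots> = (\<integral>\<^sup>+\<gamma>. (\<integral>\<^sup>+x. (G_low K (2 powi \<gamma>) (v \<gamma>) x)\<^sup>2 \<partial>lborel) \<partial>count_space UNIV)"
      by (intro nn_integral_cong nn_integral_translate[where f="\<lambda>x. (G_low K (2 powi _) (v _) x)\<^sup>2"]) measurable
    also have "\<dots> \<le> (\<integral>\<^sup>+\<gamma>. ennreal ((256 * N * \<rho> powr (- 1 / 8))\<^sup>2 * (l2 (v \<gamma>))\<^sup>2) \<partial>count_space UNIV)"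
      by (intro nn_integral_mono G_low_l2[OF q K N \<rho> _ v far]) simp
    also have "\<dots> = ennreal ((256 * N * \<rho> powr (- 1 / 8))\<^sup>2) * (\<integral>\<^sup>+\<gamma>. ennreal ((l2 (v \<gamma>))\<^sup>2) \<partial>count_space UNIV)"
      by (simp add: ennreal_mult' nn_integral_cmult)
    also have "\<dots> \<le> ennreal ((256 * N * \<rho> powr (- 1 / 8))\<^sup>2) * ennreal (S\<^sup>2)"
      by (intro mult_left_mono S) simp
    finally have H2: "(\<integral>\<^sup>+x. (H \<zeta> x)\<^sup>2 \<partial>lborel) \<le> ennreal ((256 * N * \<rho> powr (- 1 / 8))\<^sup>2) * ennreal (S\<^sup>2)" .
    have "(\<integral>\<^sup>+x. M x * H \<zeta> x \<partial>lborel)\<^sup>2 \<le> (\<integral>\<^sup>+x. (M x)\<^sup>2 \<partial>lborel) * (\<integral>\<^sup>+x. (H \<zeta> x)\<^sup>2 \<partial>lborel)"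
      by (rule Cauchy_Schwarz_nn_integral) auto
    also have "\<dots> \<le> (ennreal ((8 * pi)\<^sup>2) * ennreal ((l2 f)\<^sup>2)) * (ennreal ((256 * N * \<rho> powr (- 1 / 8))\<^sup>2) * ennreal (S\<^sup>2))"
      by (intro mult_mono M2 H2) auto
    also have "\<dots> = (ennreal Z)\<^sup>2"
      unfolding Z_def ennreal_power[OF Z0[unfolded Z_def]] power_mult_distrib by (simp only: ennreal_mult'[symmetric] zero_le_power2 mult_nonneg_nonneg mult.assoc)
    finally show ?thesis by (rule ennreal_power2_le_imp_le)
  qed
  have "(\<integral>\<^sup>+x. (SUP \<gamma>. ennreal (cmod (T_avg \<Psi> K (2 powi \<gamma>) (2 powi \<gamma> * \<tau>) (low (2 powi \<gamma>) (fourier f)) (v \<gamma>) x))) \<partial>lborel)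
    \<le> (\<integral>\<^sup>+x. \<integral>\<^sup>+\<zeta>. ennreal (cmod (\<Psi> \<zeta>) * (1 + (fst \<zeta>)\<^sup>2)) * (ennreal (2 * C_low) * (M x * H \<zeta> x)) \<partial>lborel \<partial>lborel)"
    by (intro nn_integral_mono pt)
  also have "\<dots> = (\<integral>\<^sup>+\<zeta>. \<integral>\<^sup>+x. ennreal (cmod (\<Psi> \<zeta>) * (1 + (fst \<zeta>)\<^sup>2)) * (ennreal (2 * C_low) * (M x * H \<zeta> x)) \<partial>lborel \<partial>lborel)"
    by (rule lborel_pair.Fubini'[symmetric]) (use Hm in \<open>simp add: case_prod_beta'\<close>)
  also have "\<dots> = (\<integral>\<^sup>+\<zeta>. ennreal (cmod (\<Psi> \<zeta>) * (1 + (fst \<zeta>)\<^sup>2)) * (ennreal (2 * C_low) * (\<integral>\<^sup>+x. M x * H \<zeta> x \<partial>lborel)) \<partial>lborel)"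
    by (intro nn_integral_cong) (simp add: nn_integral_cmult)
  also have "\<dots> \<le> (\<integral>\<^sup>+\<zeta>. ennreal (cmod (\<Psi> \<zeta>) * (1 + (fst \<zeta>)\<^sup>2)) * (ennreal (2 * C_low) * ennreal Z) \<partial>lborel)"
    by (intro nn_integral_mono mult_left_mono MH) auto
  also have "\<dots> = (\<integral>\<^sup>+\<zeta>. ennreal (cmod (\<Psi> \<zeta>) * (1 + (fst \<zeta>)\<^sup>2)) \<partial>lborel) * (ennreal (2 * C_low) * ennreal Z)"
    by (rule nn_integral_multc) measurable
  also have "\<dots> \<le> ennreal P * (ennreal (2 * C_low) * ennreal Z)"
    by (intro mult_right_mono P) simp
  also have "\<dots> = ennreal (P * (2 * C_low * Z))"
    using P Z0 by (simp add: ennreal_mult C_low_def)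
  finally show ?thesis by (simp add: Z_def)
qed

section \<open>Orthogonality of dyadic frequency bands\<close>

lemma powi_le_iff: "(2::real) powi a \<le> 2 powi b \<longleftrightarrow> a \<le> b"
  using power_int_strict_increasing[of b a "2::real"] power_int_increasing[of a b "2::real"] by (cases "a \<le> b") auto

text \<open>Any two admissible exponents differ by at most \<open>m\<close>, so all of them lie
  within distance \<open>m\<close> of one of them.\<close>

lemma nn_integral_dyadic_count:
  fixes c \<alpha> :: real and m :: nat
  assumes c: "c > 0"
  shows "(\<integral>\<^sup>+\<gamma>. indicator {\<gamma>::int. \<alpha> \<le> 2 powi \<gamma> * c \<and> 2 powi \<gamma> * c \<le> \<alpha> * 2 ^ m} \<gamma> \<partial>count_space UNIV) \<le> ennreal (2 * m + 1)"
proof -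
  define A where "A = {\<gamma>::int. \<alpha> \<le> 2 powi \<gamma> * c \<and> 2 powi \<gamma> * c \<le> \<alpha> * 2 ^ m}"
  have close: "a \<le> b + int m" if "a \<in> A" "b \<in> A" for a b
  proof -
    have "2 powi a * c \<le> \<alpha> * 2 ^ m" "\<alpha> \<le> 2 powi b * c" using that by (auto simp: A_def)
    then have "2 powi a * c \<le> (2 powi b * c) * 2 ^ m" by (meson mult_right_mono order_trans zero_le_numeral zero_le_power)
    also have "\<dots> = 2 powi (b + int m) * c" by (simp add: power_int_add)
    finally have "(2::real) powi a \<le> 2 powi (b + int m)" using c by (simp add: mult_le_cancel_right)
    then show ?thesis by (simp only: powi_le_iff)
  qed
  show ?thesis
  proof (cases "A = {}")
    case True
    then show ?thesis unfolding A_def[symmetric] by simp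
  next
    case False
    then obtain b where b: "b \<in> A" by auto
    have sub: "A \<subseteq> {b - int m..b + int m}" using close[OF _ b] close[OF b] by force
    then have "finite A" by (rule finite_subset) simp
    have "(\<integral>\<^sup>+\<gamma>. indicator A \<gamma> \<partial>count_space UNIV) = of_nat (card A)"
      using \<open>finite A\<close> by simp
    also have "\<dots> \<le> of_nat (card {b - int m..b + int m})"
      by (intro of_nat_mono card_mono sub) simp
    also have "\<dots> = ennreal (2 * m + 1)" by (simp add: ennreal_of_nat_eq_real_of_nat)
    finally show ?thesis unfolding A_def .
  qed
qed

lemma nn_integral_dyadic_geometric:
  fixes c :: real
  assumes c: "c > 0"
  shows "(\<integral>\<^sup>+\<gamma>. ennreal (2 powi \<gamma> * c) * indicator {\<gamma>::int. 2 powi \<gamma> * c \<le> 1} \<gamma> \<partial>count_space UNIV) \<le> ennreal 2"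
proof -
  \<comment> \<open>The largest admissible exponent: its term is at most one, and the terms below it
    halve.\<close>
  define g where "g = \<lfloor>log 2 (1 / c)\<rfloor>"
  have pw: "(2::real) powr of_int a = 2 powi a" for a by (simp add: powr_real_of_int')
  have g1: "2 powi g * c \<le> 1"
  proof -
    have "(2::real) powr of_int g \<le> 2 powr (log 2 (1 / c))" unfolding g_def by (intro powr_mono of_int_floor_le) auto
    also have "\<dots> = 1 / c" using c by (simp del: log_divide)
    finally show ?thesis using c by (simp add: pw pos_le_divide_eq)
  qed
  have A: "{\<gamma>::int. 2 powi \<gamma> * c \<le> 1} \<subseteq> {..g}"
  proof
    fix a assume "a \<in> {\<gamma>::int. 2 powi \<gamma> * c \<le> 1}"
    then have "2 powr of_int a \<le> 1 / c" using c by (simp add: pw pos_le_divide_eq)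
    then have "of_int a \<le> log 2 (1 / c)" using c by (subst le_log_iff) auto
    then show "a \<in> {..g}" by (simp add: g_def le_floor_iff)
  qed
  have "(\<integral>\<^sup>+\<gamma>. ennreal (2 powi \<gamma> * c) * indicator {\<gamma>::int. 2 powi \<gamma> * c \<le> 1} \<gamma> \<partial>count_space UNIV)
     \<le> (\<integral>\<^sup>+\<gamma>. ennreal (2 powi \<gamma> * c) * indicator {..g} \<gamma> \<partial>count_space UNIV)"
    using A by (intro nn_integral_mono mult_left_mono) (auto simp: indicator_def)
  also have "\<dots> = (\<integral>\<^sup>+\<gamma>. ennreal (2 powi \<gamma> * c) \<partial>count_space {..g})"
    by (rule nn_integral_count_space_indicator[symmetric]) simp
  also have "\<dots> = (\<integral>\<^sup>+j. ennreal (2 powi (g - int j) * c) \<partial>count_space (UNIV :: nat set))"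
  proof (rule nn_integral_bij_count_space[symmetric])
    show "bij_betw (\<lambda>j. g - int j) UNIV {..g}"
      by (rule bij_betwI[where g="\<lambda>a. nat (g - a)"]) auto
  qed
  also have "\<dots> \<le> (\<integral>\<^sup>+j. ennreal ((1/2) ^ j) \<partial>count_space (UNIV :: nat set))"
  proof (intro nn_integral_mono ennreal_leI)
    fix j :: nat
    have "2 powi (g - int j) * c = (1/2) ^ j * (2 powi g * c)"
      by (simp add: power_int_diff power_divide)
    also have "\<dots> \<le> (1/2) ^ j * 1" by (intro mult_left_mono g1) simp
    finally show "2 powi (g - int j) * c \<le> (1/2) ^ j" by simp
  qed
  also have "\<dots> = ennreal (1 / (1 - 1/2))"
    unfolding nn_integral_count_space_nat by (rule suminf_ennreal_eq[OF _ geometric_sums]) auto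
  finally show ?thesis by simp
qed

text \<open>Almost orthogonality. Exchanging sum and integral reduces the claim to the total weight
  seen by a single frequency. The frequency zero, which every dilation fixes, is a null set.\<close>

lemma sum_l2_le:
  fixes u :: "int \<Rightarrow> real \<Rightarrow> complex"
  assumes u: "\<And>\<gamma>. L2fun (u \<gamma>)" and a: "L2fun a" and [measurable]: "\<And>\<gamma>. w \<gamma> \<in> borel_measurable borel"
    and le: "\<And>\<gamma> \<xi>. ennreal ((cmod (u \<gamma> \<xi>))\<^sup>2) \<le> w \<gamma> \<xi> * ennreal ((cmod (a \<xi>))\<^sup>2)"
    and w: "\<And>\<xi>. \<xi> \<noteq> 0 \<Longrightarrow> (\<integral>\<^sup>+\<gamma>. w \<gamma> \<xi> \<partial>count_space UNIV) \<le> ennreal C" and C: "C \<ge> 0"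
  shows "(\<integral>\<^sup>+\<gamma>. ennreal ((l2 (u \<gamma>))\<^sup>2) \<partial>count_space UNIV) \<le> ennreal (C * (l2 a)\<^sup>2)"
proof -
  have [measurable]: "u \<gamma> \<in> borel_measurable borel" "a \<in> borel_measurable borel" for \<gamma>
    using u a by (auto intro: L2fun_measurable)
  have "(\<integral>\<^sup>+\<gamma>. ennreal ((l2 (u \<gamma>))\<^sup>2) \<partial>count_space UNIV) = (\<integral>\<^sup>+\<gamma>. \<integral>\<^sup>+\<xi>. ennreal ((cmod (u \<gamma> \<xi>))\<^sup>2) \<partial>lborel \<partial>count_space UNIV)"
    using u by (simp add: nn_integral_l2 L2fun_def)
  also have "\<dots> \<le> (\<integral>\<^sup>+\<gamma>. \<integral>\<^sup>+\<xi>. w \<gamma> \<xi> * ennreal ((cmod (a \<xi>))\<^sup>2) \<partial>lborel \<partial>count_space UNIV)"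
    by (intro nn_integral_mono le)
  also have "\<dots> = (\<integral>\<^sup>+\<xi>. \<integral>\<^sup>+\<gamma>. w \<gamma> \<xi> * ennreal ((cmod (a \<xi>))\<^sup>2) \<partial>count_space UNIV \<partial>lborel)"
    by (rule nn_integral_count_space_nn_integral[symmetric]) auto
  also have "\<dots> = (\<integral>\<^sup>+\<xi>. (\<integral>\<^sup>+\<gamma>. w \<gamma> \<xi> \<partial>count_space UNIV) * ennreal ((cmod (a \<xi>))\<^sup>2) \<partial>lborel)"
    by (intro nn_integral_cong nn_integral_multc) simp
  also have "\<dots> \<le> (\<integral>\<^sup>+\<xi>. ennreal C * ennreal ((cmod (a \<xi>))\<^sup>2) \<partial>lborel)"
    using AE_lborel_singleton[of 0]
    by (intro nn_integral_mono_AE, eventually_elim) (intro mult_right_mono w, auto)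
  also have "\<dots> = ennreal C * ennreal ((l2 a)\<^sup>2)"
    using nn_integral_l2[of a] a by (subst nn_integral_cmult) (auto simp: L2fun_def)
  also have "\<dots> = ennreal (C * (l2 a)\<^sup>2)" using C by (simp add: ennreal_mult)
  finally show ?thesis .
qed

text \<open>The upper limit 2 is the outer radius of the spectrum of \<open>\<Psi>\<close>. The
  lower limit is half of the inner radius \<open>1 / 2\<close>, because two coordinates below
  \<open>1 / 4\<close> give a point of norm below \<open>1 / 2\<close>.\<close>

definition band :: "real \<Rightarrow> (real \<Rightarrow> complex) \<Rightarrow> real \<Rightarrow> complex" where
  "band s a \<xi> = (if 1 / 4 \<le> s * \<bar>\<xi>\<bar> \<and> s * \<bar>\<xi>\<bar> \<le> 2 then a \<xi> else 0)"

text \<open>The frequencies up to the top of the band, after removal of the Gaussian part at the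
  larger scale \<open>t\<close>. It overlaps the band, as the other input is the one confined to the
  band.\<close>

definition mid :: "real \<Rightarrow> real \<Rightarrow> (real \<Rightarrow> complex) \<Rightarrow> real \<Rightarrow> complex" where
  "mid t s a \<xi> = (if s * \<bar>\<xi>\<bar> \<le> 2 then of_real (1 - gauss (t * \<xi>)) * a \<xi> else 0)"

lemma band_measurable [measurable]:
  assumes [measurable]: "a \<in> borel_measurable borel"
  shows "band s a \<in> borel_measurable borel" "mid t s a \<in> borel_measurable borel"
  unfolding band_def mid_def by measurable

lemma abs_one_minus_gauss: "\<bar>1 - gauss x\<bar> \<le> 1" "\<bar>1 - gauss x\<bar> = 1 - gauss x"
  using gauss_pos[of x] gauss_le1[of x] by auto

lemma L2fun_band: "L2fun a \<Longrightarrow> L2fun (band s a)" "L2fun a \<Longrightarrow> L2fun (mid t s a)"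
proof -
  assume a: "L2fun a"
  note [measurable] = L2fun_measurable[OF a]
  show "L2fun (band s a)"
    by (rule L2fun_dominated(1)[OF a, of _ 1]) (measurable, auto simp: band_def)
  show "L2fun (mid t s a)"
  proof (rule L2fun_dominated(1)[OF a, of _ 1])
    show "cmod (mid t s a \<xi>) \<le> 1 * cmod (a \<xi>)" for \<xi>
      unfolding mid_def by (auto simp: norm_mult abs_one_minus_gauss gauss_le1 simp del: of_real_diff intro!: mult_left_le_one_le)
  qed measurable
qed

lemma sum_band:
  assumes a: "L2fun a" and \<tau>: "\<tau> > 0"
  shows "(\<integral>\<^sup>+\<gamma>. ennreal ((l2 (band (2 powi \<gamma> * \<tau>) a))\<^sup>2) \<partial>count_space UNIV) \<le> ennreal (7 * (l2 a)\<^sup>2)"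
proof (rule sum_l2_le[where w="\<lambda>\<gamma> \<xi>. indicator {\<xi>. 1 / 4 \<le> 2 powi \<gamma> * \<tau> * \<bar>\<xi>\<bar> \<and> 2 powi \<gamma> * \<tau> * \<bar>\<xi>\<bar> \<le> 2} \<xi>"])
  fix \<xi> :: real assume "\<xi> \<noteq> 0"
  then have "\<tau> * \<bar>\<xi>\<bar> > 0" using \<tau> by simp
  \<comment> \<open>The endpoints of the band have ratio \<open>2 ^ 3\<close>, so at most
    \<open>2 * 3 + 1\<close> scales meet a given frequency.\<close>
  from nn_integral_dyadic_count[OF this, of "1/4" 3]
  have "(\<integral>\<^sup>+\<gamma>. indicator {\<gamma>::int. 1/4 \<le> 2 powi \<gamma> * (\<tau> * \<bar>\<xi>\<bar>) \<and> 2 powi \<gamma> * (\<tau> * \<bar>\<xi>\<bar>) \<le> 1/4 * 2 ^ 3} \<gamma> \<partial>count_space UNIV) \<le> ennreal 7"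
    by simp
  then show "(\<integral>\<^sup>+\<gamma>. indicator {\<xi>. 1 / 4 \<le> 2 powi \<gamma> * \<tau> * \<bar>\<xi>\<bar> \<and> 2 powi \<gamma> * \<tau> * \<bar>\<xi>\<bar> \<le> 2} \<xi> \<partial>count_space UNIV) \<le> ennreal 7"
    by (simp add: indicator_def mult.assoc)
qed (use a L2fun_band(1)[OF a] in \<open>auto simp: band_def indicator_def\<close>)

lemma one_minus_gauss_power2_le:
  assumes "0 \<le> r" "r \<le> 1" shows "(1 - gauss r)\<^sup>2 \<le> 16 * r"
proof -
  have "1 + (- pi * r\<^sup>2) \<le> gauss r" unfolding gauss_def by (rule exp_ge_add_one_self)
  then have "1 - gauss r \<le> pi * r\<^sup>2" by simp
  also have "\<dots> \<le> 4 * r"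
  proof (intro mult_mono)
    show "r\<^sup>2 \<le> r" using assms by (simp add: power2_eq_square mult_left_le)
  qed (use pi_less_4 in auto)
  finally have "(1 - gauss r)\<^sup>2 \<le> (4 * r)\<^sup>2" using gauss_le1[of r] by (intro power_mono) auto
  also have "\<dots> = 16 * (r * r)" by (simp add: power2_eq_square)
  also have "\<dots> \<le> 16 * r" using assms by (simp add: mult_left_le)
  finally show ?thesis .
qed

text \<open>Where \<open>2 powi \<gamma> * \<bar>\<xi>\<bar> \<le> 1\<close>, the square of
  \<open>1 - gauss\<close> is at most 16 times that quantity and the sum is geometric, giving
  \<open>16 * 2\<close>. Between 1 and \<open>2 ^ m\<close>, which is the top of the band in these
  units, at most \<open>2 * m + 1\<close> scales remain. This is the only loss that grows with
  \<open>\<mu>\<close>.\<close>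

lemma sum_mid:
  assumes a: "L2fun a" and \<tau>: "2 = \<tau> * 2 ^ m" "\<tau> > 0"
  shows "(\<integral>\<^sup>+\<gamma>. ennreal ((l2 (mid (2 powi \<gamma>) (2 powi \<gamma> * \<tau>) a))\<^sup>2) \<partial>count_space UNIV) \<le> ennreal ((2 * m + 33) * (l2 a)\<^sup>2)"
proof (rule sum_l2_le[where w="\<lambda>\<gamma> \<xi>. ennreal 16 * (ennreal (2 powi \<gamma> * \<bar>\<xi>\<bar>) * indicator {\<xi>. 2 powi \<gamma> * \<bar>\<xi>\<bar> \<le> 1} \<xi>)
      + indicator {\<xi>. 1 \<le> 2 powi \<gamma> * \<bar>\<xi>\<bar> \<and> 2 powi \<gamma> * \<bar>\<xi>\<bar> \<le> 1 * 2 ^ m} \<xi>"])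
  fix \<xi> :: real assume "\<xi> \<noteq> 0"
  then have c: "\<bar>\<xi>\<bar> > 0" by simp
  have ind: "indicator {\<xi>. 2 powi \<gamma> * \<bar>\<xi>\<bar> \<le> 1} \<xi> = (indicator {\<gamma>. 2 powi \<gamma> * \<bar>\<xi>\<bar> \<le> 1} \<gamma> :: ennreal)"
      "indicator {\<xi>. 1 \<le> 2 powi \<gamma> * \<bar>\<xi>\<bar> \<and> 2 powi \<gamma> * \<bar>\<xi>\<bar> \<le> 1 * 2 ^ m} \<xi>
        = (indicator {\<gamma>. 1 \<le> 2 powi \<gamma> * \<bar>\<xi>\<bar> \<and> 2 powi \<gamma> * \<bar>\<xi>\<bar> \<le> 1 * 2 ^ m} \<gamma> :: ennreal)" for \<gamma> :: int
    by (simp_all only: indicator_def mem_Collect_eq)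
  have "(\<integral>\<^sup>+\<gamma>. ennreal 16 * (ennreal (2 powi \<gamma> * \<bar>\<xi>\<bar>) * indicator {\<xi>. 2 powi \<gamma> * \<bar>\<xi>\<bar> \<le> 1} \<xi>)
      + indicator {\<xi>. 1 \<le> 2 powi \<gamma> * \<bar>\<xi>\<bar> \<and> 2 powi \<gamma> * \<bar>\<xi>\<bar> \<le> 1 * 2 ^ m} \<xi> \<partial>count_space UNIV)
     = ennreal 16 * (\<integral>\<^sup>+\<gamma>. ennreal (2 powi \<gamma> * \<bar>\<xi>\<bar>) * indicator {\<gamma>. 2 powi \<gamma> * \<bar>\<xi>\<bar> \<le> 1} \<gamma> \<partial>count_space UNIV)
      + (\<integral>\<^sup>+\<gamma>. indicator {\<gamma>. 1 \<le> 2 powi \<gamma> * \<bar>\<xi>\<bar> \<and> 2 powi \<gamma> * \<bar>\<xi>\<bar> \<le> 1 * 2 ^ m} \<gamma> \<partial>count_space UNIV)"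
    unfolding ind by (subst nn_integral_add, simp, simp, subst nn_integral_cmult, simp, rule refl)
  also have "\<dots> \<le> ennreal 16 * ennreal 2 + ennreal (2 * m + 1)"
    by (intro add_mono mult_left_mono nn_integral_dyadic_geometric nn_integral_dyadic_count c) simp
  also have "\<dots> = ennreal (16 * 2 + real (2 * m + 1))"
    by (subst ennreal_mult[symmetric], simp, simp, rule ennreal_plus[symmetric]) auto
  also have "16 * 2 + real (2 * m + 1) = 2 * real m + 33" by simp
  finally show "(\<integral>\<^sup>+\<gamma>. ennreal 16 * (ennreal (2 powi \<gamma> * \<bar>\<xi>\<bar>) * indicator {\<xi>. 2 powi \<gamma> * \<bar>\<xi>\<bar> \<le> 1} \<xi>)
      + indicator {\<xi>. 1 \<le> 2 powi \<gamma> * \<bar>\<xi>\<bar> \<and> 2 powi \<gamma> * \<bar>\<xi>\<bar> \<le> 1 * 2 ^ m} \<xi> \<partial>count_space UNIV) \<le> ennreal (2 * real m + 33)" .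
next
  fix \<gamma> :: int and \<xi> :: real
  define r where "r = 2 powi \<gamma> * \<bar>\<xi>\<bar>"
  have r0: "r \<ge> 0" by (simp add: r_def)
  have gr: "gauss (2 powi \<gamma> * \<xi>) = gauss r" by (simp add: gauss_def r_def power_mult_distrib)
  define z where "z = (cmod (a \<xi>))\<^sup>2"
  have z0: "z \<ge> 0" by (simp add: z_def)
  show "ennreal ((cmod (mid (2 powi \<gamma>) (2 powi \<gamma> * \<tau>) a \<xi>))\<^sup>2) \<le>
    (ennreal 16 * (ennreal (2 powi \<gamma> * \<bar>\<xi>\<bar>) * indicator {\<xi>. 2 powi \<gamma> * \<bar>\<xi>\<bar> \<le> 1} \<xi>)
      + indicator {\<xi>. 1 \<le> 2 powi \<gamma> * \<bar>\<xi>\<bar> \<and> 2 powi \<gamma> * \<bar>\<xi>\<bar> \<le> 1 * 2 ^ m} \<xi>) * ennreal ((cmod (a \<xi>))\<^sup>2)"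
  proof (cases "2 powi \<gamma> * \<tau> * \<bar>\<xi>\<bar> \<le> 2")
    case False
    then show ?thesis by (simp add: mid_def)
  next
    case True
    then have eq: "(cmod (mid (2 powi \<gamma>) (2 powi \<gamma> * \<tau>) a \<xi>))\<^sup>2 = (1 - gauss r)\<^sup>2 * z"
      unfolding mid_def gr z_def by (simp add: norm_mult power_mult_distrib abs_one_minus_gauss(2) del: of_real_diff)
    show ?thesis
    proof (cases "r \<le> 1")
      case le1: True
      have "(1 - gauss r)\<^sup>2 * z \<le> (16 * r) * z"
        by (intro mult_right_mono one_minus_gauss_power2_le r0 le1 z0)
      moreover have "ennreal ((16 * r) * z) = (ennreal 16 * ennreal r) * ennreal z"
        using ennreal_mult[of "16 * r" z] ennreal_mult[of 16 r] r0 z0 by simp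
      ultimately have "ennreal ((1 - gauss r)\<^sup>2 * z) \<le> (ennreal 16 * ennreal r) * ennreal z"
        using ennreal_leI by metis
      also have "\<dots> \<le> (ennreal 16 * (ennreal (2 powi \<gamma> * \<bar>\<xi>\<bar>) * indicator {\<xi>. 2 powi \<gamma> * \<bar>\<xi>\<bar> \<le> 1} \<xi>)
      + indicator {\<xi>. 1 \<le> 2 powi \<gamma> * \<bar>\<xi>\<bar> \<and> 2 powi \<gamma> * \<bar>\<xi>\<bar> \<le> 1 * 2 ^ m} \<xi>) * ennreal z"
        using le1 by (intro mult_right_mono) (auto simp: r_def)
      finally show ?thesis unfolding eq z_def .
    next
      case False
      have "\<tau> * r \<le> \<tau> * 2 ^ m" using True \<tau>(1) by (simp add: r_def mult_ac)
      then have "r \<le> 2 ^ m" using \<tau>(2) by simp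
      have "(1 - gauss r)\<^sup>2 * z \<le> 1 * z"
        using gauss_pos[of r] gauss_le1[of r] by (intro mult_right_mono power_le_one z0) auto
      then have "ennreal ((1 - gauss r)\<^sup>2 * z) \<le> 1 * ennreal z" by (simp add: ennreal_leI)
      also have "\<dots> \<le> (ennreal 16 * (ennreal (2 powi \<gamma> * \<bar>\<xi>\<bar>) * indicator {\<xi>. 2 powi \<gamma> * \<bar>\<xi>\<bar> \<le> 1} \<xi>)
      + indicator {\<xi>. 1 \<le> 2 powi \<gamma> * \<bar>\<xi>\<bar> \<and> 2 powi \<gamma> * \<bar>\<xi>\<bar> \<le> 1 * 2 ^ m} \<xi>) * ennreal z"
        using False \<open>r \<le> 2 ^ m\<close> by (intro mult_right_mono) (auto simp: r_def)
      finally show ?thesis unfolding eq z_def .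
    qed
  qed
qed (use a L2fun_band(2)[OF a] in auto)

text \<open>With both inputs square summable in \<open>\<gamma>\<close> the supremum is bounded by
  the sum, each term by the single-scale estimate, and the sum of products by Cauchy--Schwarz in
  \<open>\<gamma>\<close>.\<close>

lemma T_avg_diag_sum_le:
  fixes u v :: "int \<Rightarrow> real \<Rightarrow> complex"
  assumes q: "4 / 3 < q" "q \<le> 2" and K: "rough_class q N K" and N: "N > 0" and \<rho>: "2 \<le> \<rho>"
    and u: "\<And>\<gamma>. L2fun (u \<gamma>)" and v: "\<And>\<gamma>. L2fun (v \<gamma>)" and \<Psi>: "integrable lborel \<Psi>" "(LINT \<zeta>|lborel. cmod (\<Psi> \<zeta>)) \<le> P"
    and X: "\<And>\<gamma> \<xi>. u \<gamma> \<xi> \<noteq> 0 \<Longrightarrow> 2 powi \<gamma> * \<bar>\<xi>\<bar> \<le> X" "\<And>\<gamma> \<xi>. v \<gamma> \<xi> \<noteq> 0 \<Longrightarrow> 2 powi \<gamma> * \<bar>\<xi>\<bar> \<le> X"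
    and far: "(\<forall>\<gamma> \<xi>. u \<gamma> \<xi> \<noteq> 0 \<longrightarrow> \<rho> \<le> 2 powi \<gamma> * \<bar>\<xi>\<bar>) \<or> (\<forall>\<gamma> \<xi>. v \<gamma> \<xi> \<noteq> 0 \<longrightarrow> \<rho> \<le> 2 powi \<gamma> * \<bar>\<xi>\<bar>)"
    and S: "(\<integral>\<^sup>+\<gamma>. ennreal ((l2 (u \<gamma>))\<^sup>2) \<partial>count_space UNIV) \<le> ennreal (S\<^sup>2)" "S \<ge> 0"
      "(\<integral>\<^sup>+\<gamma>. ennreal ((l2 (v \<gamma>))\<^sup>2) \<partial>count_space UNIV) \<le> ennreal (S'\<^sup>2)" "S' \<ge> 0"
  shows "(\<integral>\<^sup>+x. (SUP \<gamma>. ennreal (cmod (T_avg \<Psi> K (2 powi \<gamma>) (2 powi \<gamma> * \<tau>) (u \<gamma>) (v \<gamma>) x))) \<partial>lborel)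
    \<le> ennreal (P * (C_diag q * N * \<rho> powr (- rate q)) * (S * S'))"
proof -
  have [measurable]: "u \<gamma> \<in> borel_measurable borel" "v \<gamma> \<in> borel_measurable borel" for \<gamma>
    using u v by (auto intro: L2fun_measurable)
  note [measurable] = rough_classD(1)[OF K]
  have [measurable]: "\<Psi> \<in> borel_measurable borel" using \<Psi> by auto
  define A where "A = P * (C_diag q * N * \<rho> powr (- rate q))"
  have P0: "0 \<le> P" by (rule order_trans[OF _ \<Psi>(2)]) simp
  have A: "A \<ge> 0" using P0 C_diag_pos[OF q] N by (simp add: A_def)
  have [measurable]: "(\<lambda>x. T_avg \<Psi> K t s (u \<gamma>) (v \<gamma>) x) \<in> borel_measurable borel" for t s \<gamma>
    unfolding T_avg_def by measurable
  have "(\<integral>\<^sup>+x. (SUP \<gamma>. ennreal (cmod (T_avg \<Psi> K (2 powi \<gamma>) (2 powi \<gamma> * \<tau>) (u \<gamma>) (v \<gamma>) x))) \<partial>lborel)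
    \<le> (\<integral>\<^sup>+x. (\<integral>\<^sup>+\<gamma>. ennreal (cmod (T_avg \<Psi> K (2 powi \<gamma>) (2 powi \<gamma> * \<tau>) (u \<gamma>) (v \<gamma>) x)) \<partial>count_space UNIV) \<partial>lborel)"
    by (intro nn_integral_mono SUP_least nn_integral_ge_point) simp
  also have "\<dots> = (\<integral>\<^sup>+\<gamma>. (\<integral>\<^sup>+x. ennreal (cmod (T_avg \<Psi> K (2 powi \<gamma>) (2 powi \<gamma> * \<tau>) (u \<gamma>) (v \<gamma>) x)) \<partial>lborel) \<partial>count_space UNIV)"
    by (rule nn_integral_count_space_nn_integral) auto
  also have "\<dots> \<le> (\<integral>\<^sup>+\<gamma>. ennreal A * (ennreal (l2 (u \<gamma>)) * ennreal (l2 (v \<gamma>))) \<partial>count_space UNIV)"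
  proof (intro nn_integral_mono)
    fix \<gamma> :: int
    have "(\<integral>\<^sup>+x. ennreal (cmod (T_avg \<Psi> K (2 powi \<gamma>) (2 powi \<gamma> * \<tau>) (u \<gamma>) (v \<gamma>) x)) \<partial>lborel)
      \<le> ennreal ((LINT \<zeta>|lborel. cmod (\<Psi> \<zeta>)) * (C_diag q * N * \<rho> powr (- rate q)) * (l2 (u \<gamma>) * l2 (v \<gamma>)))"
      by (rule T_avg_diag_le[OF q K N \<rho> _ u v \<Psi>(1) X(1) X(2)]) (use far in auto)
    also have "\<dots> \<le> ennreal (A * (l2 (u \<gamma>) * l2 (v \<gamma>)))"
      unfolding A_def using C_diag_pos[OF q] N \<Psi>(2) by (intro ennreal_leI mult_right_mono) auto
    also have "\<dots> = ennreal A * (ennreal (l2 (u \<gamma>)) * ennreal (l2 (v \<gamma>)))"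
      using A by (simp add: ennreal_mult)
    finally show "(\<integral>\<^sup>+x. ennreal (cmod (T_avg \<Psi> K (2 powi \<gamma>) (2 powi \<gamma> * \<tau>) (u \<gamma>) (v \<gamma>) x)) \<partial>lborel)
      \<le> ennreal A * (ennreal (l2 (u \<gamma>)) * ennreal (l2 (v \<gamma>)))" .
  qed
  also have "\<dots> = ennreal A * (\<integral>\<^sup>+\<gamma>. ennreal (l2 (u \<gamma>)) * ennreal (l2 (v \<gamma>)) \<partial>count_space UNIV)"
    by (rule nn_integral_cmult) simp
  also have "\<dots> \<le> ennreal A * ennreal (S * S')"
  proof (rule mult_left_mono, rule ennreal_power2_le_imp_le)
    have "(\<integral>\<^sup>+\<gamma>. ennreal (l2 (u \<gamma>)) * ennreal (l2 (v \<gamma>)) \<partial>count_space UNIV)\<^sup>2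
      \<le> (\<integral>\<^sup>+\<gamma>. (ennreal (l2 (u \<gamma>)))\<^sup>2 \<partial>count_space UNIV) * (\<integral>\<^sup>+\<gamma>. (ennreal (l2 (v \<gamma>)))\<^sup>2 \<partial>count_space UNIV)"
      by (rule Cauchy_Schwarz_nn_integral) auto
    also have "\<dots> \<le> ennreal (S\<^sup>2) * ennreal (S'\<^sup>2)"
      using S by (intro mult_mono) (auto simp: ennreal_power)
    also have "\<dots> = (ennreal (S * S'))\<^sup>2"
      using S by (simp add: ennreal_mult[symmetric] ennreal_power power_mult_distrib)
    finally show "(\<integral>\<^sup>+\<gamma>. ennreal (l2 (u \<gamma>)) * ennreal (l2 (v \<gamma>)) \<partial>count_space UNIV)\<^sup>2 \<le> (ennreal (S * S'))\<^sup>2" .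
  qed simp
  also have "\<dots> = ennreal (P * (C_diag q * N * \<rho> powr (- rate q)) * (S * S'))"
    using A S by (simp add: A_def ennreal_mult[symmetric])
  finally show ?thesis .
qed

section \<open>Reduction of the truncated kernels to a fixed annulus\<close>

text \<open>A single quantity that controls everything used about \<open>\<Psi>\<close>
  quantitatively: its integral norm, the quadratic weights of the low-pass part, and the size and
  Lipschitz constant of its Fourier transform.\<close>

definition weight :: "(plane \<Rightarrow> complex) \<Rightarrow> real" where
  "weight \<Psi> = (LINT \<zeta>|lborel. (1 + (norm \<zeta>)\<^sup>2) * cmod (\<Psi> \<zeta>))"

lemma weight_nonneg: "weight \<Psi> \<ge> 0"
  unfolding weight_def by simp

lemma schwartz_weight_integrable:
  fixes \<Psi> :: "plane \<Rightarrow> complex"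
  assumes \<Psi>: "schwartz \<Psi>"
  shows "integrable lborel (\<lambda>\<zeta>. (1 + (norm \<zeta>)\<^sup>2) * cmod (\<Psi> \<zeta>))" "\<Psi> \<in> borel_measurable borel"
proof -
  show m [measurable]: "\<Psi> \<in> borel_measurable borel"
    by (rule borel_measurable_continuous_onI[OF schwartz_continuous[OF \<Psi>, of "[]", simplified]])
  obtain c0 where c0: "c0 \<ge> 0" "\<And>x. norm x ^ 0 * cmod (iter_pderiv [] \<Psi> x) \<le> c0"
    by (rule schwartz_decay[OF \<Psi>, of "[]" 0]) auto
  \<comment> \<open>Sixth order decay amounts to three factors
    \<open>1 + (norm \<zeta>)\<^sup>2\<close>: one pays for the weight and two for the integrable
    majorant, a product of the functions \<open>1 / (1 + x\<^sup>2)\<close> of the two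
    coordinates.\<close>
  obtain c6 where c6: "c6 \<ge> 0" "\<And>x. norm x ^ 6 * cmod (iter_pderiv [] \<Psi> x) \<le> c6"
    by (rule schwartz_decay[OF \<Psi>, of "[]" 6]) auto
  define c where "c = 4 * (c0 + c6)"
  have c: "c \<ge> 0" using c0 c6 by (simp add: c_def)
  define b where "b x = complex_of_real (1 / (1 + x\<^sup>2))" for x :: real
  have bi: "integrable lborel b" unfolding b_def using quadratic_decay_integrable_real[of 1] by (rule integrable_of_real)
  have "integrable (lborel \<Otimes>\<^sub>M lborel) (\<lambda>(x, y). b x * b y * 1)"
    by (rule integrable_tensor[OF bi bi, where C=1]) auto
  then have tens: "integrable lborel (\<lambda>p :: plane. c *\<^sub>R (b (fst p) * b (snd p)))"
    by (simp add: lborel_prod case_prod_beta')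
  show "integrable lborel (\<lambda>\<zeta>. (1 + (norm \<zeta>)\<^sup>2) * cmod (\<Psi> \<zeta>))"
  proof (rule Bochner_Integration.integrable_bound[OF tens])
    show "AE \<zeta> in lborel. norm ((1 + (norm \<zeta>)\<^sup>2) * cmod (\<Psi> \<zeta>)) \<le> norm (c *\<^sub>R (b (fst \<zeta>) * b (snd \<zeta>)))"
    proof (rule AE_I2)
      fix \<zeta> :: plane
      define x where "x = (norm \<zeta>)\<^sup>2"
      define z where "z = cmod (\<Psi> \<zeta>)"
      have x: "x \<ge> 0" and z: "z \<ge> 0" by (simp_all add: x_def z_def)
      have n: "norm ((1 + (norm \<zeta>)\<^sup>2) * cmod (\<Psi> \<zeta>)) = (1 + x) * z" using x z by (simp add: x_def z_def)
      have xx: "x = (fst \<zeta>)\<^sup>2 + (snd \<zeta>)\<^sup>2" by (simp add: x_def norm_prod_def)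
      have "4 + 4 * x ^ 3 - (1 + x) ^ 3 = 3 * ((x - 1)\<^sup>2 * (x + 1))"
        by (simp add: power2_eq_square power3_eq_cube algebra_simps)
      moreover have "0 \<le> 3 * ((x - 1)\<^sup>2 * (x + 1))" using x by (intro mult_nonneg_nonneg) auto
      ultimately have "(1 + x) ^ 3 \<le> 4 + 4 * x ^ 3" by linarith
      then have "(1 + x) ^ 3 * z \<le> (4 + 4 * x ^ 3) * z" by (rule mult_right_mono[OF _ z])
      also have "\<dots> = 4 * z + 4 * (norm \<zeta> ^ 6 * z)"
        by (simp add: x_def power_mult[symmetric] algebra_simps)
      also have "\<dots> \<le> c" using c0(2)[of \<zeta>] c6(2)[of \<zeta>] by (simp add: c_def z_def)
      finally have A: "(1 + x) ^ 3 * z \<le> c" .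
      have "((1 + (fst \<zeta>)\<^sup>2) * (1 + (snd \<zeta>)\<^sup>2)) * ((1 + x) * z) \<le> ((1 + x) * (1 + x)) * ((1 + x) * z)"
        using x z unfolding xx by (intro mult_right_mono mult_mono) auto
      also have "\<dots> = (1 + x) ^ 3 * z" by (simp add: power3_eq_cube)
      finally have "((1 + (fst \<zeta>)\<^sup>2) * (1 + (snd \<zeta>)\<^sup>2)) * ((1 + x) * z) \<le> c" using A by linarith
      moreover have pos: "(1 + (fst \<zeta>)\<^sup>2) * (1 + (snd \<zeta>)\<^sup>2) > 0" by (intro mult_pos_pos add_pos_nonneg) auto
      ultimately have "(1 + x) * z \<le> c / ((1 + (fst \<zeta>)\<^sup>2) * (1 + (snd \<zeta>)\<^sup>2))"
        by (simp add: pos_le_divide_eq mult.commute)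
      also have "\<dots> = norm (c *\<^sub>R (b (fst \<zeta>) * b (snd \<zeta>)))"
        using c pos by (simp add: b_def norm_divide norm_mult del: of_real_add of_real_power add: abs_of_nonneg)
      finally show "norm ((1 + (norm \<zeta>)\<^sup>2) * cmod (\<Psi> \<zeta>)) \<le> norm (c *\<^sub>R (b (fst \<zeta>) * b (snd \<zeta>)))" unfolding n .
    qed
  qed measurable
qed

lemma schwartz_plane_facts:
  fixes \<Psi> :: "plane \<Rightarrow> complex"
  assumes \<Psi>: "schwartz \<Psi>"
  shows "integrable lborel \<Psi>" "(LINT \<zeta>|lborel. cmod (\<Psi> \<zeta>)) \<le> weight \<Psi>"
    "(\<integral>\<^sup>+\<zeta>. ennreal (cmod (\<Psi> \<zeta>) * (1 + (fst \<zeta>)\<^sup>2)) \<partial>lborel) \<le> ennreal (weight \<Psi>)"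
    "(\<integral>\<^sup>+\<zeta>. ennreal (cmod (\<Psi> \<zeta>) * (1 + (snd \<zeta>)\<^sup>2)) \<partial>lborel) \<le> ennreal (weight \<Psi>)"
    "cmod (fourier \<Psi> \<xi>) \<le> weight \<Psi>"
    "cmod (fourier \<Psi> \<xi> - fourier \<Psi> \<eta>) \<le> 2 * pi * weight \<Psi> * norm (\<xi> - \<eta>)"
proof -
  note W = schwartz_weight_integrable(1)[OF \<Psi>]
  note [measurable] = schwartz_weight_integrable(2)[OF \<Psi>]
  have le1: "cmod (\<Psi> \<zeta>) \<le> (1 + (norm \<zeta>)\<^sup>2) * cmod (\<Psi> \<zeta>)" for \<zeta>
    by (simp add: distrib_right)
  show i: "integrable lborel \<Psi>"
  proof (rule Bochner_Integration.integrable_bound[OF W])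
    show "AE \<zeta> in lborel. cmod (\<Psi> \<zeta>) \<le> norm ((1 + (norm \<zeta>)\<^sup>2) * cmod (\<Psi> \<zeta>))"
      using le1 by (intro AE_I2 order_trans[OF le1]) simp
  qed simp
  show l: "(LINT \<zeta>|lborel. cmod (\<Psi> \<zeta>)) \<le> weight \<Psi>"
    unfolding weight_def by (intro integral_mono le1 W integrable_norm i)
  have W': "(\<integral>\<^sup>+\<zeta>. ennreal ((1 + (norm \<zeta>)\<^sup>2) * cmod (\<Psi> \<zeta>)) \<partial>lborel) = ennreal (weight \<Psi>)"
    unfolding weight_def by (rule nn_integral_eq_integral[OF W]) simp
  show "(\<integral>\<^sup>+\<zeta>. ennreal (cmod (\<Psi> \<zeta>) * (1 + (fst \<zeta>)\<^sup>2)) \<partial>lborel) \<le> ennreal (weight \<Psi>)"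
    unfolding W'[symmetric] mult.commute[of "cmod (\<Psi> _)"]
    by (intro nn_integral_mono ennreal_leI mult_right_mono) (auto simp: norm_prod_def)
  show "(\<integral>\<^sup>+\<zeta>. ennreal (cmod (\<Psi> \<zeta>) * (1 + (snd \<zeta>)\<^sup>2)) \<partial>lborel) \<le> ennreal (weight \<Psi>)"
    unfolding W'[symmetric] mult.commute[of "cmod (\<Psi> _)"]
    by (intro nn_integral_mono ennreal_leI mult_right_mono) (auto simp: norm_prod_def)
  have "cmod (fourier \<Psi> \<xi>) \<le> (LINT \<zeta>|lborel. cmod (\<Psi> \<zeta> * ee (- (\<zeta> \<bullet> \<xi>))))"
    unfolding fourier_ee by (rule integral_norm_bound)
  then show "cmod (fourier \<Psi> \<xi>) \<le> weight \<Psi>" using l by (simp add: norm_mult)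
  have ii: "integrable lborel (\<lambda>\<zeta>. \<Psi> \<zeta> * ee (- (\<zeta> \<bullet> \<xi>)))" for \<xi>
    by (rule integrable_mult_bdd(1)[OF i, where C=1]) auto
  have "fourier \<Psi> \<xi> - fourier \<Psi> \<eta> = (LINT \<zeta>|lborel. \<Psi> \<zeta> * ee (- (\<zeta> \<bullet> \<xi>)) - \<Psi> \<zeta> * ee (- (\<zeta> \<bullet> \<eta>)))"
    unfolding fourier_ee by (rule Bochner_Integration.integral_diff[symmetric]; rule ii)
  moreover have "cmod (LINT \<zeta>|lborel. \<Psi> \<zeta> * ee (- (\<zeta> \<bullet> \<xi>)) - \<Psi> \<zeta> * ee (- (\<zeta> \<bullet> \<eta>)))
      \<le> (LINT \<zeta>|lborel. (2 * pi * norm (\<xi> - \<eta>)) * ((1 + (norm \<zeta>)\<^sup>2) * cmod (\<Psi> \<zeta>)))"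
  proof (rule Bochner_Integration.integral_norm_bound_integral)
    fix \<zeta> :: plane
    have "norm \<zeta> \<le> 1 + (norm \<zeta>)\<^sup>2"
      using zero_le_power2[of "norm \<zeta> - 1"] by (simp add: power2_diff) (smt (verit) zero_le_power2)
    have "\<Psi> \<zeta> * ee (- (\<zeta> \<bullet> \<xi>)) - \<Psi> \<zeta> * ee (- (\<zeta> \<bullet> \<eta>)) = \<Psi> \<zeta> * (ee (- (\<zeta> \<bullet> \<xi>)) - ee (- (\<zeta> \<bullet> \<eta>)))"
      by (simp add: right_diff_distrib)
    also have "cmod \<dots> \<le> cmod (\<Psi> \<zeta>) * (2 * pi * \<bar>- (\<zeta> \<bullet> \<xi>) - - (\<zeta> \<bullet> \<eta>)\<bar>)"
      unfolding norm_mult by (intro mult_left_mono norm_ee_diff_le) simp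
    also have "\<bar>- (\<zeta> \<bullet> \<xi>) - - (\<zeta> \<bullet> \<eta>)\<bar> = \<bar>\<zeta> \<bullet> (\<xi> - \<eta>)\<bar>" by (simp add: inner_diff_right)
    also have "cmod (\<Psi> \<zeta>) * (2 * pi * \<bar>\<zeta> \<bullet> (\<xi> - \<eta>)\<bar>) \<le> cmod (\<Psi> \<zeta>) * (2 * pi * (norm \<zeta> * norm (\<xi> - \<eta>)))"
      by (intro mult_left_mono Cauchy_Schwarz_ineq2) auto
    also have "\<dots> \<le> cmod (\<Psi> \<zeta>) * (2 * pi * ((1 + (norm \<zeta>)\<^sup>2) * norm (\<xi> - \<eta>)))"
      using \<open>norm \<zeta> \<le> 1 + (norm \<zeta>)\<^sup>2\<close> by (intro mult_left_mono mult_right_mono) auto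
    also have "\<dots> = (2 * pi * norm (\<xi> - \<eta>)) * ((1 + (norm \<zeta>)\<^sup>2) * cmod (\<Psi> \<zeta>))" by (simp only: mult_ac)
    finally show "cmod (\<Psi> \<zeta> * ee (- (\<zeta> \<bullet> \<xi>)) - \<Psi> \<zeta> * ee (- (\<zeta> \<bullet> \<eta>))) \<le> (2 * pi * norm (\<xi> - \<eta>)) * ((1 + (norm \<zeta>)\<^sup>2) * cmod (\<Psi> \<zeta>))" .
  qed (rule Bochner_Integration.integrable_diff[OF ii ii], rule integrable_mult_right[OF W])
  ultimately show "cmod (fourier \<Psi> \<xi> - fourier \<Psi> \<eta>) \<le> 2 * pi * weight \<Psi> * norm (\<xi> - \<eta>)"
    unfolding weight_def integral_mult_right_zero by (simp only: mult_ac)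
qed

text \<open>The terms with index 1 and 2 of the series in \<open>Phi_hat\<close>. For
  \<open>norm y \<le> 2\<close> all later ones vanish, as their arguments have norm at most
  \<open>1 / 4\<close>.\<close>

definition Phi_ann :: "(plane \<Rightarrow> complex) \<Rightarrow> plane \<Rightarrow> complex" where
  "Phi_ann \<Psi> y = 1 - (fourier \<Psi> ((1/2) *\<^sub>R y) + fourier \<Psi> ((1/4) *\<^sub>R y))"

lemma amp_Phi_ann:
  assumes \<Psi>: "schwartz \<Psi>" shows "amp (1 + 6 * weight \<Psi>) (Phi_ann \<Psi>)"
  unfolding amp_def
proof (intro conjI ballI)
  note F = schwartz_plane_facts[OF \<Psi>]
  note [measurable] = schwartz_weight_integrable(2)[OF \<Psi>]
  have [measurable]: "fourier \<Psi> \<in> borel_measurable borel" unfolding fourier_ee by measurable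
  show "Phi_ann \<Psi> \<in> borel_measurable borel" unfolding Phi_ann_def by measurable
  note w = weight_nonneg[of \<Psi>]
  fix y :: plane
  have "cmod (Phi_ann \<Psi> y) \<le> cmod 1 + (cmod (fourier \<Psi> ((1/2) *\<^sub>R y)) + cmod (fourier \<Psi> ((1/4) *\<^sub>R y)))"
    unfolding Phi_ann_def by (rule order_trans[OF norm_triangle_ineq4]) (intro add_left_mono norm_triangle_ineq)
  also have "\<dots> \<le> 1 + (weight \<Psi> + weight \<Psi>)" by (intro add_mono F(5)) simp
  finally show "cmod (Phi_ann \<Psi> y) \<le> 1 + 6 * weight \<Psi>" using w by linarith
  fix z :: plane
  have "Phi_ann \<Psi> y - Phi_ann \<Psi> z = (fourier \<Psi> ((1/2) *\<^sub>R z) - fourier \<Psi> ((1/2) *\<^sub>R y)) + (fourier \<Psi> ((1/4) *\<^sub>R z) - fourier \<Psi> ((1/4) *\<^sub>R y))"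
    by (simp add: Phi_ann_def)
  also have "cmod \<dots> \<le> 2 * pi * weight \<Psi> * norm ((1/2) *\<^sub>R z - (1/2) *\<^sub>R y) + 2 * pi * weight \<Psi> * norm ((1/4) *\<^sub>R z - (1/4) *\<^sub>R y)"
    by (rule order_trans[OF norm_triangle_ineq]) (intro add_mono F(6))
  also have "\<dots> = pi * (3/2 * (weight \<Psi> * norm (y - z)))"
    unfolding scaleR_diff_right[symmetric] norm_scaleR norm_minus_commute[of z y] by simp
  also have "\<dots> \<le> 4 * (3/2 * (weight \<Psi> * norm (y - z)))"
    using w pi_less_4 by (intro mult_right_mono mult_nonneg_nonneg) auto
  also have "\<dots> \<le> (1 + 6 * weight \<Psi>) * norm (y - z)" by (simp add: distrib_right)
  finally show "cmod (Phi_ann \<Psi> y - Phi_ann \<Psi> z) \<le> (1 + 6 * weight \<Psi>) * norm (y - z)" .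
qed

lemma amp_inverse_square: "amp 2 (\<lambda>y. complex_of_real (1 / (norm y)\<^sup>2))"
  unfolding amp_def
proof (intro conjI ballI)
  show "(\<lambda>y :: plane. complex_of_real (1 / (norm y)\<^sup>2)) \<in> borel_measurable borel" by measurable
  fix y :: plane assume y: "y \<in> ann"
  then have y1: "1 < norm y" by (simp add: ann_def)
  then show "cmod (complex_of_real (1 / (norm y)\<^sup>2)) \<le> 2"
    using one_le_power[of "norm y" 2] by (auto simp: norm_divide norm_power divide_le_eq intro: order_trans[of 1 "(norm y)\<^sup>2"])
  fix z :: plane assume "z \<in> ann"
  then have z1: "1 < norm z" by (simp add: ann_def)
  have *: "\<bar>1 / a\<^sup>2 - 1 / b\<^sup>2\<bar> \<le> 2 * \<bar>a - b\<bar>" if "1 < a" "1 < b" for a b :: real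
  proof -
    have "1 / a\<^sup>2 - 1 / b\<^sup>2 = (b - a) * (1 / (a * (b * b)) + 1 / (a * a * b))"
      using that by (simp add: field_simps power2_eq_square)
    also have "\<bar>\<dots>\<bar> = \<bar>b - a\<bar> * (1 / (a * (b * b)) + 1 / (a * a * b))"
      using that by (simp add: abs_mult)
    also have "\<dots> \<le> \<bar>b - a\<bar> * (1 + 1)"
    proof (intro mult_left_mono add_mono)
      have "1 * (1 * 1) \<le> a * (b * b)" "1 * 1 * 1 \<le> a * a * b" using that by (intro mult_mono; simp)+
      then show "1 / (a * (b * b)) \<le> 1" "1 / (a * a * b) \<le> 1" by (simp_all add: divide_le_eq)
    qed simp
    finally show ?thesis by (simp add: abs_minus_commute mult.commute)
  qed
  have "cmod (complex_of_real (1 / (norm y)\<^sup>2) - complex_of_real (1 / (norm z)\<^sup>2)) = \<bar>1 / (norm y)\<^sup>2 - 1 / (norm z)\<^sup>2\<bar>"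
    unfolding of_real_diff[symmetric] by (rule norm_of_real)
  also have "\<dots> \<le> 2 * \<bar>norm y - norm z\<bar>" by (rule *[OF y1 z1])
  also have "\<dots> \<le> 2 * norm (y - z)" using norm_triangle_ineq3[of y z] by simp
  finally show "cmod (complex_of_real (1 / (norm y)\<^sup>2) - complex_of_real (1 / (norm z)\<^sup>2)) \<le> 2 * norm (y - z)" .
qed

lemma Phi_hat_eq_Phi_ann:
  assumes \<Psi>: "\<And>\<xi>. fourier \<Psi> \<xi> \<noteq> 0 \<Longrightarrow> 1/2 \<le> norm \<xi> \<and> norm \<xi> \<le> 2" and y: "norm y \<le> 2"
  shows "Phi_hat \<Psi> y = Phi_ann \<Psi> y"
proof -
  have z: "fourier \<Psi> ((2 powi (- \<gamma>)) *\<^sub>R y) = 0" if "\<gamma> \<ge> 3" for \<gamma>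
  proof (rule ccontr)
    assume "fourier \<Psi> ((2 powi (- \<gamma>)) *\<^sub>R y) \<noteq> 0"
    from \<Psi>[OF this] have "1/2 \<le> 2 powi (- \<gamma>) * norm y" by simp
    also have "\<dots> \<le> 2 powi (- 3) * 2" using that y by (intro mult_mono power_int_increasing) auto
    finally show False by (simp add: power_int_minus)
  qed
  have "(\<Sum>\<^sub>\<infinity>\<gamma>\<in>{1::int..}. fourier \<Psi> ((2 powi (- \<gamma>)) *\<^sub>R y)) = (\<Sum>\<^sub>\<infinity>\<gamma>\<in>{1::int, 2}. fourier \<Psi> ((2 powi (- \<gamma>)) *\<^sub>R y))"
    by (rule infsum_cong_neutral) (auto intro!: z)
  also have "\<dots> = (\<Sum>\<gamma>\<in>{1::int, 2}. fourier \<Psi> ((2 powi (- \<gamma>)) *\<^sub>R y))" by (rule infsum_finite) simp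
  also have "\<dots> = fourier \<Psi> ((1/2) *\<^sub>R y) + fourier \<Psi> ((1/4) *\<^sub>R y)"
  proof -
    have "(2::real) powi (- 1) = 1/2" "(2::real) powi (- 2) = 1/4" by (simp_all add: power_int_minus)
    then show ?thesis by simp
  qed
  finally show ?thesis by (simp add: Phi_hat_def Phi_ann_def)
qed

text \<open>The truncated kernel at scale one, written as a rough part of degree zero times a
  Lipschitz amplitude, so that membership in the rough class follows from
  \<open>rough_class_angular\<close> and \<open>rough_class_mult\<close>.\<close>

definition unit_kernel :: "(plane \<Rightarrow> complex) \<Rightarrow> (plane \<Rightarrow> complex) \<Rightarrow> plane \<Rightarrow> complex" where
  "unit_kernel \<Psi> \<Omega> y = (indicator ann y *\<^sub>R angular \<Omega> y) * (complex_of_real (1 / (norm y)\<^sup>2) * Phi_ann \<Psi> y)"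

lemma rough_class_unit_kernel:
  assumes q: "4 / 3 < q" and \<Omega>: "in_Lp circle_measure q \<Omega>" and N: "N > 0" "Lp_norm circle_measure q \<Omega> \<le> N"
    and \<Psi>: "schwartz \<Psi>"
  shows "rough_class q (30720 * (1 + 6 * weight \<Psi>) * N) (unit_kernel \<Psi> \<Omega>)"
  unfolding unit_kernel_def[abs_def]
  using rough_class_mult[OF rough_class_angular[OF \<Omega> q N] amp_mult[OF amp_inverse_square amp_Phi_ann[OF \<Psi>]]] q N
  by (simp add: mult_ac)

text \<open>The rough kernel is homogeneous of degree -2 and both cutoffs are dilated by the same
  \<open>2 powi \<gamma>\<close>, so the dependence on \<open>\<gamma>\<close> reduces to the
  inverse Jacobian.\<close>

lemma K_star_eq:
  assumes \<Psi>: "\<And>\<xi>. fourier \<Psi> \<xi> \<noteq> 0 \<Longrightarrow> 1/2 \<le> norm \<xi> \<and> norm \<xi> \<le> 2"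
  shows "K_star \<Psi> \<Omega> \<gamma> ((2 powi \<gamma>) *\<^sub>R w) = of_real (1 / (2 powi \<gamma>)\<^sup>2) * unit_kernel \<Psi> \<Omega> w"
proof -
  define t where "t = (2::real) powi \<gamma>"
  have t: "t > 0" by (simp add: t_def)
  have tm: "(2::real) powi (- \<gamma>) = 1 / t" by (simp add: t_def power_int_minus inverse_eq_divide)
  have t1: "(2::real) powi (\<gamma> + 1) = t * 2" by (simp add: t_def power_int_add)
  have ind: "indicator {y. t < norm y \<and> norm y \<le> t * 2} (t *\<^sub>R w) = (indicator ann w :: complex)"
    using t by (simp add: indicator_def ann_def)
  have unt: "(1 / t) *\<^sub>R t *\<^sub>R w = w" using t by simp
  show ?thesis
  proof (cases "w \<in> ann")
    case False
    then show ?thesis unfolding K_star_def unit_kernel_def t_def[symmetric] t1 ind by simp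
  next
    case True
    then have w: "norm w > 1" "norm w \<le> 2" by (auto simp: ann_def)
    have dir: "(t *\<^sub>R w) /\<^sub>R norm (t *\<^sub>R w) = w /\<^sub>R norm w"
      using t by simp
    have ang: "angular \<Omega> w = \<Omega> (w /\<^sub>R norm w)" 
    proof -
      have "norm (w /\<^sub>R norm w) = 1" using w by (auto intro!: left_inverse)
      then show ?thesis by (simp add: angular_def ext_circle_def indicator_def del: norm_scaleR)
    qed
    have rk: "rough_kernel \<Omega> (t *\<^sub>R w) = of_real (1 / t\<^sup>2) * (angular \<Omega> w * of_real (1 / (norm w)\<^sup>2))"
      unfolding rough_kernel_def dir ang using t
      by (simp add: power_mult_distrib scaleR_conv_of_real divide_inverse mult_ac)
    have "Phi_hat \<Psi> w = Phi_ann \<Psi> w" by (rule Phi_hat_eq_Phi_ann[OF _ w(2)]) (rule \<Psi>)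
    then show ?thesis unfolding K_star_def unit_kernel_def t_def[symmetric] t1 tm ind unt rk
      using True by simp
  qed
qed

lemma integral_translate:
  fixes f :: "'a::euclidean_space \<Rightarrow> complex"
  assumes [measurable]: "f \<in> borel_measurable borel"
  shows "(LINT y|lborel. f (y - z)) = (LINT y|lborel. f y)"
proof -
  have "(LINT y|distr lborel borel ((+) (- z)). f y) = (LINT y|lborel. f ((- z) + y))"
    by (rule integral_distr) auto
  then show ?thesis by (simp add: lborel_distr_plus)
qed

lemma integral_plane_scale:
  fixes f :: "plane \<Rightarrow> complex"
  assumes [measurable]: "f \<in> borel_measurable borel" and c: "c \<noteq> 0"
  shows "(LINT y|lborel. f y) = c\<^sup>2 *\<^sub>R (LINT y|lborel. f (c *\<^sub>R y))"
  by (subst lborel_affine[OF c, of 0])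
     (simp add: integral_density integral_distr power2_eq_square)

lemma integrable_plane_scale:
  fixes f :: "plane \<Rightarrow> complex"
  assumes f: "integrable lborel f" and c: "c \<noteq> 0"
  shows "integrable lborel (\<lambda>y. f (c *\<^sub>R y))"
proof (rule integrableI_bounded)
  have [measurable]: "f \<in> borel_measurable borel" using f by auto
  show "(\<lambda>y. f (c *\<^sub>R y)) \<in> borel_measurable lborel" by measurable
  have "(\<integral>\<^sup>+y. ennreal (cmod (f (c *\<^sub>R y))) \<partial>lborel) = ennreal ((1 / c)\<^sup>2) * (\<integral>\<^sup>+y. ennreal (cmod (f y)) \<partial>lborel)"
    using c by (subst nn_integral_plane_scale[of _ "1 / c"]) auto
  also have "\<dots> < \<infinity>" using f by (simp add: integrable_iff_bounded ennreal_mult_less_top)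
  finally show "(\<integral>\<^sup>+y. ennreal (cmod (f (c *\<^sub>R y))) \<partial>lborel) < \<infinity>" .
qed

text \<open>Fubini and a translation move the convolution onto \<open>F\<close>, exhibiting the
  pairing as an average of translates with density \<open>D\<close>.\<close>

lemma convolve_pairing:
  fixes D k F :: "'a::euclidean_space \<Rightarrow> complex"
  assumes D: "integrable lborel D" and k: "integrable lborel k"
    and F [measurable]: "F \<in> borel_measurable borel" and B: "\<And>y. cmod (F y) \<le> B"
  shows "(LINT y|lborel. convolve D k y * F y) = (LINT \<zeta>|lborel. D \<zeta> * (LINT z|lborel. k z * F (z + \<zeta>)))"
proof -
  have [measurable]: "D \<in> borel_measurable borel" "k \<in> borel_measurable borel" using D k by auto
  have B0: "0 \<le> B" by (rule order_trans[OF norm_ge_zero B])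
  have int: "integrable (lborel \<Otimes>\<^sub>M lborel) (\<lambda>(y, z). D (y - z) * k z * F y)"
  proof (rule integrableI_bounded)
    show "(\<lambda>(y, z). D (y - z) * k z * F y) \<in> borel_measurable (lborel \<Otimes>\<^sub>M lborel)" by measurable
    have "(\<integral>\<^sup>+p. ennreal (cmod (case p of (y, z) \<Rightarrow> D (y - z) * k z * F y)) \<partial>(lborel \<Otimes>\<^sub>M lborel))
       = (\<integral>\<^sup>+z. \<integral>\<^sup>+y. ennreal (cmod (D (y - z) * k z * F y)) \<partial>lborel \<partial>lborel)"
      by (subst lborel_pair.nn_integral_snd[symmetric]) auto
    also have "\<dots> \<le> (\<integral>\<^sup>+z. \<integral>\<^sup>+y. ennreal (B * cmod (k z)) * ennreal (cmod (D (y - z))) \<partial>lborel \<partial>lborel)"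
    proof (intro nn_integral_mono)
      fix y z :: 'a
      have "cmod (D (y - z) * k z * F y) \<le> cmod (D (y - z)) * cmod (k z) * B"
        unfolding norm_mult by (intro mult_left_mono B) auto
      then have "cmod (D (y - z) * k z * F y) \<le> (B * cmod (k z)) * cmod (D (y - z))" by (simp add: mult_ac)
      then show "ennreal (cmod (D (y - z) * k z * F y)) \<le> ennreal (B * cmod (k z)) * ennreal (cmod (D (y - z)))"
        using B0 by (subst ennreal_mult[symmetric]) (auto intro: ennreal_leI)
    qed
    also have "\<dots> = (\<integral>\<^sup>+z. ennreal B * ennreal (cmod (k z)) * (\<integral>\<^sup>+y. ennreal (cmod (D y)) \<partial>lborel) \<partial>lborel)"
    proof (intro nn_integral_cong)
      fix z :: 'a
      have "(\<integral>\<^sup>+y. ennreal (B * cmod (k z)) * ennreal (cmod (D (y - z))) \<partial>lborel)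
        = ennreal (B * cmod (k z)) * (\<integral>\<^sup>+y. ennreal (cmod (D (y - z))) \<partial>lborel)" by (rule nn_integral_cmult) simp
      also have "(\<integral>\<^sup>+y. ennreal (cmod (D (y - z))) \<partial>lborel) = (\<integral>\<^sup>+y. ennreal (cmod (D y)) \<partial>lborel)"
        by (rule nn_integral_translate) simp
      finally show "(\<integral>\<^sup>+y. ennreal (B * cmod (k z)) * ennreal (cmod (D (y - z))) \<partial>lborel)
        = ennreal B * ennreal (cmod (k z)) * (\<integral>\<^sup>+y. ennreal (cmod (D y)) \<partial>lborel)"
        using B0 by (simp add: ennreal_mult)
    qed
    also have "\<dots> = ennreal B * (\<integral>\<^sup>+z. ennreal (cmod (k z)) \<partial>lborel) * (\<integral>\<^sup>+y. ennreal (cmod (D y)) \<partial>lborel)"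
      by (subst nn_integral_multc, simp, subst nn_integral_cmult) auto
    also have "\<dots> < \<infinity>"
      using D k by (simp add: integrable_iff_bounded ennreal_mult_less_top)
    finally show "(\<integral>\<^sup>+p. ennreal (cmod (case p of (y, z) \<Rightarrow> D (y - z) * k z * F y)) \<partial>(lborel \<Otimes>\<^sub>M lborel)) < \<infinity>" .
  qed
  have "(LINT y|lborel. convolve D k y * F y) = (LINT y|lborel. LINT z|lborel. D (y - z) * k z * F y)"
    unfolding convolve_def by (intro Bochner_Integration.integral_cong refl integral_mult_left_zero[symmetric])
  also have "\<dots> = (LINT z|lborel. LINT y|lborel. D (y - z) * k z * F y)"
    by (rule lborel_pair.Fubini_integral[OF int, symmetric])
  also have "\<dots> = (LINT z|lborel. k z * (LINT y|lborel. D y * (\<lambda>p. F (fst p + snd p)) (z, y)))"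
  proof (intro Bochner_Integration.integral_cong refl)
    fix z :: 'a
    have "(LINT y|lborel. D (y - z) * k z * F y) = (LINT y|lborel. k z * (D (y - z) * F (z + (y - z))))"
      by (simp add: mult_ac)
    also have "\<dots> = k z * (LINT y|lborel. D (y - z) * F (z + (y - z)))" by (rule integral_mult_right_zero)
    also have "(LINT y|lborel. D (y - z) * F (z + (y - z))) = (LINT y|lborel. D y * F (z + y))"
      by (rule integral_translate[of "\<lambda>y. D y * F (z + y)"]) measurable
    finally show "(LINT y|lborel. D (y - z) * k z * F y) = k z * (LINT y|lborel. D y * (\<lambda>p. F (fst p + snd p)) (z, y))" by simp
  qed
  also have "\<dots> = (LINT y|lborel. D y * (LINT z|lborel. k z * (\<lambda>p. F (fst p + snd p)) (z, y)))"
    by (rule fubini_tensor[OF k D _ B]) measurable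
  finally show ?thesis by simp
qed

text \<open>The substitutions at scale \<open>s\<close> in the variable of \<open>\<Psi>\<close> and
  at scale \<open>t\<close> in the variable of the kernel cancel the normalising factors of
  \<open>dilate\<close> and of \<open>K_star_eq\<close>; Fourier inversion then writes both inputs
  through \<open>ift\<close>.\<close>

lemma L_op_eq_T_avg:
  assumes q: "4 / 3 < q" and \<Psi>: "schwartz \<Psi>"
    and supp: "\<And>\<xi>. fourier \<Psi> \<xi> \<noteq> 0 \<Longrightarrow> 1/2 \<le> norm \<xi> \<and> norm \<xi> \<le> 2"
    and \<Omega>: "in_Lp circle_measure q \<Omega>" and f1: "schwartz f1" and f2: "schwartz f2"
  shows "L_op \<Psi> \<Omega> \<mu> \<gamma> f1 f2 x
    = T_avg \<Psi> (unit_kernel \<Psi> \<Omega>) (2 powi \<gamma>) (2 powi \<gamma> * 2 powi (- \<mu>)) (fourier f1) (fourier f2) x"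
proof -
  define t s where "t = (2::real) powi \<gamma>" and "s = t * 2 powi (- \<mu>)"
  have t: "t > 0" and s: "s > 0" by (simp_all add: t_def s_def)
  have s': "(2::real) powi (\<mu> - \<gamma>) = 1 / s"
    by (simp add: s_def t_def power_int_diff power_int_minus field_simps)
  note \<Psi>i = schwartz_plane_facts(1)[OF \<Psi>]
  \<comment> \<open>The maximum with 1 provides a strictly positive bound on the norm of
    \<open>\<Omega>\<close>; only integrability is taken from the class here.\<close>
  have Ki: "integrable lborel (unit_kernel \<Psi> \<Omega>)"
    by (rule rough_classD(3)[OF rough_class_unit_kernel[OF q \<Omega> _ _ \<Psi>, of "max 1 (Lp_norm circle_measure q \<Omega>)"]]) auto
  define D where "D = dilate (\<mu> - \<gamma>) \<Psi>"
  define k where "k = K_star \<Psi> \<Omega> \<gamma>"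
  have D_eq: "D \<zeta> = of_real (1 / s\<^sup>2) * \<Psi> ((1 / s) *\<^sub>R \<zeta>)" for \<zeta>
  proof -
    have "(2::real) powi (2 * (\<mu> - \<gamma>)) = (2 powi (\<mu> - \<gamma>)) powi 2"
      by (subst power_int_mult[symmetric]) (simp only: mult.commute)
    also have "\<dots> = 1 / s\<^sup>2" by (simp add: s' power_divide)
    finally show ?thesis by (simp add: D_def dilate_def s' scaleR_conv_of_real)
  qed
  have k_eq: "k \<zeta> = of_real (1 / t\<^sup>2) * unit_kernel \<Psi> \<Omega> ((1 / t) *\<^sub>R \<zeta>)" for \<zeta>
    using K_star_eq[OF supp, of \<Psi> \<Omega> \<gamma> "(1 / t) *\<^sub>R \<zeta>"] t by (simp add: k_def t_def)
  have Di: "integrable lborel D"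
    unfolding D_eq[abs_def] using s by (intro integrable_mult_right integrable_plane_scale \<Psi>i) auto
  have ki: "integrable lborel k"
    unfolding k_eq[abs_def] using t by (intro integrable_mult_right integrable_plane_scale Ki) auto
  have [measurable]: "D \<in> borel_measurable borel" "k \<in> borel_measurable borel" using Di ki by auto
  have [measurable]: "f1 \<in> borel_measurable borel" "f2 \<in> borel_measurable borel"
    using schwartz_real_facts(5)[OF f1] schwartz_real_facts(5)[OF f2] by (auto intro: borel_measurable_continuous_onI)
  obtain c1 c2 where c1: "\<And>x. cmod (f1 x) \<le> c1" and c2: "\<And>x. cmod (f2 x) \<le> c2"
    using schwartz_real_facts(6)[OF f1] schwartz_real_facts(6)[OF f2] by auto
  define F where "F y = f1 (x - fst y) * f2 (x - snd y)" for y :: plane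
  have Fm [measurable]: "F \<in> borel_measurable borel" unfolding F_def by measurable
  have FB: "cmod (F y) \<le> c1 * c2" for y
    unfolding F_def norm_mult by (intro mult_mono c1 c2 norm_ge_zero order_trans[OF norm_ge_zero c1])
  have "L_op \<Psi> \<Omega> \<mu> \<gamma> f1 f2 x = (LINT y|lborel. convolve D k y * F y)"
    by (simp add: L_op_def D_def k_def F_def mult.assoc)
  also have "\<dots> = (LINT \<zeta>|lborel. D \<zeta> * (LINT z|lborel. k z * F (z + \<zeta>)))"
    by (rule convolve_pairing[OF Di ki Fm FB])
  also have "\<dots> = s\<^sup>2 *\<^sub>R (LINT \<zeta>|lborel. D (s *\<^sub>R \<zeta>) * (LINT z|lborel. k z * F (z + s *\<^sub>R \<zeta>)))"
    by (rule integral_plane_scale) (use s in auto)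
  also have "\<dots> = (LINT \<zeta>|lborel. s\<^sup>2 *\<^sub>R (D (s *\<^sub>R \<zeta>) * (LINT z|lborel. k z * F (z + s *\<^sub>R \<zeta>))))"
    by simp
  also have "\<dots> = T_avg \<Psi> (unit_kernel \<Psi> \<Omega>) t s (fourier f1) (fourier f2) x"
    unfolding T_avg_def
  proof (intro Bochner_Integration.integral_cong refl)
    fix \<zeta> :: plane
    have "(LINT z|lborel. k z * F (z + s *\<^sub>R \<zeta>)) = t\<^sup>2 *\<^sub>R (LINT z|lborel. k (t *\<^sub>R z) * F (t *\<^sub>R z + s *\<^sub>R \<zeta>))"
      by (rule integral_plane_scale) (use t in auto)
    also have "\<dots> = (LINT z|lborel. t\<^sup>2 *\<^sub>R (k (t *\<^sub>R z) * F (t *\<^sub>R z + s *\<^sub>R \<zeta>)))" by simp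
    also have "\<dots> = (LINT y|lborel. unit_kernel \<Psi> \<Omega> y * (ift (fourier f1) (x - t * fst y - s * fst \<zeta>) * ift (fourier f2) (x - t * snd y - s * snd \<zeta>)))"
      unfolding schwartz_real_facts(3)[OF f1] schwartz_real_facts(3)[OF f2] k_eq F_def
      using t by (intro Bochner_Integration.integral_cong refl) (simp add: scaleR_conv_of_real diff_diff_eq)
    finally show "s\<^sup>2 *\<^sub>R (D (s *\<^sub>R \<zeta>) * (LINT z|lborel. k z * F (z + s *\<^sub>R \<zeta>))) =
      \<Psi> \<zeta> * (LINT y|lborel. unit_kernel \<Psi> \<Omega> y * (ift (fourier f1) (x - t * fst y - s * fst \<zeta>) * ift (fourier f2) (x - t * snd y - s * snd \<zeta>)))"
      unfolding D_eq using s by (simp add: scaleR_conv_of_real)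
  qed
  finally show ?thesis by (simp add: s_def t_def)
qed

section \<open>Exchanging the roles of the two inputs\<close>

lemma lborel_plane_swap: "distr lborel borel (\<lambda>p. (snd p, fst p)) = (lborel :: plane measure)"
proof (rule measure_eqI)
  fix A assume "A \<in> sets (distr lborel borel (\<lambda>p :: plane. (snd p, fst p)))"
  then have [measurable]: "A \<in> sets borel" by simp
  have "emeasure (distr lborel borel (\<lambda>p. (snd p, fst p))) A = (\<integral>\<^sup>+p. indicator A p \<partial>distr lborel borel (\<lambda>p :: plane. (snd p, fst p)))"
    by simp
  also have "\<dots> = (\<integral>\<^sup>+p. indicator A (snd p, fst p) \<partial>lborel)" by (rule nn_integral_distr) auto
  also have "\<dots> = (\<integral>\<^sup>+p. indicator A p \<partial>lborel)" by (rule nn_integral_plane_swap) simp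
  also have "\<dots> = emeasure lborel A" by simp
  finally show "emeasure (distr lborel borel (\<lambda>p. (snd p, fst p))) A = emeasure lborel A" .
qed simp

lemma integral_plane_swap:
  fixes f :: "plane \<Rightarrow> 'b::{banach, second_countable_topology}"
  assumes "f \<in> borel_measurable borel"
  shows "(LINT p|lborel. f (snd p, fst p)) = (LINT p|lborel. f p)"
    "integrable lborel f \<Longrightarrow> integrable lborel (\<lambda>p. f (snd p, fst p))"
proof -
  have sw: "(\<lambda>p :: plane. (snd p, fst p)) \<in> measurable lborel borel" by measurable
  show "(LINT p|lborel. f (snd p, fst p)) = (LINT p|lborel. f p)"
    using integral_distr[OF sw assms] by (simp add: lborel_plane_swap)
  show "integrable lborel f \<Longrightarrow> integrable lborel (\<lambda>p. f (snd p, fst p))"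
    using integrable_distr_eq[OF sw assms] by (simp add: lborel_plane_swap)
qed

lemma norm_plane_swap: "norm (snd p, fst p) = norm (p :: plane)"
  by (simp add: norm_prod_def add.commute)

lemma ann_swap: "(snd p, fst p) \<in> ann \<longleftrightarrow> p \<in> ann"
  by (simp add: ann_def norm_plane_swap)

lemma amp_swap:
  assumes A: "amp M A" shows "amp M (\<lambda>p. A (snd p, fst p))"
  unfolding amp_def
proof (intro conjI ballI)
  note [measurable] = ampD(1)[OF A]
  show "(\<lambda>p. A (snd p, fst p)) \<in> borel_measurable borel" by measurable
  fix y :: plane assume y: "y \<in> ann"
  show "cmod (A (snd y, fst y)) \<le> M" using ampD(2)[OF A] y ann_swap by blast
  fix z :: plane assume z: "z \<in> ann"
  have "norm ((snd y, fst y) - (snd z, fst z)) = norm (y - z)" using norm_plane_swap[of "y - z"] by simp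
  moreover have "cmod (A (snd y, fst y) - A (snd z, fst z)) \<le> M * norm ((snd y, fst y) - (snd z, fst z))"
    using y z by (intro ampD(3)[OF A]) (simp_all only: ann_swap)
  ultimately show "cmod (A (snd y, fst y) - A (snd z, fst z)) \<le> M * norm (y - z)" by simp
qed

lemma rough_class_swap:
  assumes K: "rough_class q N K" shows "rough_class q N (\<lambda>p. K (snd p, fst p))"
  unfolding rough_class_def
proof (intro conjI allI impI)
  note Km [measurable] = rough_classD(1)[OF K]
  have Kq: "(\<lambda>y. cmod (K y) powr q) \<in> borel_measurable borel" by measurable
  show "(\<lambda>p. K (snd p, fst p)) \<in> borel_measurable borel" by measurable
  show "K (snd y, fst y) = 0" if "y \<notin> ann" for y
    using that by (intro rough_classD(2)[OF K]) (simp only: ann_swap not_False_eq_True)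
  show "integrable lborel (\<lambda>p. K (snd p, fst p))" by (rule integral_plane_swap(2)[OF Km rough_classD(3)[OF K]])
  show "integrable lborel (\<lambda>y. cmod (K (snd y, fst y)) powr q)" by (rule integral_plane_swap(2)[OF Kq rough_classD(4)[OF K]])
  show "(LINT y|lborel. cmod (K (snd y, fst y)) powr q) \<le> N powr q"
    unfolding integral_plane_swap(1)[OF Kq] by (rule rough_classD(5)[OF K])
  fix M A and \<xi> :: plane assume A: "amp M A" and \<xi>: "1 \<le> norm \<xi>"
  note [measurable] = ampD(1)[OF A]
  have "fourier (\<lambda>y. K (snd y, fst y) * A y) \<xi> = (LINT y|lborel. (\<lambda>y. K y * A (snd y, fst y) * ee (- (y \<bullet> (snd \<xi>, fst \<xi>)))) (snd y, fst y))"
    unfolding fourier_ee by (simp add: inner_prod_def add.commute)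
  also have "\<dots> = fourier (\<lambda>y. K y * A (snd y, fst y)) (snd \<xi>, fst \<xi>)"
    unfolding fourier_ee by (rule integral_plane_swap(1)) measurable
  finally have "cmod (fourier (\<lambda>y. K (snd y, fst y) * A y) \<xi>) \<le> M * N * norm (snd \<xi>, fst \<xi>) powr (- 1 / 8)"
    using rough_classD(6)[OF K amp_swap[OF A], of "(snd \<xi>, fst \<xi>)"] \<xi> by (simp only: norm_plane_swap)
  then show "cmod (fourier (\<lambda>y. K (snd y, fst y) * A y) \<xi>) \<le> M * N * norm \<xi> powr (- 1 / 8)"
    by (simp only: norm_plane_swap)
qed

text \<open>The low-pass estimate is stated for a low-pass first input; this identity transfers it
  to the second slot, and the rough class is invariant under the swap.\<close>

lemma T_avg_swap:
  assumes [measurable]: "\<Psi> \<in> borel_measurable borel" "K \<in> borel_measurable borel" "u \<in> borel_measurable borel" "v \<in> borel_measurable borel"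
  shows "T_avg \<Psi> K t s u v x = T_avg (\<lambda>p. \<Psi> (snd p, fst p)) (\<lambda>p. K (snd p, fst p)) t s v u x"
proof -
  define G where "G \<zeta> = \<Psi> \<zeta> * (LINT y|lborel. K y *
      (ift u (x - t * fst y - s * fst \<zeta>) * ift v (x - t * snd y - s * snd \<zeta>)))" for \<zeta>
  have Gm: "G \<in> borel_measurable borel" unfolding G_def by measurable
  have "T_avg \<Psi> K t s u v x = (LINT \<zeta>|lborel. G (snd \<zeta>, fst \<zeta>))"
    unfolding T_avg_def G_def[symmetric] by (rule integral_plane_swap(1)[OF Gm, symmetric])
  also have "\<dots> = T_avg (\<lambda>p. \<Psi> (snd p, fst p)) (\<lambda>p. K (snd p, fst p)) t s v u x"
    unfolding T_avg_def
  proof (intro Bochner_Integration.integral_cong refl)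
    fix \<zeta> :: plane
    define H where "H y = K y * (ift u (x - t * fst y - s * snd \<zeta>) * ift v (x - t * snd y - s * fst \<zeta>))" for y
    have Hm: "H \<in> borel_measurable borel" unfolding H_def by measurable
    have "G (snd \<zeta>, fst \<zeta>) = \<Psi> (snd \<zeta>, fst \<zeta>) * (LINT y|lborel. H y)" by (simp add: G_def H_def)
    also have "(LINT y|lborel. H y) = (LINT y|lborel. H (snd y, fst y))" by (rule integral_plane_swap(1)[OF Hm, symmetric])
    finally show "G (snd \<zeta>, fst \<zeta>) = \<Psi> (snd \<zeta>, fst \<zeta>) * (LINT y|lborel. K (snd y, fst y) *
      (ift v (x - t * fst y - s * fst \<zeta>) * ift u (x - t * snd y - s * snd \<zeta>)))"
      by (simp add: H_def mult.commute)
  qed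
  finally show ?thesis .
qed

section \<open>Additivity, and vanishing outside the spectrum of the averaging function\<close>

lemma ift_add:
  assumes "integrable lborel u" "integrable lborel v"
  shows "ift (\<lambda>\<xi>. u \<xi> + v \<xi>) x = ift u x + ift v x"
  unfolding ift_def distrib_right
  by (intro Bochner_Integration.integral_add; rule integrable_mult_bdd(1)[where C=1]) (use assms in auto)

lemma T_avg_add_left:
  assumes K: "integrable lborel K" and \<Psi>: "integrable lborel \<Psi>" and u: "integrable lborel u" "integrable lborel u'" and v: "integrable lborel v"
  shows "T_avg \<Psi> K t s (\<lambda>\<xi>. u \<xi> + u' \<xi>) v x = T_avg \<Psi> K t s u v x + T_avg \<Psi> K t s u' v x"
  unfolding T_avg_def ift_add[OF u] distrib_right distrib_left
    Bochner_Integration.integral_add[OF T_avg_integrands(1)[OF K \<Psi> u(1) v] T_avg_integrands(1)[OF K \<Psi> u(2) v]]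
  by (rule Bochner_Integration.integral_add[OF T_avg_integrands(2)[OF K \<Psi> u(1) v] T_avg_integrands(2)[OF K \<Psi> u(2) v]])

lemma T_avg_add_right:
  assumes K: "integrable lborel K" and \<Psi>: "integrable lborel \<Psi>" and u: "integrable lborel u" and v: "integrable lborel v" "integrable lborel v'"
  shows "T_avg \<Psi> K t s u (\<lambda>\<xi>. v \<xi> + v' \<xi>) x = T_avg \<Psi> K t s u v x + T_avg \<Psi> K t s u v' x"
  unfolding T_avg_def ift_add[OF v] distrib_right distrib_left
    Bochner_Integration.integral_add[OF T_avg_integrands(1)[OF K \<Psi> u v(1)] T_avg_integrands(1)[OF K \<Psi> u v(2)]]
  by (rule Bochner_Integration.integral_add[OF T_avg_integrands(2)[OF K \<Psi> u v(1)] T_avg_integrands(2)[OF K \<Psi> u v(2)]])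

text \<open>Integrating in \<open>\<zeta>\<close> first turns the average into a bilinear Fourier
  multiplier with symbol \<open>fourier \<Psi> (s * \<xi>, s * \<eta>)\<close>, which vanishes
  wherever both inputs have mass.\<close>

lemma T_avg_eq_0:
  assumes K: "integrable lborel K" and \<Psi>: "integrable lborel \<Psi>" and u: "integrable lborel u" and v: "integrable lborel v"
    and van: "\<And>\<xi> \<eta>. u \<xi> \<noteq> 0 \<Longrightarrow> v \<eta> \<noteq> 0 \<Longrightarrow> fourier \<Psi> (s * \<xi>, s * \<eta>) = 0"
  shows "T_avg \<Psi> K t s u v x = 0"
proof -
  have [measurable]: "K \<in> borel_measurable borel" "\<Psi> \<in> borel_measurable borel" "u \<in> borel_measurable borel" "v \<in> borel_measurable borel"
    using assms by auto
  define U V where "U = (LINT \<xi>|lborel. cmod (u \<xi>))" and "V = (LINT \<xi>|lborel. cmod (v \<xi>))"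
  have b: "cmod (ift u a * ift v b) \<le> U * V" for a b
    unfolding norm_mult U_def V_def by (intro mult_mono norm_ift_le u v) auto
  define W where "W p = u (fst p) * v (snd p)" for p :: plane
  have Wi: "integrable lborel W"
    using integrable_tensor[OF u v, of "\<lambda>_. 1" 1] by (simp add: W_def[abs_def] lborel_prod case_prod_beta')
  have tens: "ift u a * ift v b = (LINT p|lborel. W p * ee (a * fst p + b * snd p))" for a b
  proof -
    have "(LINT p|lborel. W p * ee (a * fst p + b * snd p)) = (LINT \<xi>|lborel. LINT \<eta>|lborel. W (\<xi>, \<eta>) * ee (a * fst (\<xi>, \<eta>) + b * snd (\<xi>, \<eta>)))"
      by (rule plane_fubini) (rule integrable_mult_bdd(1)[OF Wi, where C=1]; simp)
    also have "\<dots> = (LINT \<xi>|lborel. LINT \<eta>|lborel. (u \<xi> * ee (a * \<xi>)) * (v \<eta> * ee (b * \<eta>)))"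
      by (simp add: W_def ee_add mult_ac)
    also have "\<dots> = (LINT \<xi>|lborel. (u \<xi> * ee (a * \<xi>)) * ift v b)"
      unfolding ift_def by (intro Bochner_Integration.integral_cong refl integral_mult_right_zero)
    also have "\<dots> = ift u a * ift v b" unfolding ift_def by (rule integral_mult_left_zero)
    finally show ?thesis by simp
  qed
  have inner: "(LINT \<zeta>|lborel. \<Psi> \<zeta> * (ift u (a - s * fst \<zeta>) * ift v (b - s * snd \<zeta>))) = 0" for a b
  proof -
    have "(LINT \<zeta>|lborel. \<Psi> \<zeta> * (ift u (a - s * fst \<zeta>) * ift v (b - s * snd \<zeta>)))
      = (LINT \<zeta>|lborel. \<Psi> \<zeta> * (LINT p|lborel. W p * (\<lambda>r. ee ((a - s * fst (fst r)) * fst (snd r) + (b - s * snd (fst r)) * snd (snd r))) (\<zeta>, p)))"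
      by (simp add: tens)
    also have "\<dots> = (LINT p|lborel. W p * (LINT \<zeta>|lborel. \<Psi> \<zeta> * (\<lambda>r. ee ((a - s * fst (fst r)) * fst (snd r) + (b - s * snd (fst r)) * snd (snd r))) (\<zeta>, p)))"
      by (rule fubini_tensor[OF \<Psi> Wi, where C=1]) auto
    also have "\<dots> = (LINT p|(lborel :: plane measure). 0)"
    proof (intro Bochner_Integration.integral_cong refl)
      fix p :: plane
      have "(LINT \<zeta>|lborel. \<Psi> \<zeta> * (\<lambda>r. ee ((a - s * fst (fst r)) * fst (snd r) + (b - s * snd (fst r)) * snd (snd r))) (\<zeta>, p))
        = (LINT \<zeta>|lborel. ee (a * fst p + b * snd p) * (\<Psi> \<zeta> * ee (- (\<zeta> \<bullet> (s * fst p, s * snd p)))))"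
        by (intro Bochner_Integration.integral_cong refl) (simp add: inner_prod_def ee_add[symmetric] algebra_simps)
      also have "\<dots> = ee (a * fst p + b * snd p) * fourier \<Psi> (s * fst p, s * snd p)"
        unfolding fourier_ee by (rule integral_mult_right_zero)
      finally show "W p * (LINT \<zeta>|lborel. \<Psi> \<zeta> * (\<lambda>r. ee ((a - s * fst (fst r)) * fst (snd r) + (b - s * snd (fst r)) * snd (snd r))) (\<zeta>, p)) = 0"
        using van[of "fst p" "snd p"] by (auto simp: W_def)
    qed
    finally show ?thesis by simp
  qed
  have "T_avg \<Psi> K t s u v x = (LINT \<zeta>|lborel. \<Psi> \<zeta> * (LINT y|lborel. K y * (\<lambda>r. ift u (x - t * fst (snd r) - s * fst (fst r)) * ift v (x - t * snd (snd r) - s * snd (fst r))) (\<zeta>, y)))"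
    by (simp add: T_avg_def)
  also have "\<dots> = (LINT y|lborel. K y * (LINT \<zeta>|lborel. \<Psi> \<zeta> * (\<lambda>r. ift u (x - t * fst (snd r) - s * fst (fst r)) * ift v (x - t * snd (snd r) - s * snd (fst r))) (\<zeta>, y)))"
    by (rule fubini_tensor[OF \<Psi> K _ b]) measurable
  also have "\<dots> = 0" by (simp add: inner)
  finally show ?thesis .
qed

section \<open>Splitting the frequencies\<close>

definition off_band :: "real \<Rightarrow> (real \<Rightarrow> complex) \<Rightarrow> real \<Rightarrow> complex" where
  "off_band s a \<xi> = (if 1 / 4 \<le> s * \<bar>\<xi>\<bar> \<and> s * \<bar>\<xi>\<bar> \<le> 2 then 0 else a \<xi>)"

definition above_band :: "real \<Rightarrow> real \<Rightarrow> (real \<Rightarrow> complex) \<Rightarrow> real \<Rightarrow> complex" where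
  "above_band t s a \<xi> = (if s * \<bar>\<xi>\<bar> \<le> 2 then 0 else of_real (1 - gauss (t * \<xi>)) * a \<xi>)"

lemma off_band_integrable: assumes a: "L2fun a" shows "integrable lborel (off_band s a)" "integrable lborel (above_band t s a)"
proof -
  note [measurable] = L2fun_measurable[OF a]
  have ai: "integrable lborel a" using a by (simp add: L2fun_def)
  show "integrable lborel (off_band s a)"
  proof (rule Bochner_Integration.integrable_bound[OF ai])
    show "off_band s a \<in> borel_measurable lborel" unfolding off_band_def by measurable
  qed (auto simp: off_band_def)
  show "integrable lborel (above_band t s a)"
  proof (rule Bochner_Integration.integrable_bound[OF ai])
    show "above_band t s a \<in> borel_measurable lborel" unfolding above_band_def by measurable
    show "AE \<xi> in lborel. cmod (above_band t s a \<xi>) \<le> cmod (a \<xi>)"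
      by (auto simp: above_band_def norm_mult abs_one_minus_gauss gauss_le1 simp del: of_real_diff intro!: mult_left_le_one_le)
  qed
qed

lemma band_decomp:
  "(\<lambda>\<xi>. band s a \<xi> + off_band s a \<xi>) = a"
  "(\<lambda>\<xi>. low t a \<xi> + (mid t s a \<xi> + above_band t s a \<xi>)) = a"
  by (auto simp: fun_eq_iff band_def off_band_def low_def mid_def above_band_def algebra_simps)

text \<open>A pair of inputs at frequencies \<open>\<xi>\<close> and \<open>\<eta>\<close> contributes nothing unless
  \<open>(s * \<xi>, s * \<eta>)\<close> lies in the support of the Fourier transform of \<open>\<Psi>\<close>.\<close>
lemma T_avg_split:
  assumes K: "integrable lborel K" and \<Psi>: "integrable lborel \<Psi>" and a: "L2fun a" and b: "L2fun b" and s: "s \<ge> 0"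
    and supp: "\<And>\<xi>. fourier \<Psi> \<xi> \<noteq> 0 \<Longrightarrow> 1/2 \<le> norm \<xi> \<and> norm \<xi> \<le> 2"
  shows "T_avg \<Psi> K t s a b x = T_avg \<Psi> K t s (band s a) b x + T_avg \<Psi> K t s (off_band s a) b x"
    "T_avg \<Psi> K t s (band s a) b x = T_avg \<Psi> K t s (band s a) (low t b) x + T_avg \<Psi> K t s (band s a) (mid t s b) x"
    "T_avg \<Psi> K t s (off_band s a) b x = T_avg \<Psi> K t s a (band s b) x - T_avg \<Psi> K t s (band s a) (band s b) x"
    "T_avg \<Psi> K t s a (band s b) x = T_avg \<Psi> K t s (low t a) (band s b) x + T_avg \<Psi> K t s (mid t s a) (band s b) x"
proof -
  have i: "integrable lborel c" "integrable lborel (band s c)" "integrable lborel (off_band s c)" "integrable lborel (low t c)"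
    "integrable lborel (mid t s c)" "integrable lborel (above_band t s c)" "integrable lborel (\<lambda>\<xi>. mid t s c \<xi> + above_band t s c \<xi>)" if c: "L2fun c" for c
    using L2fun_band[OF c] L2fun_low[OF c] off_band_integrable[OF c] c by (auto simp: L2fun_def)
  note R = T_avg_add_right[OF K \<Psi>] and L = T_avg_add_left[OF K \<Psi>]
  have far: "fourier \<Psi> (s * \<xi>, s * \<eta>) = 0" if "s * \<bar>\<xi>\<bar> > 2 \<or> s * \<bar>\<eta>\<bar> > 2" for \<xi> \<eta>
  proof (rule ccontr)
    assume "fourier \<Psi> (s * \<xi>, s * \<eta>) \<noteq> 0"
    then have "norm (s * \<xi>, s * \<eta>) \<le> 2" using supp by blast
    then show False using that s abs_fst_le_norm[of "(s * \<xi>, s * \<eta>)"] abs_snd_le_norm[of "(s * \<xi>, s * \<eta>)"]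
      by (auto simp: abs_mult)
  qed
  have near: "fourier \<Psi> (s * \<xi>, s * \<eta>) = 0" if "s * \<bar>\<xi>\<bar> < 1/4" "s * \<bar>\<eta>\<bar> < 1/4" for \<xi> \<eta>
  proof (rule ccontr)
    assume "fourier \<Psi> (s * \<xi>, s * \<eta>) \<noteq> 0"
    then have "1/2 \<le> norm (s * \<xi>, s * \<eta>)" using supp by blast
    also have "\<dots> \<le> norm (s * \<xi>) + norm (s * \<eta>)" by (rule norm_Pair_le)
    finally show False using that s by (simp add: abs_mult)
  qed
  show "T_avg \<Psi> K t s a b x = T_avg \<Psi> K t s (band s a) b x + T_avg \<Psi> K t s (off_band s a) b x"
    using L[OF i(2)[OF a] i(3)[OF a] i(1)[OF b]] by (simp add: band_decomp)
  have "T_avg \<Psi> K t s (band s a) (above_band t s b) x = 0"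
    by (rule T_avg_eq_0[OF K \<Psi> i(2)[OF a] i(6)[OF b] far]) (auto simp: above_band_def split: if_splits)
  then show "T_avg \<Psi> K t s (band s a) b x = T_avg \<Psi> K t s (band s a) (low t b) x + T_avg \<Psi> K t s (band s a) (mid t s b) x"
    using R[OF i(2)[OF a] i(4)[OF b] i(7)[OF b]] R[OF i(2)[OF a] i(5)[OF b] i(6)[OF b]] by (simp add: band_decomp)
  have "T_avg \<Psi> K t s (off_band s a) (off_band s b) x = 0"
  proof (rule T_avg_eq_0[OF K \<Psi> i(3)[OF a] i(3)[OF b]])
    fix \<xi> \<eta> assume "off_band s a \<xi> \<noteq> 0" "off_band s b \<eta> \<noteq> 0"
    then show "fourier \<Psi> (s * \<xi>, s * \<eta>) = 0" using far[of \<xi> \<eta>] near[of \<xi> \<eta>] by (auto simp: off_band_def split: if_splits)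
  qed
  then have "T_avg \<Psi> K t s (off_band s a) b x = T_avg \<Psi> K t s (off_band s a) (band s b) x"
    using R[OF i(3)[OF a] i(2)[OF b] i(3)[OF b]] by (simp add: band_decomp)
  \<comment> \<open>Writing \<open>off_band\<close> as the whole minus the band restores the full
    input \<open>a\<close>, to which the Gaussian splitting applies, for one additional term with
    both inputs in the band.\<close>
  moreover have "T_avg \<Psi> K t s a (band s b) x = T_avg \<Psi> K t s (band s a) (band s b) x + T_avg \<Psi> K t s (off_band s a) (band s b) x"
    using L[OF i(2)[OF a] i(3)[OF a] i(2)[OF b]] by (simp add: band_decomp)
  ultimately show "T_avg \<Psi> K t s (off_band s a) b x = T_avg \<Psi> K t s a (band s b) x - T_avg \<Psi> K t s (band s a) (band s b) x" by simp
  have "T_avg \<Psi> K t s (above_band t s a) (band s b) x = 0"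
    by (rule T_avg_eq_0[OF K \<Psi> i(6)[OF a] i(2)[OF b] far]) (auto simp: above_band_def split: if_splits)
  then show "T_avg \<Psi> K t s a (band s b) x = T_avg \<Psi> K t s (low t a) (band s b) x + T_avg \<Psi> K t s (mid t s a) (band s b) x"
    using L[OF i(4)[OF a] i(7)[OF a] i(2)[OF b]] L[OF i(5)[OF a] i(6)[OF a] i(2)[OF b]] by (simp add: band_decomp)
qed

definition sup_L1_norm :: "(int \<Rightarrow> real \<Rightarrow> complex) \<Rightarrow> ennreal" where
  "sup_L1_norm f = (\<integral>\<^sup>+x. (SUP \<gamma>. ennreal (cmod (f \<gamma> x))) \<partial>lborel)"

lemma sup_L1_norm_add:
  assumes le: "\<And>\<gamma> x. cmod (f \<gamma> x) \<le> cmod (g \<gamma> x) + cmod (h \<gamma> x)"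
    and [measurable]: "\<And>\<gamma>. g \<gamma> \<in> borel_measurable borel" "\<And>\<gamma>. h \<gamma> \<in> borel_measurable borel"
    and A: "sup_L1_norm g \<le> ennreal A" "A \<ge> 0" and B: "sup_L1_norm h \<le> ennreal B" "B \<ge> 0"
  shows "sup_L1_norm f \<le> ennreal (A + B)"
proof -
  have "sup_L1_norm f \<le> (\<integral>\<^sup>+x. (SUP \<gamma>. ennreal (cmod (g \<gamma> x))) + (SUP \<gamma>. ennreal (cmod (h \<gamma> x))) \<partial>lborel)"
    unfolding sup_L1_norm_def
  proof (intro nn_integral_mono SUP_least)
    fix x \<gamma>
    have "ennreal (cmod (f \<gamma> x)) \<le> ennreal (cmod (g \<gamma> x)) + ennreal (cmod (h \<gamma> x))"
      using ennreal_leI[OF le[of \<gamma> x]] by simp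
    also have "\<dots> \<le> (SUP \<gamma>. ennreal (cmod (g \<gamma> x))) + (SUP \<gamma>. ennreal (cmod (h \<gamma> x)))"
      by (intro add_mono SUP_upper) auto
    finally show "ennreal (cmod (f \<gamma> x)) \<le> (SUP \<gamma>. ennreal (cmod (g \<gamma> x))) + (SUP \<gamma>. ennreal (cmod (h \<gamma> x)))" .
  qed
  also have "\<dots> = sup_L1_norm g + sup_L1_norm h"
    unfolding sup_L1_norm_def by (rule nn_integral_add) measurable
  also have "\<dots> \<le> ennreal A + ennreal B" by (intro add_mono A B)
  finally show ?thesis using A B by simp
qed

text \<open>The splitting leaves five operators with at least one input in the band. Where the other
  input is low (two cases) the maximal bound \<open>B1\<close> holds; where it is \<open>mid\<close>
  or \<open>band\<close> (three cases) the summed single-scale bound \<open>B2\<close>. Hence the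
  coefficient \<open>8192 = 2 * 4096\<close> and the factor 3.\<close>

lemma T_avg_sup_le:
  assumes q: "4 / 3 < q" "q \<le> 2" and K: "rough_class q N K" and N: "N > 0"
    and \<tau>: "2 = \<tau> * 2 ^ m" "\<tau> > 0" "\<tau> \<le> 1" and \<rho>: "\<rho> = 1 / (4 * \<tau>)" "2 \<le> \<rho>"
    and f: "schwartz f" and g: "schwartz g" and \<Psi>: "schwartz \<Psi>"
    and supp: "\<And>\<xi>. fourier \<Psi> \<xi> \<noteq> 0 \<Longrightarrow> 1/2 \<le> norm \<xi> \<and> norm \<xi> \<le> 2"
  shows "sup_L1_norm (\<lambda>\<gamma>. T_avg \<Psi> K (2 powi \<gamma>) (2 powi \<gamma> * \<tau>) (fourier f) (fourier g))
     \<le> ennreal (weight \<Psi> * (8192 * pi * C_low + 3 * C_diag q) * N * (\<rho> powr (- rate q) * (2 * m + 33)) * (l2 f * l2 g))"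
proof -
  define a b where "a = fourier f" and "b = fourier g"
  \<comment> \<open>\<open>Q\<^sup>2\<close> bounds the overlap of the \<open>mid\<close> pieces and
    also the overlap 7 of the bands. Since \<open>Q \<ge> 1\<close>, the low-pass terms, which
    involve it once, fit under the same factor \<open>Q\<^sup>2\<close>.\<close>
  define W Q where "W = weight \<Psi>" and "Q = sqrt (2 * real m + 33)"
  note F = schwartz_real_facts(1,2,4)[OF f, folded a_def] and G = schwartz_real_facts(1,2,4)[OF g, folded b_def]
  note P = schwartz_plane_facts[OF \<Psi>]
  note Km [measurable] = rough_classD(1)[OF K] L2fun_measurable[OF F(2)] L2fun_measurable[OF G(2)]
  have Pm [measurable]: "\<Psi> \<in> borel_measurable borel" using P(1) by auto
  have W: "W \<ge> 0" by (simp add: W_def weight_nonneg)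
  have Q2: "Q\<^sup>2 = 2 * real m + 33" by (simp add: Q_def)
  have Q1: "1 \<le> Q" by (simp add: Q_def)
  have q0: "q > 0" using q by simp
  have sH: "(\<integral>\<^sup>+\<gamma>. ennreal ((l2 (band (2 powi \<gamma> * \<tau>) c))\<^sup>2) \<partial>count_space UNIV) \<le> ennreal ((Q * l2 h)\<^sup>2)"
    and sh: "(\<integral>\<^sup>+\<gamma>. ennreal ((l2 (mid (2 powi \<gamma>) (2 powi \<gamma> * \<tau>) c))\<^sup>2) \<partial>count_space UNIV) \<le> ennreal ((Q * l2 h)\<^sup>2)"
    if c: "L2fun c" and le: "l2 c \<le> l2 h" for c h
  proof -
    have *: "(l2 c)\<^sup>2 \<le> (l2 h)\<^sup>2" using le by (intro power_mono) auto
    have "7 * (l2 c)\<^sup>2 \<le> Q\<^sup>2 * (l2 h)\<^sup>2" using * unfolding Q2 by (intro mult_mono) auto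
    then show "(\<integral>\<^sup>+\<gamma>. ennreal ((l2 (band (2 powi \<gamma> * \<tau>) c))\<^sup>2) \<partial>count_space UNIV) \<le> ennreal ((Q * l2 h)\<^sup>2)"
      unfolding power_mult_distrib by (intro order_trans[OF sum_band[OF c \<tau>(2)]] ennreal_leI)
    have "(2 * real m + 33) * (l2 c)\<^sup>2 \<le> Q\<^sup>2 * (l2 h)\<^sup>2" using * unfolding Q2 by (intro mult_left_mono) auto
    then show "(\<integral>\<^sup>+\<gamma>. ennreal ((l2 (mid (2 powi \<gamma>) (2 powi \<gamma> * \<tau>) c))\<^sup>2) \<partial>count_space UNIV) \<le> ennreal ((Q * l2 h)\<^sup>2)"
      unfolding power_mult_distrib by (intro order_trans[OF sum_mid[OF c \<tau>(1,2)]] ennreal_leI)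
  qed
  have farH: "\<rho> \<le> 2 powi \<gamma> * \<bar>\<xi>\<bar>" "2 powi \<gamma> * \<bar>\<xi>\<bar> \<le> 2 / \<tau>" if "band (2 powi \<gamma> * \<tau>) c \<xi> \<noteq> 0" for \<gamma> c \<xi>
    using that \<tau>(2) unfolding \<rho>(1) by (auto simp: band_def divide_le_eq le_divide_eq mult_ac split: if_splits)
  have Xh: "2 powi \<gamma> * \<bar>\<xi>\<bar> \<le> 2 / \<tau>" if "mid (2 powi \<gamma>) (2 powi \<gamma> * \<tau>) c \<xi> \<noteq> 0" for \<gamma> c \<xi>
    using that \<tau>(2) by (auto simp: mid_def le_divide_eq mult_ac split: if_splits)
  define E where "E = \<rho> powr (- rate q) * (Q\<^sup>2 * (l2 f * l2 g))"
  have E0: "E \<ge> 0" by (simp add: E_def)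
  define B1 where "B1 = W * (4096 * pi * C_low) * N * E"
  define B2 where "B2 = W * C_diag q * N * E"
  have B0: "B1 \<ge> 0" "B2 \<ge> 0" using W N E0 C_diag_pos[OF q] by (auto simp: B1_def B2_def C_low_def)
  \<comment> \<open>The low-pass terms keep the full exponent \<open>1 / 8\<close>; it is weakened
    to \<open>rate q\<close> to reach a common bound.\<close>
  have rl: "rate q \<le> 1/8"
  proof -
    define r where "r = q / (q - 1)"
    have "2 \<le> r" using dual_exponent(1)[OF q] by (simp add: r_def)
    then show ?thesis unfolding rate_def r_def[symmetric] by simp
  qed
  have low_bd: "W * (2 * C_low * (8 * pi * l2 f' * (256 * N * \<rho> powr (- 1 / 8) * (Q * l2 g')))) \<le> B1"
    if "l2 f' * l2 g' = l2 f * l2 g" for f' g'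
  proof -
    have "\<rho> powr (- 1 / 8) * Q \<le> \<rho> powr (- rate q) * Q\<^sup>2"
    proof (intro mult_mono)
      show "\<rho> powr (- 1 / 8) \<le> \<rho> powr (- rate q)" using \<rho>(2) rl by (intro powr_mono) auto
      show "Q \<le> Q\<^sup>2" using Q1 by (simp add: power2_eq_square)
    qed (use Q1 in auto)
    then have "(W * (4096 * pi * C_low) * N * (l2 f * l2 g)) * (\<rho> powr (- 1 / 8) * Q) \<le> (W * (4096 * pi * C_low) * N * (l2 f * l2 g)) * (\<rho> powr (- rate q) * Q\<^sup>2)"
      using W N by (intro mult_left_mono mult_nonneg_nonneg) (auto simp: C_low_def)
    moreover have "W * (2 * C_low * (8 * pi * l2 f' * (256 * N * \<rho> powr (- 1 / 8) * (Q * l2 g')))) = (W * (4096 * pi * C_low) * N * (l2 f * l2 g)) * (\<rho> powr (- 1 / 8) * Q)"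
      unfolding that[symmetric] by simp
    moreover have "B1 = (W * (4096 * pi * C_low) * N * (l2 f * l2 g)) * (\<rho> powr (- rate q) * Q\<^sup>2)"
      unfolding B1_def E_def by (simp only: mult_ac)
    ultimately show ?thesis by linarith
  qed
  have diag_bd: "W * (C_diag q * N * \<rho> powr (- rate q)) * ((Q * l2 f) * (Q * l2 g)) = B2"
    unfolding B2_def E_def power2_eq_square by (simp only: mult_ac)
  have QL: "0 \<le> Q * l2 h" for h using Q1 by simp
  define p where "p u v \<gamma> = T_avg \<Psi> K (2 powi \<gamma>) (2 powi \<gamma> * \<tau>) (u \<gamma>) (v \<gamma>)" for u v \<gamma>
  define aH bH ah bh al bl where
    "aH \<gamma> = band (2 powi \<gamma> * \<tau>) a" and "bH \<gamma> = band (2 powi \<gamma> * \<tau>) b"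
    and "ah \<gamma> = mid (2 powi \<gamma>) (2 powi \<gamma> * \<tau>) a" and "bh \<gamma> = mid (2 powi \<gamma>) (2 powi \<gamma> * \<tau>) b"
    and "al \<gamma> = low (2 powi \<gamma>) a" and "bl \<gamma> = low (2 powi \<gamma>) b" for \<gamma> :: int
  note H = aH_def bH_def ah_def bh_def al_def bl_def
  have L: "L2fun (aH \<gamma>)" "L2fun (bH \<gamma>)" "L2fun (ah \<gamma>)" "L2fun (bh \<gamma>)" "L2fun (al \<gamma>)" "L2fun (bl \<gamma>)" for \<gamma>
    unfolding H by (intro L2fun_band L2fun_low F(2) G(2))+
  note [measurable] = L[THEN L2fun_measurable]
  have pm: "p u v \<gamma> \<in> borel_measurable borel" if "u \<gamma> \<in> borel_measurable borel" "v \<gamma> \<in> borel_measurable borel" for u v \<gamma>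
    unfolding p_def using that by measurable
  have diag: "sup_L1_norm (p u v) \<le> ennreal B2"
    if u: "\<And>\<gamma>. L2fun (u \<gamma>)" and v: "\<And>\<gamma>. L2fun (v \<gamma>)" and X: "\<And>\<gamma> \<xi>. u \<gamma> \<xi> \<noteq> 0 \<Longrightarrow> 2 powi \<gamma> * \<bar>\<xi>\<bar> \<le> 2 / \<tau>" "\<And>\<gamma> \<xi>. v \<gamma> \<xi> \<noteq> 0 \<Longrightarrow> 2 powi \<gamma> * \<bar>\<xi>\<bar> \<le> 2 / \<tau>"
      and far: "u = aH \<or> v = bH"
      and S: "(\<integral>\<^sup>+\<gamma>. ennreal ((l2 (u \<gamma>))\<^sup>2) \<partial>count_space UNIV) \<le> ennreal ((Q * l2 f)\<^sup>2)"
        "(\<integral>\<^sup>+\<gamma>. ennreal ((l2 (v \<gamma>))\<^sup>2) \<partial>count_space UNIV) \<le> ennreal ((Q * l2 g)\<^sup>2)" for u v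
    unfolding sup_L1_norm_def p_def diag_bd[symmetric] W_def
  proof (rule T_avg_diag_sum_le[OF q K N \<rho>(2) u v P(1) P(2) X _ S(1) QL S(2) QL])
    show "(\<forall>\<gamma> \<xi>. u \<gamma> \<xi> \<noteq> 0 \<longrightarrow> \<rho> \<le> 2 powi \<gamma> * \<bar>\<xi>\<bar>) \<or> (\<forall>\<gamma> \<xi>. v \<gamma> \<xi> \<noteq> 0 \<longrightarrow> \<rho> \<le> 2 powi \<gamma> * \<bar>\<xi>\<bar>)"
      using far farH(1) by (auto simp: H)
  qed
  have t0: "0 \<le> \<tau>" using \<tau>(2) by simp
  \<comment> \<open>The low-pass input sits in the second slot here, so kernel and
    \<open>\<Psi>\<close> are swapped first; the weight in \<open>snd \<zeta>\<close> becomes one in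
    \<open>fst \<zeta>\<close>.\<close>
  have T1: "sup_L1_norm (p aH bl) \<le> ennreal B1"
  proof -
    define \<Psi>' where "\<Psi>' p = \<Psi> (snd p, fst p)" for p
    have \<Psi>'i: "integrable lborel \<Psi>'" unfolding \<Psi>'_def by (rule integral_plane_swap(2)[OF Pm P(1)])
    have \<Psi>'P: "(\<integral>\<^sup>+\<zeta>. ennreal (cmod (\<Psi>' \<zeta>) * (1 + (fst \<zeta>)\<^sup>2)) \<partial>lborel) \<le> ennreal W"
      using P(4) nn_integral_plane_swap[of "\<lambda>\<zeta>. ennreal (cmod (\<Psi> \<zeta>) * (1 + (snd \<zeta>)\<^sup>2))"] by (simp add: \<Psi>'_def W_def)
    have "sup_L1_norm (p aH bl) = (\<integral>\<^sup>+x. (SUP \<gamma>. ennreal (cmod (T_avg \<Psi>' (\<lambda>p. K (snd p, fst p)) (2 powi \<gamma>) (2 powi \<gamma> * \<tau>) (low (2 powi \<gamma>) (fourier g)) (aH \<gamma>) x))) \<partial>lborel)"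
      unfolding sup_L1_norm_def p_def bl_def b_def[symmetric]
      by (intro nn_integral_cong SUP_cong refl) (subst T_avg_swap, auto simp: \<Psi>'_def[abs_def])
    also have "\<dots> \<le> ennreal (W * (2 * C_low * (8 * pi * l2 g * (256 * N * \<rho> powr (- 1 / 8) * (Q * l2 f)))))"
      by (rule T_avg_low_sup_le[OF q0 rough_class_swap[OF K] N \<rho>(2) t0 \<tau>(3) G(1) _ L(1) _ _ QL \<Psi>'i \<Psi>'P W])
         (use G(2) farH(1) sH[OF F(2) F(3)] in \<open>auto simp: b_def aH_def\<close>)
    also have "\<dots> \<le> ennreal B1" by (intro ennreal_leI low_bd) simp
    finally show ?thesis .
  qed
  have T3: "sup_L1_norm (p al bH) \<le> ennreal B1"
  proof -
    have "sup_L1_norm (p al bH) \<le> ennreal (W * (2 * C_low * (8 * pi * l2 f * (256 * N * \<rho> powr (- 1 / 8) * (Q * l2 g)))))"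
      unfolding sup_L1_norm_def p_def al_def a_def W_def
      by (rule T_avg_low_sup_le[OF q0 K N \<rho>(2) t0 \<tau>(3) F(1) _ L(2) _ _ QL P(1) P(3) weight_nonneg])
         (use F(2) farH(1) sH[OF G(2) G(3)] in \<open>auto simp: a_def bH_def\<close>)
    also have "\<dots> \<le> ennreal B1" by (intro ennreal_leI low_bd) simp
    finally show ?thesis .
  qed
  have T2: "sup_L1_norm (p aH bh) \<le> ennreal B2"
    by (rule diag[OF L(1) L(4)]) (use farH(2) Xh sH[OF F(2) F(3)] sh[OF G(2) G(3)] in \<open>auto simp: H\<close>)
  have T4: "sup_L1_norm (p ah bH) \<le> ennreal B2"
    by (rule diag[OF L(3) L(2)]) (use farH(2) Xh sH[OF G(2) G(3)] sh[OF F(2) F(3)] in \<open>auto simp: H\<close>)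
  have T5: "sup_L1_norm (p aH bH) \<le> ennreal B2"
    by (rule diag[OF L(1) L(2)]) (use farH(2) sH[OF G(2) G(3)] sH[OF F(2) F(3)] in \<open>auto simp: H\<close>)
  define ar where "ar \<gamma> = off_band (2 powi \<gamma> * \<tau>) a" for \<gamma> :: int
  have [measurable]: "off_band s a \<in> borel_measurable borel" for s unfolding off_band_def by measurable
  have st: "0 \<le> 2 powi \<gamma> * \<tau>" for \<gamma> :: int using t0 by simp
  note sp = T_avg_split[OF rough_classD(3)[OF K] P(1) F(2) G(2) st supp]
  have U1: "sup_L1_norm (p aH (\<lambda>_. b)) \<le> ennreal (B1 + B2)"
    by (rule sup_L1_norm_add[OF _ _ _ T1 B0(1) T2 B0(2)]) (auto simp: p_def H sp(2) norm_triangle_ineq)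
  have U2: "sup_L1_norm (p (\<lambda>_. a) bH) \<le> ennreal (B1 + B2)"
    by (rule sup_L1_norm_add[OF _ _ _ T3 B0(1) T4 B0(2)]) (auto simp: p_def H sp(4) norm_triangle_ineq)
  have U3: "sup_L1_norm (p ar (\<lambda>_. b)) \<le> ennreal (B1 + B2 + B2)"
    by (rule sup_L1_norm_add[OF _ _ _ U2 _ T5 B0(2)]) (use B0 in \<open>auto simp: p_def H ar_def sp(3) norm_triangle_ineq4\<close>)
  have U4: "sup_L1_norm (p (\<lambda>_. a) (\<lambda>_. b)) \<le> ennreal ((B1 + B2) + (B1 + B2 + B2))"
    by (rule sup_L1_norm_add[OF _ _ _ U1 _ U3]) (use B0 in \<open>auto simp: p_def H ar_def sp(1) norm_triangle_ineq\<close>)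
  have "(B1 + B2) + (B1 + B2 + B2) = weight \<Psi> * (8192 * pi * C_low + 3 * C_diag q) * N * (\<rho> powr (- rate q) * (2 * m + 33)) * (l2 f * l2 g)"
    unfolding B1_def B2_def E_def Q2 W_def by (simp add: algebra_simps)
  then show ?thesis using U4 by (simp only: p_def[abs_def] a_def b_def)
qed

lemma Lp_norm_2_eq_l2: "Lp_norm lborel 2 f = l2 f"
  by (simp add: Lp_norm_def l2_def powr_half_sqrt)

text \<open>Half of the exponent is given up to absorb the linear factor, through
  \<open>1 + r * x / 4 \<le> 2 powr (r * x / 2)\<close>. The shift by 2 in the exponent comes from
  the lower edge \<open>1 / 4\<close> of the band.\<close>

lemma linear_times_exponential_le:
  fixes r x :: real
  assumes r: "r > 0" and x: "x \<ge> 0"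
  shows "2 powr (- r * (x - 2)) * (2 * x + 35) \<le> (2 powr (2 * r) * (35 + 8 / r)) * 2 powr (- (r / 2) * x)"
proof -
  have rx: "r * x \<ge> 0" using r x by simp
  have "1 + r * x / 4 \<le> 1 + (r * x / 2) * ln 2"
    using mult_left_mono[of "1/2" "ln 2" "r * x / 2"] ln2_ge_two_thirds rx by simp
  also have "\<dots> \<le> 2 powr (r * x / 2)"
    using exp_ge_add_one_self[of "(r * x / 2) * ln 2"] by (simp add: powr_def)
  finally have e: "1 + r * x / 4 \<le> 2 powr (r * x / 2)" .
  have "(35 + 8 / r) * (1 + r * x / 4) = 35 + 2 * x + 8 / r + 35 / 4 * (r * x)"
    using r by (simp add: field_simps)
  then have "2 * x + 35 \<le> (35 + 8 / r) * (1 + r * x / 4)" using r rx by simp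
  also have "\<dots> \<le> (35 + 8 / r) * 2 powr (r * x / 2)" using r by (intro mult_left_mono e) simp
  finally have "2 powr (- r * (x - 2)) * (2 * x + 35) \<le> 2 powr (- r * (x - 2)) * ((35 + 8 / r) * 2 powr (r * x / 2))"
    by (intro mult_left_mono) auto
  also have "\<dots> = (35 + 8 / r) * (2 powr (- r * (x - 2)) * 2 powr (r * x / 2))" by simp
  also have "2 powr (- r * (x - 2)) * 2 powr (r * x / 2) = 2 powr (2 * r) * 2 powr (- (r / 2) * x)"
    unfolding powr_add[symmetric] by (simp add: algebra_simps)
  finally show ?thesis by (simp add: mult_ac)
qed

text \<open>The norm of \<open>\<Omega>\<close> may vanish, so \<open>N\<close> is an arbitrary positive upper bound.\<close>
lemma L_op_sup_le:
  assumes q: "4 / 3 < q" "q \<le> 2" and \<Psi>: "schwartz \<Psi>"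
    and supp: "\<And>\<xi>. fourier \<Psi> \<xi> \<noteq> 0 \<Longrightarrow> 1/2 \<le> norm \<xi> \<and> norm \<xi> \<le> 2"
    and \<mu>: "\<mu> \<ge> 3" and \<Omega>: "in_Lp circle_measure q \<Omega>" and N: "N > 0" "Lp_norm circle_measure q \<Omega> \<le> N"
    and f: "schwartz f" and g: "schwartz g"
  shows "sup_L1_norm (\<lambda>\<gamma>. L_op \<Psi> \<Omega> \<mu> \<gamma> f g) \<le> ennreal (weight \<Psi> * (8192 * pi * C_low + 3 * C_diag q) * (30720 * (1 + 6 * weight \<Psi>))
       * (2 powr (2 * rate q) * (35 + 8 / rate q)) * 2 powr (- (rate q / 2) * of_int \<mu>) * (l2 f * l2 g) * N)"
proof -
  define W where "W = weight \<Psi>"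
  define A where "A = W * (8192 * pi * C_low + 3 * C_diag q)"
  define M where "M = 30720 * (1 + 6 * W) * N"
  have W: "W \<ge> 0" by (simp add: W_def weight_nonneg)
  have A: "A \<ge> 0" using W C_diag_pos[OF q] by (simp add: A_def C_low_def)
  have M: "M > 0" using W N by (simp add: M_def)
  define \<tau> where "\<tau> = (2::real) powi (- \<mu>)"
  define \<rho> where "\<rho> = 1 / (4 * \<tau>)"
  \<comment> \<open>One more than \<open>\<mu>\<close>, because the band ends at 2 and not at 1:
    this gives \<open>\<tau> * 2 ^ m = 2\<close>.\<close>
  define m where "m = nat (\<mu> + 1)"
  have \<tau>: "\<tau> > 0" "\<tau> \<le> 1" using \<mu> powi_le_iff[of "- \<mu>" 0] by (auto simp: \<tau>_def)
  have "int m = \<mu> + 1" using \<mu> by (simp add: m_def)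
  then have "(2::real) ^ m = 2 powi (\<mu> + 1)" by (metis power_int_of_nat)
  then have \<tau>m: "2 = \<tau> * 2 ^ m" by (simp add: \<tau>_def power_int_add power_int_minus)
  have "(4::real) = 2 powi 2" by simp
  then have \<rho>i: "\<rho> = 2 powi (\<mu> - 2)" by (simp add: \<rho>_def \<tau>_def power_int_diff power_int_minus field_simps)
  have \<rho>2: "2 \<le> \<rho>" using powi_le_iff[of 1 "\<mu> - 2"] \<mu> by (simp add: \<rho>i)
  have rm: "2 * real m + 33 = 2 * of_int \<mu> + 35" using \<mu> by (simp add: m_def)
  have "\<rho> powr (- rate q) = 2 powr (- rate q * (of_int \<mu> - 2))"
    unfolding \<rho>i by (simp add: powr_real_of_int'[symmetric] powr_powr mult.commute)
  then have dec: "\<rho> powr (- rate q) * (2 * real m + 33) \<le> (2 powr (2 * rate q) * (35 + 8 / rate q)) * 2 powr (- (rate q / 2) * of_int \<mu>)"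
    unfolding rm using linear_times_exponential_le[OF rate_pos[OF q], of "of_int \<mu>"] \<mu> by simp
  have "sup_L1_norm (\<lambda>\<gamma>. L_op \<Psi> \<Omega> \<mu> \<gamma> f g) = sup_L1_norm (\<lambda>\<gamma>. T_avg \<Psi> (unit_kernel \<Psi> \<Omega>) (2 powi \<gamma>) (2 powi \<gamma> * \<tau>) (fourier f) (fourier g))"
  proof -
    have "L_op \<Psi> \<Omega> \<mu> \<gamma> f g = T_avg \<Psi> (unit_kernel \<Psi> \<Omega>) (2 powi \<gamma>) (2 powi \<gamma> * \<tau>) (fourier f) (fourier g)" for \<gamma>
      unfolding \<tau>_def by (rule ext, rule L_op_eq_T_avg[OF q(1) \<Psi> _ \<Omega> f g]) (rule supp)
    then show ?thesis by (simp only:)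
  qed
  also have "\<dots> \<le> ennreal (A * M * (\<rho> powr (- rate q) * (2 * m + 33)) * (l2 f * l2 g))"
    unfolding A_def W_def
    by (rule T_avg_sup_le[OF q _ M \<tau>m \<tau> \<rho>_def \<rho>2 f g \<Psi> supp])
       (unfold M_def W_def, rule rough_class_unit_kernel[OF q(1) \<Omega> N \<Psi>])
  also have "\<dots> \<le> ennreal (A * M * ((2 powr (2 * rate q) * (35 + 8 / rate q)) * 2 powr (- (rate q / 2) * of_int \<mu>)) * (l2 f * l2 g))"
    using A M dec by (intro ennreal_leI mult_right_mono mult_left_mono) auto
  also have "A * M * ((2 powr (2 * rate q) * (35 + 8 / rate q)) * 2 powr (- (rate q / 2) * of_int \<mu>)) * (l2 f * l2 g)
     = A * (30720 * (1 + 6 * W)) * (2 powr (2 * rate q) * (35 + 8 / rate q)) * 2 powr (- (rate q / 2) * of_int \<mu>) * (l2 f * l2 g) * N"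
    unfolding M_def by (simp only: mult_ac)
  finally show ?thesis unfolding A_def W_def .
qed

theorem proposition5:
  fixes q :: real
  assumes "4 / 3 < q" and "q \<le> 2"
  shows "\<exists>\<delta>>0. \<forall>(C0::real)>1. \<forall>\<Psi>. littlewood_paley \<Psi> \<longrightarrow>
    (\<exists>C>0. \<forall>(\<mu>::int) \<Omega> f1 f2.
       2 powi (\<mu> - 10) > C0 \<longrightarrow>
       in_Lp circle_measure q \<Omega> \<longrightarrow>
       (LINT \<theta>|circle_measure. \<Omega> \<theta>) = 0 \<longrightarrow>
       schwartz f1 \<longrightarrow> schwartz f2 \<longrightarrow>
       (\<integral>\<^sup>+ x. (SUP \<gamma>::int. ennreal (cmod (L_op \<Psi> \<Omega> \<mu> \<gamma> f1 f2 x))) \<partial>lborel)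
         \<le> ennreal (C * 2 powr (- \<delta> * of_int \<mu>) * Lp_norm circle_measure q \<Omega>
                     * Lp_norm lborel 2 f1 * Lp_norm lborel 2 f2))"
proof (rule exI[of _ "rate q / 2"], intro conjI allI impI)
  \<comment> \<open>The witness for \<open>\<delta>\<close> is half of \<open>rate q\<close>; the
    other half was spent on the linear number of scales.\<close>
  note q = assms
  show "rate q / 2 > 0" using rate_pos[OF q] by simp
  fix C0 :: real and \<Psi> :: "plane \<Rightarrow> complex"
  assume C0: "C0 > 1" and lp: "littlewood_paley \<Psi>"
  have \<Psi>: "schwartz \<Psi>" using lp unfolding littlewood_paley_def by (elim conjE)
  have supp: "1/2 \<le> norm \<xi> \<and> norm \<xi> \<le> 2" if "fourier \<Psi> \<xi> \<noteq> 0" for \<xi>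
  proof -
    have "\<xi> \<in> closure {\<xi>. fourier \<Psi> \<xi> \<noteq> 0}" 
      by (rule subsetD[OF closure_subset]) (simp add: that)
    also have "\<dots> \<subseteq> {\<xi>. 1/2 \<le> norm \<xi> \<and> norm \<xi> \<le> 2}" using lp unfolding littlewood_paley_def by (elim conjE)
    finally show ?thesis by (rule CollectD)
  qed
  define c where "c = weight \<Psi> * (8192 * pi * C_low + 3 * C_diag q) * (30720 * (1 + 6 * weight \<Psi>)) * (2 powr (2 * rate q) * (35 + 8 / rate q))"
  have c: "c \<ge> 0" using weight_nonneg[of \<Psi>] C_diag_pos[OF q] rate_pos[OF q]
    unfolding c_def C_low_def by (intro mult_nonneg_nonneg add_nonneg_nonneg) auto
  show "\<exists>C>0. \<forall>(\<mu>::int) \<Omega> f1 f2.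
       2 powi (\<mu> - 10) > C0 \<longrightarrow>
       in_Lp circle_measure q \<Omega> \<longrightarrow>
       (LINT \<theta>|circle_measure. \<Omega> \<theta>) = 0 \<longrightarrow>
       schwartz f1 \<longrightarrow> schwartz f2 \<longrightarrow>
       (\<integral>\<^sup>+ x. (SUP \<gamma>::int. ennreal (cmod (L_op \<Psi> \<Omega> \<mu> \<gamma> f1 f2 x))) \<partial>lborel)
         \<le> ennreal (C * 2 powr (- (rate q / 2) * of_int \<mu>) * Lp_norm circle_measure q \<Omega>
                     * Lp_norm lborel 2 f1 * Lp_norm lborel 2 f2)"
  proof (intro exI[of _ "c + 1"] conjI allI impI)
    \<comment> \<open>\<open>c\<close> is only known to be nonnegative, and the constant has to be
      positive.\<close>
    show "c + 1 > 0" using c by simp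
    fix \<mu> :: int and \<Omega> :: "plane \<Rightarrow> complex" and f1 f2 :: "real \<Rightarrow> complex"
    assume \<mu>: "2 powi (\<mu> - 10) > C0" and \<Omega>: "in_Lp circle_measure q \<Omega>" and f: "schwartz f1" "schwartz f2"
    \<comment> \<open>The threshold exceeds 1, so \<open>\<mu> > 10\<close>; what is used below is
      \<open>\<mu> \<ge> 3\<close>, which makes the lower edge \<open>2 powi (\<mu> - 2)\<close> of
      the rescaled band at least 2.\<close>
    have "\<not> \<mu> - 10 \<le> 0" using powi_le_iff[of "\<mu> - 10" 0] \<mu> C0 by auto
    then have \<mu>3: "\<mu> \<ge> 3" by simp
    define n where "n = Lp_norm circle_measure q \<Omega>"
    have n: "n \<ge> 0" by (simp add: n_def Lp_norm_def)
    define D where "D = 2 powr (- (rate q / 2) * of_int \<mu>) * (l2 f1 * l2 f2)"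
    have D: "D \<ge> 0" by (simp add: D_def)
    have bd: "sup_L1_norm (\<lambda>\<gamma>. L_op \<Psi> \<Omega> \<mu> \<gamma> f1 f2) \<le> ennreal (c * D * N)" if "N > 0" "n \<le> N" for N
      by (rule order_trans[OF L_op_sup_le[OF q \<Psi> _ \<mu>3 \<Omega> that[unfolded n_def] f]])
         (erule supp, simp only: c_def D_def mult.assoc order_refl)
    have "sup_L1_norm (\<lambda>\<gamma>. L_op \<Psi> \<Omega> \<mu> \<gamma> f1 f2) \<le> ennreal (c * D * n)"
    proof (rule ennreal_le_epsilon)
      fix e :: real assume e: "0 < e"
      define h where "h = e / (c * D + 1)"
      have cD: "c * D \<ge> 0" using c D by simp
      then have h: "h > 0" using e by (simp add: h_def)
      have "c * D * h \<le> e" using e cD by (simp add: h_def divide_le_eq algebra_simps)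
      then have "c * D * (n + h) \<le> c * D * n + e" by (simp add: distrib_left)
      then have "ennreal (c * D * (n + h)) \<le> ennreal (c * D * n) + ennreal e"
        using cD n e by (simp add: ennreal_plus[symmetric] ennreal_leI del: ennreal_plus)
      then show "sup_L1_norm (\<lambda>\<gamma>. L_op \<Psi> \<Omega> \<mu> \<gamma> f1 f2) \<le> ennreal (c * D * n) + ennreal e"
        using bd[of "n + h"] h n by (meson add_nonneg_pos le_add_same_cancel1 less_imp_le order_trans)
    qed
    also have "\<dots> \<le> ennreal ((c + 1) * D * n)" using D n by (intro ennreal_leI mult_right_mono) auto
    also have "(c + 1) * D * n = (c + 1) * 2 powr (- (rate q / 2) * of_int \<mu>) * n * l2 f1 * l2 f2"
      unfolding D_def by (simp only: mult_ac)
    finally show "(\<integral>\<^sup>+ x. (SUP \<gamma>::int. ennreal (cmod (L_op \<Psi> \<Omega> \<mu> \<gamma> f1 f2 x))) \<partial>lborel)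
         \<le> ennreal ((c + 1) * 2 powr (- (rate q / 2) * of_int \<mu>) * Lp_norm circle_measure q \<Omega>
                     * Lp_norm lborel 2 f1 * Lp_norm lborel 2 f2)"
      by (simp only: sup_L1_norm_def n_def Lp_norm_2_eq_l2)
  qed
qed

end
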